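(* Let $(R,\mathfrak m)$ be a regular local ring, $\mathfrak a$ an ideal of $R$, and $\varphi\colon R\to R$ a flat local ring endomorphism such that $\{\varphi^t(\mathfrak a)R\}_{t\ge 0}$ is a decreasing chain of ideals cofinal with the chain $\{\mathfrak a^t\}_{t\ge 0}$. Let $i\ge 0$ be an integer. Then $H^i_{\mathfrak a}(R)=0$ if and only if some iterate of the induced action $$\overline\varphi_*\colon H^{\dim R-i}_{\mathfrak m}(R/\mathfrak a)\longrightarrow H^{\dim R-i}_{\mathfrak m}(R/\mathfrak a)$$ is zero, i.e., there exists an integer $k\ge 1$ such that $(\overline\varphi_* )^k=0$.
   Context: All rings are commutative, Noetherian, and contain an identity element. $H^j_{\mathfrak b}(-)$ denotes local cohomology with support in the ideal $\mathfrak b$ (zero for $j<0$). $\varphi^t$ denotes the $t$-fold composite of $\varphi$, and $\varphi^t(\mathfrak a)R$ is the ideal of $R$ generated by $\varphi^t(\mathfrak a)$. Two decreasing chains of ideals are cofinal if each member of either chain contains some member of the other. Induced action: since the chain is decreasing, $\varphi(\mathfrak a)\subseteq\mathfrak a$, so $\varphi$ induces a ring endomorphism $\overline\varphi$ of $R/\mathfrak a$. Since $\varphi$ is flat and local and $R$ is regular local, $\varphi(\mathfrak m)R$ is $\mathfrak m$-primary. If $\boldsymbol x$ is a sequence of elements of $R$ generating $\mathfrak m$ up to radical, then $\overline\varphi$ induces, by localization, a map of Čech complexes $\check C^\bullet_{\boldsymbol x}(R/\mathfrak a)\to\check C^\bullet_{\varphi(\boldsymbol x)}(R/\mathfrak a)$.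 Taking cohomology gives, for each $j$, an additive map $\overline\varphi_*\colon H^j_{\mathfrak m}(R/\mathfrak a)\to H^j_{\varphi(\mathfrak m)R}(R/\mathfrak a)=H^j_{\mathfrak m}(R/\mathfrak a)$, which is an endomorphism of the underlying Abelian group satisfying $\overline\varphi_*(r\eta)=\varphi(r)\overline\varphi_*(\eta)$ for $r\in R$. *)

theory Defs
  imports "HOL-Algebra.Free_Abelian_Groups" "HOL-Algebra.Ideal_Product" "HOL-Algebra.Ring_Divisibility"
    "HOL-Library.Extended_Nat"
begin

section \<open>Regular local rings\<close>

definition krull_dim :: "('a, 'r) ring_scheme \<Rightarrow> enat" where
  "krull_dim R = Sup {enat n | n. \<exists>P :: nat \<Rightarrow> 'a set.
     (\<forall>k\<le>n. primeideal (P k) R) \<and> (\<forall>k<n. P k \<subset> P (Suc k))}"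

definition local_ring :: "('a, 'r) ring_scheme \<Rightarrow> 'a set \<Rightarrow> bool" where
  "local_ring R \<mm> \<longleftrightarrow> cring R \<and> maximalideal \<mm> R \<and> (\<forall>\<nn>. maximalideal \<nn> R \<longrightarrow> \<nn> = \<mm>)"

definition regular_local_ring :: "('a, 'r) ring_scheme \<Rightarrow> 'a set \<Rightarrow> bool" where
  "regular_local_ring R \<mm> \<longleftrightarrow> local_ring R \<mm> \<and> noetherian_ring R \<and>
     krull_dim R =
       enat (LEAST n. \<exists>A \<subseteq> carrier R. finite A \<and> card A = n \<and> \<mm> = genideal R A)"

section \<open>Ideals: radicals and chains\<close>

definition radical :: "('a, 'r) ring_scheme \<Rightarrow> 'a set \<Rightarrow> 'a set" where
  "radical R I = {r \<in> carrier R. \<exists>n::nat. r [^]\<^bsub>R\<^esub> n \<in> I}"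

definition generates_up_to_radical :: "('a, 'r) ring_scheme \<Rightarrow> 'a list \<Rightarrow> 'a set \<Rightarrow> bool" where
  "generates_up_to_radical R xs I \<longleftrightarrow>
     set xs \<subseteq> carrier R \<and> radical R (genideal R (set xs)) = radical R I"

definition cofinal_chains :: "(nat \<Rightarrow> 'a set) \<Rightarrow> (nat \<Rightarrow> 'a set) \<Rightarrow> bool" where
  "cofinal_chains I J \<longleftrightarrow> (\<forall>t. \<exists>s. J s \<subseteq> I t) \<and> (\<forall>t. \<exists>s. I s \<subseteq> J t)"

section \<open>Modules\<close>

text \<open>The record \<open>module\<close> extends \<open>ring\<close>; its fields \<open>mult\<close> and \<open>one\<close> play no role for modules
  (the locale \<open>module\<close> ignores them) and are left undefined below where there is no
  natural choice.\<close>

definition self_module :: "('a, 'r) ring_scheme \<Rightarrow> ('a, 'a) module" where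
  "self_module R = \<lparr>carrier = carrier R, monoid.mult = monoid.mult R, one = \<one>\<^bsub>R\<^esub>,
     ring.zero = \<zero>\<^bsub>R\<^esub>, add = ring.add R, smult = monoid.mult R\<rparr>"

text \<open>The additive part of the library's quotient \<open>M Quot N\<close>, which makes sense for modules, extended
  by the scalar multiplication on cosets. For \<open>M = self_module R\<close> and an ideal \<open>N\<close> the
  underlying ring is \<open>R Quot N\<close>.\<close>

definition quot_module ::
    "('a, 'b, 'm) module_scheme \<Rightarrow> 'b set \<Rightarrow> ('a, 'b set) module" where
  "quot_module M N = ring.extend (M Quot N)
     (module.fields (\<lambda>r X. \<Union>x\<in>X. N +>\<^bsub>M\<^esub> (r \<odot>\<^bsub>M\<^esub> x)))"

text \<open>The map \<open>M/N \<rightarrow> M'/N'\<close>, \<open>x + N \<mapsto> f x + N'\<close>, induced by an additive \<open>f\<close>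
  with \<open>f ` N \<subseteq> N'\<close>; here \<open>M'\<close> and \<open>N'\<close> are the arguments.\<close>

definition coset_map ::
    "('b, 'm) ring_scheme \<Rightarrow> 'b set \<Rightarrow> ('c \<Rightarrow> 'b) \<Rightarrow> 'c set \<Rightarrow> 'b set" where
  "coset_map M N f X = (\<Union>x\<in>X. N +>\<^bsub>M\<^esub> f x)"

definition module_homs ::
    "('a, 'r) ring_scheme \<Rightarrow> ('a, 'b, 'm) module_scheme \<Rightarrow> ('a, 'c, 'n) module_scheme
      \<Rightarrow> ('b \<Rightarrow> 'c) set" where
  "module_homs R M N = {f \<in> carrier M \<rightarrow> carrier N.
     (\<forall>x\<in>carrier M. \<forall>y\<in>carrier M. f (x \<oplus>\<^bsub>M\<^esub> y) = f x \<oplus>\<^bsub>N\<^esub> f y) \<and>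
     (\<forall>r\<in>carrier R. \<forall>x\<in>carrier M. f (r \<odot>\<^bsub>M\<^esub> x) = r \<odot>\<^bsub>N\<^esub> f x)}"

section \<open>Tensor products and flatness\<close>

definition tensor_relations ::
    "('a, 'r) ring_scheme \<Rightarrow> ('a, 'b, 'm) module_scheme \<Rightarrow> ('a, 'c, 'n) module_scheme
      \<Rightarrow> (('b \<times> 'c) \<Rightarrow>\<^sub>0 int) set" where
  "tensor_relations R M N = generate (free_Abelian_group (carrier M \<times> carrier N))
     ({frag_of (x \<oplus>\<^bsub>M\<^esub> x', y) - frag_of (x, y) - frag_of (x', y) | x x' y.
         x \<in> carrier M \<and> x' \<in> carrier M \<and> y \<in> carrier N} \<union>
      {frag_of (x, y \<oplus>\<^bsub>N\<^esub> y') - frag_of (x, y) - frag_of (x, y') | x y y'.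
         x \<in> carrier M \<and> y \<in> carrier N \<and> y' \<in> carrier N} \<union>
      {frag_of (r \<odot>\<^bsub>M\<^esub> x, y) - frag_of (x, r \<odot>\<^bsub>N\<^esub> y) | r x y.
         r \<in> carrier R \<and> x \<in> carrier M \<and> y \<in> carrier N})"

definition tensor_product ::
    "('a, 'r) ring_scheme \<Rightarrow> ('a, 'b, 'm) module_scheme \<Rightarrow> ('a, 'c, 'n) module_scheme
      \<Rightarrow> (('b \<times> 'c) \<Rightarrow>\<^sub>0 int) set monoid" where
  "tensor_product R M N =
     free_Abelian_group (carrier M \<times> carrier N) Mod tensor_relations R M N"

text \<open>The map \<open>f \<otimes> id\<close> from \<open>L \<otimes> M\<close> to \<open>L' \<otimes> M\<close>, for \<open>f : L \<rightarrow> L'\<close>.\<close>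

definition tensor_map ::
    "('a, 'r) ring_scheme \<Rightarrow> ('a, 'c, 'n) module_scheme \<Rightarrow> ('a, 'b, 'm) module_scheme
      \<Rightarrow> ('d \<Rightarrow> 'c) \<Rightarrow> (('d \<times> 'b) \<Rightarrow>\<^sub>0 int) set \<Rightarrow> (('c \<times> 'b) \<Rightarrow>\<^sub>0 int) set" where
  "tensor_map R L' M f X =
     (\<Union>c\<in>X. tensor_relations R L' M #>\<^bsub>free_Abelian_group (carrier L' \<times> carrier M)\<^esub>
        frag_extend (\<lambda>(l, m). frag_of (f l, m)) c)"

text \<open>A definition cannot quantify over types, so the test modules \<open>L\<close>, \<open>L'\<close> have carriers in the
  type of the ring elements. This is no restriction: \<open>R\<close> and all its ideals are among
  them, and injectivity of \<open>I \<otimes> M \<rightarrow> R \<otimes> M\<close> for all ideals \<open>I\<close> already gives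
  flatness.\<close>

definition flat_module ::
    "('a, 'r) ring_scheme \<Rightarrow> ('a, 'b, 'm) module_scheme \<Rightarrow> bool" where
  "flat_module R M \<longleftrightarrow> module R M \<and>
     (\<forall>(L :: ('a, 'a) module) (L' :: ('a, 'a) module) f.
        module R L \<and> module R L' \<and> f \<in> module_homs R L L' \<and> inj_on f (carrier L) \<longrightarrow>
        inj_on (tensor_map R L' M f) (carrier (tensor_product R L M)))"

definition restrict_scalars ::
    "('a \<Rightarrow> 'b) \<Rightarrow> ('b, 's) ring_scheme \<Rightarrow> ('a, 'b) module" where
  "restrict_scalars \<phi> S = \<lparr>carrier = carrier S, monoid.mult = monoid.mult S, one = \<one>\<^bsub>S\<^esub>,
     ring.zero = \<zero>\<^bsub>S\<^esub>, add = ring.add S, smult = (\<lambda>r s. \<phi> r \<otimes>\<^bsub>S\<^esub> s)\<rparr>"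

definition flat_local_endomorphism ::
    "('a, 'r) ring_scheme \<Rightarrow> 'a set \<Rightarrow> ('a \<Rightarrow> 'a) \<Rightarrow> bool" where
  "flat_local_endomorphism R \<mm> \<phi> \<longleftrightarrow>
     \<phi> \<in> ring_hom R R \<and> \<phi> ` \<mm> \<subseteq> \<mm> \<and> flat_module R (restrict_scalars \<phi> R)"

section \<open>Localization of a module at the powers of an element\<close>

text \<open>The fraction \<open>m / f\<^sup>k\<close>: the class of the pair \<open>(m, k)\<close>.\<close>

definition loc_frac ::
    "('a, 'r) ring_scheme \<Rightarrow> ('a, 'b, 'm) module_scheme \<Rightarrow> 'a \<Rightarrow> 'b \<Rightarrow> nat \<Rightarrow> ('b \<times> nat) set"
  where
  "loc_frac R M f m k = {(m', k'). m' \<in> carrier M \<and>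
     (\<exists>e::nat. (f [^]\<^bsub>R\<^esub> e) \<odot>\<^bsub>M\<^esub> ((f [^]\<^bsub>R\<^esub> k') \<odot>\<^bsub>M\<^esub> m) =
               (f [^]\<^bsub>R\<^esub> e) \<odot>\<^bsub>M\<^esub> ((f [^]\<^bsub>R\<^esub> k) \<odot>\<^bsub>M\<^esub> m'))}"

text \<open>The unions range over the representatives of the arguments; the result does not depend on
  the representative, so they are unions of equal sets.\<close>

definition loc_module ::
    "('a, 'r) ring_scheme \<Rightarrow> ('a, 'b, 'm) module_scheme \<Rightarrow> 'a \<Rightarrow> ('a, ('b \<times> nat) set) module"
  where
  "loc_module R M f =
     \<lparr>carrier = {loc_frac R M f m k | m k. m \<in> carrier M},
      monoid.mult = undefined, one = undefined,
      ring.zero = loc_frac R M f \<zero>\<^bsub>M\<^esub> 0,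
      add = (\<lambda>X Y. \<Union>(m, k)\<in>X. \<Union>(n, l)\<in>Y.
         loc_frac R M f (((f [^]\<^bsub>R\<^esub> l) \<odot>\<^bsub>M\<^esub> m) \<oplus>\<^bsub>M\<^esub> ((f [^]\<^bsub>R\<^esub> k) \<odot>\<^bsub>M\<^esub> n)) (k + l)),
      smult = (\<lambda>r X. \<Union>(m, k)\<in>X. loc_frac R M f (r \<odot>\<^bsub>M\<^esub> m) k)\<rparr>"

text \<open>The canonical map from the localization at \<open>f\<close> to the localization at \<open>h = f g\<close>,
  sending \<open>m / f\<^sup>k\<close> to \<open>g\<^sup>k m / h\<^sup>k\<close>; only \<open>g\<close> and \<open>h\<close> are arguments.\<close>

definition loc_further ::
    "('a, 'r) ring_scheme \<Rightarrow> ('a, 'b, 'm) module_scheme \<Rightarrow> 'a \<Rightarrow> 'a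
      \<Rightarrow> ('b \<times> nat) set \<Rightarrow> ('b \<times> nat) set" where
  "loc_further R M g h X = (\<Union>(m, k)\<in>X. loc_frac R M h ((g [^]\<^bsub>R\<^esub> k) \<odot>\<^bsub>M\<^esub> m) k)"

section \<open>Cech complex and local cohomology\<close>

text \<open>In degree \<open>j\<close> the Cech complex of \<open>M\<close> on \<open>xs = x\<^sub>0, \<dots>, x\<^sub>n\<^sub>-\<^sub>1\<close> is the direct sum of the
  localizations of \<open>M\<close> at the products of the \<open>x\<^sub>k\<close>, \<open>k \<in> S\<close>, over all
  \<open>S \<subseteq> {0, \<dots>, n - 1}\<close> with \<open>j\<close> elements. Degrees are integers; there is no such \<open>S\<close>
  for \<open>j < 0\<close>, and the complex is zero there.\<close>

definition cech_index :: "nat \<Rightarrow> int \<Rightarrow> nat set set" where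
  "cech_index n j = {S. S \<subseteq> {..<n} \<and> int (card S) = j}"

definition subprod :: "('a, 'r) ring_scheme \<Rightarrow> 'a list \<Rightarrow> nat set \<Rightarrow> 'a" where
  "subprod R xs S = (\<Otimes>\<^bsub>R\<^esub>k\<in>S. xs ! k)"

definition cech_module ::
    "('a, 'r) ring_scheme \<Rightarrow> 'a list \<Rightarrow> ('a, 'b, 'm) module_scheme \<Rightarrow> int
      \<Rightarrow> ('a, nat set \<Rightarrow> ('b \<times> nat) set) module" where
  "cech_module R xs M j =
     \<lparr>carrier = (\<Pi>\<^sub>E S\<in>cech_index (length xs) j. carrier (loc_module R M (subprod R xs S))),
      monoid.mult = undefined, one = undefined,
      ring.zero = (\<lambda>S\<in>cech_index (length xs) j. \<zero>\<^bsub>loc_module R M (subprod R xs S)\<^esub>),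
      add = (\<lambda>\<eta> \<theta>. \<lambda>S\<in>cech_index (length xs) j.
         \<eta> S \<oplus>\<^bsub>loc_module R M (subprod R xs S)\<^esub> \<theta> S),
      smult = (\<lambda>r \<eta>. \<lambda>S\<in>cech_index (length xs) j.
         r \<odot>\<^bsub>loc_module R M (subprod R xs S)\<^esub> \<eta> S)\<rparr>"

text \<open>The summand indexed by \<open>S - {i}\<close> maps to the one indexed by \<open>S\<close> with sign \<open>-1\<close> to the
  number of elements of \<open>S\<close> below \<open>i\<close>.\<close>

definition cech_diff ::
    "('a, 'r) ring_scheme \<Rightarrow> 'a list \<Rightarrow> ('a, 'b, 'm) module_scheme \<Rightarrow> int
      \<Rightarrow> (nat set \<Rightarrow> ('b \<times> nat) set) \<Rightarrow> (nat set \<Rightarrow> ('b \<times> nat) set)" where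
  "cech_diff R xs M j \<eta> = (\<lambda>S\<in>cech_index (length xs) (j + 1).
     (\<Oplus>\<^bsub>loc_module R M (subprod R xs S)\<^esub>i\<in>S.
        (let t = loc_further R M (xs ! i) (subprod R xs S) (\<eta> (S - {i}))
         in if even (card {l \<in> S. l < i}) then t
            else \<ominus>\<^bsub>loc_module R M (subprod R xs S)\<^esub> t)))"

definition cech_cocycles ::
    "('a, 'r) ring_scheme \<Rightarrow> 'a list \<Rightarrow> ('a, 'b, 'm) module_scheme \<Rightarrow> int
      \<Rightarrow> (nat set \<Rightarrow> ('b \<times> nat) set) set" where
  "cech_cocycles R xs M j = {\<eta> \<in> carrier (cech_module R xs M j).
     cech_diff R xs M j \<eta> = \<zero>\<^bsub>cech_module R xs M (j + 1)\<^esub>}"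

definition cech_coboundaries ::
    "('a, 'r) ring_scheme \<Rightarrow> 'a list \<Rightarrow> ('a, 'b, 'm) module_scheme \<Rightarrow> int
      \<Rightarrow> (nat set \<Rightarrow> ('b \<times> nat) set) set" where
  "cech_coboundaries R xs M j = cech_diff R xs M (j - 1) ` carrier (cech_module R xs M (j - 1))"

text \<open>Over a Noetherian ring this is the local cohomology of \<open>M\<close> in degree \<open>j\<close> with support in any
  ideal that \<open>xs\<close> generates up to radical; \<open>change_generators\<close> below compares two choices
  of \<open>xs\<close> for the same ideal.\<close>

definition local_cohomology ::
    "('a, 'r) ring_scheme \<Rightarrow> 'a list \<Rightarrow> ('a, 'b, 'm) module_scheme \<Rightarrow> int
      \<Rightarrow> ('a, (nat set \<Rightarrow> ('b \<times> nat) set) set) module" where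
  "local_cohomology R xs M j =
     quot_module ((cech_module R xs M j)\<lparr>carrier := cech_cocycles R xs M j\<rparr>)
       (cech_coboundaries R xs M j)"

text \<open>The canonical identification of the local cohomology computed by \<open>xs\<close> with that computed by
  \<open>ys\<close>, when both generate the same ideal up to radical. The Cech complex on the
  concatenation \<open>xs @ ys\<close> projects onto the complexes on \<open>xs\<close> and on \<open>ys\<close>, by keeping only
  the components indexed by sets of positions in \<open>xs\<close>, respectively in \<open>ys\<close>. Both
  projections are then isomorphisms in cohomology, and one inverts the first.\<close>

definition cech_proj_left ::
    "'a list \<Rightarrow> int \<Rightarrow> (nat set \<Rightarrow> ('b \<times> nat) set) \<Rightarrow> (nat set \<Rightarrow> ('b \<times> nat) set)" where
  "cech_proj_left xs j \<eta> = (\<lambda>S\<in>cech_index (length xs) j. \<eta> S)"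

definition cech_proj_right ::
    "'a list \<Rightarrow> 'a list \<Rightarrow> int
      \<Rightarrow> (nat set \<Rightarrow> ('b \<times> nat) set) \<Rightarrow> (nat set \<Rightarrow> ('b \<times> nat) set)" where
  "cech_proj_right xs ys j \<eta> =
     (\<lambda>S\<in>cech_index (length ys) j. \<eta> ((\<lambda>k. length xs + k) ` S))"

definition change_generators ::
    "('a, 'r) ring_scheme \<Rightarrow> 'a list \<Rightarrow> 'a list \<Rightarrow> ('a, 'b, 'm) module_scheme \<Rightarrow> int
      \<Rightarrow> (nat set \<Rightarrow> ('b \<times> nat) set) set \<Rightarrow> (nat set \<Rightarrow> ('b \<times> nat) set) set" where
  "change_generators R xs ys M j =
     coset_map (cech_module R ys M j) (cech_coboundaries R ys M j) (cech_proj_right xs ys j) \<circ>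
     inv_into (carrier (local_cohomology R (xs @ ys) M j))
       (coset_map (cech_module R xs M j) (cech_coboundaries R xs M j) (cech_proj_left xs j))"

section \<open>The induced action\<close>

definition quot_endo :: "('a, 'r) ring_scheme \<Rightarrow> 'a set \<Rightarrow> ('a \<Rightarrow> 'a) \<Rightarrow> 'a set \<Rightarrow> 'a set" where
  "quot_endo R \<aa> \<phi> = coset_map R \<aa> \<phi>"

text \<open>The map from the Cech complex of \<open>M\<close> on \<open>xs\<close> to that on \<open>map \<phi> xs\<close> induced by an additive
  \<open>\<psi> : M \<rightarrow> M\<close> with \<open>\<psi> (r m) = \<phi> r \<psi> m\<close>. It sends \<open>m / x\<^sub>S\<^sup>k\<close> to \<open>\<psi> m / \<phi>(x\<^sub>S)\<^sup>k\<close>,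
  where \<open>x\<^sub>S\<close> is the product of the \<open>x\<^sub>i\<close> with \<open>i\<close> in \<open>S\<close>.\<close>

definition cech_map ::
    "('a, 'r) ring_scheme \<Rightarrow> 'a list \<Rightarrow> ('a, 'b, 'm) module_scheme \<Rightarrow> ('a \<Rightarrow> 'a) \<Rightarrow> ('b \<Rightarrow> 'b)
      \<Rightarrow> int \<Rightarrow> (nat set \<Rightarrow> ('b \<times> nat) set) \<Rightarrow> (nat set \<Rightarrow> ('b \<times> nat) set)" where
  "cech_map R xs M \<phi> \<psi> j \<eta> = (\<lambda>S\<in>cech_index (length xs) j.
     \<Union>(m, k)\<in>\<eta> S. loc_frac R M (subprod R (map \<phi> xs) S) (\<psi> m) k)"

text \<open>The composite of the map on cohomology given by \<open>cech_map\<close>, with values in the cohomology on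
  \<open>map \<phi> xs\<close>, and the identification of the latter with the cohomology on \<open>xs\<close>.\<close>

definition induced_action ::
    "('a, 'r) ring_scheme \<Rightarrow> 'a set \<Rightarrow> ('a \<Rightarrow> 'a) \<Rightarrow> 'a list \<Rightarrow> int
      \<Rightarrow> (nat set \<Rightarrow> ('a set \<times> nat) set) set \<Rightarrow> (nat set \<Rightarrow> ('a set \<times> nat) set) set" where
  "induced_action R \<aa> \<phi> xs j =
     (let M = quot_module (self_module R) \<aa>; ys = map \<phi> xs in
      change_generators R ys xs M j \<circ>
      coset_map (cech_module R ys M j) (cech_coboundaries R ys M j)
        (cech_map R xs M \<phi> (quot_endo R \<aa> \<phi>) j))"

end

theory Submission
  imports Defs
begin

text \<open>Classes of Cech cohomology are written as Koszul cochains with values in \<open>R\<close>, modulo an ideal, with a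
  common denominator. Let \<open>x\<close> be a regular system of parameters, \<open>d = dim R\<close>. The union of the modules
  \<open>R/(x\<^sup>k)\<close> along multiplication by the product of \<open>x\<close> is injective and detects nonzero elements, by Baer's
  criterion; pairing with it turns vanishing of the \<open>i\<close>-th cohomology on \<open>y\<close> into pro-vanishing of the Koszul
  homology on powers of \<open>y\<close> of that union. On the mixed complex of powers of \<open>y\<close> (chains) and of \<open>x\<close>
  (cochains), regularity trades \<open>x\<close> for the relations \<open>x\<^sup>k\<close>, shifting degrees by \<open>d\<close>, and the Noetherian
  hypothesis trades \<open>y\<close>, up to pro-isomorphism, for the relations \<open>y\<^sup>s\<close>. Hence the \<open>i\<close>-th cohomology with support
  in \<open>\<aa>\<close> vanishes iff the \<open>(d - i)\<close>-th local cohomology modules of the \<open>R/(y\<^sup>s)\<close>, equivalently of the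
  \<open>R/\<phi>\<^sup>t(\<aa>)R\<close>, are pro-zero. By flatness the cocycles modulo \<open>\<phi>\<^sup>t(\<aa>)R\<close> are spanned by the \<open>\<phi>\<^sup>t\<close>-images of
  those modulo \<open>\<aa>\<close>, so this means that a power of the induced action is zero.\<close>

section \<open>Ideals of Noetherian rings\<close>

text \<open>The cohomology with support in \<aa> is not finitely generated, and its dual is an
  inverse limit of local cohomology modules rather than one of them. Hence two indices run through
  the proof: \<open>s\<close>, the exponent of the generators of \<aa>, in which a system is
  pro-zero, and \<open>k\<close>, the exponent on the side of \<mm>, in which a direct limit is
  taken. Finite generation of each Koszul module turns vanishing in the limit into vanishing after a
  uniform shift, which is a statement that can be dualized. The exponent of nilpotence comes from
  one level only: pro-vanishing is used over \<open>R / \<aa>\<close> itself. Conversely, one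
  vanishing map into that level suffices, because flat base change along \<open>\<phi> ^^ t\<close>
  carries it to every level \<open>t\<close>. No injective hull or derived functor is formed, and
  localizations enter only at the end, when classes are matched with the Cech complex. Until then a
  class is a vector of ring elements, and its vanishing is an equation modulo an ideal after
  multiplication by powers. This is why weights, exponents and signs stay explicit.\<close>

abbreviation (in ring) "CR \<equiv> carrier R"
abbreviation (in ring) "inR xs \<equiv> set xs \<subseteq> CR"

locale noetherian_cring = noetherian_ring + cring

context cring
begin

lemmas cr_simps = cring_simprules a_minus_def

lemma ideal_diff: "ideal I R ==> a\<in>I ==> b\<in>I ==> a\<ominus>b\<in>I"
 unfolding a_minus_def by (meson additive_subgroup.a_closed additive_subgroup.a_inv_closed ideal_def)

lemma ideal_add: "ideal I R ==> a\<in>I ==> b\<in>I ==> a\<oplus>b\<in>I"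
 by (meson additive_subgroup.a_closed ideal_def)

lemma ideal_neg: "ideal I R ==> a\<in>I ==>\<ominus>a\<in>I"
 by (meson additive_subgroup.a_inv_closed ideal_def)

lemma ideal_zero: "ideal I R ==> \<zero>\<in>I"
 by (meson additive_subgroup.zero_closed ideal_def)

lemma ideal_carr: "ideal I R ==> a\<in>I ==> a\<in>CR"
 by (meson ideal.Icarr)

lemma ideal_sub: "ideal I R ==> I\<subseteq>CR"
 using ideal_carr by blast

lemma ideal_mult: "ideal I R ==> a\<in>I ==> r\<in>CR ==> r\<otimes>a\<in>I"
 by (meson ideal.I_l_closed)

lemma ideal_mult_r: "ideal I R ==> a\<in>I ==> r\<in>CR ==> a\<otimes>r\<in>I"
 by (meson ideal.I_r_closed)

lemma ideal_add_cancel: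
 assumes "ideal I R" "a\<in>I" "a\<oplus>b\<in>I" "b\<in>CR" shows "b\<in>I"
proof -
 have "(a\<oplus>b)\<ominus>a = \<zero>\<oplus>b" if "a\<in>CR" "b\<in>CR" using that by algebra
 thus ?thesis using ideal_diff[OF assms(1,3,2)] ideal_carr assms l_zero by metis
qed

lemma ideal_addr_cancel:
 assumes "ideal I R" "a\<in>I" "b\<oplus>a\<in>I" "b\<in>CR" shows "b\<in>I"
 using assms ideal_add_cancel by (metis a_comm ideal_carr)

lemma ideal_sub_cancel:
 assumes "ideal I R" "a\<in>I" "b\<ominus>a\<in>I" "b\<in>CR" shows "b\<in>I"
proof -
 have "\<ominus>a\<in>I" using ideal_neg[OF assms(1,2)] .
 then show ?thesis using ideal_addr_cancel[OF assms(1) _ _ assms(4)] assms(3)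
  by (simp add: a_minus_def)
qed

lemma idealI_cring:
 assumes "I\<subseteq>CR" "\<zero>\<in>I" "!!a b. a\<in>I ==> b\<in>I ==> a\<oplus>b\<in>I"
  "!!a r. a\<in>I ==> r\<in>CR ==> r\<otimes>a\<in>I"
 shows "ideal I R"
proof (rule idealI)
 show "ring R" by (rule ring_axioms)
 show "subgroup I (add_monoid R)"
 proof
  show "I\<subseteq>carrier (add_monoid R)" using assms by simp
  show "x\<otimes>\<^bsub>add_monoid R\<^esub> y\<in>I" if "x\<in>I" "y\<in>I" for x y using assms that by simp
  show "\<one>\<^bsub>add_monoid R\<^esub>\<in>I" using assms by simp
  show "inv\<^bsub>add_monoid R\<^esub> x\<in>I" if "x\<in>I" for x
  proof -
   have "x\<in>CR" using that assms by blast
   hence "\<ominus>x = (\<ominus>\<one>)\<otimes>x" by (simp add: l_minus)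
   thus ?thesis using assms(4)[OF that, of "\<ominus>\<one>"] by (simp add: a_inv_def)
  qed
 qed
 show "x\<otimes>a\<in>I" if "a\<in>I" "x\<in>CR" for a x using assms(4) that by blast
 show "a\<otimes>x\<in>I" if "a\<in>I" "x\<in>CR" for a x
  using assms(4)[OF that] that assms(1) m_comm[of a x] by auto
qed

lemma idl_insert:
 assumes "A\<subseteq>CR" "x\<in>CR"
 shows "Idl (insert x A) = {a\<oplus>c\<otimes>x | a c. a\<in>Idl A\<and>c\<in>CR}" (is "_ = ?S")
proof
 have I: "ideal (Idl A) R" using assms genideal_ideal by blast
 note IC = ideal_carr[OF I]
 have "ideal ?S R"
 proof (rule idealI_cring)
  show "?S\<subseteq>CR" using IC assms by auto
  have "\<zero> = \<zero>\<oplus>\<zero>\<otimes>x" using assms by simp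
  thus "\<zero>\<in>?S" using ideal_zero[OF I] by blast
  fix a b assume "a\<in>?S"
  then obtain i c where a: "a = i\<oplus>c\<otimes>x" "i\<in>Idl A" "c\<in>CR" by blast
  { assume "b\<in>?S"
   then obtain j e where b: "b = j\<oplus>e\<otimes>x" "j\<in>Idl A" "e\<in>CR" by blast
   have "a\<oplus>b = (i\<oplus>j)\<oplus>(c\<oplus>e)\<otimes>x" unfolding a b using a b IC assms
    by (simp add: cr_simps)
   thus "a\<oplus>b\<in>?S" using a b ideal_add[OF I] by blast }
  fix r assume r: "r\<in>CR"
  have "r\<otimes>a = (r\<otimes>i)\<oplus>(r\<otimes>c)\<otimes>x" unfolding a using a IC assms r
   by (simp add: cr_simps)
  thus "r\<otimes>a\<in>?S" using a r ideal_mult[OF I] by blast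
 qed
 moreover have "insert x A\<subseteq>?S"
 proof
  fix y assume "y\<in>insert x A"
  then consider "y = x" | "y\<in>A" by blast
  then show "y\<in>?S"
  proof cases
   case 1
   have "y = \<zero>\<oplus>\<one>\<otimes>x" using 1 assms by simp
   thus ?thesis using ideal_zero[OF I] by blast
  next
   case 2
   have "y = y\<oplus>\<zero>\<otimes>x" using 2 assms by auto
   moreover have "y\<in>Idl A" using 2 genideal_self[OF assms(1)] by blast
   ultimately show ?thesis by blast
  qed
 qed
 ultimately show "Idl (insert x A)\<subseteq>?S" using genideal_minimal by blast
 have J: "ideal (Idl (insert x A)) R" using assms genideal_ideal by auto
 show "?S\<subseteq>Idl (insert x A)"
 proof
  fix y assume "y\<in>?S"
  then obtain i c where a: "y = i\<oplus>c\<otimes>x" "i\<in>Idl A" "c\<in>CR" by blast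
  have "Idl A\<subseteq>Idl (insert x A)"
   using genideal_minimal[OF J] genideal_self[of "insert x A"] assms by auto
  moreover have "x\<in>Idl (insert x A)" using genideal_self[of "insert x A"] assms by auto
  ultimately show "y\<in>Idl (insert x A)" unfolding a(1) using a ideal_add[OF J] ideal_mult[OF J] by blast
 qed
qed

lemma idl_ideal: "ideal I R ==> Idl I = I"
 using genideal_minimal[of I I] genideal_self[OF ideal_sub] by blast

lemma idl_mono: "A\<subseteq>B ==> B\<subseteq>CR ==> Idl A\<subseteq>Idl B"
 by (rule genideal_minimal[OF genideal_ideal order_trans[OF _ genideal_self]])

lemma idl_insert_ideal:
 assumes "ideal I R" "x\<in>CR"
 shows "Idl (insert x I) = {a\<oplus>c\<otimes>x | a c. a\<in>I\<and>c\<in>CR}"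
 using idl_insert[OF ideal_sub[OF assms(1)] assms(2)] idl_ideal[OF assms(1)] by simp

lemma idl_insert_idl:
 assumes "A\<subseteq>CR" "x\<in>CR"
 shows "Idl (insert x (Idl A)) = Idl (insert x A)"
 using idl_insert[OF assms] idl_insert_ideal[OF genideal_ideal[OF assms(1)] assms(2)] by simp

lemma idl_empty: "Idl {} = {\<zero>}"
 using zeroideal genideal_minimal[of "{\<zero>}" "{}"] genideal_ideal[of "{}"] ideal_zero by blast

lemma idl_insert_is_ideal: "ideal I R ==> x\<in>CR ==> ideal (Idl (insert x I)) R"
 using genideal_ideal ideal_sub by simp

lemma idl_insert_sup: "ideal I R ==> x\<in>CR ==> insert x I\<subseteq>Idl (insert x I)"
 using genideal_self[of "insert x I"] ideal_sub by simp

lemma one_in_ideal: "ideal I R ==> \<one>\<in>I ==> I = CR"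
 by (simp add: ideal.one_imp_carrier)

section \<open>Colon ideals and saturation at a prime ideal\<close>

definition colon :: "'a set => 'a => 'a set" where
 "colon I u = {r\<in>CR. r\<otimes>u\<in>I}"

lemma colon_ideal: assumes "ideal I R" "u\<in>CR" shows "ideal (colon I u) R"
proof (rule idealI_cring)
 show "colon I u\<subseteq>CR" by (auto simp: colon_def)
 show "\<zero>\<in>colon I u" using assms ideal_zero by (simp add: colon_def)
 show "a\<oplus>b\<in>colon I u" if "a\<in>colon I u" "b\<in>colon I u" for a b
  using assms that ideal_add by (simp add: colon_def l_distr)
 show "r\<otimes>a\<in>colon I u" if "a\<in>colon I u" "r\<in>CR" for a r
  using assms that ideal_mult by (simp add: colon_def m_assoc)
qed

text \<open>This is the contraction to \<open>R\<close> of the extension of \<open>J\<close> to the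
  local ring at \<open>P\<close>. Arguments in that local ring are run on saturated ideals of
  \<open>R\<close>.\<close>

definition saturation :: "'a set => 'a set => 'a set" where
 "saturation P J = {r\<in>CR. \<exists>s\<in>CR - P. s\<otimes>r\<in>J}"

lemma prime_compl_mult: "primeideal P R ==> s\<in>CR - P ==> t\<in>CR - P ==> s\<otimes>t\<in>CR - P"
 using primeideal.I_prime[of P R s t] by auto

lemma prime_one: "primeideal P R ==> \<one>\<in>CR - P"
 using one_in_ideal primeideal.I_notcarr primeideal_def by blast

lemma prime_pow: "primeideal P R ==> x\<in>CR ==> x[^](n::nat)\<in>P ==> x\<in>P"
proof (induction n)
 case (Suc n)
 thus ?case using primeideal.I_prime[of P R "x[^]n" x] by auto
qed (use prime_one[of P] in auto)

lemma saturation_ideal: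
 assumes P: "primeideal P R" and J: "ideal J R" shows "ideal (saturation P J) R"
proof (rule idealI_cring)
 show "saturation P J\<subseteq>CR" by (auto simp: saturation_def)
 show "\<zero>\<in>saturation P J" using prime_one[OF P] ideal_zero[OF J] by (auto simp: saturation_def)
 show "a\<oplus>b\<in>saturation P J" if ab: "a\<in>saturation P J" "b\<in>saturation P J" for a b
 proof -
  obtain s t where st: "s\<in>CR - P" "s\<otimes>a\<in>J" "t\<in>CR - P" "t\<otimes>b\<in>J" "a\<in>CR" "b\<in>CR"
   using ab by (auto simp: saturation_def)
  have "(s\<otimes>t)\<otimes>(a\<oplus>b) = t\<otimes>(s\<otimes>a)\<oplus>s\<otimes>(t\<otimes>b)"
   using st by (simp add: cr_simps)
  moreover have "\<dots>\<in>J" using st ideal_add[OF J] ideal_mult[OF J] by simp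
  ultimately show ?thesis using prime_compl_mult[OF P st(1,3)] st unfolding saturation_def by (metis (mono_tags, lifting) a_closed mem_Collect_eq)
 qed
 show "r\<otimes>a\<in>saturation P J" if ra: "a\<in>saturation P J" "r\<in>CR" for a r
 proof -
  obtain s where st: "s\<in>CR - P" "s\<otimes>a\<in>J" "a\<in>CR"
   using ra by (auto simp: saturation_def)
  have "s\<otimes>(r\<otimes>a) = r\<otimes>(s\<otimes>a)" using st ra by (simp add: cr_simps)
  hence "s\<otimes>(r\<otimes>a)\<in>J" using ra st ideal_mult[OF J] by simp
  thus ?thesis using ra st by (auto simp: saturation_def)
 qed
qed

lemma saturation_sup: "primeideal P R ==> ideal J R ==> J\<subseteq>saturation P J"
 using prime_one ideal_carr by (force simp: saturation_def)

lemma saturation_idem: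
 assumes P: "primeideal P R" and J: "ideal J R"
 shows "saturation P (saturation P J) = saturation P J"
proof
 show "saturation P (saturation P J)\<subseteq>saturation P J"
 proof
  fix r assume "r\<in>saturation P (saturation P J)"
  then obtain s t where st: "s\<in>CR - P" "t\<in>CR - P" "t\<otimes>(s\<otimes>r)\<in>J" "r\<in>CR"
   by (auto simp: saturation_def)
  have "(t\<otimes>s)\<otimes>r\<in>J" using st by (simp add: m_assoc)
  thus "r\<in>saturation P J" using st prime_compl_mult[OF P st(2,1)] by (auto simp: saturation_def)
 qed
 show "saturation P J\<subseteq>saturation P (saturation P J)"
  using saturation_sup[OF P saturation_ideal[OF P J]] .
qed

lemma saturation_mono: "J\<subseteq>K ==> saturation P J\<subseteq>saturation P K"
 by (auto simp: saturation_def)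

lemma saturated_dest:
 "saturation P J = J ==> s\<in>CR - P ==> r\<in>CR ==> s\<otimes>r\<in>J ==> r\<in>J"
 by (auto simp: saturation_def)

end

section \<open>Noetherian induction and Krull's principal ideal theorem\<close>

context noetherian_cring
begin

text \<open>Zorn's lemma applies because a nonempty chain of ideals of a Noetherian ring contains
  its union. The predicate \<open>Q\<close> is arbitrary, so this serves as Noetherian induction
  below.\<close>

lemma obtain_maximal_ideal:
 assumes "Q I0" "!!I. Q I ==> ideal I R"
 obtains I where "Q I" "!!J. Q J ==> I\<subseteq>J ==> J = I"
proof -
 have "\<exists>M\<in>Collect Q. \<forall>X\<in>Collect Q. M\<subseteq>X --> X = M"
 proof (rule subset_Zorn)
  fix C assume C: "subset.chain (Collect Q) C"
  hence CS: "C\<subseteq>Collect Q" unfolding subset_chain_def by simp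
  show "\<exists>U\<in>Collect Q. \<forall>X\<in>C. X\<subseteq>U"
  proof (cases "C = {}")
   case True thus ?thesis using assms by auto
  next
   case False
   have "subset.chain {I. ideal I R} C"
    using C assms(2) unfolding subset_chain_def by (simp add: subset_iff)
   hence "\<Union>C\<in>C" using ideal_chain_is_trivial False by blast
   thus ?thesis using CS by blast
  qed
 qed
 thus ?thesis using that by blast
qed

lemma ascending_ideals_stabilize:
 assumes "!!n. ideal (I n) R" "!!n::nat. I n\<subseteq>I (Suc n)"
 shows "\<exists>N. \<forall>n\<ge>N. I n = I N"
proof -
 obtain N where N: "!!J. J\<in>range I ==> I N\<subseteq>J ==> J = I N"
 proof -
  have "I 0\<in>range I" by simp
  then obtain M where M: "M\<in>range I" "!!J. J\<in>range I ==> M\<subseteq>J ==> J = M"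
   by (rule obtain_maximal_ideal) (use assms(1) in auto)
  from M(1) obtain N where "M = I N" by (rule rangeE)
  thus ?thesis using that[of N] M(2) by blast
 qed
 have "I N\<subseteq>I n" if "n\<ge>N" for n
  using that by (induction rule: dec_induct) (use assms(2) in auto)
 thus ?thesis using N by blast
qed

text \<open>An ideal \<open>P\<close> maximal among those over \<open>I\<close> that miss
  \<open>S\<close> is prime: for \<open>a\<close> and \<open>b\<close> outside \<open>P\<close> both
  \<open>P + (a)\<close> and \<open>P + (b)\<close> meet \<open>S\<close>, and the product of the
  two elements met lies in \<open>P + (a b)\<close>.\<close>

lemma exists_prime_avoiding:
 assumes I: "ideal I R" and S: "S\<subseteq>CR" "\<one>\<in>S" "!!s t. s\<in>S ==> t\<in>S ==> s\<otimes>t\<in>S"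
  and d: "I\<inter>S = {}"
 shows "\<exists>P. primeideal P R\<and>I\<subseteq>P\<and>P\<inter>S = {}"
proof -
 define F where "F = (%P. ideal P R\<and>I\<subseteq>P\<and>P\<inter>S = {})"
 have "F I" unfolding F_def using I d by simp
 then obtain P where FP: "F P" and mxF: "!!J. F J ==> P\<subseteq>J ==> J = P"
  by (rule obtain_maximal_ideal) (auto simp: F_def)
 hence P: "ideal P R" "I\<subseteq>P" "P\<inter>S = {}" unfolding F_def by auto
 have mx: "J = P" if "ideal J R" "P\<subseteq>J" "J\<inter>S = {}" for J
  using mxF[of J] that P(2) unfolding F_def by auto
 have meet: "\<exists>p\<in>P. \<exists>c\<in>CR. p\<oplus>c\<otimes>a\<in>S" if a: "a\<in>CR - P" for a
 proof (rule ccontr)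
  assume n: "\<not> ?thesis"
  have e: "Idl (insert a P) = {p\<oplus>c\<otimes>a | p c. p\<in>P\<and>c\<in>CR}"
   using idl_insert_ideal[OF P(1)] a by blast
  have i: "ideal (Idl (insert a P)) R" "insert a P\<subseteq>Idl (insert a P)"
   using idl_insert_is_ideal[OF P(1)] idl_insert_sup[OF P(1)] a by blast+
  have "Idl (insert a P)\<inter>S = {}" unfolding e using n by blast
  hence "Idl (insert a P) = P" using mx i P by blast
  thus False using i a by blast
 qed
 have "primeideal P R"
 proof (rule primeidealI[OF P(1) is_cring])
  show "CR\<noteq>P" using S P by blast
  fix a b assume ab: "a\<in>CR" "b\<in>CR" "a\<otimes>b\<in>P"
  show "a\<in>P \<or> b\<in>P"
  proof (rule ccontr)
   assume "\<not> ?thesis"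
   then obtain p c q e where pc: "p\<in>P" "c\<in>CR" "p\<oplus>c\<otimes>a\<in>S"
    "q\<in>P" "e\<in>CR" "q\<oplus>e\<otimes>b\<in>S" using meet ab by (metis Diff_iff)
   have pq: "p\<in>CR" "q\<in>CR" using pc P(1) ideal_carr by blast+
   have "(p\<oplus>c\<otimes>a)\<otimes>(q\<oplus>e\<otimes>b) = (q\<oplus>e\<otimes>b)\<otimes>p\<oplus>((c\<otimes>a)\<otimes>q\<oplus>(c\<otimes>e)\<otimes>(a\<otimes>b))"
    using pc pq ab by (simp add: cr_simps)
   moreover have "\<dots>\<in>P" using pc pq ab ideal_add[OF P(1)] ideal_mult[OF P(1)] by simp
   ultimately show False using S(3)[OF pc(3,6)] P by auto
  qed
 qed
 thus ?thesis using P by blast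
qed

text \<open>An element \<open>u\<close> with maximal annihilator modulo \<open>J\<close> is killed by everything that is nilpotent
 modulo \<open>J\<close>.\<close>

lemma exists_socle:
 assumes J: "ideal J R" "J\<noteq>CR" and K: "K\<subseteq>CR" "!!p. p\<in>K ==> \<exists>n::nat. p[^]n\<in>J"
 shows "\<exists>u\<in>CR - J. \<forall>p\<in>K. p\<otimes>u\<in>J"
proof -
 have "\<one>\<in>CR - J" using J one_in_ideal by blast
 hence "colon J \<one>\<in>colon J`(CR - J)" by (rule imageI)
 then obtain C where C: "C\<in>colon J`(CR - J)"
  and mxC: "!!D. D\<in>colon J`(CR - J) ==> C\<subseteq>D ==> D = C"
  by (rule obtain_maximal_ideal) (use colon_ideal[OF J(1)] in auto)
 from C obtain u where u: "u\<in>CR - J" "C = colon J u" by (rule imageE)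
 have mx: "colon J v = colon J u" if "v\<in>CR - J" "colon J u\<subseteq>colon J v" for v
  using mxC[OF imageI[OF that(1)]] that(2) u(2) by simp
 have "p\<otimes>u\<in>J" if p: "p\<in>K" for p
 proof (rule ccontr)
  assume n: "p\<otimes>u\<notin>J"
  have pc: "p\<in>CR" using K p by blast
  have "colon J u\<subseteq>colon J (p\<otimes>u)"
  proof
   fix r assume r: "r\<in>colon J u"
   hence "r\<otimes>(p\<otimes>u) = p\<otimes>(r\<otimes>u)" using pc u by (auto simp: colon_def cr_simps)
   thus "r\<in>colon J (p\<otimes>u)" using r pc ideal_mult[OF J(1)] by (auto simp: colon_def)
  qed
  hence eq: "colon J (p\<otimes>u) = colon J u" using mx n pc u by auto
  \<comment> \<open>Since \<open>p u\<close> has the same annihilator as \<open>u\<close> modulo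
    \<open>J\<close>, a factor \<open>p\<close> can be cancelled; one factor at a time, no power of
    \<open>p\<close> kills \<open>u\<close>.\<close>
  have "p[^]m\<notin>colon J u" for m :: nat
  proof (induction m)
   case 0 thus ?case using u by (auto simp: colon_def)
  next
   case (Suc m)
   have "p[^]Suc m\<otimes>u = p[^]m\<otimes>(p\<otimes>u)" using pc u by (simp add: m_assoc)
   hence "p[^]Suc m\<in>colon J u \<longleftrightarrow> p[^]m\<in>colon J (p\<otimes>u)" using pc by (simp add: colon_def)
   thus ?case using Suc eq by simp
  qed
  moreover obtain m :: nat where "p[^]m\<in>J" using K(2)[OF p] by blast
  ultimately show False using pc u ideal_mult_r[OF J(1)] by (auto simp: colon_def)
 qed
 thus ?thesis using u by blast
qed

text \<open>Saturated ideals over \<open>I\<close> are the ideals of the local ring at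
  \<open>P\<close> modulo \<open>I\<close>, whose maximal ideal is nil; such a Noetherian local ring
  is Artinian. In place of a composition series, \<open>I\<close> is taken maximal among the ideals
  with a chain that does not stabilize, and is enlarged to \<open>K\<close> by a socle
  element.\<close>

lemma saturated_dcc:
 assumes P: "primeideal P R" and I: "ideal I R" "saturation P I = I" "!!p. p\<in>P ==> \<exists>n::nat. p[^]n\<in>I"
  and C: "!!n::nat. ideal (C n) R" "!!n. saturation P (C n) = C n" "!!n. I\<subseteq>C n" "!!n. C (Suc n)\<subseteq>C n"
 shows "\<exists>N. \<forall>n\<ge>N. C n = C N"
proof (rule ccontr)
 assume neg: "\<not> ?thesis"
 define good where "good = (%(I::'a set) C. (\<forall>n::nat. ideal (C n) R\<and>saturation P (C n) = C n\<and>I\<subseteq>C n\<and>C (Suc n)\<subseteq>C n))"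
 define F where "F = (%I. ideal I R\<and>saturation P I = I\<and>(\<forall>p\<in>P. \<exists>n::nat. p[^]n\<in>I)\<and>
   (\<exists>C. good I C\<and>\<not> (\<exists>N. \<forall>n\<ge>N. C n = C N)))"
 have "good I C" unfolding good_def using C by simp
 hence "F I" unfolding F_def using neg I by auto
 then obtain I where IF: "F I" and mx: "!!J. F J ==> I\<subseteq>J ==> J = I"
  by (rule obtain_maximal_ideal) (auto simp: F_def)
 obtain C where I: "ideal I R" "saturation P I = I" "\<forall>p\<in>P. \<exists>n::nat. p[^]n\<in>I"
  and g: "good I C" and ns: "\<not> (\<exists>N. \<forall>n\<ge>N. C n = C N)" using IF unfolding F_def by blast
 have C: "!!n::nat. ideal (C n) R" "!!n. saturation P (C n) = C n" "!!n. I\<subseteq>C n" "!!n. C (Suc n)\<subseteq>C n"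
  using g unfolding good_def by blast+
 have anti: "C n\<subseteq>C m" if "m\<le>n" for m n using that C(4) by (rule lift_Suc_antimono_le[rotated])
 have "I\<noteq>CR"
 proof
  assume "I = CR"
  hence "C n = CR" for n using C(3)[of n] ideal_sub[OF C(1)[of n]] by auto
  thus False using ns by auto
 qed
 moreover have "P\<subseteq>CR" using P ideal_sub primeideal_def by blast
 ultimately obtain u where u: "u\<in>CR - I" "\<forall>p\<in>P. p\<otimes>u\<in>I"
  using exists_socle[of I P] I by blast
 define K0 where "K0 = Idl (insert u I)"
 have K0: "ideal K0 R" "insert u I\<subseteq>K0" unfolding K0_def
  using idl_insert_is_ideal idl_insert_sup I u by blast+
 have K0e: "K0 = {a\<oplus>c\<otimes>u | a c. a\<in>I\<and>c\<in>CR}"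
  unfolding K0_def using idl_insert_ideal I u by blast
 define K where "K = saturation P K0"
 have K: "ideal K R" "saturation P K = K" "insert u I\<subseteq>K"
  unfolding K_def using saturation_ideal[OF P K0(1)] saturation_idem[OF P K0(1)]
   saturation_sup[OF P K0(1)] K0 by blast+
 have KF: "\<not> F K" using mx K u by blast
 \<comment> \<open>The quotient of \<open>K\<close> by \<open>I\<close> is simple over the local
   ring at \<open>P\<close>: it is generated by \<open>u\<close>, which \<open>P\<close> kills, and
   a coefficient outside \<open>P\<close> can be cancelled.\<close>
 have simple: "J = I \<or> J = K" if J: "ideal J R" "saturation P J = J" "I\<subseteq>J" "J\<subseteq>K" for J
 proof (rule ccontr)
  assume n: "\<not> ?thesis"
  then obtain j where j: "j\<in>J" "j\<notin>I" using J by blast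
  hence jc: "j\<in>CR" "j\<in>K" using J ideal_carr by blast+
  then obtain s where s: "s\<in>CR - P" "s\<otimes>j\<in>K0" by (auto simp: K_def saturation_def)
  then obtain a c where ac: "a\<in>I" "c\<in>CR" "s\<otimes>j = a\<oplus>c\<otimes>u" unfolding K0e by blast
  have "c\<notin>P"
  proof
   assume "c\<in>P"
   hence "s\<otimes>j\<in>I" using ac u ideal_add[OF I(1)] by simp
   thus False using saturated_dest[OF I(2) s(1)] jc j by blast
  qed
  moreover have "c\<otimes>u\<in>J"
  proof (rule ideal_add_cancel[OF J(1), of a "c\<otimes>u"])
   show "a\<in>J" using ac J by blast
   show "a\<oplus>c\<otimes>u\<in>J" unfolding ac(3)[symmetric] using s j ideal_mult[OF J(1)] by simp
  qed (use ac u in auto)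
  ultimately have uJ: "u\<in>J" using saturated_dest[OF J(2), of c u] ac u by blast
  have "K0\<subseteq>J" unfolding K0e using uJ J ideal_add[OF J(1)] ideal_mult[OF J(1)] by blast
  hence "K\<subseteq>J" unfolding K_def using saturation_mono J(2) by metis
  thus False using n J by blast
 qed
 define D where "D = (%n. saturation P (C n <+>\<^bsub>R\<^esub> K))"
 have idsum: "ideal (C n <+>\<^bsub>R\<^esub> K) R" for n using add_ideals[OF C(1) K(1)] .
 have sumE: "(C n <+>\<^bsub>R\<^esub> K) = {a\<oplus>b | a b. a\<in>C n\<and>b\<in>K}" for n
  by (auto simp: set_add_def')
 have subK: "K\<subseteq>C n <+>\<^bsub>R\<^esub> K" for n
  unfolding sumE using ideal_zero[OF C(1)] ideal_carr[OF K(1)] by force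
 have subC: "C n\<subseteq>C n <+>\<^bsub>R\<^esub> K" for n
  unfolding sumE using ideal_zero[OF K(1)] ideal_carr[OF C(1)] by force
 have "good K D" unfolding good_def
 proof (intro allI conjI)
  fix n
  show "ideal (D n) R" "saturation P (D n) = D n" unfolding D_def
   using saturation_ideal[OF P idsum] saturation_idem[OF P idsum] .
  show "K\<subseteq>D n" unfolding D_def using subK saturation_sup[OF P idsum] by blast
  show "D (Suc n)\<subseteq>D n" unfolding D_def
   by (rule saturation_mono) (use C(4) in \<open>force simp: sumE\<close>)
 qed
 moreover have "\<forall>p\<in>P. \<exists>n::nat. p[^]n\<in>K" using I K by blast
 ultimately obtain N where N: "\<forall>n\<ge>N. D n = D N" using KF K unfolding F_def by blast
 have int: "C n\<inter>K = I \<or> C n\<inter>K = K" for n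
 proof (rule simple)
  show "ideal (C n\<inter>K) R" using i_intersect[OF C(1) K(1)] .
  show "saturation P (C n\<inter>K) = C n\<inter>K"
  proof
   show "saturation P (C n\<inter>K)\<subseteq>C n\<inter>K"
    using saturation_mono[of "C n\<inter>K" "C n" P] saturation_mono[of "C n\<inter>K" K P] C(2) K(2) by auto
   show "C n\<inter>K\<subseteq>saturation P (C n\<inter>K)"
    using saturation_sup[OF P i_intersect[OF C(1) K(1)]] .
  qed
 qed (use C K in auto)
 have "\<exists>N'. \<forall>n\<ge>N'. C n\<inter>K = C N'\<inter>K"
 proof (cases "\<exists>m. C m\<inter>K = I")
  case True
  then obtain m where m: "C m\<inter>K = I" by blast
  have "C n\<inter>K = I" if "n\<ge>m" for n using anti[OF that] m C(3)[of n] K(3) by blast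
  thus ?thesis using m by metis
 next
  case False thus ?thesis using int by metis
 qed
 then obtain N' where N': "\<forall>n\<ge>N'. C n\<inter>K = C N'\<inter>K" by blast
 define L where "L = max N N'"
 \<comment> \<open>Modular law: the chain is constant both after adding \<open>K\<close> and after
   intersecting with \<open>K\<close>, and its members are comparable.\<close>
 have "C n = C L" if n: "n\<ge>L" for n
 proof
  show "C n\<subseteq>C L" using anti n by blast
  show "C L\<subseteq>C n"
  proof
   fix j assume j: "j\<in>C L"
   hence jc: "j\<in>CR" using C ideal_carr by blast
   have "j\<in>D L" unfolding D_def using subC saturation_sup[OF P idsum] j by blast
   hence "j\<in>D n" using N n unfolding L_def by (metis max.bounded_iff order.refl)
   then obtain s a b where s: "s\<in>CR - P" "s\<otimes>j = a\<oplus>b" "a\<in>C n" "b\<in>K"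
    unfolding D_def sumE saturation_def by blast
   have bc: "b\<in>CR" using s K ideal_carr by blast
   have "a\<oplus>b\<in>C L" using s(1) j ideal_mult[OF C(1)] unfolding s(2)[symmetric] by blast
   hence "b\<in>C L" using ideal_add_cancel[OF C(1)[of L], of a b] s anti n bc by blast
   hence "b\<in>C n\<inter>K" using s N' n unfolding L_def by (metis IntI max.bounded_iff order.refl)
   hence "s\<otimes>j\<in>C n" using s ideal_add[OF C(1)] by simp
   thus "j\<in>C n" using saturated_dest[OF C(2) s(1) jc] by blast
  qed
 qed
 thus False using ns by blast
qed

text \<open>Nakayama's lemma over the local ring at \<open>P\<close>. A saturated ideal
  \<open>K\<close> over \<open>N\<close>, maximal among those not containing \<open>M\<close>,
  contains \<open>x M\<close>: otherwise \<open>K + (x m)\<close> would locally contain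
  \<open>m\<close>, and \<open>s m = k + c x m\<close> puts \<open>m\<close> into \<open>K\<close>
  because \<open>s - c x\<close> is outside \<open>P\<close>.\<close>

lemma nakayama_saturated:
 assumes P: "primeideal P R" and M: "ideal M R" and N: "ideal N R" and x: "x\<in>P"
  and h: "!!m. m\<in>M ==> \<exists>s\<in>CR - P. \<exists>n\<in>N. \<exists>m'\<in>M. s\<otimes>m = n\<oplus>x\<otimes>m'"
 shows "M\<subseteq>saturation P N"
proof (rule ccontr)
 assume neg: "\<not> ?thesis"
 define F where "F = (%K. ideal K R\<and>N\<subseteq>K\<and>saturation P K = K\<and>\<not> M\<subseteq>K)"
 have "F (saturation P N)" unfolding F_def
  using neg saturation_ideal[OF P N] saturation_idem[OF P N] saturation_sup[OF P N] by simp
 then obtain K where FK: "F K" and mx: "!!J. F J ==> K\<subseteq>J ==> J = K"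
  by (rule obtain_maximal_ideal) (auto simp: F_def)
 hence K: "ideal K R" "N\<subseteq>K" "saturation P K = K" "\<not> M\<subseteq>K" unfolding F_def by auto
 have Pi: "ideal P R" using P primeideal_def by blast
 have xc: "x\<in>CR" using ideal_carr[OF Pi x] .
 have xM: "x\<otimes>m\<in>K" if m: "m\<in>M" for m
 proof (rule ccontr)
  assume n: "x\<otimes>m\<notin>K"
  have mc: "m\<in>CR" using m M ideal_carr by blast
  define K0 where "K0 = Idl (insert (x\<otimes>m) K)"
  have K0: "ideal K0 R" "insert (x\<otimes>m) K\<subseteq>K0" unfolding K0_def
   using idl_insert_is_ideal idl_insert_sup K xc mc by simp_all
  have "saturation P K0\<noteq>K" using n K0 saturation_sup[OF P K0(1)] by blast
  moreover have KK: "K\<subseteq>saturation P K0" using saturation_sup[OF P K0(1)] K0 by auto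
  ultimately have "\<not> F (saturation P K0)" using mx by blast
  hence "M\<subseteq>saturation P K0"
   using saturation_ideal[OF P K0(1)] saturation_idem[OF P K0(1)] K(2) KK unfolding F_def by auto
  hence "m\<in>saturation P K0" using m by blast
  then obtain s where s: "s\<in>CR - P" "s\<otimes>m\<in>K0" unfolding saturation_def by blast
  then obtain k c where kc: "k\<in>K" "c\<in>CR" "s\<otimes>m = k\<oplus>c\<otimes>(x\<otimes>m)"
   unfolding K0_def using idl_insert_ideal[OF K(1)] xc mc by auto
  have k: "k\<in>CR" using kc K ideal_carr by blast
  have "(s\<ominus>c\<otimes>x)\<otimes>m = s\<otimes>m\<ominus>c\<otimes>(x\<otimes>m)" using s kc xc mc by (simp add: cr_simps)
  also have "\<dots> = k" unfolding kc(3) using k kc xc mc by (simp add: cr_simps)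
  finally have "(s\<ominus>c\<otimes>x)\<otimes>m\<in>K" using kc by simp
  moreover have "s\<ominus>c\<otimes>x\<in>CR - P"
   using s kc xc ideal_sub_cancel[OF Pi, of "c\<otimes>x" s] ideal_mult[OF Pi x] by auto
  ultimately have "m\<in>K" using saturated_dest[OF K(3)] mc by blast
  hence "x\<otimes>m\<in>K" using ideal_mult[OF K(1)] xc by blast
  thus False using n by blast
 qed
 obtain m where m: "m\<in>M" "m\<notin>K" using K by blast
 obtain s n m' where "s\<in>CR - P" "n\<in>N" "m'\<in>M" "s\<otimes>m = n\<oplus>x\<otimes>m'" using h m by blast
 moreover from this have "s\<otimes>m\<in>K" using xM K ideal_add[OF K(1)] by auto
 ultimately show False using saturated_dest[OF K(3)] m M ideal_carr by blast
qed

text \<open>Krull's principal ideal theorem: the prime \<open>P2\<close>, of height at least two over \<open>P0\<close>, is not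
 minimal over \<open>P0 + (x)\<close>.\<close>

lemma krull_principal_ideal:
 assumes P0: "primeideal P0 R" and P1: "primeideal P1 R" and P2: "primeideal P2 R"
  and sub: "P0\<subset>P1" "P1\<subset>P2" and x: "x\<in>P2"
 shows "\<exists>P. primeideal P R\<and>P0\<subset>P\<and>P\<subset>P2\<and>x\<in>P"
proof (rule ccontr)
 assume neg: "\<not> ?thesis"
 have i: "ideal P0 R" "ideal P1 R" "ideal P2 R" using P0 P1 P2 primeideal_def by blast+
 have xc: "x\<in>CR" using i x ideal_carr by blast
 have x1: "x\<notin>P1" using neg P1 sub by blast
 hence x0: "x\<notin>P0" using sub by blast
 define I0 where "I0 = Idl (insert x P0)"
 have I0: "ideal I0 R" "insert x P0\<subseteq>I0" unfolding I0_def
  using idl_insert_is_ideal idl_insert_sup i xc by blast+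
 define I where "I = saturation P2 I0"
 have I: "ideal I R" "saturation P2 I = I" "I0\<subseteq>I"
  unfolding I_def using saturation_ideal[OF P2 I0(1)] saturation_idem[OF P2 I0(1)]
   saturation_sup[OF P2 I0(1)] by blast+
 have nil: "\<exists>n::nat. p[^]n\<in>I" if p: "p\<in>P2" for p
 proof (rule ccontr)
  assume no: "\<not> ?thesis"
  have pc: "p\<in>CR" using i p ideal_carr by blast
  \<comment> \<open>A prime over \<open>I0\<close> that misses these products lies inside
    \<open>P2\<close>, does not contain \<open>p\<close>, and contains both \<open>x\<close> and
    \<open>P0\<close>, against \<open>neg\<close>.\<close>
  define S where "S = {s\<otimes>p[^]n | s n::nat. s\<in>CR - P2}"
  have "\<exists>P. primeideal P R\<and>I0\<subseteq>P\<and>P\<inter>S = {}"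
  proof (rule exists_prime_avoiding[OF I0(1)])
   show "S\<subseteq>CR" unfolding S_def using pc by auto
   have "\<one> = \<one>\<otimes>p[^](0::nat)" by simp
   thus "\<one>\<in>S" unfolding S_def using prime_one[OF P2] by blast
   show "a\<otimes>b\<in>S" if "a\<in>S" "b\<in>S" for a b
   proof -
    obtain s n t m where st: "a = s\<otimes>p[^](n::nat)" "b = t\<otimes>p[^](m::nat)" "s\<in>CR - P2" "t\<in>CR - P2"
     using \<open>a\<in>S\<close> \<open>b\<in>S\<close> unfolding S_def by blast
    have "a\<otimes>b = (s\<otimes>t)\<otimes>p[^](n + m)" unfolding st using st pc
     by (simp add: nat_pow_mult[symmetric] cr_simps)
    thus ?thesis unfolding S_def using prime_compl_mult[OF P2] st by blast
   qed
   show "I0\<inter>S = {}"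
   proof -
    have "s\<otimes>p[^]n\<notin>I0" if "s\<in>CR - P2" for s and n :: nat
     using no that pc unfolding I_def saturation_def by auto
    thus ?thesis unfolding S_def by blast
   qed
  qed
  then obtain P where P: "primeideal P R" "I0\<subseteq>P" "P\<inter>S = {}" by blast
  have Pi: "ideal P R" using P primeideal_def by blast
  have "P\<subseteq>P2"
  proof
   fix s assume s: "s\<in>P"
   have sc: "s\<in>CR" using s Pi ideal_carr by blast
   show "s\<in>P2"
   proof (rule ccontr)
    assume "s\<notin>P2"
    hence "s\<otimes>p[^](0::nat)\<in>S" unfolding S_def using sc by blast
    thus False using P s sc by auto
   qed
  qed
  moreover have "p\<notin>P"
  proof
   assume "p\<in>P"
   moreover have "\<one>\<otimes>p[^](1::nat)\<in>S" unfolding S_def using prime_one[OF P2] by blast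
   ultimately show False using P pc by auto
  qed
  ultimately show False using neg P I0 x0 p by blast
 qed
 obtain y where y: "y\<in>P1" "y\<notin>P0" using sub by blast
 have yc: "y\<in>CR" using i y ideal_carr by blast
 define Q0 where "Q0 = (%n::nat. Idl (insert (y[^]n) P0))"
 have Q0: "ideal (Q0 n) R" "insert (y[^]n) P0\<subseteq>Q0 n" for n unfolding Q0_def
  using idl_insert_is_ideal[OF i(1)] idl_insert_sup[OF i(1)] yc by auto
 \<comment> \<open>In the local ring at \<open>P1\<close> these are the powers of \<open>y\<close>
   over \<open>P0\<close>, in the role of the symbolic powers in Krull's proof. Together with
   \<open>x\<close> they give a descending chain over \<open>I\<close>, stationary by
   \<open>saturated_dcc\<close>; Nakayama's lemma then removes \<open>x\<close>.\<close>
 define Q where "Q = (%n. saturation P1 (Q0 n))"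
 have Q: "ideal (Q n) R" "saturation P1 (Q n) = Q n" "Q0 n\<subseteq>Q n" for n
  unfolding Q_def using saturation_ideal[OF P1 Q0(1)] saturation_idem[OF P1 Q0(1)]
   saturation_sup[OF P1 Q0(1)] by blast+
 have Qdec: "Q (Suc n)\<subseteq>Q n" for n
 proof -
  have "y[^]Suc n\<in>Q0 n" using Q0(2)[of n] ideal_mult_r[OF Q0(1)[of n]] yc by simp
  hence "Q0 (Suc n)\<subseteq>Q0 n" unfolding Q0_def[of ] using Q0[of n] genideal_minimal[of "Q0 n"]
   by (simp add: Q0_def)
  thus ?thesis unfolding Q_def by (rule saturation_mono)
 qed
 define C0 where "C0 = (%n. Idl (insert x (Q n)))"
 have C0: "ideal (C0 n) R" "insert x (Q n)\<subseteq>C0 n" for n unfolding C0_def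
  using idl_insert_is_ideal idl_insert_sup Q xc by blast+
 define C where "C = (%n. saturation P2 (C0 n))"
 have C: "ideal (C n) R" "saturation P2 (C n) = C n" "C0 n\<subseteq>C n" for n
  unfolding C_def using saturation_ideal[OF P2 C0(1)] saturation_idem[OF P2 C0(1)]
   saturation_sup[OF P2 C0(1)] by blast+
 have "\<exists>N. \<forall>n\<ge>N. C n = C N"
 proof (rule saturated_dcc[OF P2 I(1,2) nil C(1,2)])
  fix n
  have "insert x P0\<subseteq>C0 n" using C0(2)[of n] Q(3)[of n] Q0(2)[of n] by blast
  hence "I0\<subseteq>C0 n" unfolding I0_def using genideal_minimal[OF C0(1)] by blast
  thus "I\<subseteq>C n" unfolding I_def C_def by (rule saturation_mono)
  have "C0 (Suc n)\<subseteq>C0 n" unfolding C0_def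
   using idl_mono[of "insert x (Q (Suc n))" "insert x (Q n)"] Qdec[of n] ideal_sub[OF Q(1)] xc by blast
  thus "C (Suc n)\<subseteq>C n" unfolding C_def by (rule saturation_mono)
 qed
 then obtain n where n: "C (Suc n) = C n" by (metis le_Suc_eq order.refl)
 have "Q n\<subseteq>saturation P2 (Q (Suc n))"
 proof (rule nakayama_saturated[OF P2 Q(1) Q(1) x])
  fix r assume r: "r\<in>Q n"
  hence rc: "r\<in>CR" using Q ideal_carr by blast
  have "r\<in>C (Suc n)" using r n C(3)[of n] C0(2)[of n] by blast
  then obtain s where s: "s\<in>CR - P2" "s\<otimes>r\<in>C0 (Suc n)" unfolding C_def saturation_def by blast
  then obtain q b where qb: "q\<in>Q (Suc n)" "b\<in>CR" "s\<otimes>r = q\<oplus>b\<otimes>x"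
   unfolding C0_def using idl_insert_ideal[OF Q(1) xc] by auto
  have "q\<oplus>b\<otimes>x\<in>Q n" unfolding qb(3)[symmetric] using r s ideal_mult[OF Q(1)] by blast
  hence "b\<otimes>x\<in>Q n" using ideal_add_cancel[OF Q(1)[of n], of q "b\<otimes>x"] qb Qdec xc by blast
  hence "x\<otimes>b\<in>Q n" using qb xc by (simp add: m_comm)
  hence "b\<in>Q n" using saturated_dest[OF Q(2)[of n], of x b] x1 xc qb by blast
  moreover have "s\<otimes>r = q\<oplus>x\<otimes>b" using qb xc by (simp add: m_comm)
  ultimately show "\<exists>s\<in>CR - P2. \<exists>q\<in>Q (Suc n). \<exists>b\<in>Q n. s\<otimes>r = q\<oplus>x\<otimes>b" using s qb by blast
 qed
 moreover have "y[^]n\<in>Q n" using Q(3)[of n] Q0(2)[of n] by blast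
 ultimately obtain s where s: "s\<in>CR - P2" "s\<otimes>y[^]n\<in>Q (Suc n)" unfolding saturation_def by blast
 have "y[^]n\<in>Q (Suc n)" using saturated_dest[OF Q(2)[of "Suc n"], of s "y[^]n"] s sub yc by blast
 then obtain t where t: "t\<in>CR - P1" "t\<otimes>y[^]n\<in>Q0 (Suc n)" unfolding Q_def saturation_def by blast
 then obtain p c where pc: "p\<in>P0" "c\<in>CR" "t\<otimes>y[^]n = p\<oplus>c\<otimes>y[^]Suc n"
  unfolding Q0_def using idl_insert_ideal[OF i(1)] yc by auto
 have pR: "p\<in>CR" using pc i ideal_carr by blast
 have "y[^]n\<otimes>(t\<ominus>c\<otimes>y) = t\<otimes>y[^]n\<ominus>c\<otimes>y[^]Suc n"
  using t pc yc by (simp add: cr_simps)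
 also have "\<dots> = p" unfolding pc(3) using pR pc yc by (simp add: cr_simps)
 finally have "y[^]n\<otimes>(t\<ominus>c\<otimes>y)\<in>P0" using pc by simp
 hence "y[^]n\<in>P0 \<or> t\<ominus>c\<otimes>y\<in>P0" using primeideal.I_prime[OF P0, of "y[^]n" "t\<ominus>c\<otimes>y"] t pc yc by simp
 hence "t\<ominus>c\<otimes>y\<in>P0" using prime_pow[OF P0 yc] y by blast
 hence "t\<ominus>c\<otimes>y\<in>P1" using sub by blast
 hence "t\<in>P1" using ideal_sub_cancel[OF i(2), of "c\<otimes>y" t] ideal_mult[OF i(2) y(1)] pc t by blast
 thus False using t by blast
qed

end

section \<open>Chains of primes and systems of parameters\<close>

locale local_noetherian = noetherian_cring +
 fixes \<mm>
 assumes local: "local_ring R \<mm>"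
begin

lemma m_max: "maximalideal \<mm> R" using local by (simp add: local_ring_def)

lemma m_prime: "primeideal \<mm> R" using maximalideal_prime[OF m_max] .

lemma m_ideal: "ideal \<mm> R" using m_prime primeideal_def by blast

lemma m_carr: "x\<in>\<mm> ==> x\<in>CR" using m_ideal ideal_carr by blast

lemma proper_ideal_sub_m:
 assumes "ideal J R" "J\<noteq>CR" shows "J\<subseteq>\<mm>"
proof -
 define F where "F = (%I. ideal I R\<and>I\<noteq>CR\<and>J\<subseteq>I)"
 have "F J" unfolding F_def using assms by simp
 then obtain I where I: "F I" "!!K. F K ==> I\<subseteq>K ==> K = I"
  by (rule obtain_maximal_ideal) (auto simp: F_def)
 have "maximalideal I R"
 proof (rule maximalidealI)
  show "ideal I R" "CR\<noteq>I" using I unfolding F_def by auto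
  show "K = I \<or> K = CR" if "ideal K R" "I\<subseteq>K" "K\<subseteq>CR" for K
   using I that unfolding F_def by blast
 qed
 hence "I = \<mm>" using local unfolding local_ring_def by blast
 thus ?thesis using I unfolding F_def by blast
qed

lemma unit_cancel:
 assumes "s\<in>CR - \<mm>" "r\<in>CR" "ideal J R" "s\<otimes>r\<in>J" shows "r\<in>J"
proof -
 have "s\<in>colon J r" using assms by (simp add: colon_def)
 hence "colon J r = CR" using proper_ideal_sub_m[OF colon_ideal] assms by blast
 hence "\<one>\<in>colon J r" by simp
 thus ?thesis using assms by (simp add: colon_def)
qed

primrec prime_chain :: "nat => 'a set => bool" where
 "prime_chain 0 P \<longleftrightarrow> P = \<mm>"
| "prime_chain (Suc n) P \<longleftrightarrow> primeideal P R\<and>(\<exists>Q. P\<subset>Q\<and>prime_chain n Q)"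

lemma prime_chain_prime: "prime_chain n P ==> primeideal P R"
 by (cases n) (use m_prime in auto)

lemma prime_chain_sub: "prime_chain n P ==> P\<subseteq>\<mm>"
 by (induction n arbitrary: P) auto

text \<open>The top prime \<mm> contains \<open>x\<close>. From there downwards, Krull's theorem
  replaces each prime by one that contains \<open>x\<close>, and the length of the chain is
  kept.\<close>

lemma prime_chain_through:
 "prime_chain (Suc n) P ==> x\<in>\<mm> ==> \<exists>Q. P\<subset>Q\<and>x\<in>Q\<and>prime_chain n Q"
proof (induction n arbitrary: P)
 case 0 thus ?case by auto
next
 case (Suc n)
 then obtain P1 where P1: "primeideal P R" "P\<subset>P1" "prime_chain (Suc n) P1" by auto
 obtain P2 where P2: "P1\<subset>P2" "x\<in>P2" "prime_chain n P2" using Suc.IH[OF P1(3) Suc.prems(2)] by blast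
 obtain Q where "primeideal Q R" "P\<subset>Q" "Q\<subset>P2" "x\<in>Q"
  using krull_principal_ideal[OF P1(1) prime_chain_prime[OF P1(3)] prime_chain_prime[OF P2(3)] P1(2) P2(1,2)] by blast
 thus ?case using P2(3) prime_chain.simps(2) by blast
qed

text \<open>This is the argument that a regular local ring is a domain, relative to
  \<open>J\<close>. Some \<open>x\<close> in \<open>X\<close> is outside \<open>P\<close>; by
  induction the next prime through \<open>x\<close> is \<open>J + (x)\<close>. A multiple of
  \<open>x\<close> in \<open>P\<close> has its cofactor in \<open>P\<close>, so
  \<open>P = J + x P\<close>, and Nakayama's lemma gives \<open>P = J\<close>.\<close>

lemma full_chain_start:
 assumes "finite X" "X\<subseteq>\<mm>" "ideal J R" "Idl (J\<union>X) = \<mm>" "J\<subseteq>P" "prime_chain (card X) P"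
 shows "P = J"
 using assms
proof (induction "card X" arbitrary: X J P)
 case 0
 hence "X = {}" "P = \<mm>" by auto
 thus ?case using 0 idl_ideal by simp
next
 case (Suc n)
 have pc: "prime_chain (Suc n) P" using Suc by simp
 have Pp: "primeideal P R" using prime_chain_prime[OF pc] .
 have Pi: "ideal P R" using Pp primeideal_def by blast
 have "\<not> X\<subseteq>P"
 proof
  assume "X\<subseteq>P"
  hence "\<mm>\<subseteq>P" using genideal_minimal[OF Pi, of "J\<union>X"] Suc by simp
  thus False using pc prime_chain_sub by auto
 qed
 then obtain x where x: "x\<in>X" "x\<notin>P" by blast
 have xm: "x\<in>\<mm>" using x Suc by blast
 have xc: "x\<in>CR" using m_carr[OF xm] .
 obtain Q where Q: "P\<subset>Q" "x\<in>Q" "prime_chain n Q" using prime_chain_through[OF pc xm] by blast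
 have Qi: "ideal Q R" using prime_chain_prime[OF Q(3)] primeideal_def by blast
 let ?J = "Idl (insert x J)"
 have J': "ideal ?J R" "insert x J\<subseteq>?J" using idl_insert_is_ideal idl_insert_sup Suc(5) xc by auto
 have Xc: "J\<union>X\<subseteq>CR" using Suc.prems m_carr ideal_sub by blast
 have "Idl (?J\<union>(X - {x})) = \<mm>"
 proof
  have "?J\<subseteq>\<mm>" using genideal_minimal[OF m_ideal, of "insert x J"] Suc.prems xm prime_chain_sub[OF pc] by blast
  thus "Idl (?J\<union>(X - {x}))\<subseteq>\<mm>" using genideal_minimal[OF m_ideal, of "?J\<union>(X - {x})"] Suc.prems(2) by auto
  have "J\<union>X\<subseteq>?J\<union>(X - {x})" using J' by blast
  moreover have "?J\<union>(X - {x})\<subseteq>CR" using ideal_sub[OF J'(1)] Xc by blast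
  ultimately show "\<mm>\<subseteq>Idl (?J\<union>(X - {x}))" using idl_mono Suc.prems(4) by metis
 qed
 moreover have "?J\<subseteq>Q" using genideal_minimal[OF Qi, of "insert x J"] Q Suc.prems by blast
 moreover have "card (X - {x}) = n" using Suc x by simp
 ultimately have QJ: "Q = ?J" using Suc.hyps(1)[of "X - {x}" ?J Q] Suc.prems J' Q by auto
 have "P\<subseteq>saturation \<mm> J"
 proof (rule nakayama_saturated[OF m_prime Pi Suc.prems(3) xm])
  fix p assume p: "p\<in>P"
  hence "p\<in>?J" using Q QJ by blast
  then obtain j c where jc: "j\<in>J" "c\<in>CR" "p = j\<oplus>c\<otimes>x"
   using idl_insert_ideal[OF Suc.prems(3) xc] by auto
  have "c\<otimes>x\<in>P" using ideal_add_cancel[OF Pi, of j "c\<otimes>x"] jc p Suc.prems xc by auto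
  hence "c\<in>P" using primeideal.I_prime[OF Pp, of c x] jc xc x by blast
  moreover have "\<one>\<otimes>p = j\<oplus>x\<otimes>c" using jc xc ideal_carr[OF Suc.prems(3)] by (simp add: m_comm)
  ultimately show "\<exists>s\<in>CR - \<mm>. \<exists>n\<in>J. \<exists>c\<in>P. s\<otimes>p = n\<oplus>x\<otimes>c"
   using prime_one[OF m_prime] jc by blast
 qed
 hence "P\<subseteq>J" using unit_cancel[OF _ _ Suc.prems(3)] by (auto simp: saturation_def)
 thus ?case using Suc.prems by blast
qed

end

section \<open>Regularity modulo an ideal, and ideals generated by powers\<close>

context cring
begin

definition regular_mod :: "'a set => 'a => bool" where
 "regular_mod J x \<longleftrightarrow> (\<forall>r\<in>CR. r\<otimes>x\<in>J --> r\<in>J)"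

lemma regular_modD: "regular_mod J x ==> r\<in>CR ==> r\<otimes>x\<in>J ==> r\<in>J"
 by (auto simp: regular_mod_def)

text \<open>Multiplication by \<open>u\<close> embeds \<open>R / (J, v)\<close> in
  \<open>R / (J, u v)\<close> with quotient \<open>R / (J, u)\<close>, and an element regular on
  both ends of an extension is regular in the middle. The proof is this chase on
  representatives.\<close>

lemma regular_mod_mult_gen:
 assumes J: "ideal J R" and c: "u\<in>CR" "v\<in>CR" "x\<in>CR"
  and r: "regular_mod J u" "regular_mod (Idl (insert u J)) x" "regular_mod (Idl (insert v J)) x"
 shows "regular_mod (Idl (insert (u\<otimes>v) J)) x"
 unfolding regular_mod_def
proof (intro ballI impI)
 note e = idl_insert_ideal[OF J]
 fix r assume rc: "r\<in>CR" and "r\<otimes>x\<in>Idl (insert (u\<otimes>v) J)"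
 then obtain j a where ja: "j\<in>J" "a\<in>CR" "r\<otimes>x = j\<oplus>a\<otimes>(u\<otimes>v)"
  using e[of "u\<otimes>v"] c by auto
 have jc: "j\<in>CR" using ja J ideal_carr by blast
 have "r\<otimes>x = j\<oplus>(a\<otimes>v)\<otimes>u" using ja c jc by (simp add: cr_simps)
 hence "r\<otimes>x\<in>Idl (insert u J)" using e[OF c(1)] ja c by auto
 hence "r\<in>Idl (insert u J)" using r(2) rc regular_modD by blast
 then obtain j' r' where j': "j'\<in>J" "r'\<in>CR" "r = j'\<oplus>r'\<otimes>u" using e[OF c(1)] by auto
 have jc': "j'\<in>CR" using j' J ideal_carr by blast
 note cs [simp] = j'(2) ja(2) jc jc' c
 have "(r'\<otimes>x\<ominus>a\<otimes>v)\<otimes>u = (((j'\<oplus>r'\<otimes>u)\<otimes>x\<ominus>(j\<oplus>a\<otimes>(u\<otimes>v)))\<oplus>j)\<ominus>x\<otimes>j'"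
  using cs by algebra
 also have "\<dots> = \<zero>\<oplus>j\<ominus>x\<otimes>j'" unfolding j'(3)[symmetric] ja(3)[symmetric] using rc c by (simp add: a_minus_def r_neg)
 also have "\<dots>\<in>J" using ja j' c J jc by (simp add: ideal_diff ideal_mult)
 finally have "r'\<otimes>x\<ominus>a\<otimes>v\<in>J" by (rule regular_modD[OF r(1), rotated]) simp
 moreover have "r'\<otimes>x = (r'\<otimes>x\<ominus>a\<otimes>v)\<oplus>a\<otimes>v" using cs by algebra
 ultimately have "r'\<otimes>x\<in>Idl (insert v J)" unfolding e[OF c(2)] using ja(2) by blast
 hence "r'\<in>Idl (insert v J)" using r(3) j' regular_modD by blast
 then obtain k b where kb: "k\<in>J" "b\<in>CR" "r' = k\<oplus>b\<otimes>v" using e[OF c(2)] by auto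
 have kc: "k\<in>CR" using kb J ideal_carr by blast
 have "r = (j'\<oplus>u\<otimes>k)\<oplus>b\<otimes>(u\<otimes>v)" unfolding j'(3) kb(3) using kc jc' kb c by (simp add: cr_simps)
 moreover have "j'\<oplus>u\<otimes>k\<in>J" using j' kb c J by (simp add: ideal_add ideal_mult)
 ultimately show "r\<in>Idl (insert (u\<otimes>v) J)" using e[of "u\<otimes>v"] c kb by auto
qed

lemma regular_mod_pow:
 assumes "regular_mod J x" "x\<in>CR" shows "regular_mod J (x[^](n::nat))"
proof (induction n)
 case 0 thus ?case by (simp add: regular_mod_def)
next
 case (Suc n)
 show ?case unfolding regular_mod_def
 proof (intro ballI impI)
  fix r assume r: "r\<in>CR" "r\<otimes>x[^]Suc n\<in>J"
  hence "(r\<otimes>x[^]n)\<otimes>x\<in>J" using assms by (simp add: m_assoc)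
  hence "r\<otimes>x[^]n\<in>J" using assms r regular_modD by simp
  thus "r\<in>J" using Suc r regular_modD by blast
 qed
qed

lemma cancel_regular_gen:
 assumes J: "ideal J R" and c: "r\<in>CR" "y\<in>CR" "b\<in>CR"
  and reg: "regular_mod J y" and h: "r\<otimes>y\<in>Idl (insert (b\<otimes>y) J)"
 shows "r\<in>Idl (insert b J)"
proof -
 obtain j a where ja: "j\<in>J" "a\<in>CR" "r\<otimes>y = j\<oplus>a\<otimes>(b\<otimes>y)"
  using idl_insert_ideal[OF J, of "b\<otimes>y"] c h by auto
 have jc: "j\<in>CR" using ja J ideal_carr by blast
 note cs [simp] = c ja(2) jc
 have "(r\<ominus>a\<otimes>b)\<otimes>y = r\<otimes>y\<ominus>a\<otimes>(b\<otimes>y)" using cs by algebra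
 also have "\<dots> = j\<oplus>a\<otimes>(b\<otimes>y)\<ominus>a\<otimes>(b\<otimes>y)" unfolding ja(3) ..
 also have "\<dots> = j" using cs by algebra
 finally have "(r\<ominus>a\<otimes>b)\<otimes>y\<in>J" using ja(1) by (rule ssubst)
 hence "r\<ominus>a\<otimes>b\<in>J" by (rule regular_modD[OF reg, rotated]) simp
 moreover have "r = (r\<ominus>a\<otimes>b)\<oplus>a\<otimes>b" using cs by algebra
 ultimately show ?thesis unfolding idl_insert_ideal[OF J c(3)] using ja(2) by blast
qed

text \<open>Each element has its own exponent, so that inductions can lower the exponent of one
  parameter at a time.\<close>

definition pow_ideal :: "('a => nat) => 'a set => 'a set" where
 "pow_ideal \<kappa> A = Idl ((%a. a[^]\<kappa> a)`A)"

lemma pow_ideal_ideal: "A\<subseteq>CR ==> ideal (pow_ideal \<kappa> A) R"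
 unfolding pow_ideal_def by (rule genideal_ideal) auto

lemma pow_ideal_mono: "A\<subseteq>B ==> B\<subseteq>CR ==> pow_ideal \<kappa> A\<subseteq>pow_ideal \<kappa> B"
 unfolding pow_ideal_def by (rule idl_mono) auto

lemma pow_ideal_gen: "A\<subseteq>CR ==> a\<in>A ==> a[^]\<kappa> a\<in>pow_ideal \<kappa> A"
 unfolding pow_ideal_def using genideal_self[of "(%a. a[^]\<kappa> a)`A"] by auto

lemma pow_ideal_least:
 "ideal J R ==> (!!a. a\<in>A ==> a[^]\<kappa> a\<in>J) ==> pow_ideal \<kappa> A\<subseteq>J"
 unfolding pow_ideal_def by (rule genideal_minimal) auto

lemma pow_ideal_insert:
 "A\<subseteq>CR ==> a\<in>CR ==> pow_ideal \<kappa> (insert a A) = Idl (insert (a[^]\<kappa> a) (pow_ideal \<kappa> A))"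
 unfolding pow_ideal_def using idl_insert_idl[of "(%a. a[^]\<kappa> a)`A" "a[^]\<kappa> a"] by auto

lemma pow_ideal_remove:
 "X\<subseteq>CR ==> a\<in>X ==> pow_ideal \<kappa> X = Idl (insert (a[^]\<kappa> a) (pow_ideal \<kappa> (X - {a})))"
 using pow_ideal_insert[of "X - {a}" a \<kappa>] by (metis Diff_subset insert_Diff subset_iff)

lemma pow_ideal_cong: "(!!a. a\<in>A ==> \<kappa> a = \<kappa>' a) ==> pow_ideal \<kappa> A = pow_ideal \<kappa>' A"
 unfolding pow_ideal_def by (metis (mono_tags, lifting) image_cong)

end

text \<open>Every subset of \<open>X\<close> generates a prime ideal, and no proper subset generates the rest: the form
 in which a regular system of parameters \<open>X\<close> is used.\<close>

locale parameter_system = noetherian_cring +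
 fixes X
 assumes X_carr: "X\<subseteq>CR" and X_fin: "finite X"
  and X_prime: "A\<subseteq>X ==> primeideal (Idl A) R"
  and X_indep: "A\<subseteq>X ==> x\<in>X - A ==> x\<notin>Idl A"
begin

text \<open>Without powers, \<open>Idl A\<close> is prime and does not contain \<open>x\<close>.
  Each further \<open>b\<close> is raised to its power by \<open>regular_mod_mult_gen\<close>:
  modulo the other generators \<open>b\<close> is regular, and \<open>x\<close> is regular modulo
  \<open>b\<close>, hence, by induction on the exponent, modulo every power of
  \<open>b\<close>.\<close>

lemma regular_mod_subset_powers:
 assumes "B\<subseteq>X" "A\<subseteq>X" "A\<inter>B = {}" "x\<in>X - (A\<union>B)"
 shows "regular_mod (Idl (A\<union>(%b. b[^](\<kappa> b::nat))`B)) x"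
proof -
 have "finite B" using assms X_fin finite_subset by blast
 thus ?thesis using assms
 proof (induction B arbitrary: A x rule: finite_induct)
  case empty
  have "primeideal (Idl A) R" "x\<notin>Idl A" using X_prime X_indep empty by auto
  moreover have "x\<in>CR" using empty X_carr by blast
  ultimately show ?case unfolding regular_mod_def using primeideal.I_prime[of "Idl A" R _ x] by auto
 next
  case (insert b B)
  let ?S = "A\<union>(%b. b[^](\<kappa> b::nat))`B"
  have S: "?S\<subseteq>CR" using insert.prems X_carr by auto
  have bc: "b\<in>CR" "x\<in>CR" using insert.prems X_carr by auto
  define J where "J = Idl ?S"
  have J: "ideal J R" unfolding J_def using genideal_ideal[OF S] .
  have rb: "regular_mod J b" unfolding J_def using insert by blast
  have "regular_mod (Idl (insert b A\<union>(%b. b[^](\<kappa> b::nat))`B)) x"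
   by (rule insert.IH) (use insert in auto)
  hence rx: "regular_mod (Idl (insert b J)) x" unfolding J_def idl_insert_idl[OF S bc(1)] by simp
  have "regular_mod (Idl (insert (b[^]k) J)) x" for k :: nat
  proof (induction k)
   case 0
   have "\<one>\<in>Idl (insert \<one> J)" using idl_insert_sup[OF J, of \<one>] by simp
   hence "Idl (insert \<one> J) = CR" using one_in_ideal idl_insert_is_ideal[OF J] by simp
   thus ?case by (simp add: regular_mod_def)
  next
   case (Suc k)
   have "b[^]Suc k = b\<otimes>b[^]k" using bc by (simp add: m_comm)
   thus ?case using regular_mod_mult_gen[OF J bc(1) _ bc(2) rb rx Suc] bc by simp
  qed
  thus ?case unfolding J_def idl_insert_idl[OF S nat_pow_closed[OF bc(1)]] by simp
 qed
qed

lemma regular_mod_powers: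
 assumes "A\<subseteq>X" "x\<in>X - A"
 shows "regular_mod (pow_ideal \<kappa> A) (x[^](k::nat))"
 using regular_mod_subset_powers[of A "{}" x \<kappa>] assms X_carr
 by (intro regular_mod_pow) (auto simp: pow_ideal_def)

abbreviation "Xp\<equiv>finprod R (%x. x) X"

definition qx :: "nat => 'a set" where "qx k = pow_ideal (%_. k) X"

lemma qx_ideal: "ideal (qx k) R" unfolding qx_def using pow_ideal_ideal X_carr by blast

lemma cancel_one_param:
 assumes a: "a\<in>X" and r: "r\<in>CR" "r\<otimes>a\<in>pow_ideal \<kappa> X" "\<kappa> a = Suc k"
 shows "r\<in>pow_ideal (\<kappa>(a := k)) X"
proof -
 have ac: "a\<in>CR" using a X_carr by blast
 let ?J = "pow_ideal \<kappa> (X - {a})"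
 have J: "ideal ?J R" using pow_ideal_ideal X_carr by blast
 have "regular_mod ?J (a[^](1::nat))" using regular_mod_powers[of "X - {a}" a] a by blast
 hence "regular_mod ?J a" using ac by simp
 moreover have "r\<otimes>a\<in>Idl (insert (a[^]k\<otimes>a) ?J)"
  using r pow_ideal_remove[OF X_carr a, of \<kappa>] by simp
 ultimately have "r\<in>Idl (insert (a[^]k) ?J)"
  using cancel_regular_gen[OF J r(1) ac] ac by blast
 moreover have "?J = pow_ideal (\<kappa>(a := k)) (X - {a})" by (rule pow_ideal_cong) auto
 ultimately show ?thesis using pow_ideal_remove[OF X_carr a, of "\<kappa>(a := k)"] by simp
qed

text \<open>Injectivity of the map from \<open>R / qx k\<close> to \<open>R / qx (Suc k)\<close>
  given by \<open>Xp\<close>. The factors of \<open>Xp\<close> are cancelled one by one, so the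
  ideals in between have exponent \<open>k\<close> on \<open>B\<close> and \<open>Suc k\<close>
  elsewhere.\<close>

lemma cancel_param_product:
 assumes "r\<in>CR" "r\<otimes>Xp\<in>qx (Suc k)" shows "r\<in>qx k"
proof -
 have "r\<in>pow_ideal (%x. if x\<in>B then k else Suc k) X"
  if "B\<subseteq>X" "r\<in>CR" "r\<otimes>finprod R (%x. x) B\<in>qx (Suc k)" for B r
 proof -
  have "finite B" using that X_fin finite_subset by blast
  thus ?thesis using that
  proof (induction B arbitrary: r rule: finite_induct)
   case empty thus ?case by (simp add: qx_def)
  next
   case (insert b B)
   have bc: "b\<in>CR" "B\<subseteq>CR" using insert.prems X_carr by auto
   have fp: "finprod R (%x. x) B\<in>CR" using bc by (intro finprod_closed) auto
   have "finprod R (%x. x) (insert b B) = b\<otimes>finprod R (%x. x) B"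
    using insert bc by (intro finprod_insert) auto
   hence "(r\<otimes>b)\<otimes>finprod R (%x. x) B\<in>qx (Suc k)" using insert.prems bc fp by (simp add: m_assoc)
   hence "r\<otimes>b\<in>pow_ideal (%x. if x\<in>B then k else Suc k) X" using insert bc by simp
   hence "r\<in>pow_ideal ((%x. if x\<in>B then k else Suc k)(b := k)) X"
    using insert by (intro cancel_one_param) auto
   moreover have "((%x. if x\<in>B then k else Suc k)(b := k)) = (%x. if x\<in>insert b B then k else Suc k)"
    by auto
   ultimately show ?case by simp
  qed
 qed
 from this[of X r] have "r\<in>pow_ideal (%x. if x\<in>X then k else Suc k) X" using assms by blast
 moreover have "pow_ideal (%x. if x\<in>X then k else Suc k) X = qx k"
  unfolding qx_def by (rule pow_ideal_cong) simp
 ultimately show ?thesis by simp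
qed

lemma Xp_carr: "Xp\<in>CR" using X_carr by (intro finprod_closed) auto

lemma cancel_param_product_pow:
 "r\<in>CR ==> Xp[^](n::nat)\<otimes>r\<in>qx (k + n) ==> r\<in>qx k"
proof (induction n arbitrary: r)
 case (Suc n)
 have "Xp[^]Suc n\<otimes>r = (Xp[^]n\<otimes>r)\<otimes>Xp" using Suc Xp_carr by (simp add: cr_simps)
 hence "(Xp[^]n\<otimes>r)\<otimes>Xp\<in>qx (Suc (k + n))" using Suc.prems by simp
 hence "Xp[^]n\<otimes>r\<in>qx (k + n)" by (rule cancel_param_product[rotated]) (use Suc.prems Xp_carr in simp)
 thus ?case using Suc by blast
qed simp

lemma finprod_split:
 assumes "B\<subseteq>CR" "finite B" "b\<in>B"
 shows "finprod R (%x. x) B = b\<otimes>finprod R (%x. x) (B - {b})"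
proof -
 have "finprod R (%x. x) (insert b (B - {b})) = b\<otimes>finprod R (%x. x) (B - {b})"
  using assms by (intro finprod_insert) auto
 thus ?thesis using assms by (simp add: insert_absorb)
qed

text \<open>This makes multiplication by \<open>Xp\<close> a map from \<open>R / qx k\<close> to
  \<open>R / qx (Suc k)\<close>; \<open>cancel_param_product\<close> is its injectivity.\<close>

lemma Xp_qx: assumes "r\<in>qx k" shows "Xp\<otimes>r\<in>qx (Suc k)"
proof -
 have "qx k\<subseteq>colon (qx (Suc k)) Xp" unfolding qx_def[of k]
 proof (rule pow_ideal_least[OF colon_ideal[OF qx_ideal Xp_carr]])
  fix a assume a: "a\<in>X"
  let ?p = "finprod R (%x. x) (X - {a})"
  have c: "a\<in>CR" "?p\<in>CR" using a X_carr by (auto intro!: finprod_closed)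
  have "a[^]k\<otimes>Xp = ?p\<otimes>a[^]Suc k"
   unfolding finprod_split[OF X_carr X_fin a] using c by (simp add: cr_simps)
  also have "\<dots>\<in>qx (Suc k)" unfolding qx_def
   using pow_ideal_gen[OF X_carr a, of "%_. Suc k"] ideal_mult[OF pow_ideal_ideal[OF X_carr]] c by blast
  finally show "a[^]k\<in>colon (qx (Suc k)) Xp" using c by (simp add: colon_def)
 qed
 thus ?thesis using assms Xp_carr by (auto simp: colon_def m_comm)
qed

text \<open>For \<open>B = X\<close> this computes the socle of the quotient by powers of the
  parameters: it is generated by the product of the powers one below. Each \<open>b\<close> in turn
  allows \<open>t\<close> to be divided by \<open>b[^](\<kappa> b - 1)\<close> modulo the other
  powers.\<close>

lemma colon_params:
 assumes "B\<subseteq>X" "t\<in>CR" "!!b. b\<in>B ==> b\<otimes>t\<in>pow_ideal \<kappa> X" "!!b. b\<in>B ==> \<kappa> b\<noteq>0"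
 shows "t\<in>Idl (insert (finprod R (%b. b[^](\<kappa> b - 1)) B) (pow_ideal \<kappa> X))"
proof -
 have "finite B" using assms X_fin finite_subset by blast
 thus ?thesis using assms
 proof (induction B arbitrary: \<kappa> t rule: finite_induct)
  case empty
  have "\<one>\<in>Idl (insert \<one> (pow_ideal \<kappa> X))"
   using idl_insert_sup[OF pow_ideal_ideal[OF X_carr], of \<one>] by simp
  hence "Idl (insert \<one> (pow_ideal \<kappa> X)) = CR"
   using one_in_ideal idl_insert_is_ideal[OF pow_ideal_ideal[OF X_carr]] by simp
  thus ?case using empty by simp
 next
  case (insert b B)
  have bX: "b\<in>X" using insert by auto
  have bc: "b\<in>CR" "B\<subseteq>CR" using insert.prems X_carr by auto
  obtain k where k: "\<kappa> b = Suc k" using insert.prems(4)[of b] by (cases "\<kappa> b") auto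
  let ?q = "pow_ideal \<kappa> X" and ?J = "pow_ideal \<kappa> (X - {b})"
  have qi: "ideal ?q R" "ideal ?J R" using pow_ideal_ideal X_carr by blast+
  have Jq: "?J\<subseteq>?q" using pow_ideal_mono[of "X - {b}" X \<kappa>] X_carr by blast
  have Je: "?J = pow_ideal (\<kappa>(b := j)) (X - {b})" for j by (rule pow_ideal_cong) auto
  have "t\<otimes>b\<in>?q" using insert.prems(3)[of b] insert.prems(2) bc by (simp add: m_comm)
  hence "t\<in>pow_ideal (\<kappa>(b := k)) X" using cancel_one_param[of b t \<kappa> k] bX insert.prems(2) k by blast
  hence "t\<in>Idl (insert (b[^]k) ?J)"
   using pow_ideal_remove[OF X_carr bX, of "\<kappa>(b := k)"] Je by simp
  then obtain p t' where t: "p\<in>?J" "t'\<in>CR" "t = p\<oplus>t'\<otimes>b[^]k"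
   using idl_insert_ideal[OF qi(2), of "b[^]k"] bc by auto
  have pc: "p\<in>CR" using t qi ideal_carr by blast
  \<comment> \<open>After division by \<open>b[^]k\<close> the cofactor \<open>t'\<close> matters
    only modulo \<open>b\<close>, so the induction continues with exponent one at
    \<open>b\<close>.\<close>
  let ?l = "\<kappa>(b := 1)"
  have q1: "pow_ideal ?l X = Idl (insert b ?J)"
   using pow_ideal_remove[OF X_carr bX, of ?l] Je[of 1] bc by simp
  have it': "i\<otimes>t'\<in>pow_ideal ?l X" if i: "i\<in>B" for i
  proof -
   have ic: "i\<in>CR" using i bc by blast
   have "i\<otimes>t = i\<otimes>p\<oplus>(i\<otimes>t')\<otimes>b[^]k" unfolding t(3) using ic pc t(2) bc by (simp add: cr_simps)
   moreover have "i\<otimes>t\<in>?q" using insert.prems i by blast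
   moreover have "i\<otimes>p\<in>?q" using t Jq ideal_mult[OF qi(1)] ic by blast
   ultimately have "(i\<otimes>t')\<otimes>b[^]k\<in>?q"
    using ideal_add_cancel[OF qi(1), of "i\<otimes>p" "(i\<otimes>t')\<otimes>b[^]k"] ic t(2) bc by simp
   moreover have "?q = Idl (insert (b\<otimes>b[^]k) ?J)"
    using pow_ideal_remove[OF X_carr bX, of \<kappa>] k bc by (simp add: m_comm)
   moreover have "regular_mod ?J (b[^]k)" using regular_mod_powers[of "X - {b}" b] bX by blast
   ultimately have "i\<otimes>t'\<in>Idl (insert b ?J)"
    using cancel_regular_gen[OF qi(2), of "i\<otimes>t'" "b[^]k" b] ic t(2) bc by simp
   thus ?thesis using q1 by simp
  qed
  have "t'\<in>Idl (insert (finprod R (%c. c[^](?l c - 1)) B) (pow_ideal ?l X))"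
  proof (rule insert.IH[OF _ t(2) it'])
   show "?l c\<noteq>0" if "c\<in>B" for c using insert.prems(4)[of c] that by auto
  qed (use insert in auto)
  moreover have "finprod R (%c. c[^](?l c - 1)) B = finprod R (%c. c[^](\<kappa> c - 1)) B"
   using insert bc by (intro finprod_cong') auto
  ultimately have "t'\<in>Idl (insert (finprod R (%c. c[^](\<kappa> c - 1)) B) (pow_ideal ?l X))" by simp
  moreover define F where "F = finprod R (%c. c[^](\<kappa> c - 1)) B"
  moreover have Fc: "F\<in>CR" unfolding F_def using bc by (intro finprod_closed) auto
  ultimately obtain p' e where e: "p'\<in>pow_ideal ?l X" "e\<in>CR" "t' = p'\<oplus>e\<otimes>F"
   using idl_insert_ideal[OF pow_ideal_ideal[OF X_carr], of F] by auto
  then obtain p'' f where f: "p''\<in>?J" "f\<in>CR" "p' = p''\<oplus>f\<otimes>b"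
   unfolding q1 using idl_insert_ideal[OF qi(2) bc(1)] by auto
  have pc'': "p''\<in>CR" using f qi ideal_carr by blast
  have bk: "b[^]Suc k\<in>?q" using pow_ideal_gen[OF X_carr bX, of \<kappa>] k by simp
  have "t = (p\<oplus>b[^]k\<otimes>p''\<oplus>f\<otimes>b[^]Suc k)\<oplus>e\<otimes>(b[^]k\<otimes>F)"
   unfolding t(3) e(3) f(3) using pc pc'' f(2) e(2) bc Fc by (simp add: cr_simps)
  moreover have "p\<oplus>b[^]k\<otimes>p''\<oplus>f\<otimes>b[^]Suc k\<in>?q"
   using t(1) f(1,2) Jq bc bk by (intro ideal_add[OF qi(1)] ideal_mult[OF qi(1)]) auto
  moreover have "finprod R (%c. c[^](\<kappa> c - 1)) (insert b B) = b[^]k\<otimes>F"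
   unfolding F_def using insert bc k by (subst finprod_insert) auto
  ultimately show ?case using idl_insert_ideal[OF qi(1), of "b[^]k\<otimes>F"] e bc Fc by auto
 qed
qed

text \<open>Multiplication by the product of the parameters embeds \<open>R / qx k\<close> in \<open>R / qx (k + 1)\<close>; in the
 union of these modules, compatible data \<open>e\<close> on the parameters come from a single element. This is
 what makes that union injective.\<close>

lemma solve_params:
 assumes e: "!!x. x\<in>X ==> e x\<in>CR"
  and comp: "!!x y. x\<in>X ==> y\<in>X ==> x\<otimes>e y\<ominus>y\<otimes>e x\<in>qx k"
 shows "\<exists>w\<in>CR. \<forall>x\<in>X. x\<otimes>w\<ominus>Xp\<otimes>e x\<in>qx (Suc k)"
proof -
 note qi = qx_ideal[of "Suc k"]
 have "\<exists>w\<in>CR. \<forall>x\<in>B. x\<otimes>w\<ominus>Xp\<otimes>e x\<in>qx (Suc k)" if "B\<subseteq>X" for B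
 proof -
  have "finite B" using that X_fin finite_subset by blast
  thus ?thesis using that
  proof (induction B rule: finite_induct)
   case empty thus ?case by auto
  next
   case (insert r B)
   then obtain w where w: "w\<in>CR" "!!x. x\<in>B ==> x\<otimes>w\<ominus>Xp\<otimes>e x\<in>qx (Suc k)" by auto
   have rX: "r\<in>X" and BX: "B\<subseteq>X" using insert by auto
   have rc: "r\<in>CR" "e r\<in>CR" using rX e X_carr by auto
   let ?p = "finprod R (%x. x) (X - {r})"
   have pc: "?p\<in>CR" using X_carr by (auto intro!: finprod_closed)
   have Xpe: "Xp = r\<otimes>?p" using finprod_split[OF X_carr X_fin rX] .
   \<comment> \<open>The element \<open>?p \<otimes> e r\<close> solves the equation at
     \<open>r\<close>. By compatibility its discrepancy with \<open>w\<close> is killed by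
     \<open>B\<close> once the exponent at \<open>r\<close> is lowered to \<open>k\<close>, so
     \<open>colon_params\<close> writes it as \<open>c \<otimes> F\<close> plus a term that
     \<open>r\<close> carries into \<open>qx (Suc k)\<close>. Adding \<open>c \<otimes> F\<close> to
     \<open>w\<close> repairs the equation at \<open>r\<close> and does not disturb those on
     \<open>B\<close>.\<close>
   define \<delta> where "\<delta> = ?p\<otimes>e r\<ominus>w"
   have \<delta>c: "\<delta>\<in>CR" unfolding \<delta>_def using pc rc w by simp
   let ?\<kappa> = "(%_. Suc k)(r := k)"
   have "i\<otimes>\<delta>\<in>pow_ideal ?\<kappa> X" if i: "i\<in>B" for i
   proof (rule cancel_one_param[OF rX])
    have ic: "i\<in>CR" "e i\<in>CR" using i BX e X_carr by auto
    show "i\<otimes>\<delta>\<in>CR" using ic \<delta>c by simp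
    have id: "(i\<otimes>(p\<otimes>er\<ominus>w))\<otimes>r = (r\<otimes>p)\<otimes>(i\<otimes>er\<ominus>r\<otimes>ei)\<ominus>r\<otimes>(i\<otimes>w\<ominus>(r\<otimes>p)\<otimes>ei)"
     if "i\<in>CR" "p\<in>CR" "er\<in>CR" "ei\<in>CR" "r\<in>CR" "w\<in>CR"
     for i p er ei r w using that by algebra
    have "(i\<otimes>\<delta>)\<otimes>r = Xp\<otimes>(i\<otimes>e r\<ominus>r\<otimes>e i)\<ominus>r\<otimes>(i\<otimes>w\<ominus>Xp\<otimes>e i)"
     unfolding Xpe \<delta>_def using id[OF ic(1) pc rc(2) ic(2) rc(1) w(1)] .
    also have "\<dots>\<in>qx (Suc k)"
     using Xp_qx comp[of i r] i BX rX w(2)[OF i] ideal_mult[OF qi] rc by (intro ideal_diff[OF qi]) auto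
    finally show "(i\<otimes>\<delta>)\<otimes>r\<in>pow_ideal (%_. Suc k) X" by (simp add: qx_def)
   qed simp
   moreover have "?\<kappa> b\<noteq>0" if "b\<in>B" for b using that insert by auto
   ultimately have "\<delta>\<in>Idl (insert (finprod R (%b. b[^](?\<kappa> b - 1)) B) (pow_ideal ?\<kappa> X))"
    using colon_params[OF BX \<delta>c] by blast
   moreover define F where "F = finprod R (%b. b[^](?\<kappa> b - 1)) B"
   moreover have Fe: "F = finprod R (%b. b[^]k) B" unfolding F_def
    using insert BX X_carr by (intro finprod_cong') auto
   moreover have Fc: "F\<in>CR" unfolding Fe using BX X_carr by (intro finprod_closed) auto
   ultimately obtain p c where p: "p\<in>pow_ideal ?\<kappa> X" "c\<in>CR" "\<delta> = p\<oplus>c\<otimes>F"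
    using idl_insert_ideal[OF pow_ideal_ideal[OF X_carr], of F] by auto
   have pc': "p\<in>CR" using p ideal_carr[OF pow_ideal_ideal[OF X_carr]] by blast
   have rp: "r\<otimes>p\<in>qx (Suc k)"
   proof -
    have "pow_ideal ?\<kappa> X\<subseteq>colon (qx (Suc k)) r"
    proof (rule pow_ideal_least[OF colon_ideal[OF qi rc(1)]])
     fix a assume a: "a\<in>X"
     have ac: "a\<in>CR" using a X_carr by blast
     have "a[^]Suc k\<in>qx (Suc k)" unfolding qx_def using pow_ideal_gen[OF X_carr a, of "%_. Suc k"] .
     thus "a[^]?\<kappa> a\<in>colon (qx (Suc k)) r"
     using ac rc ideal_mult_r[OF qi, of "a[^]Suc k" r] by (cases "a = r") (auto simp: colon_def)
    qed
    thus ?thesis using p pc' rc by (auto simp: colon_def m_comm)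
   qed
   have bF: "b\<otimes>F\<in>qx (Suc k)" if b: "b\<in>B" for b
   proof -
    let ?G = "finprod R (%b. b[^]k) (B - {b})"
    have bc: "b\<in>CR" "?G\<in>CR" using b BX X_carr by (auto intro!: finprod_closed)
    have "finprod R (%b. b[^]k) (insert b (B - {b})) = b[^]k\<otimes>?G"
     using insert BX X_carr bc by (intro finprod_insert) auto
    hence "F = b[^]k\<otimes>?G" unfolding Fe using b by (simp add: insert_absorb)
    hence "b\<otimes>F = ?G\<otimes>b[^]Suc k" using bc by (simp add: cr_simps)
    thus ?thesis using pow_ideal_gen[OF X_carr, of b "%_. Suc k"] b BX ideal_mult[OF qi] bc
     unfolding qx_def by auto
   qed
   show ?case
   proof (intro bexI[of _ "w\<oplus>c\<otimes>F"] ballI)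
    show wc: "w\<oplus>c\<otimes>F\<in>CR" using w p Fc by simp
    fix x assume "x\<in>insert r B"
    then consider "x = r" | "x\<in>B" by blast
    thus "x\<otimes>(w\<oplus>c\<otimes>F)\<ominus>Xp\<otimes>e x\<in>qx (Suc k)"
    proof cases
     case 1
     have id: "r\<otimes>(w\<oplus>cF)\<ominus>(r\<otimes>q)\<otimes>er =\<ominus>(r\<otimes>p)\<oplus>r\<otimes>((p\<oplus>cF)\<ominus>(q\<otimes>er\<ominus>w))"
     if "r\<in>CR" "p\<in>CR" "er\<in>CR" "q\<in>CR" "w\<in>CR" "cF\<in>CR"
     for r p er q w cF using that by algebra
     have "r\<otimes>(w\<oplus>c\<otimes>F)\<ominus>Xp\<otimes>e r =\<ominus>(r\<otimes>p)\<oplus>r\<otimes>((p\<oplus>c\<otimes>F)\<ominus>\<delta>)"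
     unfolding Xpe \<delta>_def using id[OF rc(1) pc' rc(2) pc w(1), of "c\<otimes>F"] p Fc by simp
     also have "\<dots> =\<ominus>(r\<otimes>p)" unfolding p(3)[symmetric] using \<delta>c rc pc' by (simp add: a_minus_def r_neg)
     also have "\<dots>\<in>qx (Suc k)" using rp ideal_neg[OF qi] by blast
     finally show ?thesis using 1 by simp
    next
     case 2
     have xc: "x\<in>CR" "e x\<in>CR" using 2 BX e X_carr by auto
     have "x\<otimes>(w\<oplus>c\<otimes>F)\<ominus>Xp\<otimes>e x = (x\<otimes>w\<ominus>Xp\<otimes>e x)\<oplus>c\<otimes>(x\<otimes>F)"
     using xc w p Fc Xp_carr by (simp add: cr_simps)
     thus ?thesis using w(2)[OF 2] bF[OF 2] ideal_mult[OF qi] p by (simp add: ideal_add[OF qi])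
    qed
   qed
  qed
 qed
 thus ?thesis by blast
qed

end

section \<open>Koszul complexes\<close>

text \<open>Cochains on lists of any length share one function type; only the bit lists as long as
  the list of generators carry meaning. Fixing the first or the last bit splits a cochain into the
  parts without and with that generator.\<close>

definition hpart :: "bool => (bool list => 'a) => bool list => 'a" where
 "hpart b z = (%c. z (b#c))"

definition tpart :: "bool => (bool list => 'a) => bool list => 'a" where
 "tpart b z = (%c. z (c@[b]))"

definition glue :: "'a => (bool list => 'a) => (bool list => 'a) => bool list => 'a" where
 "glue o' z w = (%bs. case bs of [] => o' | b#c => if b then w c else z c)"

definition tglue :: "'a => (bool list => 'a) => (bool list => 'a) => bool list => 'a" where
 "tglue o' z w = (%bs. if bs = [] then o' else if last bs then w (butlast bs) else z (butlast bs))"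

lemma hpart_glue [simp]: "hpart b (glue o' z w) = (if b then w else z)"
 by (auto simp: hpart_def glue_def fun_eq_iff)

lemma tpart_tglue [simp]: "tpart b (tglue o' z w) = (if b then w else z)"
 by (auto simp: tpart_def tglue_def fun_eq_iff)

primrec kdeg :: "(bool\<times>'a) list => bool list => int" where
 "kdeg [] bs = 0"
| "kdeg (p#L) bs = (case bs of [] => 0 | b#c =>
  (if b then (if fst p then 1 else -1) else 0) + kdeg L c)"

lemma all_length_Suc: "(\<forall>bs. length bs = Suc n --> Q bs) \<longleftrightarrow> (\<forall>b c. length c = n --> Q (b#c))"
 by (metis length_Cons length_Suc_conv nat.inject)

lemma all_length_snoc: "(\<forall>bs. length bs = Suc n --> Q bs) \<longleftrightarrow> (\<forall>b c. length c = n --> Q (c@[b]))"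
 by (metis length_append_singleton length_Suc_conv_rev nat.inject)

lemma kdeg_append: "length bs = length L ==> kdeg (L@M) (bs@cs) = kdeg L bs + kdeg M cs"
 by (induction L arbitrary: bs) (auto simp: length_Suc_conv)

lemma kdeg_cong: "map fst L = map fst M ==> kdeg L = kdeg M"
proof (induction L arbitrary: M)
 case (Cons p L)
 then obtain q M' where "M = q#M'" "fst p = fst q" "kdeg L = kdeg M'" by (cases M) auto
 thus ?case by (auto simp: fun_eq_iff split: list.splits)
qed (simp add: fun_eq_iff)

abbreviation coh :: "'a list => (bool\<times>'a) list" where "coh xs\<equiv>map (Pair True) xs"
abbreviation chn :: "'a list => (bool\<times>'a) list" where "chn xs\<equiv>map (Pair False) xs"

section \<open>Cochains and the Koszul differential\<close>

context cring
begin

definition vec :: "(bool list => 'a) => bool" where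
 "vec z \<longleftrightarrow> (\<forall>bs. z bs\<in>CR)"

definition va :: "(bool list => 'a) => (bool list => 'a) => bool list => 'a" where
 "va z w = (%bs. z bs\<oplus>w bs)"

definition vn :: "(bool list => 'a) => bool list => 'a" where
 "vn z = (%bs.\<ominus>z bs)"

definition vm :: "'a => (bool list => 'a) => bool list => 'a" where
 "vm r z = (%bs. r\<otimes>z bs)"

abbreviation vz :: "bool list => 'a" where "vz\<equiv>(%_. \<zero>)"

lemma vecD [simp]: "vec z ==> z bs\<in>CR" by (simp add: vec_def)

lemma vec_closed [simp]:
 "vec z ==> vec w ==> vec (va z w)" "vec z ==> vec (vn z)" "r\<in>CR ==> vec z ==> vec (vm r z)"
 "vec vz" "vec z ==> vec (hpart b z)" "vec z ==> vec (tpart b z)"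
 "vec z ==> vec w ==> vec (glue \<zero> z w)" "vec z ==> vec w ==> vec (tglue \<zero> z w)"
 by (auto simp: vec_def va_def vn_def vm_def hpart_def tpart_def glue_def tglue_def split: list.splits)

lemma hpart_simps [simp]:
 "hpart b (va z w) = va (hpart b z) (hpart b w)" "hpart b (vn z) = vn (hpart b z)"
 "hpart b (vm r z) = vm r (hpart b z)" "hpart b vz = vz"
 "tpart b (va z w) = va (tpart b z) (tpart b w)" "tpart b (vn z) = vn (tpart b z)"
 "tpart b (vm r z) = vm r (tpart b z)" "tpart b vz = vz"
 by (auto simp: hpart_def tpart_def va_def vn_def vm_def)

text \<open>The Koszul complex of a list of ring elements, as a differential on functions of the subsets
 (coded as bit lists) of the list. Elements tagged \<open>True\<close> raise the degree (cochains), those tagged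
 \<open>False\<close> lower it (chains); a mixed list gives the total complex of the tensor product.\<close>

primrec kd :: "(bool\<times>'a) list => (bool list => 'a) => bool list => 'a" where
 "kd [] z = vz"
| "kd (p#L) z =
  (if fst p then glue \<zero> (kd L (hpart False z)) (va (vm (snd p) (hpart False z)) (vn (kd L (hpart True z))))
  else glue \<zero> (va (kd L (hpart False z)) (vm (snd p) (hpart True z))) (vn (kd L (hpart True z))))"

definition its :: "(bool\<times>'a) list => bool" where "its L \<longleftrightarrow> snd`set L\<subseteq>CR"

lemma its_simps [simp]: "its []" "its (p#L) \<longleftrightarrow> snd p\<in>CR\<and>its L"
 "its (L@M) \<longleftrightarrow> its L\<and>its M" "its (coh xs) \<longleftrightarrow> inR xs" "its (chn xs) \<longleftrightarrow> inR xs"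
 by (auto simp: its_def image_image)

lemma hpart_kd: "hpart b (kd (p#L) z) =
 (if fst p then if b then va (vm (snd p) (hpart False z)) (vn (kd L (hpart True z))) else kd L (hpart False z)
  else if b then vn (kd L (hpart True z)) else va (kd L (hpart False z)) (vm (snd p) (hpart True z)))"
 by simp

lemma hpart_kd_coh: "hpart False (kd ((True, x)#L) z) = kd L (hpart False z)"
  "hpart True (kd ((True, x)#L) z) = va (vm x (hpart False z)) (vn (kd L (hpart True z)))"
 and hpart_kd_chn: "hpart False (kd ((False, x)#L) z) = va (kd L (hpart False z)) (vm x (hpart True z))"
  "hpart True (kd ((False, x)#L) z) = vn (kd L (hpart True z))"
 by simp_all

lemma vec_kd [simp]: "its L ==> vec z ==> vec (kd L z)"
 by (induction L arbitrary: z) auto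

lemma glue_eqI: "z [] = w [] ==> hpart False z = hpart False w ==> hpart True z = hpart True w ==> z = w"
proof
 fix bs assume a: "z [] = w []" "hpart False z = hpart False w" "hpart True z = hpart True w"
 show "z bs = w bs"
 proof (cases bs)
  case (Cons b c)
  thus ?thesis using a(2,3) by (cases b) (auto simp: hpart_def fun_eq_iff)
 qed (use a in auto)
qed

lemma glue_Nil [simp]: "glue o' z w [] = o'" by (simp add: glue_def)

text \<open>The premises keep the simplifier from unfolding the operations where they are not applied.\<close>

lemma vapp:
 "z bs\<in>CR ==> w bs\<in>CR ==> va z w bs = z bs\<oplus>w bs"
 "z bs\<in>CR ==> vn z bs =\<ominus>z bs"
 "z bs\<in>CR ==> vm r z bs = r\<otimes>z bs"
 by (simp_all add: va_def vn_def vm_def)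

lemma kd_va: "its L ==> vec z ==> vec w ==> kd L (va z w) = va (kd L z) (kd L w)"
proof (induction L arbitrary: z w)
 case Nil thus ?case by (intro ext) (simp add: vapp)
next
 case (Cons p L)
 have c: "snd p\<in>CR" "its L" using Cons by auto
 show ?case
  by (rule glue_eqI) (use Cons c in \<open>(simp; intro ext impI conjI; simp add: vapp cr_simps)+\<close>)
qed

lemma kd_vm: "its L ==> r\<in>CR ==> vec z ==> kd L (vm r z) = vm r (kd L z)"
proof (induction L arbitrary: z)
 case Nil thus ?case by (intro ext) (simp add: vapp)
next
 case (Cons p L)
 have c: "snd p\<in>CR" "its L" using Cons by auto
 show ?case
  by (rule glue_eqI) (use Cons c in \<open>(simp; intro ext impI conjI; simp add: vapp cr_simps)+\<close>)
qed

lemma vn_vm: "vec z ==> vn z = vm (\<ominus>\<one>) z"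
 by (intro ext) (simp add: vapp l_minus)

lemma vn_vn: "vec z ==> vn (vn z) = z"
 by (intro ext) (simp add: vapp)

lemma kd_vn: "its L ==> vec z ==> kd L (vn z) = vn (kd L z)"
 by (simp add: vn_vm kd_vm)

lemma kd_vz: "its L ==> kd L vz = vz"
proof (induction L)
 case (Cons p L)
 show ?case by (rule glue_eqI) (use Cons in \<open>(simp; intro ext impI conjI; simp add: vapp)+\<close>)
qed auto

lemma kd_kd: "its L ==> vec z ==> kd L (kd L z) = vz"
proof (induction L arbitrary: z)
 case (Cons p L)
 have c: "snd p\<in>CR" "its L" using Cons by auto
 show ?case
  by (rule glue_eqI) (use Cons c in \<open>(simp add: kd_va kd_vm kd_vn; intro ext impI conjI; simp add: vapp cr_simps)+\<close>)
qed auto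

text \<open>Vanishing of a cochain over \<open>R / J\<close>, tested on its values in
  \<open>R\<close>, so that complexes over all quotients of \<open>R\<close> share the same
  cochains.\<close>

definition vin :: "nat => 'a set => (bool list => 'a) => bool" where
 "vin n J z \<longleftrightarrow> (\<forall>bs. length bs = n --> z bs\<in>J)"

lemma vin_part: "vin (Suc n) J z \<longleftrightarrow> vin n J (hpart False z)\<and>vin n J (hpart True z)"
 unfolding vin_def hpart_def by (auto simp: length_Suc_conv) (metis (full_types))

lemma vin_tpart: "vin (Suc n) J z \<longleftrightarrow> vin n J (tpart False z)\<and>vin n J (tpart True z)"
proof
 assume r: "vin n J (tpart False z)\<and>vin n J (tpart True z)"
 show "vin (Suc n) J z" unfolding vin_def
 proof (intro allI impI)
  fix bs :: "bool list" assume l: "length bs = Suc n"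
  then obtain c b where "bs = c@[b]" "length c = n" by (metis length_append_singleton append_butlast_last_id length_0_conv nat.distinct(1) nat.inject)
  thus "z bs\<in>J" using r by (cases b) (auto simp: vin_def tpart_def)
 qed
qed (auto simp: vin_def tpart_def)

lemma vin_va: "ideal J R ==> vin n J z ==> vin n J w ==> vin n J (va z w)"
 by (simp add: vin_def va_def ideal_add)

lemma vin_vn: "ideal J R ==> vin n J z ==> vin n J (vn z)"
 by (simp add: vin_def vn_def ideal_neg)

lemma vin_vm: "ideal J R ==> vin n J z ==> r\<in>CR ==> vin n J (vm r z)"
 by (simp add: vin_def vm_def ideal_mult)

lemma vin_vz: "ideal J R ==> vin n J vz" by (simp add: vin_def ideal_zero)

lemma vin_mono: "J\<subseteq>K ==> vin n J z ==> vin n K z" by (auto simp: vin_def)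

lemma vin_kd: "ideal J R ==> its L ==> vec z ==> vin (length L) J z ==> vin (length L) J (kd L z)"
proof (induction L arbitrary: z)
 case Nil thus ?case by (simp add: vin_vz)
next
 case (Cons p L)
 have c: "snd p\<in>CR" "its L" using Cons by auto
 have h: "vin (length L) J (hpart b z)" for b using Cons.prems(4) by (cases b) (auto simp: vin_part)
 have k: "vin (length L) J (kd L (hpart b z))" for b using Cons.IH[OF Cons.prems(1) c(2)] Cons.prems(3) h by simp
 show ?case unfolding list.size add_Suc_right add_0_right vin_part hpart_kd
  using h k c Cons.prems(1) by (simp add: vin_va vin_vn vin_vm)
qed

lemma vin_cong: "(!!bs. length bs = n ==> z bs = w bs) ==> vin n J z \<longleftrightarrow> vin n J w"
 by (auto simp: vin_def)

definition homog :: "(bool\<times>'a) list => int => (bool list => 'a) => bool" where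
 "homog L j z \<longleftrightarrow> (\<forall>bs. length bs = length L --> kdeg L bs\<noteq>j --> z bs = \<zero>)"

lemma homog_Cons: "homog (p#L) j z \<longleftrightarrow>
  homog L j (hpart False z)\<and>homog L (if fst p then j - 1 else j + 1) (hpart True z)"
proof -
 have e: "(1 + k = j) = (k = j - 1)" "(-1 + k = j) = (k = j + 1)" "(k + 1 = j) = (k = j - 1)" "(k - 1 = j) = (k = j + 1)" for k :: int
  by auto
 have "homog (p#L) j z \<longleftrightarrow> (\<forall>b c. length c = length L -->
  (if b then (if fst p then 1 else -1) else 0) + kdeg L c\<noteq>j --> z (b#c) = \<zero>)"
  unfolding homog_def by (simp add: all_length_Suc)
 also have "\<dots> \<longleftrightarrow> homog L j (hpart False z)\<and>homog L (if fst p then j - 1 else j + 1) (hpart True z)"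
  unfolding homog_def hpart_def all_bool_eq by (cases "fst p") (simp_all add: e conj_commute)
 finally show ?thesis .
qed

lemma homog_snoc: "homog (L@[p]) j z \<longleftrightarrow>
  homog L j (tpart False z)\<and>homog L (if fst p then j - 1 else j + 1) (tpart True z)"
proof -
 have e: "(1 + k = j) = (k = j - 1)" "(-1 + k = j) = (k = j + 1)" "(k + 1 = j) = (k = j - 1)" "(k - 1 = j) = (k = j + 1)" for k :: int
  by auto
 have "homog (L@[p]) j z \<longleftrightarrow> (\<forall>b c. length c = length L -->
  kdeg (L@[p]) (c@[b])\<noteq>j --> z (c@[b]) = \<zero>)"
  unfolding homog_def by (simp add: all_length_snoc)
 also have "\<dots> \<longleftrightarrow> homog L j (tpart False z)\<and>homog L (if fst p then j - 1 else j + 1) (tpart True z)"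
  unfolding homog_def tpart_def all_bool_eq
  by (cases "fst p") (simp_all add: kdeg_append e conj_commute cong: conj_cong imp_cong)
 finally show ?thesis .
qed

lemma homog_va: "homog L j z ==> homog L j w ==> homog L j (va z w)" by (simp add: homog_def va_def)
lemma homog_vn: "homog L j z ==> homog L j (vn z)" by (simp add: homog_def vn_def)
lemma homog_vm: "homog L j z ==> r\<in>CR ==> homog L j (vm r z)" by (simp add: homog_def vm_def)
lemma homog_vz: "homog L j vz" by (simp add: homog_def)

lemmas homog_simps = homog_va homog_vn homog_vm homog_vz

lemma homog_cong: "map fst L = map fst M ==> homog L j = homog M j"
 using kdeg_cong[of L M] map_eq_imp_length_eq[of fst L fst M] by (auto simp: homog_def fun_eq_iff)

lemma homog_kd: "its L ==> vec z ==> homog L j z ==> homog L (j + 1) (kd L z)"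
proof (induction L arbitrary: z j)
 case Nil thus ?case by (simp add: homog_def)
next
 case (Cons p L)
 have h: "homog L j (hpart False z)" "homog L (if fst p then j - 1 else j + 1) (hpart True z)"
  using Cons homog_Cons by blast+
 have c: "snd p\<in>CR" "its L" using Cons by auto
 have k: "homog L (j + 1) (kd L (hpart False z))"
  "homog L ((if fst p then j - 1 else j + 1) + 1) (kd L (hpart True z))"
  using Cons.IH[OF c(2) _ h(1)] Cons.IH[OF c(2) _ h(2)] Cons.prems by auto
 show ?case unfolding homog_Cons hpart_kd
  using h c k by (cases "fst p") (simp_all add: homog_simps)
qed

text \<open>The component of degree \<open>j\<close>. It serves to make witnesses homogeneous where
  an existence statement does not say so.\<close>

definition trunc :: "(bool\<times>'a) list => int => (bool list => 'a) => bool list => 'a" where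
 "trunc L j z = (%bs. if kdeg L bs = j then z bs else \<zero>)"

lemma trunc_vec [simp]: "vec z ==> vec (trunc L j z)" by (auto simp: vec_def trunc_def)
lemma trunc_homog: "homog L j (trunc L j z)" by (simp add: homog_def trunc_def)

lemma hpart_trunc: "hpart b (trunc (p#L) j z) = trunc L (if b then if fst p then j - 1 else j + 1 else j) (hpart b z)"
 by (auto simp: hpart_def trunc_def fun_eq_iff)

lemma trunc_lin: "trunc L j (va z w) = va (trunc L j z) (trunc L j w)"  if "vec z" "vec w"
 using that by (intro ext) (simp add: trunc_def vapp)
lemma trunc_vn: "trunc L j (vn z) = vn (trunc L j z)"
 by (intro ext) (simp add: trunc_def vn_def)
lemma trunc_vm: "r\<in>CR ==> trunc L j (vm r z) = vm r (trunc L j z)"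
 by (intro ext) (simp add: trunc_def vm_def)

lemma kd_trunc: "its L ==> vec z ==> kd L (trunc L j z) = trunc L (j + 1) (kd L z)"
proof (induction L arbitrary: z j)
 case Nil thus ?case by (auto simp: trunc_def)
next
 case (Cons p L)
 have c: "snd p\<in>CR" "its L" using Cons by auto
 show ?case
 proof (rule glue_eqI)
  show "kd (p#L) (trunc (p#L) j z) [] = trunc (p#L) (j + 1) (kd (p#L) z) []"
   by (simp add: trunc_def)
  show "hpart False (kd (p#L) (trunc (p#L) j z)) = hpart False (trunc (p#L) (j + 1) (kd (p#L) z))"
   using Cons c by (simp add: hpart_trunc hpart_kd trunc_lin trunc_vm del: kd.simps)
  show "hpart True (kd (p#L) (trunc (p#L) j z)) = hpart True (trunc (p#L) (j + 1) (kd (p#L) z))"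
   using Cons c by (simp add: hpart_trunc hpart_kd trunc_lin trunc_vm trunc_vn del: kd.simps)
 qed
qed

text \<open>The weight of the summand at \<open>bs\<close> under a transition map: the factors at
  the set bits are those by which the power of each generator present in the summand
  changes.\<close>

primrec sel :: "'a list => bool list => 'a" where
 "sel [] bs = \<one>"
| "sel (u#us) bs = (case bs of [] => \<one> | b#c => (if b then u else \<one>)\<otimes>sel us c)"

lemma sel_carr [simp]: "inR us ==> sel us bs\<in>CR"
 by (induction us arbitrary: bs) (auto split: list.splits)

definition vs :: "'a list => (bool list => 'a) => bool list => 'a" where
 "vs us z = (%bs. sel us bs\<otimes>z bs)"

lemma vec_vs [simp]: "inR us ==> vec z ==> vec (vs us z)"
 by (simp add: vec_def vs_def)

lemma hpart_vs: "inR us ==> u\<in>CR ==> vec z ==>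
 hpart b (vs (u#us) z) = (if b then vm u (vs us (hpart True z)) else vs us (hpart False z))"
 by (intro ext) (simp add: hpart_def vs_def vm_def m_assoc)

lemma hpart_vs2:
 assumes "inR us" "u\<in>CR" "vec z"
 shows "hpart False (vs (u#us) z) = vs us (hpart False z)" "hpart True (vs (u#us) z) = vm u (vs us (hpart True z))"
 using hpart_vs[OF assms] by simp_all

lemma sel_append: "length bs = length us ==> inR us ==> inR ws ==>
 sel (us@ws) (bs@cs) = sel us bs\<otimes>sel ws cs"
 by (induction us arbitrary: bs) (auto simp: length_Suc_conv m_assoc)

lemma vs_va: "inR us ==> vec z ==> vec w ==> vs us (va z w) = va (vs us z) (vs us w)"
 by (intro ext) (simp add: vs_def va_def r_distr)
lemma vs_vn: "inR us ==> vec z ==> vs us (vn z) = vn (vs us z)"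
 by (intro ext) (simp add: vs_def vn_def r_minus)
lemma vs_vm: "inR us ==> vec z ==> r\<in>CR ==> vs us (vm r z) = vm r (vs us z)"
 by (intro ext) (simp add: vs_def vm_def m_lcomm)
lemma vs_vz: "inR us ==> vs us vz = vz" by (auto simp: vs_def)

lemma vin_vs: "ideal J R ==> inR us ==> vin n J z ==> vin n J (vs us z)"
 by (simp add: vin_def vs_def ideal_mult)

lemma homog_vs: "inR us ==> homog L j z ==> homog L j (vs us z)"
 by (simp add: homog_def vs_def)

text \<open>The condition for the weights \<open>us\<close> to give a map of complexes from
  \<open>L\<close> to \<open>L'\<close>. A cochain item gains the factor \<open>u\<close>; a chain
  item loses it, since there the transition goes to lower powers.\<close>

fun compat :: "(bool\<times>'a) list => 'a list => (bool\<times>'a) list => bool" where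
 "compat [] [] [] \<longleftrightarrow> True"
| "compat (p#L) (u#us) (q#L') \<longleftrightarrow> u\<in>CR\<and>fst p = fst q\<and>
  (if fst p then snd q = u\<otimes>snd p else snd p = u\<otimes>snd q)\<and>compat L us L'"
| "compat _ _ _ \<longleftrightarrow> False"

lemma compat_carr: "compat L us L' ==> inR us"
 by (induction L us L' rule: compat.induct) auto

lemma compat_length: "compat L us L' ==> length us = length L\<and>length L' = length L"
 by (induction L us L' rule: compat.induct) auto

lemma kd_vs:
 "compat L us L' ==> its L ==> its L' ==> vec z ==> length bs = length L ==> kd L' (vs us z) bs = vs us (kd L z) bs"
proof (induction L us L' arbitrary: z bs rule: compat.induct)
 case 1 thus ?case by (simp add: vs_def)
next
 case (2 p L u us q L')
 have c: "u\<in>CR" "snd p\<in>CR" "snd q\<in>CR" "its L" "its L'" "compat L us L'"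
  using 2 by auto
 have us: "inR us" using compat_carr[OF c(6)] .
 obtain b c' where bs: "bs = b#c'" "length c' = length L" using 2 by (auto simp: length_Suc_conv)
 have e: "kd L' (vs us w) c' = vs us (kd L w) c'" if "vec w" for w
  using 2(1)[OF c(6) c(4) c(5) that bs(2)] .
 have e': "kd (q#L') w (b#c') = hpart b (kd (q#L') w) c'" "vs (u#us) w (b#c') = hpart b (vs (u#us) w) c'" for w
  by (simp_all add: hpart_def)
 have v: "vec (hpart a z)" for a using 2 by simp
 have fq: "fst q = fst p" "fst p ==> snd q = u\<otimes>snd p" "\<not> fst p ==> snd p = u\<otimes>snd q" using 2 by auto
 have vz: "vec z" "vec (kd (p#L) z)" using 2 c by (auto simp del: kd.simps)
 have kv: "kd L (hpart a z) c'\<in>CR" "vs us (hpart a z) c'\<in>CR" "vs us (kd L (hpart a z)) c'\<in>CR" for a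
  using v c us by simp_all
 show ?case unfolding bs e'
  unfolding hpart_kd hpart_vs[OF us c(1) vz(1)] hpart_vs[OF us c(1) vz(2)] fq(1)
  using v us c kv by (cases b; cases "fst p") (simp_all add: fq(2,3) kd_vm vs_va vs_vm vs_vn e vapp cr_simps)
qed auto

primrec dot :: "'a list => 'a list => 'a" where
 "dot [] xs = \<zero>"
| "dot (c#cs) xs = (case xs of [] => \<zero> | x#xs' => c\<otimes>x\<oplus>dot cs xs')"

lemma dot_carr [simp]: "inR cs ==> inR xs ==> dot cs xs\<in>CR"
 by (induction cs arbitrary: xs) (auto split: list.splits)

text \<open>Contraction against \<open>cs\<close>, that is the chain differential of \<open>cs\<close>, is a homotopy between
 multiplication by \<open>dot cs xs\<close> and zero.\<close>

lemma kd_homotopy: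
 "length cs = length xs ==> inR cs ==> inR xs ==> vec z ==> length bs = length xs ==>
 kd (coh xs) (kd (chn cs) z) bs\<oplus>kd (chn cs) (kd (coh xs) z) bs = dot cs xs\<otimes>z bs"
proof (induction cs xs arbitrary: z bs rule: list_induct2)
 case Nil thus ?case by simp
next
 case (Cons c cs x xs)
 obtain b bs' where bs: "bs = b#bs'" "length bs' = length xs" using Cons.prems by (auto simp: length_Suc_conv)
 have k: "c\<in>CR" "x\<in>CR" "inR cs" "inR xs" using Cons.prems by auto
 define A where "A = kd (coh xs)"
 define B where "B = kd (chn cs)"
 have lin: "A (va z w) = va (A z) (A w)" "A (vn z) = vn (A z)" "A (vm r z) = vm r (A z)"
  "B (va z w) = va (B z) (B w)" "B (vn z) = vn (B z)" "B (vm r z) = vm r (B z)" "vec (A z)" "vec (B z)"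
  if "vec z" "vec w" "r\<in>CR" for z w r
  unfolding A_def B_def using that k by (simp_all add: kd_va kd_vn kd_vm)
 have IH: "A (B w) bs' = dot cs xs\<otimes>w bs'\<ominus>B (A w) bs'" if w: "vec w" for w
 proof -
  have m: "A (B w) bs'\<in>CR" "B (A w) bs'\<in>CR" using w k by (simp_all add: A_def B_def)
  show ?thesis using Cons.IH[OF k(3,4) w bs(2)] m unfolding A_def[symmetric] B_def[symmetric]
   by (metis add.inv_solve_right' a_minus_def m(1) a_closed)
 qed
 have p: "z (b#bs') = hpart b z bs'" by (simp add: hpart_def)
 have v: "kd (coh (x#xs)) w (b#bs') = hpart b (kd (coh (x#xs)) w) bs'"
  "kd (chn (c#cs)) w (b#bs') = hpart b (kd (chn (c#cs)) w) bs'" for w by (simp_all add: hpart_def)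
 have d: "dot cs xs\<in>CR" using k by simp
 have pf: "vec (hpart a z)" for a using Cons.prems by simp
 have vv: "vec (A (hpart a z))" "vec (B (hpart a z))" "vec (B (A (hpart a z)))" for a
  using pf k by (simp_all add: A_def B_def)
 have l: "A (va z w) = va (A z) (A w)" "A (vn z) = vn (A z)" "B (va z w) = va (B z) (B w)" "B (vn z) = vn (B z)"
  if "vec z" "vec w" for z w using that lin[of z w \<one>] by auto
 have l': "A (vm r z) = vm r (A z)" "B (vm r z) = vm r (B z)" if "vec z" "r\<in>CR" for z r
  using that lin[of z z r] by auto
 have ln: "A (vn z) = vn (A z)" "B (vn z) = vn (B z)" if "vec z" for z using l[OF that that] by auto
 have can: "a\<oplus>(q\<oplus>(r\<oplus>\<ominus> a)) = q\<oplus>r"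
  if [simp]: "a\<in>CR" "q\<in>CR" "r\<in>CR" for a q r
  using that by algebra
 show ?case unfolding bs p v
  by (cases b) (use k d pf vv in \<open>simp_all add: hpart_kd A_def[symmetric] B_def[symmetric] l l' ln IH vapp can cr_simps del: kd.simps\<close>)
qed

text \<open>The sign that an item acquires when it is moved past the generators present in
  \<open>bs\<close>; the sign convention of \<open>kd\<close> favours the head of the list.\<close>

definition ksgn :: "bool list => 'a => 'a" where
 "ksgn bs r = (if even (length (filter id bs)) then r else\<ominus>r)"

lemma ksgn_carr [simp]: "r\<in>CR ==> ksgn bs r\<in>CR" by (simp add: ksgn_def)
lemma ksgn_ksgn [simp]: "r\<in>CR ==> ksgn bs (ksgn bs r) = r" by (simp add: ksgn_def)
lemma ksgn_Cons: "r\<in>CR ==> ksgn (b#bs) r = (if b then\<ominus>ksgn bs r else ksgn bs r)" by (simp add: ksgn_def)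
lemma ksgn_mult: "r\<in>CR ==> x\<in>CR ==> ksgn bs (x\<otimes>r) = x\<otimes>ksgn bs r"
 by (simp add: ksgn_def r_minus)

definition ve :: "(bool list => 'a) => bool list => 'a" where "ve z = (%bs. ksgn bs (z bs))"

lemma ve_app: "ve z bs = ksgn bs (z bs)" by (simp add: ve_def)
lemma vec_ve [simp]: "vec z ==> vec (ve z)" by (simp add: vec_def ve_def)
lemma ve_ve [simp]: "vec z ==> ve (ve z) = z" by (auto simp: ve_def)
lemma hpart_ve: "vec z ==> hpart b (ve z) = (if b then vn (ve (hpart b z)) else ve (hpart b z))"
 by (intro ext) (simp add: hpart_def ve_def ksgn_Cons vn_def)
lemma ve_lin: "vec z ==> vec w ==> ve (va z w) = va (ve z) (ve w)" "vec z ==> ve (vn z) = vn (ve z)"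
 "vec z ==> r\<in>CR ==> ve (vm r z) = vm r (ve z)"
 by (intro ext; simp add: ve_def ksgn_def va_def vn_def vm_def minus_add r_minus)+
lemma vin_ve: "ideal J R ==> vec z ==> vin n J (ve z) \<longleftrightarrow> vin n J z"
 using ideal_neg[of J] minus_minus[OF vecD[of z]] unfolding vin_def ve_def ksgn_def by metis
lemma homog_ve: "homog L j z ==> homog L j (ve z)" by (simp add: homog_def ve_def ksgn_def)

lemma kd_ve: "its L ==> vec z ==> kd L (ve z) = vn (ve (kd L z))"
proof (induction L arbitrary: z)
 case Nil thus ?case by (intro ext) (simp add: ve_def ksgn_def vn_def)
next
 case (Cons p L)
 have c: "snd p\<in>CR" "its L" using Cons by auto
 have v: "vec (hpart b z)" "vec (kd L (hpart b z))" "vec (kd (p#L) z)" for b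
  using Cons c by (auto simp del: kd.simps)
 show ?case
 proof (rule glue_eqI)
  show "kd (p#L) (ve z) [] = vn (ve (kd (p#L) z)) []" by (simp add: ve_def ksgn_def vn_def)
  have "hpart b (kd (p#L) (ve z)) = hpart b (vn (ve (kd (p#L) z)))" for b
   by (rule ext, cases b; cases "fst p")
    (use Cons c v in \<open>simp_all add: hpart_ve hpart_kd kd_vn ve_lin vapp cr_simps del: kd.simps\<close>)
  thus "hpart False (kd (p#L) (ve z)) = hpart False (vn (ve (kd (p#L) z)))"
   "hpart True (kd (p#L) (ve z)) = hpart True (vn (ve (kd (p#L) z)))" by blast+
 qed
qed

lemma hpart_tpart: "hpart b (tpart c z) = tpart c (hpart b z)" by (simp add: hpart_def tpart_def)

text \<open>The recursion of \<open>kd\<close> read from the other end of the list. The negations of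
  the tail, one for each set bit in front of \<open>x\<close>, add up to
  \<open>ksgn bs\<close>.\<close>

lemma kd_snoc:
 "its L ==> x\<in>CR ==> vec z ==> length bs = length L ==>
 kd (L@[(True, x)]) z (bs@[b]) =
  (if b then kd L (tpart True z) bs\<oplus>ksgn bs (x\<otimes>z (bs@[False])) else kd L (tpart False z) bs)"
proof (induction L arbitrary: z bs b)
 case Nil thus ?case by (simp add: glue_def hpart_def ksgn_def vapp)
next
 case (Cons p L)
 obtain a c where bs: "bs = a#c" "length c = length L" using Cons.prems by (auto simp: length_Suc_conv)
 have k: "snd p\<in>CR" "its L" using Cons by auto
 have e: "kd (p#L@[(True, x)]) z (a#c@[b]) = hpart a (kd (p#L@[(True, x)]) z) (c@[b])"
  "kd (p#L) w (a#c) = hpart a (kd (p#L) w) c" for w by (simp_all add: hpart_def)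
 have z: "z (a#c@[False]) = hpart a z (c@[False])" by (simp add: hpart_def)
 have IH: "kd (L@[(True, x)]) (hpart i z) (c@[b]) = (if b then kd L (tpart True (hpart i z)) c\<oplus>ksgn c (x\<otimes>hpart i z (c@[False]))
   else kd L (tpart False (hpart i z)) c)" for i b
  using Cons.IH[OF k(2) Cons.prems(2) _ bs(2)] Cons.prems by simp
 have v: "vec (hpart i z)" for i using Cons.prems by simp
 have v': "kd L (tpart j (hpart i z)) c\<in>CR" for i j using v k by simp
 have t: "hpart i z (c@[b]) = tpart b (hpart i z) c" for i b by (simp add: tpart_def)
 show ?case unfolding bs append_Cons e z
  by (cases a; cases "fst p"; cases b)
   (use k v v' Cons.prems in \<open>simp_all add: hpart_kd IH hpart_tpart t ksgn_Cons vapp cr_simps del: kd.simps\<close>)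
qed

lemma tpart_kd_snoc:
 assumes "its L" "x\<in>CR" "vec z" "length bs = length L"
 shows "tpart b (kd (L@[(True, x)]) z) bs =
  (if b then va (kd L (tpart True z)) (vm x (ve (tpart False z))) else kd L (tpart False z)) bs"
 using kd_snoc[OF assms, of b] assms by (simp add: tpart_def[of _ "kd (L@[(True, x)]) z"] tpart_def[of False z] ve_def ksgn_mult vapp)

section \<open>The pairing of cochains with chains\<close>

primrec pr :: "nat => (bool list => 'a) => (bool list => 'a) => 'a" where
 "pr 0 z w = z []\<otimes>w []"
| "pr (Suc n) z w = pr n (hpart False z) (hpart False w)\<oplus>pr n (hpart True z) (hpart True w)"

lemma pr_carr [simp]: "vec z ==> vec w ==> pr n z w\<in>CR"
 by (induction n arbitrary: z w) auto

lemma pr_add_l: "vec z ==> vec z' ==> vec w ==> pr n (va z z') w = pr n z w\<oplus>pr n z' w"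
 by (induction n arbitrary: z z' w) (simp_all add: vapp cr_simps)

lemma pr_add_r: "vec z ==> vec w' ==> vec w ==> pr n z (va w w') = pr n z w\<oplus>pr n z w'"
 by (induction n arbitrary: z w' w) (simp_all add: vapp cr_simps)

lemma pr_vm_l: "vec z ==> r\<in>CR ==> vec w ==> pr n (vm r z) w = r\<otimes>pr n z w"
 by (induction n arbitrary: z w) (simp_all add: vapp cr_simps)

lemma pr_vm_r: "vec z ==> r\<in>CR ==> vec w ==> pr n z (vm r w) = r\<otimes>pr n z w"
 by (induction n arbitrary: z w) (simp_all add: vapp cr_simps)

lemma pr_vn_l: "vec z ==> vec w ==> pr n (vn z) w =\<ominus>pr n z w"
 by (simp add: vn_vm pr_vm_l l_minus)
lemma pr_vn_r: "vec z ==> vec w ==> pr n z (vn w) =\<ominus>pr n z w"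
 by (simp add: vn_vm pr_vm_r l_minus)

lemma pr_ideal: "ideal J R ==> vec z ==> vec w ==> vin n J w ==> pr n z w\<in>J"
proof (induction n arbitrary: z w)
 case 0 thus ?case by (simp add: vin_def ideal_mult)
next
 case (Suc n) thus ?case unfolding vin_part by (simp add: ideal_add)
qed

text \<open>Cochain and chain items negate the tail in the same way and carry the factor in opposite
  directions, so the two differentials are transposes of each other without any sign.\<close>

lemma pr_adjoint: "inR ys ==> vec z ==> vec w ==>
 pr (length ys) (kd (coh ys) z) w = pr (length ys) z (kd (chn ys) w)"
proof (induction ys arbitrary: z w)
 case (Cons y ys)
 have c: "y\<in>CR" "inR ys" using Cons by auto
 have "pr (length ys) (kd (coh ys) (hpart a z)) (hpart a w) = pr (length ys) (hpart a z) (kd (chn ys) (hpart a w))" for a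
  using Cons c by simp
 thus ?case using c Cons.prems
  by (simp add: pr_add_l pr_add_r pr_vm_l pr_vm_r pr_vn_l pr_vn_r cr_simps)
qed simp

lemma pr_vs: "inR us ==> length us = n ==> vec z ==> vec w ==> pr n (vs us z) w = pr n z (vs us w)"
proof (induction us arbitrary: z w n)
 case Nil thus ?case by (simp add: vs_def)
next
 case (Cons u us)
 thus ?case by (auto simp: hpart_vs pr_vm_l pr_vm_r)
qed

definition unitv :: "bool list => bool list => 'a" where
 "unitv bs = (%c. if c = bs then \<one> else \<zero>)"

lemma unitv_vec [simp]: "vec (unitv bs)" by (simp add: vec_def unitv_def)

lemma hpart_unitv: "hpart a (unitv (b#bs)) = (if a = b then unitv bs else vz)"
 by (auto simp: hpart_def unitv_def fun_eq_iff)

lemma pr_vz: "vec w ==> pr n vz w = \<zero>"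
 by (induction n arbitrary: w) auto

lemma pr_unitv: "vec w ==> length bs = n ==> pr n (unitv bs) w = w bs"
proof (induction bs arbitrary: n w)
 case Nil thus ?case by (simp add: unitv_def)
next
 case (Cons b bs)
 have "hpart b w bs = w (b#bs)" by (simp add: hpart_def)
 thus ?case using Cons by (cases b) (auto simp: hpart_unitv pr_vz)
qed

end

section \<open>Change of generators\<close>

context cring
begin

lemma idl_set_dot: "inR xs ==>
 Idl (set xs) = {dot cs xs | cs. length cs = length xs\<and>inR cs}"
proof (induction xs)
 case Nil thus ?case by (auto simp: idl_empty)
next
 case (Cons x xs)
 have x: "x\<in>CR" "inR xs" using Cons by auto
 have "Idl (set (x#xs)) = {a\<oplus>c\<otimes>x | a c. a\<in>Idl (set xs)\<and>c\<in>CR}"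
  using idl_insert[OF x(2,1)] by simp
 also have "\<dots> = {dot cs (x#xs) | cs. length cs = length (x#xs)\<and>inR cs}" (is "?A = ?B")
 proof
  show "?A\<subseteq>?B"
  proof
   fix a assume "a\<in>?A"
   then obtain cs c where c: "length cs = length xs" "inR cs" "c\<in>CR" "a = dot cs xs\<oplus>c\<otimes>x"
    using Cons.IH[OF x(2)] by auto
   have "a = dot (c#cs) (x#xs)" using c x by (simp add: a_comm)
   moreover have "length (c#cs) = length (x#xs)" "set (c#cs)\<subseteq>CR" using c by auto
   ultimately show "a\<in>?B" by blast
  qed
  show "?B\<subseteq>?A"
  proof
   fix a assume "a\<in>?B"
   then obtain ds where d: "length ds = length (x#xs)" "inR ds" "a = dot ds (x#xs)" by blast
   then obtain c cs where c: "ds = c#cs" "length cs = length xs" by (auto simp: length_Suc_conv)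
   have "dot cs xs\<in>Idl (set xs)" using Cons.IH[OF x(2)] c d by auto
   moreover have "a = dot cs xs\<oplus>c\<otimes>x" using c d x by (simp add: a_comm)
   ultimately show "a\<in>?A" using c d by auto
  qed
 qed
 finally show ?case .
qed

definition pows :: "'a list => nat => 'a list" where
 "pows xs k = map (%x. x[^]k) xs"

lemma pows_simps [simp]: "pows [] k = []" "pows (x#xs) k = x[^]k#pows xs k"
 "pows (xs@ys) k = pows xs k@pows ys k" "length (pows xs k) = length xs"
 by (simp_all add: pows_def)

lemma pows_carr [simp]: "inR xs ==> set (pows xs k)\<subseteq>CR"
 by (auto simp: pows_def)

lemma compat_coh: "inR xs ==> compat (coh (pows xs k)) (pows xs e) (coh (pows xs (k + e)))"
 by (induction xs) (auto simp: nat_pow_mult add.commute)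

lemma sel_pows_add: "inR xs ==> sel (pows xs (e + f)) bs = sel (pows xs e) bs\<otimes>sel (pows xs f) bs"
 by (induction xs arbitrary: bs) (auto split: list.splits simp: nat_pow_mult[symmetric] cr_simps)

lemma vs_pows_add: "inR xs ==> vec z ==> vs (pows xs e) (vs (pows xs f) z) = vs (pows xs (e + f)) z"
 by (intro ext) (simp add: vs_def sel_pows_add m_assoc)

lemma vs_pows_0: "inR xs ==> vec z ==> vs (pows xs 0) z = z"
proof (intro ext)
 fix bs assume a: "inR xs" "vec z"
 have "sel (pows xs 0) bs = \<one>" using a(1) by (induction xs arbitrary: bs) (auto split: list.splits)
 thus "vs (pows xs 0) z bs = z bs" using a by (simp add: vs_def)
qed

definition veq :: "nat => 'a set => (bool list => 'a) => (bool list => 'a) => bool" where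
 "veq n J z w \<longleftrightarrow> vin n J (va z (vn w))"

lemma veq_vin: "ideal J R ==> vec z ==> vec w ==> veq n J z w ==> vin n J z \<longleftrightarrow> vin n J w"
proof -
 assume a: "ideal J R" "vec z" "vec w" "veq n J z w"
 have "z bs\<in>J \<longleftrightarrow> w bs\<in>J" if "length bs = n" for bs
 proof -
  have "z bs\<ominus>w bs\<in>J" using a that by (simp add: veq_def vin_def va_def vn_def a_minus_def)
  moreover have "z bs\<in>CR" "w bs\<in>CR" using a by auto
  ultimately show ?thesis using ideal_sub_cancel[OF a(1), of "w bs" "z bs"] ideal_add_cancel[OF a(1), of "z bs" "\<ominus>w bs"]
    ideal_neg[OF a(1), of "\<ominus>w bs"] by (auto simp: a_minus_def)
 qed
 thus ?thesis by (auto simp: vin_def)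
qed

lemma veq_eq: "ideal J R ==> vec z ==> (!!bs. length bs = n ==> z bs = w bs) ==> veq n J z w"
 unfolding veq_def vin_def
proof (intro allI impI)
 fix bs :: "bool list" assume a: "ideal J R" "vec z" "!!bs. length bs = n ==> z bs = w bs" "length bs = n"
 have "w bs\<in>CR" using a vecD[of z bs] by simp
 thus "va z (vn w) bs\<in>J" using a ideal_zero[OF a(1)] by (simp add: vapp r_neg)
qed

lemma veq_refl: "ideal J R ==> vec z ==> veq n J z z" by (rule veq_eq) auto

lemma veq_sym: assumes "ideal J R" "vec z" "vec w" "veq n J z w" shows "veq n J w z"
proof -
 have "va w (vn z) = vn (va z (vn w))" using assms by (intro ext) (simp add: vapp cr_simps)
 thus ?thesis using assms vin_vn by (simp add: veq_def)
qed

lemma veq_trans: assumes "ideal J R" "vec z" "vec w" "vec u" "veq n J z w" "veq n J w u" shows "veq n J z u"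
proof -
 have can: "(a\<oplus>\<ominus> b)\<oplus>(b\<oplus>\<ominus> c) = a\<oplus>\<ominus> c"
  if [simp]: "a\<in>CR" "b\<in>CR" "c\<in>CR" for a b c
  using that by algebra
 have "va z (vn u) = va (va z (vn w)) (va w (vn u))" using assms by (intro ext) (simp add: vapp can)
 thus ?thesis using assms vin_va by (simp add: veq_def)
qed

lemma veq_va: assumes "ideal J R" "vec z" "vec w" "vec z'" "vec w'" "veq n J z w" "veq n J z' w'"
 shows "veq n J (va z z') (va w w')"
proof -
 have "va (va z z') (vn (va w w')) = va (va z (vn w)) (va z' (vn w'))"
  using assms by (intro ext) (simp add: vapp cr_simps)
 thus ?thesis using assms vin_va by (simp add: veq_def)
qed

lemma veq_vm: assumes "ideal J R" "vec z" "vec w" "r\<in>CR" "veq n J z w" shows "veq n J (vm r z) (vm r w)"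
proof -
 have "va (vm r z) (vn (vm r w)) = vm r (va z (vn w))" using assms by (intro ext) (simp add: vapp cr_simps)
 thus ?thesis using assms vin_vm by (simp add: veq_def)
qed

lemma veq_vs: assumes "ideal J R" "inR us" "vec z" "vec w" "veq n J z w" shows "veq n J (vs us z) (vs us w)"
 using assms vin_vs[of J us n "va z (vn w)"] by (simp add: veq_def vs_va vs_vn)

lemma veq_kd: assumes "ideal J R" "its L" "vec z" "vec w" "veq (length L) J z w" shows "veq (length L) J (kd L z) (kd L w)"
 using assms vin_kd[of J L "va z (vn w)"] by (simp add: veq_def kd_va kd_vn)

lemma veq_mono: "J\<subseteq>K ==> veq n J z w ==> veq n K z w" by (auto simp: veq_def vin_def)

lemma veq_hpart: "veq (Suc n) J z w \<longleftrightarrow> veq n J (hpart False z) (hpart False w)\<and>veq n J (hpart True z) (hpart True w)"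
 by (simp add: veq_def vin_part)

lemma veq_vz: "vec z ==> veq n J z vz \<longleftrightarrow> vin n J z"
 unfolding veq_def by (rule vin_cong) (simp add: vapp)

text \<open>\<open>null xs k J z\<close>: the class in the cohomology of the Cech complex of \<open>R / J\<close> on \<open>xs\<close> of the
 cocycle with numerators \<open>z\<close> and denominators the \<open>k\<close>-th powers vanishes.\<close>

definition null :: "'a list => nat => 'a set => (bool list => 'a) => bool" where
 "null xs k J z \<longleftrightarrow> (\<exists>e v. vec v\<and>veq (length xs) J (vs (pows xs e) z) (kd (coh (pows xs (k + e))) v))"

text \<open>The condition is put on the numerators themselves, not on their multiples by powers.
  Every Cech cocycle can be written this way after raising its denominators, see
  \<open>cc_cocycle\<close>.\<close>

definition cocycle :: "'a list => nat => 'a set => (bool list => 'a) => bool" where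
 "cocycle xs k J z \<longleftrightarrow> vec z\<and>vin (length xs) J (kd (coh (pows xs k)) z)"

lemma cocycle_vec: "cocycle xs k J z ==> vec z" by (simp add: cocycle_def)

lemma kd_pows:
 "inR xs ==> ideal J R ==> vec z ==>
 veq (length xs) J (kd (coh (pows xs (k + e))) (vs (pows xs e) z)) (vs (pows xs e) (kd (coh (pows xs k)) z))"
 by (rule veq_eq) (auto simp: kd_vs[OF compat_coh])

lemma cocycle_vs:
 assumes "inR xs" "ideal J R" "cocycle xs k J z" shows "cocycle xs (k + e) J (vs (pows xs e) z)"
proof -
 have v: "vec z" "vin (length xs) J (kd (coh (pows xs k)) z)" using assms by (auto simp: cocycle_def)
 have "vin (length xs) J (vs (pows xs e) (kd (coh (pows xs k)) z))" using v assms by (intro vin_vs) simp_all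
 moreover have "vec (kd (coh (pows xs (k + e))) (vs (pows xs e) z))" "vec (vs (pows xs e) (kd (coh (pows xs k)) z))"
  using v assms by simp_all
 ultimately show ?thesis using veq_vin[OF assms(2) _ _ kd_pows[OF assms(1,2) v(1), of k e]] v assms by (simp add: cocycle_def)
qed

lemma null_raise:
 assumes xs: "inR xs" "ideal J R" and v: "vec z" "vec v"
  and h: "veq (length xs) J (vs (pows xs e) z) (kd (coh (pows xs (k + e))) v)"
 shows "veq (length xs) J (vs (pows xs (f + e)) z) (kd (coh (pows xs (k + e + f))) (vs (pows xs f) v))"
proof -
 let ?d = "kd (coh (pows xs (k + e))) v"
 have vd: "vec ?d" "vec (vs (pows xs e) z)" "vec (vs (pows xs f) ?d)" "vec (kd (coh (pows xs (k + e + f))) (vs (pows xs f) v))"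
  "vec (vs (pows xs (f + e)) z)" using xs v by simp_all
 have "veq (length xs) J (vs (pows xs f) (vs (pows xs e) z)) (vs (pows xs f) ?d)"
  using veq_vs[OF xs(2) pows_carr[OF xs(1)] vd(2,1) h] .
 hence a: "veq (length xs) J (vs (pows xs (f + e)) z) (vs (pows xs f) ?d)"
  unfolding vs_pows_add[OF xs(1) v(1)] .
 have "veq (length xs) J (vs (pows xs f) ?d) (kd (coh (pows xs (k + e + f))) (vs (pows xs f) v))"
  using veq_sym[OF xs(2) vd(4,3) kd_pows[OF xs v(2), of "k + e" f]] .
 from veq_trans[OF xs(2) vd(5,3,4) a this] show ?thesis .
qed

text \<open>Nullity depends on the class and not on the level at which it is written: the two ways
  of raising exponents commute.\<close>

lemma null_level:
 assumes xs: "inR xs" "ideal J R" and v: "vec z"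
 shows "null xs (k + f) J (vs (pows xs f) z) \<longleftrightarrow> null xs k J z"
proof
 assume "null xs (k + f) J (vs (pows xs f) z)"
 then obtain e v where "vec v" "veq (length xs) J (vs (pows xs e) (vs (pows xs f) z)) (kd (coh (pows xs (k + f + e))) v)"
  unfolding null_def by blast
 moreover have "k + f + e = k + (e + f)" by simp
 ultimately have "veq (length xs) J (vs (pows xs (e + f)) z) (kd (coh (pows xs (k + (e + f)))) v)" "vec v"
  by (simp_all only: vs_pows_add[OF xs(1) v])
 thus "null xs k J z" unfolding null_def by blast
next
 assume "null xs k J z"
 then obtain e w where w: "vec w" "veq (length xs) J (vs (pows xs e) z) (kd (coh (pows xs (k + e))) w)"
  unfolding null_def by blast
 have "f + e = e + f" "k + e + f = k + f + e" by simp_all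
 hence "veq (length xs) J (vs (pows xs e) (vs (pows xs f) z)) (kd (coh (pows xs (k + f + e))) (vs (pows xs f) w))"
  using null_raise[OF xs v w, of f] by (simp only: vs_pows_add[OF xs(1) v])
 moreover have "vec (vs (pows xs f) w)" using w xs by simp
 ultimately show "null xs (k + f) J (vs (pows xs f) z)" unfolding null_def by blast
qed

lemma null_va:
 assumes xs: "inR xs" "ideal J R" and z: "vec z" and w: "vec w"
  and n: "null xs k J z" "null xs k J w"
 shows "null xs k J (va z w)"
proof -
 obtain e v where v: "vec v" "veq (length xs) J (vs (pows xs e) z) (kd (coh (pows xs (k + e))) v)"
  using n(1) unfolding null_def by blast
 obtain f u where u: "vec u" "veq (length xs) J (vs (pows xs f) w) (kd (coh (pows xs (k + f))) u)"
  using n(2) unfolding null_def by blast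
 have e: "k + e + f = k + (f + e)" "k + f + e = k + (f + e)" "e + f = f + e" by simp_all
 have 1: "veq (length xs) J (vs (pows xs (f + e)) z) (kd (coh (pows xs (k + (f + e)))) (vs (pows xs f) v))"
  using null_raise[OF xs z v, of f] unfolding e .
 have 2: "veq (length xs) J (vs (pows xs (f + e)) w) (kd (coh (pows xs (k + (f + e)))) (vs (pows xs e) u))"
  using null_raise[OF xs w u, of e] unfolding e .
 have vv: "vec (vs (pows xs f) v)" "vec (vs (pows xs e) u)" using xs u v by simp_all
 have "veq (length xs) J (vs (pows xs (f + e)) (va z w)) (kd (coh (pows xs (k + (f + e)))) (va (vs (pows xs f) v) (vs (pows xs e) u)))"
  using veq_va[OF xs(2) _ _ _ _ 1 2] xs z w vv by (simp add: vs_va kd_va)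
 moreover have "vec (va (vs (pows xs f) v) (vs (pows xs e) u))" using vv by simp
 ultimately show ?thesis unfolding null_def by blast
qed

lemma null_vm:
 assumes "inR xs" "ideal J R" "vec z" "r\<in>CR" "null xs k J z"
 shows "null xs k J (vm r z)"
proof -
 obtain e v where v: "vec v" "veq (length xs) J (vs (pows xs e) z) (kd (coh (pows xs (k + e))) v)"
  using assms by (auto simp: null_def)
 have "veq (length xs) J (vs (pows xs e) (vm r z)) (kd (coh (pows xs (k + e))) (vm r v))"
  using veq_vm[OF assms(2) _ _ assms(4) v(2)] assms v by (simp add: vs_vm kd_vm)
 thus ?thesis unfolding null_def using v assms by (metis vec_closed(3))
qed

lemma null_vin:
 assumes "inR xs" "ideal J R" "vec z" "vin (length xs) J z"
 shows "null xs k J z"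
proof -
 have "veq (length xs) J (vs (pows xs 0) z) (kd (coh (pows xs (k + 0))) vz)"
  using assms by (simp add: vs_pows_0 kd_vz veq_vz)
 thus ?thesis unfolding null_def using vec_closed(4) by blast
qed

lemma null_mono: "J\<subseteq>K ==> null xs k J z ==> null xs k K z"
 unfolding null_def using veq_mono by blast

text \<open>Membership in the radical, with coefficients for every level \<open>k\<close>: the
  contraction that kills cohomology at level \<open>k\<close> is taken against the coefficients of
  the \<open>k\<close>-th powers.\<close>

definition in_rad :: "'a => 'a list => bool" where
 "in_rad y xs \<longleftrightarrow> (\<forall>k. \<exists>N cs. length cs = length xs\<and>inR cs\<and>y[^](N::nat) = dot cs (pows xs k))"

text \<open>On a cocycle one of the two terms of the homotopy vanishes modulo \<open>J\<close>. So
  the ideal of the \<open>k\<close>-th powers kills Koszul cohomology at level \<open>k\<close>, and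
  the contraction is an explicit preimage.\<close>

lemma contract:
 assumes xs: "inR xs" "ideal J R" and cs: "length cs = length xs" "inR cs"
  and z: "cocycle xs k J z"
 shows "veq (length xs) J (vm (dot cs (pows xs k)) z) (kd (coh (pows xs k)) (kd (chn cs) z))"
proof -
 have v: "vec z" using z by (simp add: cocycle_def)
 have h: "vin (length xs) J (kd (chn cs) (kd (coh (pows xs k)) z))"
  using vin_kd[OF assms(2), of "chn cs"] z xs cs by (simp add: cocycle_def)
 have can: "(a\<oplus>b)\<oplus>\<ominus> a = b" if "a\<in>CR" "b\<in>CR" for a b using that by algebra
 define D where "D = kd (coh (pows xs k)) (kd (chn cs) z)"
 define E where "E = kd (chn cs) (kd (coh (pows xs k)) z)"
 have vDE: "vec D" "vec E" unfolding D_def E_def using xs cs v by simp_all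
 define c where "c = dot cs (pows xs k)"
 have cc: "c\<in>CR" unfolding c_def using xs cs by simp
 have "va (vm c z) (vn D) bs = E bs" if l: "length bs = length xs" for bs
 proof -
  have "c\<otimes>z bs = D bs\<oplus>E bs"
   using kd_homotopy[of cs "pows xs k" z bs] cs xs v l unfolding D_def E_def c_def by simp
  thus ?thesis using can[of "D bs" "E bs"] vDE v cc by (simp add: vapp)
 qed
 hence "vin (length xs) J (va (vm c z) (vn D))" using h unfolding E_def[symmetric] by (simp add: vin_def)
 thus ?thesis unfolding veq_def D_def c_def .
qed

lemma cocycle_Cons:
 assumes "inR xs" "y\<in>CR" "ideal J R" "vec z"
 shows "cocycle (y#xs) k J z \<longleftrightarrow> cocycle xs k J (hpart False z)\<and>
  veq (length xs) J (vm (y[^]k) (hpart False z)) (kd (coh (pows xs k)) (hpart True z))"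
 using assms by (simp add: cocycle_def vin_part veq_def)

text \<open>The Cech complex on \<open>y # xs\<close> consists of the complex on \<open>xs\<close>
  and of its localization at \<open>y\<close>. The latter is acyclic, because some power of
  \<open>y\<close> is in the ideal of the powers of \<open>xs\<close>; hence the part without
  \<open>y\<close> decides.\<close>

lemma null_Cons:
 assumes xs: "inR xs" "y\<in>CR" "ideal J R" and r: "in_rad y xs" and z: "cocycle (y#xs) k J z"
 shows "null (y#xs) k J z \<longleftrightarrow> null xs k J (hpart False z)"
proof
 let ?n = "length xs"
 have vz: "vec z" using z by (simp add: cocycle_def)
 show "null xs k J (hpart False z)" if nz: "null (y#xs) k J z"
 proof -
  obtain e v where v: "vec v" "veq (length (y#xs)) J (vs (pows (y#xs) e) z) (kd (coh (pows (y#xs) (k + e))) v)"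
   using nz unfolding null_def by blast
  have "veq ?n J (hpart False (vs (pows (y#xs) e) z)) (hpart False (kd (coh (pows (y#xs) (k + e))) v))"
   using v(2) by (simp only: list.size add_Suc_right add_0_right veq_hpart)
  hence "veq ?n J (vs (pows xs e) (hpart False z)) (kd (coh (pows xs (k + e))) (hpart False v))"
   using xs vz by (simp add: hpart_vs)
  thus ?thesis unfolding null_def using vec_closed(5)[OF v(1)] by blast
 qed
 assume "null xs k J (hpart False z)"
 then obtain e v0 where v0: "vec v0" "veq ?n J (vs (pows xs e) (hpart False z)) (kd (coh (pows xs (k + e))) v0)"
  unfolding null_def by blast
 define K where "K = k + e"
 define U where "U = vs (pows (y#xs) e) z"
 have ys: "set (y#xs)\<subseteq>CR" using xs by simp
 have U: "cocycle (y#xs) K J U" unfolding U_def K_def using cocycle_vs[OF ys xs(3) z] .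
 have vU: "vec U" using U cocycle_vec by blast
 define U0 U1 where "U0 = hpart False U" and "U1 = hpart True U"
 have U0: "U0 = vs (pows xs e) (hpart False z)" unfolding U0_def U_def using xs vz by (simp add: hpart_vs)
 have vU01 [simp]: "vec U0" "vec U1" unfolding U0_def U1_def using vU by simp_all
 let ?d = "kd (coh (pows xs K))"
 have d [simp]: "vec (?d w)" if "vec w" for w using that xs by simp
 have e0: "veq ?n J U0 (?d v0)" unfolding U0 using v0 K_def by simp
 have e1: "veq ?n J (vm (y[^]K) U0) (?d U1)"
  using U cocycle_Cons[OF xs vU] unfolding U0_def U1_def by blast
 \<comment> \<open>Both terms have the same boundary modulo \<open>J\<close>, so \<open>w1\<close>
   is a cocycle, which a power of \<open>y\<close> turns into the boundary of \<open>h\<close>. This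
   \<open>h\<close>, negated, is the component of the witness at \<open>y\<close>.\<close>
 define w1 where "w1 = va U1 (vn (vm (y[^]K) v0))"
 have vw1 [simp]: "vec w1" unfolding w1_def using v0 xs by simp
 have "veq ?n J (?d U1) (vm (y[^]K) (?d v0))"
  using veq_trans[OF xs(3) _ _ _ veq_sym[OF xs(3) _ _ e1] veq_vm[OF xs(3) _ _ _ e0, of "y[^]K"]] xs v0 by simp
 hence "vin ?n J (?d w1)" unfolding w1_def veq_def using xs v0 by (simp add: kd_va kd_vn kd_vm)
 hence cw: "cocycle xs K J w1" unfolding cocycle_def by simp
 obtain N cs where N: "length cs = length xs" "inR cs" "y[^](N::nat) = dot cs (pows xs K)"
  using r unfolding in_rad_def by blast
 define h where "h = kd (chn cs) w1"
 have vh [simp]: "vec h" unfolding h_def using N by simp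
 have c1: "veq ?n J (vm (y[^]N) w1) (?d h)" unfolding h_def N(3) using contract[OF xs(1,3) N(1,2) cw] .
 define v where "v = glue \<zero> (vs (pows xs N) v0) (vn (vs (pows xs N) h))"
 have vv: "vec v" unfolding v_def using v0 xs by simp
 let ?T = "vs (pows xs N)" and ?d' = "kd (coh (pows xs (K + N)))"
 have T [simp]: "vec (?T w)" if "vec w" for w using that xs by simp
 have d' [simp]: "vec (?d' w)" if "vec w" for w using that xs by simp
 have Td: "veq ?n J (?T (?d w)) (?d' (?T w))" if "vec w" for w
  using veq_sym[OF xs(3) _ _ kd_pows[OF xs(1,3) that, of K N]] that by simp
 have A: "veq ?n J (?T U0) (?d' (?T v0))"
  using veq_trans[OF xs(3) _ _ _ veq_vs[OF xs(3) _ _ _ e0] Td[OF v0(1)]] v0 xs by simp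
 have B: "veq ?n J (vm (y[^]N) (?T U1)) (va (vm (y[^](K + N)) (?T v0)) (?d' (?T h)))"
 proof -
  have "veq ?n J (?T (vm (y[^]N) w1)) (?d' (?T h))"
   using veq_trans[OF xs(3) _ _ _ veq_vs[OF xs(3) _ _ _ c1] Td] xs by simp
  from veq_va[OF xs(3) _ _ _ _ veq_refl[OF xs(3)] this, of "vm (y[^](K + N)) (?T v0)"]
  have *: "veq ?n J (va (vm (y[^](K + N)) (?T v0)) (?T (vm (y[^]N) w1))) (va (vm (y[^](K + N)) (?T v0)) (?d' (?T h)))"
   using xs v0 by simp
  have can: "(b\<otimes>a)\<otimes>t\<oplus>a\<otimes>(u\<oplus>\<ominus> (b\<otimes>t)) = a\<otimes>u"
   if [simp]: "a\<in>CR" "b\<in>CR" "t\<in>CR" "u\<in>CR" for a b t u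
   using that by algebra
  have "va (vm (y[^](K + N)) (?T v0)) (?T (vm (y[^]N) w1)) = vm (y[^]N) (?T U1)"
   unfolding w1_def using xs v0 by (intro ext) (simp add: vs_va vs_vn vs_vm vapp nat_pow_mult[symmetric] can)
  thus ?thesis using * by simp
 qed
 have "veq (Suc ?n) J (vs (pows (y#xs) N) U) (kd (coh (pows (y#xs) (K + N))) v)"
  unfolding veq_hpart pows_simps list.map hpart_kd hpart_vs[OF pows_carr[OF xs(1)] nat_pow_closed[OF xs(2)] vU]
  using A B xs v0 unfolding v_def by (simp add: U0_def[symmetric] U1_def[symmetric] kd_vn vn_vn)
 moreover have "vs (pows (y#xs) N) U = vs (pows (y#xs) (e + N)) z"
  unfolding U_def using vs_pows_add[OF ys vz] by (simp add: add.commute)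
 ultimately have "veq (length (y#xs)) J (vs (pows (y#xs) (e + N)) z) (kd (coh (pows (y#xs) (k + (e + N)))) v)"
  by (simp only: K_def add.assoc list.size add_Suc_right add_0_right)
 thus "null (y#xs) k J z" unfolding null_def using vv by blast
qed

lemma homog_chn: assumes "length cs = length xs" shows "homog (chn cs) (-j) z \<longleftrightarrow> homog (coh xs) j z"
proof -
 have "kdeg (chn cs) bs = - kdeg (coh xs) bs" for bs using assms
  by (induction cs xs arbitrary: bs rule: list_induct2) (simp_all split: list.split)
 thus ?thesis unfolding homog_def using assms by auto
qed

text \<open>A power of \<open>y\<close> times \<open>z\<close> is the boundary of the contraction
  \<open>h\<close>; up to a factor this \<open>h\<close> is the component at \<open>y\<close> that
  completes \<open>z\<close> to a cocycle. The contraction lowers the degree by one, as homogeneity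
  requires.\<close>

lemma extend_cocycle_Cons:
 assumes xs: "inR xs" "y\<in>CR" "ideal J R" and r: "in_rad y xs"
  and z: "cocycle xs k J z" "homog (coh xs) j z"
 shows "\<exists>N u. cocycle (y#xs) (k + N) J u\<and>homog (coh (y#xs)) j u\<and>hpart False u = vs (pows xs N) z"
proof -
 let ?n = "length xs"
 have vz: "vec z" using z cocycle_vec by blast
 obtain N cs where N: "length cs = length xs" "inR cs" "y[^](N::nat) = dot cs (pows xs k)"
  using r unfolding in_rad_def by blast
 define h where "h = kd (chn cs) z"
 have vh [simp]: "vec h" unfolding h_def using N vz by simp
 have hh: "homog (coh xs) (j - 1) h"
 proof -
  have "homog (chn cs) (-j) z" using z(2) homog_chn[OF N(1)] by simp
  hence "homog (chn cs) (-(j - 1)) h" unfolding h_def using homog_kd[of "chn cs" z "-j"] N vz by simp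
  thus ?thesis by (simp only: homog_chn[OF N(1)])
 qed
 let ?T = "vs (pows xs N)" and ?d = "kd (coh (pows xs k))" and ?d' = "kd (coh (pows xs (k + N)))"
 have c1: "veq ?n J (vm (y[^]N) z) (?d h)" unfolding h_def N(3) using contract[OF xs(1,3) N(1,2) z(1)] .
 have "veq ?n J (?T (vm (y[^]N) z)) (?d' (?T h))"
  using veq_trans[OF xs(3) _ _ _ veq_vs[OF xs(3) _ _ _ c1] veq_sym[OF xs(3) _ _ kd_pows[OF xs(1,3) vh, of k N]]] xs vz by simp
 hence "veq ?n J (vm (y[^]k) (?T (vm (y[^]N) z))) (vm (y[^]k) (?d' (?T h)))"
  using xs vz by (intro veq_vm) simp_all
 moreover have "vm (y[^]k) (?T (vm (y[^]N) z)) = vm (y[^](k + N)) (?T z)"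
  using xs vz by (intro ext) (simp add: vs_vm vapp nat_pow_mult[symmetric] m_assoc)
 moreover have "vm (y[^]k) (?d' (?T h)) = ?d' (vm (y[^]k) (?T h))" using xs by (simp add: kd_vm)
 ultimately have e: "veq ?n J (vm (y[^](k + N)) (?T z)) (?d' (vm (y[^]k) (?T h)))" by simp
 define u where "u = glue \<zero> (?T z) (vm (y[^]k) (?T h))"
 have vu: "vec u" unfolding u_def using xs vz by simp
 have "cocycle (y#xs) (k + N) J u"
  using cocycle_Cons[OF xs vu] cocycle_vs[OF xs(1,3) z(1)] e by (simp add: u_def)
 moreover have "homog (coh (y#xs)) j u"
  using z hh xs by (simp add: homog_Cons u_def homog_vm homog_vs)
 moreover have "hpart False u = ?T z" by (simp add: u_def)
 ultimately show ?thesis by blast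
qed

text \<open>Statements about an added generator are proved at the head, where \<open>kd\<close>
  recurses; this isomorphism carries them to a generator added at the end. The sign in the part with
  the moved generator makes it commute with the differentials.\<close>

definition rot :: "(bool list => 'a) => bool list => 'a" where
 "rot z = glue \<zero> (tpart False z) (ve (tpart True z))"

definition unrot :: "(bool list => 'a) => bool list => 'a" where
 "unrot z = tglue \<zero> (hpart False z) (ve (hpart True z))"

lemma rot_vec [simp]: "vec z ==> vec (rot z)" "vec z ==> vec (unrot z)"
 by (simp_all add: rot_def unrot_def)

lemma hpart_rot [simp]: "hpart b (rot z) = (if b then ve (tpart True z) else tpart False z)"
 by (simp add: rot_def)

lemma tpart_unrot [simp]: "tpart b (unrot z) = (if b then ve (hpart True z) else hpart False z)"
 by (simp add: unrot_def)

lemma app_hpart: "z (b#c) = hpart b z c" by (simp add: hpart_def)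

lemma rot_unrot: "vec z ==> length bs = Suc n ==> rot (unrot z) bs = z bs"
proof -
 assume v: "vec z" and "length bs = Suc n"
 then obtain b c where bs: "bs = b#c" by (cases bs) auto
 show "rot (unrot z) bs = z bs" unfolding bs app_hpart using v by (cases b) simp_all
qed

lemma vin_rot: "ideal J R ==> vec z ==> vin (Suc n) J (rot z) \<longleftrightarrow> vin (Suc n) J z"
 by (subst vin_part, subst vin_tpart) (simp add: vin_ve)

lemma homog_rot: "vec z ==> homog ((True, x)#L) j (rot z) \<longleftrightarrow> homog (L@[(True, x)]) j z"
proof -
 assume v: "vec z"
 have "homog L (j - 1) (ve (tpart True z)) \<longleftrightarrow> homog L (j - 1) (tpart True z)"
  using homog_ve[of L "j - 1" "tpart True z"] homog_ve[of L "j - 1" "ve (tpart True z)"] v by auto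
 thus ?thesis by (simp add: homog_Cons homog_snoc)
qed

lemma kd_cong:
 assumes "its L" "vec z" "vec w" "!!bs. length bs = length L ==> z bs = w bs" "length bs = length L"
 shows "kd L z bs = kd L w bs"
proof -
 have "veq (length L) {\<zero>} (kd L z) (kd L w)"
  using assms by (intro veq_kd veq_eq) (simp_all add: zeroideal)
 hence "kd L z bs\<ominus>kd L w bs = \<zero>" using assms(1-3,5) by (simp add: veq_def vin_def vapp a_minus_def)
 thus ?thesis using assms by simp
qed

lemma kd_rot:
 assumes "its L" "x\<in>CR" "vec z" "length bs = Suc (length L)"
 shows "kd ((True, x)#L) (rot z) bs = rot (kd (L@[(True, x)]) z) bs"
proof -
 obtain b c where bs: "bs = b#c" "length c = length L" using assms by (cases bs) auto
 note t = tpart_kd_snoc[OF assms(1-3) bs(2)]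
 show ?thesis unfolding bs(1) app_hpart hpart_kd hpart_rot
 proof (cases b)
  case True
  have [simp]: "ksgn c (p\<oplus>q) = ksgn c p\<oplus>ksgn c q" if "p\<in>CR" "q\<in>CR" for p q
   using that by (simp add: ksgn_def minus_add)
  show "(if fst (True, x) then if b then va (vm (snd (True, x)) (if False then ve (tpart True z) else tpart False z))
    (vn (kd L (if True then ve (tpart True z) else tpart False z)))
   else kd L (if False then ve (tpart True z) else tpart False z)
   else if b then vn (kd L (if True then ve (tpart True z) else tpart False z))
    else va (kd L (if False then ve (tpart True z) else tpart False z))
     (vm (snd (True, x)) (if True then ve (tpart True z) else tpart False z))) c =
   (if b then ve (tpart True (kd (L@[(True, x)]) z)) else tpart False (kd (L@[(True, x)]) z)) c"
   using assms t[of True] True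
   by (simp add: ve_app[of "tpart True (kd (L@[(True, x)]) z)"] vapp ve_app ksgn_mult kd_ve vn_vn a_comm)
 qed (use t[of False] in simp)
qed

lemma vs_rot:
 assumes "inR us" "x\<in>CR" "vec z" "length bs = Suc (length us)"
 shows "vs (x#us) (rot z) bs = rot (vs (us@[x]) z) bs"
proof -
 obtain b c where bs: "bs = b#c" "length c = length us" using assms by (cases bs) auto
 have "tpart d (vs (us@[x]) z) c = (if d then x\<otimes>vs us (tpart True z) c else vs us (tpart False z) c)" for d
  using assms sel_append[OF bs(2), of "[x]" "[d]"] by (cases d) (simp_all add: vs_def tpart_def cr_simps)
 thus ?thesis unfolding bs(1) app_hpart
  using assms by (cases b) (simp_all add: hpart_vs vapp ve_app vs_def[of us] ksgn_mult)
qed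

lemma veq_rot: "ideal J R ==> vec z ==> vec w ==> veq (Suc n) J (rot z) (rot w) \<longleftrightarrow> veq (Suc n) J z w"
proof -
 assume a: "ideal J R" "vec z" "vec w"
 have "va (rot z) (vn (rot w)) bs = rot (va z (vn w)) bs" if l: "length bs = Suc n" for bs
 proof -
  obtain b c where bs: "bs = b#c" using l by (cases bs) auto
  have [simp]: "ksgn c (p\<oplus>\<ominus> q) = ksgn c p\<oplus>\<ominus> ksgn c q" if "p\<in>CR" "q\<in>CR" for p q
   using that by (simp add: ksgn_def minus_add)
  show ?thesis unfolding bs app_hpart using a by (cases b) (simp_all add: vapp ve_app)
 qed
 hence "veq (Suc n) J (rot z) (rot w) \<longleftrightarrow> vin (Suc n) J (rot (va z (vn w)))"
  unfolding veq_def by (rule vin_cong)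
 thus ?thesis using a vin_rot by (simp add: veq_def)
qed

lemma veq_cong:
 assumes "!!bs. length bs = n ==> z bs = z' bs" "!!bs. length bs = n ==> w bs = w' bs"
 shows "veq n J z w \<longleftrightarrow> veq n J z' w'"
 unfolding veq_def by (rule vin_cong) (simp add: va_def vn_def assms)

lemma cocycle_rot:
 assumes "inR xs" "y\<in>CR" "ideal J R" "vec z"
 shows "cocycle (y#xs) k J (rot z) \<longleftrightarrow> cocycle (xs@[y]) k J z"
proof -
 have "vin (Suc (length xs)) J (kd (coh (pows (y#xs) k)) (rot z)) \<longleftrightarrow>
  vin (Suc (length xs)) J (rot (kd (coh (pows (xs@[y]) k)) z))"
  by (rule vin_cong) (use assms kd_rot[of "coh (pows xs k)" "y[^]k" z] in simp)
 also have "\<dots> \<longleftrightarrow> vin (Suc (length xs)) J (kd (coh (pows (xs@[y]) k)) z)"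
  using assms by (intro vin_rot) simp_all
 finally show ?thesis using assms by (simp add: cocycle_def del: kd.simps pows_simps(2,3))
qed

lemma null_rot_step:
 assumes xs: "inR xs" "y\<in>CR" "ideal J R" "vec z" "vec v"
 shows "veq (Suc (length xs)) J (vs (pows (y#xs) e) (rot z)) (kd (coh (pows (y#xs) K)) (rot v)) \<longleftrightarrow>
  veq (Suc (length xs)) J (vs (pows (xs@[y]) e) z) (kd (coh (pows (xs@[y]) K)) v)"
proof -
 have "veq (Suc (length xs)) J (vs (pows (y#xs) e) (rot z)) (kd (coh (pows (y#xs) K)) (rot v)) \<longleftrightarrow>
  veq (Suc (length xs)) J (rot (vs (pows (xs@[y]) e) z)) (rot (kd (coh (pows (xs@[y]) K)) v))"
  by (rule veq_cong)
   (use xs vs_rot[of "pows xs e" "y[^]e" z] kd_rot[of "coh (pows xs K)" "y[^]K" v] in \<open>simp_all\<close>)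
 also have "\<dots> \<longleftrightarrow> veq (Suc (length xs)) J (vs (pows (xs@[y]) e) z) (kd (coh (pows (xs@[y]) K)) v)"
 proof (rule veq_rot[OF xs(3)])
  show "vec (vs (pows (xs@[y]) e) z)" "vec (kd (coh (pows (xs@[y]) K)) v)" using xs by (auto intro!: vec_vs vec_kd)
 qed
 finally show ?thesis .
qed

lemma null_rot:
 assumes xs: "inR xs" "y\<in>CR" "ideal J R" "vec z"
 shows "null (y#xs) k J (rot z) \<longleftrightarrow> null (xs@[y]) k J z"
proof
 assume "null (xs@[y]) k J z"
 then obtain e v where "vec v" "veq (Suc (length xs)) J (vs (pows (xs@[y]) e) z) (kd (coh (pows (xs@[y]) (k + e))) v)"
  unfolding null_def by auto
 hence "vec (rot v)" "veq (length (y#xs)) J (vs (pows (y#xs) e) (rot z)) (kd (coh (pows (y#xs) (k + e))) (rot v))"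
  using null_rot_step[OF xs, of v e "k + e"] by simp_all
 thus "null (y#xs) k J (rot z)" unfolding null_def by blast
next
 assume "null (y#xs) k J (rot z)"
 then obtain e v where v: "vec v" "veq (Suc (length xs)) J (vs (pows (y#xs) e) (rot z)) (kd (coh (pows (y#xs) (k + e))) v)"
  unfolding null_def by auto
 have "kd (coh (pows (y#xs) (k + e))) v bs = kd (coh (pows (y#xs) (k + e))) (rot (unrot v)) bs"
  if "length bs = Suc (length xs)" for bs
  by (rule kd_cong) (use v xs that rot_unrot[of v _ "length xs"] in simp_all)
 hence "veq (Suc (length xs)) J (vs (pows (y#xs) e) (rot z)) (kd (coh (pows (y#xs) (k + e))) (rot (unrot v)))"
  using veq_cong[of "Suc (length xs)" "vs (pows (y#xs) e) (rot z)" "vs (pows (y#xs) e) (rot z)"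
   "kd (coh (pows (y#xs) (k + e))) v" "kd (coh (pows (y#xs) (k + e))) (rot (unrot v))" J] v by blast
 hence "veq (length (xs@[y])) J (vs (pows (xs@[y]) e) z) (kd (coh (pows (xs@[y]) (k + e))) (unrot v))"
  using null_rot_step[OF xs, of "unrot v" e "k + e"] v by simp
 thus "null (xs@[y]) k J z" unfolding null_def using rot_vec(2)[OF v(1)] by blast
qed

lemma vec_app [simp]: "vec z ==> vec (%bs. z (f bs))" by (simp add: vec_def)

end

section \<open>Radicals, and the Cech complex on a concatenated list\<close>

context noetherian_cring
begin

lemma mem_radical_iff:
 assumes I: "ideal I R" and y: "y\<in>CR"
 shows "(\<exists>n::nat. y[^]n\<in>I) \<longleftrightarrow> (\<forall>P. primeideal P R --> I\<subseteq>P --> y\<in>P)"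
proof
 assume "\<exists>n::nat. y[^]n\<in>I"
 thus "\<forall>P. primeideal P R --> I\<subseteq>P --> y\<in>P" using prime_pow y by blast
next
 assume h: "\<forall>P. primeideal P R --> I\<subseteq>P --> y\<in>P"
 show "\<exists>n::nat. y[^]n\<in>I"
 proof (rule ccontr)
  assume n: "\<not> ?thesis"
  have "\<exists>P. primeideal P R\<and>I\<subseteq>P\<and>P\<inter>range (%n::nat. y[^]n) = {}"
  proof (rule exists_prime_avoiding[OF I])
   show "range (%n::nat. y[^]n)\<subseteq>CR" using y by auto
   show "\<one>\<in>range (%n::nat. y[^]n)" using nat_pow_0[of y] by (metis rangeI)
   show "s\<otimes>t\<in>range (%n::nat. y[^]n)" if "s\<in>range (%n::nat. y[^]n)" "t\<in>range (%n::nat. y[^]n)" for s t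
    using that y by (auto simp: nat_pow_mult)
   show "I\<inter>range (%n::nat. y[^]n) = {}" using n by auto
  qed
  then obtain P where P: "primeideal P R" "I\<subseteq>P" "P\<inter>range (%n::nat. y[^]n) = {}" by blast
  have "y[^](1::nat)\<notin>P" using P(3) by blast
  thus False using h P y by simp
 qed
qed

text \<open>Transitivity of membership in a radical, argued on the primes above the ideals so that
  no exponents have to be combined.\<close>

lemma radical_gens:
 assumes "A\<subseteq>CR" "B\<subseteq>CR" "!!b. b\<in>B ==> \<exists>n::nat. b[^]n\<in>Idl A"
  and "y\<in>CR" "\<exists>n::nat. y[^]n\<in>Idl B"
 shows "\<exists>n::nat. y[^]n\<in>Idl A"
proof -
 have i: "ideal (Idl A) R" "ideal (Idl B) R" using assms genideal_ideal by blast+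
 show ?thesis unfolding mem_radical_iff[OF i(1) assms(4)]
 proof (intro allI impI)
  fix P assume P: "primeideal P R" "Idl A\<subseteq>P"
  have "B\<subseteq>P" using assms(2,3) mem_radical_iff[OF i(1)] P by blast
  hence "Idl B\<subseteq>P" using genideal_minimal P primeideal_def by blast
  thus "y\<in>P" using assms(5) mem_radical_iff[OF i(2) assms(4)] P by blast
 qed
qed

lemma in_radI:
 assumes "inR xs" "y\<in>CR" "\<exists>n::nat. y[^]n\<in>Idl (set xs)"
 shows "in_rad y xs"
 unfolding in_rad_def
proof
 fix k
 have "\<exists>n::nat. y[^]n\<in>Idl (set (pows xs k))"
 proof (rule radical_gens[OF pows_carr assms(1)])
  fix b assume "b\<in>set xs"
  hence "b[^]k\<in>Idl (set (pows xs k))"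
   using genideal_self[OF pows_carr[OF assms(1), of k]] by (auto simp: pows_def)
  thus "\<exists>n::nat. b[^]n\<in>Idl (set (pows xs k))" by blast
 qed (use assms in auto)
 thus "\<exists>N cs. length cs = length xs\<and>inR cs\<and>y[^](N::nat) = dot cs (pows xs k)"
  using idl_set_dot[OF pows_carr[OF assms(1), of k]] by auto
qed

lemma in_rad_mono:
 assumes "set xs\<subseteq>set zs" "inR zs" "y\<in>CR" "\<exists>n::nat. y[^]n\<in>Idl (set xs)"
 shows "in_rad y zs"
 using in_radI[OF assms(2,3)] idl_mono[OF assms(1,2)] assms(4) by blast

text \<open>The generators of \<open>A\<close> are dropped from the front. At every stage the
  remaining list still contains \<open>B\<close>, so the dropped one lies in its radical and
  \<open>null_Cons\<close> applies.\<close>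

lemma null_right:
 assumes "inR A" "inR B" "ideal J R" "!!a. a\<in>set A ==> \<exists>n::nat. a[^]n\<in>Idl (set B)"
  and "cocycle (A@B) k J u"
 shows "null (A@B) k J u \<longleftrightarrow> null B k J (%bs. u (replicate (length A) False@bs))"
 using assms
proof (induction A arbitrary: u)
 case Nil thus ?case by simp
next
 case (Cons a A)
 have c: "set (A@B)\<subseteq>CR" "a\<in>CR" using Cons by auto
 have r: "in_rad a (A@B)" by (rule in_rad_mono[of B]) (use Cons c in auto)
 have cc: "cocycle (a#(A@B)) k J u" using Cons by simp
 have "cocycle (A@B) k J (hpart False u)"
  using cocycle_Cons[OF c Cons.prems(3) cocycle_vec[OF cc]] cc by blast
 hence "null (A@B) k J (hpart False u) \<longleftrightarrow> null B k J (%bs. hpart False u (replicate (length A) False@bs))"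
  by (intro Cons.IH) (use Cons.prems in auto)
 thus ?case using null_Cons[OF c Cons.prems(3) r cc] by (simp add: hpart_def)
qed

lemma replicate_snoc: "replicate n x@[x] = x#replicate n x"
 by (induction n) auto

text \<open>The mirror image of \<open>null_right\<close>: generators of \<open>B\<close> are
  rotated to the front before they are dropped.\<close>

lemma null_left:
 assumes "inR A" "inR B" "ideal J R" "!!b. b\<in>set B ==> \<exists>n::nat. b[^]n\<in>Idl (set A)"
  and "cocycle (A@B) k J u"
 shows "null (A@B) k J u \<longleftrightarrow> null A k J (%bs. u (bs@replicate (length B) False))"
 using assms
proof (induction B arbitrary: u rule: rev_induct)
 case Nil thus ?case by simp
next
 case (snoc b B)
 have c: "set (A@B)\<subseteq>CR" "b\<in>CR" using snoc by auto
 have r: "in_rad b (A@B)" by (rule in_rad_mono[of A]) (use snoc c in auto)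
 have v: "vec u" using snoc.prems cocycle_vec by blast
 have cc: "cocycle (b#(A@B)) k J (rot u)" using cocycle_rot[OF c snoc.prems(3) v] snoc.prems(5) by simp
 have "cocycle (A@B) k J (hpart False (rot u))"
  using cocycle_Cons[OF c snoc.prems(3) cocycle_vec[OF cc]] cc by blast
 hence "cocycle (A@B) k J (tpart False u)" by simp
 hence "null (A@B) k J (tpart False u) \<longleftrightarrow> null A k J (%bs. tpart False u (bs@replicate (length B) False))"
  by (intro snoc.IH) (use snoc.prems in auto)
 moreover have "null ((A@B)@[b]) k J u \<longleftrightarrow> null (A@B) k J (tpart False u)"
  using null_Cons[OF c snoc.prems(3) r cc] null_rot[OF c snoc.prems(3) v] by simp
 ultimately show ?case by (simp add: tpart_def replicate_snoc)
qed

text \<open>With \<open>null_left\<close> this makes the projection to the complex on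
  \<open>A\<close> bijective on cohomology. The class of \<open>z\<close> is lifted at a higher
  level, and the weight \<open>pows A N\<close> rewrites \<open>z\<close> at that level.\<close>

lemma extend_cocycle:
 assumes "inR A" "inR B" "ideal J R" "!!b. b\<in>set B ==> \<exists>n::nat. b[^]n\<in>Idl (set A)"
  and "cocycle A k J z" "homog (coh A) j z"
 shows "\<exists>N u. cocycle (A@B) (k + N) J u\<and>homog (coh (A@B)) j u\<and>
  (\<forall>bs. length bs = length A --> u (bs@replicate (length B) False) = vs (pows A N) z bs)"
 using assms
proof (induction B rule: rev_induct)
 case Nil
 have "cocycle (A@[]) (k + 0) J z" "\<forall>bs. length bs = length A --> z (bs@replicate (length []) False) = vs (pows A 0) z bs"
  using Nil cocycle_vec[OF Nil.prems(5)] by (simp_all add: vs_pows_0)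
 thus ?case using Nil by (metis append_Nil2)
next
 case (snoc b B)
 have c: "set (A@B)\<subseteq>CR" "b\<in>CR" using snoc by auto
 have r: "in_rad b (A@B)" by (rule in_rad_mono[of A]) (use snoc c in auto)
 obtain N u where u: "cocycle (A@B) (k + N) J u" "homog (coh (A@B)) j u"
  "!!bs. length bs = length A ==> u (bs@replicate (length B) False) = vs (pows A N) z bs"
  using snoc.IH snoc.prems by (metis Un_iff set_append le_sup_iff)
 obtain N' w where w: "cocycle (b#(A@B)) (k + N + N') J w" "homog (coh (b#(A@B))) j w" "hpart False w = vs (pows (A@B) N') u"
  using extend_cocycle_Cons[OF c snoc.prems(3) r u(1,2)] by blast
 have vw: "vec w" "vec u" "vec z" using w u snoc.prems cocycle_vec by blast+
 define x where "x = unrot w"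
 have vx: "vec x" unfolding x_def using vw by simp
 let ?L = "coh (pows (b#(A@B)) (k + N + N'))"
 have rw: "rot x bs = w bs" if "length bs = Suc (length (A@B))" for bs
  unfolding x_def using rot_unrot[OF vw(1) that] .
 have "vin (Suc (length (A@B))) J (kd ?L (rot x)) \<longleftrightarrow> vin (Suc (length (A@B))) J (kd ?L w)"
 proof (rule vin_cong)
  fix bs :: "bool list" assume l: "length bs = Suc (length (A@B))"
  show "kd ?L (rot x) bs = kd ?L w bs"
   by (rule kd_cong) (use vx vw c l rw in simp_all)
 qed
 hence "cocycle (b#(A@B)) (k + N + N') J (rot x)" using w(1) vx by (simp add: cocycle_def del: kd.simps pows_simps)
 hence 1: "cocycle (A@B@[b]) (k + (N + N')) J x"
  using cocycle_rot[OF c snoc.prems(3) vx] by (simp add: add.assoc)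
 have "homog (coh (b#(A@B))) j (rot x)" using w(2) rw unfolding homog_def by simp
 hence 2: "homog (coh (A@B@[b])) j x" using homog_rot[OF vx, of b "coh (A@B)" j] by simp
 have 3: "x (bs@replicate (length (B@[b])) False) = vs (pows A (N + N')) z bs" if l: "length bs = length A" for bs
 proof -
  have cA: "set (pows A N)\<subseteq>CR" "set (pows A N')\<subseteq>CR" "set (pows B N')\<subseteq>CR" "inR A"
   using c by auto
  have "x (bs@replicate (length (B@[b])) False) = tpart False x (bs@replicate (length B) False)"
   by (simp add: tpart_def replicate_snoc)
  also have "\<dots> = vs (pows (A@B) N') u (bs@replicate (length B) False)" unfolding x_def using w(3) by simp
  also have "\<dots> = sel (pows A N') bs\<otimes>sel (pows B N') (replicate (length B) False)\<otimes>vs (pows A N) z bs"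
   using sel_append[of bs "pows A N'" "pows B N'"] cA l u(3)[OF l] by (simp add: vs_def)
  also have "sel (pows B N') (replicate (length B) False) = \<one>"
   by (induction B) simp_all
  finally show ?thesis using cA vw by (simp add: vs_def sel_pows_add cr_simps)
 qed
 show ?case using 1 2 3 by blast
qed

end

section \<open>Removing generators in the limit\<close>

context cring
begin

text \<open>Where \<open>z\<close> vanishes, \<open>c\<close> is chosen to be zero, so
  \<open>c\<close> inherits the homogeneity of \<open>z\<close>; an arbitrary choice of quotients
  would lose the degree.\<close>

lemma solve_mod:
 assumes J: "ideal J R" and a: "a\<in>CR" and z: "vec z" "vin n (Idl (insert a J)) z"
 shows "\<exists>c. vec c\<and>vin n J (va z (vn (vm a c)))\<and>(\<forall>bs. z bs = \<zero> --> c bs = \<zero>)"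
proof -
 have "\<exists>c\<in>CR. z bs\<ominus>a\<otimes>c\<in>J" if l: "length bs = n" for bs
 proof -
  obtain j c where jc: "j\<in>J" "c\<in>CR" "z bs = j\<oplus>c\<otimes>a"
   using z(2) l idl_insert_ideal[OF J a] unfolding vin_def by blast
  have j: "j\<in>CR" using jc J ideal_carr by blast
  have "(j\<oplus>c\<otimes>a)\<ominus>a\<otimes>c = j" if "j\<in>CR" "c\<in>CR" "a\<in>CR" for j c a using that by algebra
  hence "z bs\<ominus>a\<otimes>c = j" using jc(2) j a unfolding jc(3) by blast
  thus ?thesis using jc(1,2) by (intro bexI[of _ c]) simp_all
 qed
 then obtain c0 where c0: "!!bs. length bs = n ==> c0 bs\<in>CR\<and>z bs\<ominus>a\<otimes>c0 bs\<in>J" by metis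
 define c where "c = (%bs. if z bs = \<zero> \<or> length bs\<noteq>n then \<zero> else c0 bs)"
 have vc: "vec c" using c0 by (auto simp: vec_def c_def)
 have "va z (vn (vm a c)) bs\<in>J" if l: "length bs = n" for bs
 proof (cases "z bs = \<zero>")
  case True
  have "va z (vn (vm a c)) bs = \<zero>" using True a vc z by (simp add: vapp c_def)
  thus ?thesis using ideal_zero[OF J] by simp
 next
  case False
  have "va z (vn (vm a c)) bs = z bs\<ominus>a\<otimes>c bs" using a vc z by (simp add: vapp a_minus_def)
  thus ?thesis using False l c0 by (simp add: c_def)
 qed
 thus ?thesis using vc by (auto simp: vin_def c_def)
qed

lemma homog_support: "homog L j z ==> (\<forall>bs. z bs = \<zero> --> c bs = \<zero>) ==> homog L j c"
 by (auto simp: homog_def)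

lemma idl_insert_intro: "ideal J R ==> a\<in>CR ==> j\<in>J ==> c\<in>CR ==> j\<oplus>a\<otimes>c\<in>Idl (insert a J)"
 using idl_insert_ideal[of J a] m_comm[of a c] by auto

text \<open>A family of item lists \<open>L s k\<close>, where \<open>s\<close> is the exponent of the chain items and \<open>k\<close> that of the
 cochain items, with transition weights \<open>W e f\<close> from level \<open>(s + e, k)\<close> to level \<open>(s, k + f)\<close>.\<close>

definition family :: "(nat => nat => (bool\<times>'a) list) => (nat => nat => 'a list) => bool" where
 "family L W \<longleftrightarrow> (\<forall>s k. its (L s k))\<and>(\<forall>s k. map fst (L s k) = map fst (L 0 0))\<and>
  (\<forall>s e k f. compat (L (s + e) k) (W e f) (L s (k + f)))\<and>
  (\<forall>e e' f f' bs. sel (W (e + e') (f + f')) bs = sel (W e f) bs\<otimes>sel (W e' f') bs)"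

text \<open>Every class at a far enough level \<open>s + e\<close> dies at level \<open>s\<close> in the limit over \<open>k\<close>.\<close>

definition pro_zero :: "(nat => nat => (bool\<times>'a) list) => (nat => nat => 'a list) =>
  (nat => nat => 'a set) => (nat => 'a) => int => bool" where
 "pro_zero L W J a j \<longleftrightarrow> (\<forall>s. \<exists>e. \<forall>k z. vec z --> homog (L 0 0) j z -->
   vin (length (L 0 0)) (J (s + e) k) (kd (L (s + e) k) z) -->
   (\<exists>f v. vec v\<and>veq (length (L 0 0)) (J s (k + f)) (vm (a f) (vs (W e f) z)) (kd (L s (k + f)) v)))"

lemma family_facts:
 assumes "family L W"
 shows "its (L s k)" "length (L s k) = length (L 0 0)" "homog (L s k) j = homog (L 0 0) j"
  "compat (L (s + e) k) (W e f) (L s (k + f))" "set (W e f)\<subseteq>CR" "length (W e f) = length (L 0 0)"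
  "sel (W (e + e') (f + f')) bs = sel (W e f) bs\<otimes>sel (W e' f') bs"
proof -
 show 0: "its (L s k)" "compat (L (s + e) k) (W e f) (L s (k + f))"
  "sel (W (e + e') (f + f')) bs = sel (W e f) bs\<otimes>sel (W e' f') bs"
  using assms unfolding family_def by blast+
 have t: "map fst (L s k) = map fst (L 0 0)" for s k using assms unfolding family_def by blast
 show "length (L s k) = length (L 0 0)" using t[of s k] map_eq_imp_length_eq by blast
 show "homog (L s k) j = homog (L 0 0) j" using homog_cong[OF t] .
 show "set (W e f)\<subseteq>CR" using compat_carr[OF 0(2)] .
 show "length (W e f) = length (L 0 0)" using compat_length[OF 0(2)] t[of "s+e" k] map_eq_imp_length_eq[of fst "L (s + e) k" fst "L 0 0"] by simp
qed

lemma family_kd: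
 assumes "family L W" "vec z" "length bs = length (L 0 0)"
 shows "kd (L s (k + f)) (vs (W e f) z) bs = sel (W e f) bs\<otimes>kd (L (s + e) k) z bs"
proof -
 have "kd (L s (k + f)) (vs (W e f) z) bs = vs (W e f) (kd (L (s + e) k) z) bs"
  by (rule kd_vs[OF family_facts(4)[OF assms(1)] family_facts(1)[OF assms(1)] family_facts(1)[OF assms(1)] assms(2)])
   (use assms(3) family_facts(2)[OF assms(1), of "s + e" k] in simp)
 also have "\<dots> = sel (W e f) bs\<otimes>kd (L (s + e) k) z bs" by (simp add: vs_def)
 finally show ?thesis .
qed

lemma family_chn: "family L W ==> y\<in>CR ==> family (%s k. (False, y[^]s)#L s k) (%e f. y[^]e#W e f)"
proof -
 assume f: "family L W" and y: "y\<in>CR"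
 note ff = family_facts[OF f]
 show ?thesis unfolding family_def
 proof (intro conjI allI)
  show "its ((False, y[^]s)#L s k)" for s k :: nat using ff(1) y by simp
  show "map fst ((False, y[^]s)#L s k) = map fst ((False, y[^](0::nat))#L 0 0)" for s k
   using f unfolding family_def by auto
  show "compat ((False, y[^](s + e))#L (s + e) k) (y[^]e#W e g) ((False, y[^]s)#L s (k + g))" for s e k g
   using ff(4) y by (simp add: nat_pow_mult add.commute[of e s])
  show "sel (y[^](e + e')#W (e + e') (g + g')) bs = sel (y[^]e#W e g) bs\<otimes>sel (y[^]e'#W e' g') bs" for e e' g g' bs
   using ff(5,7) y by (auto simp: nat_pow_mult[symmetric] cr_simps split: list.split)
 qed
qed

lemma family_coh: "family L W ==> x\<in>CR ==> family (%s k. (True, x[^]k)#L s k) (%e f. x[^]f#W e f)"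
proof -
 assume f: "family L W" and y: "x\<in>CR"
 note ff = family_facts[OF f]
 show ?thesis unfolding family_def
 proof (intro conjI allI)
  show "its ((True, x[^]k)#L s k)" for s k :: nat using ff(1) y by simp
  show "map fst ((True, x[^]k)#L s k) = map fst ((True, x[^](0::nat))#L 0 0)" for s k
   using f unfolding family_def by auto
  show "compat ((True, x[^]k)#L (s + e) k) (x[^]g#W e g) ((True, x[^](k + g))#L s (k + g))" for s e k g
   using ff(4) y by (simp add: nat_pow_mult add.commute[of g k])
  show "sel (x[^](g + g')#W (e + e') (g + g')) bs = sel (x[^]g#W e g) bs\<otimes>sel (x[^]g'#W e' g') bs" for e e' g g' bs
   using ff(5,7) y by (auto simp: nat_pow_mult[symmetric] cr_simps split: list.split)
 qed
qed

text \<open>A chain item \<open>y\<close> may be traded for a relation \<open>y\<^sup>s\<close>, provided multiplication by powers of \<open>y\<close> is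
 injective up to the transition maps; over a Noetherian ring that always holds.\<close>

lemma pro_zero_chn:
 assumes F: "family L W" and y: "y\<in>CR"
  and J: "!!s. ideal (J s) R" and Jmono: "!!s t. s\<le>t ==> J t\<subseteq>J s"
  and proreg: "!!s. \<exists>N. \<forall>r\<in>CR. y[^](s + N)\<otimes>r\<in>J s --> y[^]N\<otimes>r\<in>J s"
 shows "pro_zero (%s k. (False, y[^]s)#L s k) (%e f. y[^]e#W e f) (%s k. J s) (%_. \<one>) j \<longleftrightarrow>
  pro_zero L W (%s k. Idl (insert (y[^]s) (J s))) (%_. \<one>) j"
proof
 note ff = family_facts[OF F]
 let ?n = "length (L 0 0)"
 have D [simp]: "vec (kd (L s k) z)" if "vec z" for s k z using that ff(1) by simp
 have T [simp]: "vec (vs (W e f) z)" if "vec z" for e f z using that ff(5) by simp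
 have se [simp]: "sel (W e f) bs\<in>CR" for e f bs using ff(5) by simp
 have yp [simp]: "y[^](i::nat)\<in>CR" for i using y by simp
 have one [simp]: "vm \<one> z = z" if "vec z" for z using that by (intro ext) (simp add: vapp)
 have vin_D: "vin ?n (J s) (kd (L t k) z)" if "vec z" "vin ?n (J s) z" for s t k z
  using vin_kd[OF J ff(1)[of t k] that(1), of s] ff(2)[of t k] that by simp
 have vsapp: "vs (W e f) z bs = sel (W e f) bs\<otimes>z bs" for e f z bs by (simp add: vs_def)
 note Dlin = kd_va[OF ff(1)] kd_vn[OF ff(1)] kd_vm[OF ff(1)]
 {
  assume H: "pro_zero L W (%s k. Idl (insert (y[^]s) (J s))) (%_. \<one>) j"
  show "pro_zero (%s k. (False, y[^]s)#L s k) (%e f. y[^]e#W e f) (%s k. J s) (%_. \<one>) j"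
   unfolding pro_zero_def
  proof
   fix s
   obtain N where N: "!!r. r\<in>CR ==> y[^](s + N)\<otimes>r\<in>J s ==> y[^]N\<otimes>r\<in>J s"
    using proreg by blast
   \<comment> \<open>The \<open>N\<close> extra levels are spent on \<open>proreg\<close>: a
     relation known only after multiplication by \<open>y[^]s1\<close> is reduced to one after
     multiplication by \<open>y[^]N\<close>, and this factor is available in the transition from
     \<open>s1\<close> to \<open>s\<close>.\<close>
   define s1 where "s1 = s + N"
   obtain e1 where e1: "!!k z. vec z ==> homog (L 0 0) j z ==>
     vin ?n (Idl (insert (y[^](s1 + e1)) (J (s1 + e1)))) (kd (L (s1 + e1) k) z) ==>
     \<exists>f v. vec v\<and>veq ?n (Idl (insert (y[^]s1) (J s1))) (vm \<one> (vs (W e1 f) z)) (kd (L s1 (k + f)) v)"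
    using H unfolding pro_zero_def by blast
   define e where "e = e1 + N"
   have se1: "s + e = s1 + e1" by (simp add: e_def s1_def)
   show "\<exists>e. \<forall>k z. vec z --> homog ((False, y[^](0::nat))#L 0 0) j z -->
    vin (length ((False, y[^](0::nat))#L 0 0)) (J (s + e)) (kd ((False, y[^](s + e))#L (s + e) k) z) -->
    (\<exists>f v. vec v\<and>veq (length ((False, y[^](0::nat))#L 0 0)) (J s) (vm \<one> (vs (y[^]e#W e f) z))
     (kd ((False, y[^]s)#L s (k + f)) v))"
   proof (rule exI[of _ e], intro allI impI)
    fix k z
    assume z: "vec z" "homog ((False, y[^](0::nat))#L 0 0) j z"
     and cy: "vin (length ((False, y[^](0::nat))#L 0 0)) (J (s + e)) (kd ((False, y[^](s + e))#L (s + e) k) z)"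
    define w0 w1 where "w0 = hpart False z" and "w1 = hpart True z"
    have w [simp]: "vec w0" "vec w1" unfolding w0_def w1_def using z by simp_all
    have h0: "homog (L 0 0) j w0" using z(2) by (simp add: homog_Cons w0_def)
    have cF: "vin ?n (J (s + e)) (va (kd (L (s + e) k) w0) (vm (y[^](s + e)) w1))"
     using cy by (simp add: vin_part w0_def w1_def)
    have cw0: "vin ?n (Idl (insert (y[^](s1 + e1)) (J (s1 + e1)))) (kd (L (s1 + e1) k) w0)"
     unfolding vin_def
    proof (intro allI impI)
     fix bs :: "bool list" assume l: "length bs = ?n"
     let ?d = "kd (L (s1 + e1) k) w0 bs"
     have "va (kd (L (s + e) k) w0) (vm (y[^](s + e)) w1) bs\<in>J (s + e)" using cF l by (simp add: vin_def)
     hence "?d\<oplus>y[^](s1 + e1)\<otimes>w1 bs\<in>J (s1 + e1)" unfolding se1 by (simp add: vapp)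
     hence "(?d\<oplus>y[^](s1 + e1)\<otimes>w1 bs)\<oplus>y[^](s1 + e1)\<otimes>(\<ominus>w1 bs)\<in>Idl (insert (y[^](s1 + e1)) (J (s1 + e1)))"
     by (intro idl_insert_intro J) simp_all
     moreover have "(?d\<oplus>y[^](s1 + e1)\<otimes>w1 bs)\<oplus>y[^](s1 + e1)\<otimes>(\<ominus>w1 bs) = ?d"
     by (simp add: a_assoc r_minus r_neg)
     ultimately show "?d\<in>Idl (insert (y[^](s1 + e1)) (J (s1 + e1)))" by simp
    qed
    obtain f v0 where v0: "vec v0" "veq ?n (Idl (insert (y[^]s1) (J s1))) (vs (W e1 f) w0) (kd (L s1 (k + f)) v0)"
     using e1[OF w(1) h0 cw0] by auto
    define D1 where "D1 = kd (L s1 (k + f))"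
    define T1 where "T1 = vs (W e1 f)"
    have D1 [simp]: "vec (D1 z)" if "vec z" for z using that by (simp add: D1_def)
    have T1 [simp]: "vec (T1 z)" if "vec z" for z using that by (simp add: T1_def)
    obtain v1 where v1: "vec v1" "vin ?n (J s1) (va (va (T1 w0) (vn (D1 v0))) (vn (vm (y[^]s1) v1)))"
     using solve_mod[OF J yp, of "va (T1 w0) (vn (D1 v0))" ?n s1 s1] v0 unfolding veq_def D1_def T1_def by auto
    \<comment> \<open>The cocycle condition on \<open>z\<close> and the differential of the equation
      for \<open>v1\<close> share the term \<open>D1 (T1 w0)\<close>; their difference is the
      bracketed sum times \<open>y[^]s1\<close>.\<close>
    have key: "y[^]N\<otimes>(y[^]e1\<otimes>T1 w1 bs\<oplus>D1 v1 bs)\<in>J s" if l: "length bs = ?n" for bs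
    proof (rule N)
     show "y[^]e1\<otimes>T1 w1 bs\<oplus>D1 v1 bs\<in>CR" using v1 by simp
     have A: "D1 (T1 w0) bs\<oplus>y[^](s1 + e1)\<otimes>T1 w1 bs\<in>J s1"
     proof -
     have "sel (W e1 f) bs\<otimes>va (kd (L (s + e) k) w0) (vm (y[^](s + e)) w1) bs\<in>J (s1 + e1)"
     using cF l ideal_mult[OF J] unfolding vin_def se1 by simp
     moreover have "D1 (T1 w0) bs = sel (W e1 f) bs\<otimes>kd (L (s1 + e1) k) w0 bs"
     unfolding D1_def T1_def using family_kd[OF F w(1) l] .
     ultimately have "D1 (T1 w0) bs\<oplus>y[^](s1 + e1)\<otimes>T1 w1 bs\<in>J (s1 + e1)"
     unfolding se1 T1_def by (simp add: vapp vsapp cr_simps)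
     thus ?thesis using Jmono[of s1 "s1 + e1"] by auto
     qed
     have "vin ?n (J s1) (D1 (va (va (T1 w0) (vn (D1 v0))) (vn (vm (y[^]s1) v1))))"
     unfolding D1_def using v1 v0(1) by (intro vin_D) (simp_all add: D1_def)
     moreover have "D1 (va (va (T1 w0) (vn (D1 v0))) (vn (vm (y[^]s1) v1))) =
     va (va (D1 (T1 w0)) (vn (D1 (D1 v0)))) (vn (vm (y[^]s1) (D1 v1)))"
     using v0(1) v1(1) unfolding D1_def by (simp add: Dlin)
     moreover have "D1 (D1 v0) = vz" unfolding D1_def using kd_kd[OF ff(1) v0(1)] .
     ultimately have B: "D1 (T1 w0) bs\<ominus>y[^]s1\<otimes>D1 v1 bs\<in>J s1"
     using l v1(1) by (simp add: vin_def vapp a_minus_def)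
     have id: "(d\<oplus>(p\<otimes>q)\<otimes>t)\<ominus>(d\<ominus>p\<otimes>u) = p\<otimes>(q\<otimes>t\<oplus>u)"
     if [simp]: "d\<in>CR" "p\<in>CR" "q\<in>CR" "t\<in>CR" "u\<in>CR" for d p q t u
     using that by algebra
     have "y[^]s1\<otimes>(y[^]e1\<otimes>T1 w1 bs\<oplus>D1 v1 bs)\<in>J s1"
     using ideal_diff[OF J A B] id[of "D1 (T1 w0) bs" "y[^]s1" "y[^]e1" "T1 w1 bs" "D1 v1 bs"] v1(1) y
     by (simp add: nat_pow_mult)
     thus "y[^](s + N)\<otimes>(y[^]e1\<otimes>T1 w1 bs\<oplus>D1 v1 bs)\<in>J s"
     using Jmono[of s s1] unfolding s1_def by auto
    qed
    define U where "U = vs (W N 0)"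
    have U [simp]: "vec (U z)" if "vec z" for z using that by (simp add: U_def)
    define v where "v = glue \<zero> (U v0) (vm (y[^]N) (U v1))"
    have vv: "vec v" unfolding v_def using v0 v1 by simp
    have ye: "y[^]e = y[^]e1\<otimes>y[^]N" using y by (simp add: e_def nat_pow_mult)
    have W2: "vs (W e f) q bs = sel (W N 0) bs\<otimes>T1 q bs" if "vec q" for q bs
     using ff(7)[of e1 N f 0 bs] that by (simp add: vsapp T1_def e_def cr_simps)
    have DU: "kd (L s (k + f)) (U q) bs = sel (W N 0) bs\<otimes>D1 q bs" if "vec q" "length bs = ?n" for q bs
     using family_kd[OF F that, of s "k + f" 0 N] by (simp add: U_def D1_def s1_def)
    have "veq (Suc ?n) (J s) (vs (y[^]e#W e f) z) (kd ((False, y[^]s)#L s (k + f)) v)"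
     unfolding veq_hpart hpart_vs2[OF ff(5) yp z(1)] hpart_kd_chn
    proof (intro conjI)
     show "veq ?n (J s) (vs (W e f) (hpart False z))
     (va (kd (L s (k + f)) (hpart False v)) (vm (y[^]s) (hpart True v)))"
     unfolding veq_def vin_def
     proof (intro allI impI)
     fix bs :: "bool list" assume l: "length bs = ?n"
     have id: "g\<otimes>t\<ominus>(g\<otimes>d\<oplus>ys\<otimes>(yn\<otimes>(g\<otimes>u))) = g\<otimes>(t\<ominus>d\<ominus>(ys\<otimes>yn)\<otimes>u)"
     if "g\<in>CR" "t\<in>CR" "d\<in>CR" "ys\<in>CR" "yn\<in>CR" "u\<in>CR"
     for g t d ys yn u using that by algebra
     have "T1 w0 bs\<ominus>D1 v0 bs\<ominus>y[^]s1\<otimes>v1 bs\<in>J s1"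
     using v1 v0(1) l by (simp add: vin_def vapp a_minus_def)
     hence "sel (W N 0) bs\<otimes>(T1 w0 bs\<ominus>D1 v0 bs\<ominus>(y[^]s\<otimes>y[^]N)\<otimes>v1 bs)\<in>J s"
     using ideal_mult[OF J] Jmono[of s s1] y unfolding s1_def by (auto simp: nat_pow_mult)
     hence "sel (W N 0) bs\<otimes>T1 w0 bs\<ominus>(sel (W N 0) bs\<otimes>D1 v0 bs\<oplus>y[^]s\<otimes>(y[^]N\<otimes>(sel (W N 0) bs\<otimes>v1 bs)))\<in>J s"
     using id v0(1) v1(1) by simp
     thus "va (vs (W e f) (hpart False z))
     (vn (va (kd (L s (k + f)) (hpart False v)) (vm (y[^]s) (hpart True v)))) bs\<in>J s"
     using v0(1) v1(1) l by (simp add: w0_def[symmetric] v_def vapp W2 DU a_minus_def) (simp add: U_def vsapp)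
     qed
     show "veq ?n (J s) (vm (y[^]e) (vs (W e f) (hpart True z)))
     (vn (kd (L s (k + f)) (hpart True v)))"
     unfolding veq_def vin_def
     proof (intro allI impI)
     fix bs :: "bool list" assume l: "length bs = ?n"
     have id: "(ye\<otimes>yn)\<otimes>(g\<otimes>t)\<ominus>(\<ominus>(yn\<otimes>(g\<otimes>u))) = g\<otimes>(yn\<otimes>(ye\<otimes>t\<oplus>u))"
     if "g\<in>CR" "t\<in>CR" "ye\<in>CR" "yn\<in>CR" "u\<in>CR"
     for g t ye yn u using that by algebra
     have "sel (W N 0) bs\<otimes>(y[^]N\<otimes>(y[^]e1\<otimes>T1 w1 bs\<oplus>D1 v1 bs))\<in>J s"
     using ideal_mult[OF J key[OF l]] by simp
     hence "(y[^]e1\<otimes>y[^]N)\<otimes>(sel (W N 0) bs\<otimes>T1 w1 bs)\<ominus>(\<ominus>(y[^]N\<otimes>(sel (W N 0) bs\<otimes>D1 v1 bs)))\<in>J s"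
     using id v1(1) by simp
     thus "va (vm (y[^]e) (vs (W e f) (hpart True z)))
     (vn (vn (kd (L s (k + f)) (hpart True v)))) bs\<in>J s"
     using v0(1) v1(1) l y by (simp add: w1_def[symmetric] v_def vapp W2 DU a_minus_def kd_vm[OF ff(1)] ye)
     qed
    qed
    thus "\<exists>f v. vec v\<and>veq (length ((False, y[^](0::nat))#L 0 0)) (J s) (vm \<one> (vs (y[^]e#W e f) z))
     (kd ((False, y[^]s)#L s (k + f)) v)"
     using vv z(1) ff(5) y by (intro exI[of _ f] exI[of _ v]) (simp del: kd.simps)
   qed
  qed
 }
 assume H: "pro_zero (%s k. (False, y[^]s)#L s k) (%e f. y[^]e#W e f) (%s k. J s) (%_. \<one>) j"
 show "pro_zero L W (%s k. Idl (insert (y[^]s) (J s))) (%_. \<one>) j"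
  unfolding pro_zero_def
 proof
  fix s
  obtain e1 where e1: "!!k z. vec z ==> homog ((False, y[^](0::nat))#L 0 0) j z ==>
    vin (Suc ?n) (J (s + e1)) (kd ((False, y[^](s + e1))#L (s + e1) k) z) ==>
    \<exists>f v. vec v\<and>veq (Suc ?n) (J s) (vm \<one> (vs (y[^]e1#W e1 f) z))
     (kd ((False, y[^]s)#L s (k + f)) v)"
   using H unfolding pro_zero_def list.size add_Suc_right add_0_right by blast
  define s1 where "s1 = s + e1"
  obtain N where N: "!!r. r\<in>CR ==> y[^](s1 + N)\<otimes>r\<in>J s1 ==> y[^]N\<otimes>r\<in>J s1"
   using proreg by blast
  define e where "e = N + e1"
  have se1: "s + e = s1 + N" by (simp add: e_def s1_def)
  show "\<exists>e. \<forall>k z. vec z --> homog (L 0 0) j z --> vin ?n (Idl (insert (y[^](s + e)) (J (s + e)))) (kd (L (s + e) k) z) -->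
    (\<exists>f v. vec v\<and>veq ?n (Idl (insert (y[^]s) (J s))) (vm \<one> (vs (W e f) z)) (kd (L s (k + f)) v))"
  proof (rule exI[of _ e], intro allI impI)
   fix k w0 assume w0: "vec w0" "homog (L 0 0) j w0"
    and cy: "vin ?n (Idl (insert (y[^](s + e)) (J (s + e)))) (kd (L (s + e) k) w0)"
   define D' where "D' = kd (L (s1 + N) k)"
   have D' [simp]: "vec (D' z)" if "vec z" for z using that by (simp add: D'_def)
   obtain c where c: "vec c" "vin ?n (J (s1 + N)) (va (D' w0) (vn (vm (y[^](s1 + N)) c)))" "\<forall>bs. D' w0 bs = \<zero> --> c bs = \<zero>"
    using solve_mod[OF J yp, of "D' w0" ?n "s1 + N" "s1 + N"] w0(1) cy unfolding se1 D'_def by auto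
   have hc: "homog (L 0 0) (j + 1) c"
   proof (rule homog_support[OF _ c(3)])
    show "homog (L 0 0) (j + 1) (D' w0)" using homog_kd[OF ff(1) w0(1), of "s1 + N" k j] w0(2)
     unfolding D'_def ff(3)[of "s1 + N" k] by blast
   qed
   have key: "y[^]N\<otimes>D' c bs\<in>J s1" if l: "length bs = ?n" for bs
   proof (rule N)
    show "D' c bs\<in>CR" using c by simp
    have "vin ?n (J (s1 + N)) (D' (va (D' w0) (vn (vm (y[^](s1 + N)) c))))"
     unfolding D'_def using c w0(1) by (intro vin_D) (simp_all add: D'_def)
    moreover have "D' (va (D' w0) (vn (vm (y[^](s1 + N)) c))) = va (D' (D' w0)) (vn (vm (y[^](s1 + N)) (D' c)))"
     using w0(1) c(1) unfolding D'_def by (simp add: Dlin)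
    moreover have "D' (D' w0) = vz" unfolding D'_def using kd_kd[OF ff(1) w0(1)] .
    ultimately have "\<ominus>(y[^](s1 + N)\<otimes>D' c bs)\<in>J (s1 + N)" using l c(1) by (simp add: vin_def vapp)
    hence "\<ominus>(\<ominus>(y[^](s1 + N)\<otimes>D' c bs))\<in>J (s1 + N)" by (rule ideal_neg[OF J])
    thus "y[^](s1 + N)\<otimes>D' c bs\<in>J s1" using Jmono[of s1 "s1 + N"] c(1) by auto
   qed
   define U where "U = vs (W N 0)"
   have U [simp]: "vec (U z)" if "vec z" for z using that by (simp add: U_def)
   have DU: "kd (L s1 k) (U q) bs = sel (W N 0) bs\<otimes>D' q bs" if "vec q" "length bs = ?n" for q bs
    using family_kd[OF F that, of s1 k 0 N] by (simp add: U_def D'_def)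
   \<comment> \<open>The component at \<open>y\<close> is the quotient of \<open>D' w0\<close> by
     the power of \<open>y\<close>. Its own boundary is killed only by a power of \<open>y\<close>,
     so the factor \<open>y[^]N\<close> is kept to make \<open>z\<close> a cocycle at level
     \<open>s1\<close>.\<close>
   define z where "z = glue \<zero> (U w0) (vn (vm (y[^]N) (U c)))"
   have vzz: "vec z" unfolding z_def using w0 c by simp
   have hz: "homog ((False, y[^](0::nat))#L 0 0) j z"
    unfolding homog_Cons z_def U_def using w0(2) hc ff(5) by (simp add: homog_vs homog_vn homog_vm)
   have "vin (Suc ?n) (J s1) (kd ((False, y[^]s1)#L s1 k) z)"
    unfolding vin_part hpart_kd_chn
   proof (intro conjI)
    have id: "g\<otimes>d\<oplus>ys\<otimes>\<ominus> (yn\<otimes>(g\<otimes>c)) = g\<otimes>(d\<ominus>(ys\<otimes>yn)\<otimes>c)"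
     if [simp]: "g\<in>CR" "d\<in>CR" "ys\<in>CR" "yn\<in>CR" "c\<in>CR" for g d ys yn c
     using that by algebra
    have "va (kd (L s1 k) (U w0)) (vm (y[^]s1) (vn (vm (y[^]N) (U c)))) bs\<in>J s1" if l: "length bs = ?n" for bs
    proof -
     have "D' w0 bs\<ominus>(y[^]s1\<otimes>y[^]N)\<otimes>c bs\<in>J s1"
     using c(2) w0(1) c(1) l Jmono[of s1 "s1 + N"] y by (auto simp: vin_def vapp a_minus_def nat_pow_mult)
     hence "sel (W N 0) bs\<otimes>(D' w0 bs\<ominus>(y[^]s1\<otimes>y[^]N)\<otimes>c bs)\<in>J s1" using ideal_mult[OF J] by simp
     hence "sel (W N 0) bs\<otimes>D' w0 bs\<oplus>y[^]s1\<otimes>\<ominus> (y[^]N\<otimes>(sel (W N 0) bs\<otimes>c bs))\<in>J s1"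
     using id w0(1) c(1) by simp
     thus ?thesis using w0(1) c(1) l by (simp add: vapp DU) (simp add: U_def vsapp)
    qed
    thus "vin ?n (J s1) (va (kd (L s1 k) (hpart False z)) (vm (y[^]s1) (hpart True z)))"
     by (simp add: vin_def z_def)
    have "vn (kd (L s1 k) (vn (vm (y[^]N) (U c)))) bs\<in>J s1" if l: "length bs = ?n" for bs
    proof -
     have "vn (kd (L s1 k) (vn (vm (y[^]N) (U c)))) bs = sel (W N 0) bs\<otimes>(y[^]N\<otimes>D' c bs)"
     using c(1) l by (simp add: Dlin vn_vn vapp DU m_lcomm)
     thus ?thesis using ideal_mult[OF J key[OF l]] by simp
    qed
    thus "vin ?n (J s1) (vn (kd (L s1 k) (hpart True z)))"
     by (simp add: vin_def z_def)
   qed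
   then obtain f v where v: "vec v" "veq (Suc ?n) (J s) (vm \<one> (vs (y[^]e1#W e1 f) z)) (kd ((False, y[^]s)#L s (k + f)) v)"
    using e1[OF vzz hz, of k] unfolding s1_def by blast
   have "vec (vs (y[^]e1#W e1 f) z)" using vzz ff(5) y by (intro vec_vs) auto
   hence "veq ?n (J s) (hpart False (vs (y[^]e1#W e1 f) z)) (hpart False (kd ((False, y[^]s)#L s (k + f)) v))"
    using v(2) by (simp only: veq_hpart one)
   hence v0: "veq ?n (J s) (vs (W e1 f) (U w0)) (va (kd (L s (k + f)) (hpart False v)) (vm (y[^]s) (hpart True v)))"
    unfolding hpart_vs2[OF ff(5) yp vzz] hpart_kd_chn by (simp add: z_def)
   have "veq ?n (Idl (insert (y[^]s) (J s))) (vs (W e f) w0) (kd (L s (k + f)) (hpart False v))"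
    unfolding veq_def vin_def
   proof (intro allI impI)
    fix bs :: "bool list" assume l: "length bs = ?n"
    have W2: "vs (W e f) w0 bs = vs (W e1 f) (U w0) bs"
     using ff(7)[of N e1 0 f bs] w0(1) by (simp add: vsapp U_def e_def cr_simps)
    let ?t = "vs (W e f) w0 bs" and ?d = "kd (L s (k + f)) (hpart False v) bs" and ?u = "hpart True v bs"
    have "?t\<ominus>(?d\<oplus>y[^]s\<otimes>?u)\<in>J s"
     using v0 l v(1) w0(1) unfolding W2 by (simp add: veq_def vin_def vapp a_minus_def)
    hence "(?t\<ominus>(?d\<oplus>y[^]s\<otimes>?u))\<oplus>y[^]s\<otimes>?u\<in>Idl (insert (y[^]s) (J s))"
     using v(1) by (intro idl_insert_intro J) simp_all
    moreover have id: "(t\<ominus>(d\<oplus>p\<otimes>u))\<oplus>p\<otimes>u = t\<ominus>d"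
     if [simp]: "t\<in>CR" "d\<in>CR" "p\<in>CR" "u\<in>CR" for t d p u
     using that by algebra
    ultimately have "?t\<ominus>?d\<in>Idl (insert (y[^]s) (J s))" using v(1) w0(1) by simp
    thus "va (vs (W e f) w0) (vn (kd (L s (k + f)) (hpart False v))) bs\<in>Idl (insert (y[^]s) (J s))"
     using v(1) w0(1) by (simp add: vapp a_minus_def)
   qed
   thus "\<exists>f v. vec v\<and>veq ?n (Idl (insert (y[^]s) (J s))) (vm \<one> (vs (W e f) w0)) (kd (L s (k + f)) v)"
    using v(1) w0(1) by (intro exI[of _ f] exI[of _ "hpart False v"]) simp
  qed
 qed
qed

text \<open>Multiplication by the regular element \<open>x[^]k\<close> on \<open>R / J k\<close> has
  zero kernel and cokernel \<open>R / (J k, x[^]k)\<close>, which the cochain item places one degree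
  higher; hence \<open>j - 1\<close>. From \<open>k\<close> to \<open>k + f\<close> the map of
  cokernels is multiplication by \<open>x[^]f\<close>, and this is the factor that joins
  \<open>a\<close>.\<close>

lemma pro_zero_coh:
 assumes F: "family L W" and x: "x\<in>CR" and J: "!!k. ideal (J k) R"
  and a: "!!f. a f\<in>CR" "!!k f r. r\<in>J k ==> a f\<otimes>r\<in>J (k + f)"
  and reg: "!!k. regular_mod (J k) (x[^]k)"
 shows "pro_zero (%s k. (True, x[^]k)#L s k) (%e f. x[^]f#W e f) (%s k. J k) a j \<longleftrightarrow>
  pro_zero L W (%s k. Idl (insert (x[^]k) (J k))) (%f. a f\<otimes>x[^]f) (j - 1)"
proof
 note ff = family_facts[OF F]
 let ?n = "length (L 0 0)"
 have D [simp]: "vec (kd (L s k) z)" if "vec z" for s k z using that ff(1) by simp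
 have T [simp]: "vec (vs (W e f) z)" if "vec z" for e f z using that ff(5) by simp
 have se [simp]: "sel (W e f) bs\<in>CR" for e f bs using ff(5) by simp
 have xp [simp]: "x[^](i::nat)\<in>CR" for i using x by simp
 note ac [simp] = a(1)
 have vin_D: "vin ?n (J i) (kd (L t k) z)" if "vec z" "vin ?n (J i) z" for i t k z
  using vin_kd[OF J ff(1)[of t k] that(1), of i] ff(2)[of t k] that by simp
 note Dlin = kd_va[OF ff(1)] kd_vn[OF ff(1)] kd_vm[OF ff(1)]
 {
  assume H: "pro_zero L W (%s k. Idl (insert (x[^]k) (J k))) (%f. a f\<otimes>x[^]f) (j - 1)"
  show "pro_zero (%s k. (True, x[^]k)#L s k) (%e f. x[^]f#W e f) (%s k. J k) a j"
   unfolding pro_zero_def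
  proof
   fix s
   obtain e where e: "!!k z. vec z ==> homog (L 0 0) (j - 1) z ==>
     vin ?n (Idl (insert (x[^]k) (J k))) (kd (L (s + e) k) z) ==>
     \<exists>f v. vec v\<and>veq ?n (Idl (insert (x[^](k + f)) (J (k + f)))) (vm (a f\<otimes>x[^]f) (vs (W e f) z)) (kd (L s (k + f)) v)"
    using H unfolding pro_zero_def by blast
   show "\<exists>e. \<forall>k z. vec z --> homog ((True, x[^](0::nat))#L 0 0) j z -->
    vin (length ((True, x[^](0::nat))#L 0 0)) (J k) (kd ((True, x[^]k)#L (s + e) k) z) -->
    (\<exists>f v. vec v\<and>veq (length ((True, x[^](0::nat))#L 0 0)) (J (k + f)) (vm (a f) (vs (x[^]f#W e f) z))
     (kd ((True, x[^](k + f))#L s (k + f)) v))"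
   proof (rule exI[of _ e], intro allI impI)
    fix k z
    assume z: "vec z" "homog ((True, x[^](0::nat))#L 0 0) j z"
     and cy: "vin (length ((True, x[^](0::nat))#L 0 0)) (J k) (kd ((True, x[^]k)#L (s + e) k) z)"
    define w0 w1 where "w0 = hpart False z" and "w1 = hpart True z"
    have w [simp]: "vec w0" "vec w1" unfolding w0_def w1_def using z by simp_all
    have h1: "homog (L 0 0) (j - 1) w1" using z(2) by (simp add: homog_Cons w1_def)
    define D' where "D' = kd (L (s + e) k)"
    have D' [simp]: "vec (D' z)" if "vec z" for z using that by (simp add: D'_def)
    have cy': "vin (Suc ?n) (J k) (kd ((True, x[^]k)#L (s + e) k) z)" using cy by simp
    have cF: "vin ?n (J k) (D' w0)" "vin ?n (J k) (va (vm (x[^]k) w0) (vn (D' w1)))"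
     using cy' unfolding vin_part hpart_kd_coh by (simp_all add: w0_def w1_def D'_def)
    have cw1: "vin ?n (Idl (insert (x[^]k) (J k))) (D' w1)"
     unfolding vin_def
    proof (intro allI impI)
     fix bs :: "bool list" assume l: "length bs = ?n"
     have "x[^]k\<otimes>w0 bs\<oplus>\<ominus> D' w1 bs\<in>J k" using cF(2) l by (simp add: vin_def vapp)
     hence "\<ominus>(x[^]k\<otimes>w0 bs\<oplus>\<ominus> D' w1 bs)\<oplus>x[^]k\<otimes>w0 bs\<in>Idl (insert (x[^]k) (J k))"
     by (intro idl_insert_intro J ideal_neg) simp_all
     moreover have "\<ominus>(p\<otimes>u\<oplus>\<ominus> d)\<oplus>p\<otimes>u = d"
     if "p\<in>CR" "u\<in>CR" "d\<in>CR" for p u d using that by algebra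
     ultimately show "D' w1 bs\<in>Idl (insert (x[^]k) (J k))" by simp
    qed
    obtain f v1 where v1: "vec v1" "veq ?n (Idl (insert (x[^](k + f)) (J (k + f)))) (vm (a f\<otimes>x[^]f) (vs (W e f) w1)) (kd (L s (k + f)) v1)"
     using e[OF w(2) h1 cw1[unfolded D'_def]] by blast
    define D1 where "D1 = kd (L s (k + f))"
    define T1 where "T1 = vs (W e f)"
    have D1 [simp]: "vec (D1 z)" if "vec z" for z using that by (simp add: D1_def)
    have T1 [simp]: "vec (T1 z)" if "vec z" for z using that by (simp add: T1_def)
    obtain c where c: "vec c" "vin ?n (J (k + f)) (va (va (vm (a f\<otimes>x[^]f) (T1 w1)) (vn (D1 v1))) (vn (vm (x[^](k + f)) c)))"
     using solve_mod[OF J xp, of "va (vm (a f\<otimes>x[^]f) (T1 w1)) (vn (D1 v1))" ?n "k + f" "k + f"] v1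
     unfolding veq_def D1_def T1_def by auto
    have T1app: "T1 q bs = sel (W e f) bs\<otimes>q bs" if "vec q" for q bs by (simp add: T1_def vs_def)
    have DT: "D1 (T1 q) bs = sel (W e f) bs\<otimes>D' q bs" if "vec q" "length bs = ?n" for q bs
     unfolding D1_def T1_def D'_def using family_kd[OF F that] .
    have key: "a f\<otimes>T1 w0 bs\<ominus>D1 c bs\<in>J (k + f)" if l: "length bs = ?n" for bs
    proof (rule regular_modD[OF reg])
     show "a f\<otimes>T1 w0 bs\<ominus>D1 c bs\<in>CR" using c by simp
     have "a f\<otimes>(sel (W e f) bs\<otimes>(x[^]k\<otimes>w0 bs\<ominus>D' w1 bs))\<in>J (k + f)"
     using cF(2) l ideal_mult[OF J] by (intro a(2)) (simp add: vin_def vapp a_minus_def)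
     hence A: "a f\<otimes>(x[^]k\<otimes>T1 w0 bs\<ominus>D1 (T1 w1) bs)\<in>J (k + f)"
     using l by (simp add: DT T1app cr_simps)
     have "vin ?n (J (k + f)) (D1 (va (va (vm (a f\<otimes>x[^]f) (T1 w1)) (vn (D1 v1))) (vn (vm (x[^](k + f)) c))))"
     unfolding D1_def using c v1(1) by (intro vin_D) (simp_all add: D1_def)
     moreover have "D1 (va (va (vm (a f\<otimes>x[^]f) (T1 w1)) (vn (D1 v1))) (vn (vm (x[^](k + f)) c))) =
     va (va (vm (a f\<otimes>x[^]f) (D1 (T1 w1))) (vn (D1 (D1 v1)))) (vn (vm (x[^](k + f)) (D1 c)))"
     using v1(1) c(1) unfolding D1_def by (simp add: Dlin)
     moreover have "D1 (D1 v1) = vz" unfolding D1_def using kd_kd[OF ff(1) v1(1)] .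
     ultimately have B: "(a f\<otimes>x[^]f)\<otimes>D1 (T1 w1) bs\<ominus>x[^](k + f)\<otimes>D1 c bs\<in>J (k + f)"
     using l c(1) by (simp add: vin_def vapp a_minus_def)
     have id: "q\<otimes>(b\<otimes>(p\<otimes>t\<ominus>d))\<oplus>((b\<otimes>q)\<otimes>d\<ominus>(p\<otimes>q)\<otimes>u) = (b\<otimes>t\<ominus>u)\<otimes>(p\<otimes>q)"
     if [simp]: "b\<in>CR" "d\<in>CR" "p\<in>CR" "q\<in>CR" "t\<in>CR" "u\<in>CR" for b d p q t u
     using that by algebra
     have "x[^](k + f) = x[^]k\<otimes>x[^]f" using x by (simp add: nat_pow_mult)
     thus "(a f\<otimes>T1 w0 bs\<ominus>D1 c bs)\<otimes>x[^](k + f)\<in>J (k + f)"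
     using ideal_add[OF J ideal_mult[OF J A xp[of f]] B] id[of "a f" "D1 (T1 w1) bs" "x[^]k" "x[^]f" "T1 w0 bs" "D1 c bs"] c(1)
     by simp
    qed
    have D1vn: "D1 (vn v1) = vn (D1 v1)" unfolding D1_def using kd_vn[OF ff(1) v1(1)] .
    define v where "v = glue \<zero> c (vn v1)"
    have vv: "vec v" unfolding v_def using c v1 by simp
    have "veq (Suc ?n) (J (k + f)) (vm (a f) (vs (x[^]f#W e f) z)) (kd ((True, x[^](k + f))#L s (k + f)) v)"
     unfolding veq_hpart hpart_simps hpart_vs2[OF ff(5) xp z(1)] hpart_kd_coh
    proof (intro conjI)
     show "veq ?n (J (k + f)) (vm (a f) (vs (W e f) (hpart False z)))
     (kd (L s (k + f)) (hpart False v))"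
     using key c(1) by (simp add: veq_def vin_def v_def w0_def[symmetric] D1_def[symmetric] T1_def[symmetric] vapp a_minus_def)
     have "va (vm (a f\<otimes>x[^]f) (T1 w1)) (vn (va (vm (x[^](k + f)) c) (D1 v1))) =
     va (va (vm (a f\<otimes>x[^]f) (T1 w1)) (vn (D1 v1))) (vn (vm (x[^](k + f)) c))"
     using c(1) v1(1) by (intro ext) (simp add: vapp cr_simps)
     moreover have "vm (a f) (vm (x[^]f) (T1 w1)) = vm (a f\<otimes>x[^]f) (T1 w1)"
     by (intro ext) (simp add: vapp m_assoc)
     ultimately show "veq ?n (J (k + f)) (vm (a f) (vm (x[^]f) (vs (W e f) (hpart True z))))
     (va (vm (x[^](k + f)) (hpart False v)) (vn (kd (L s (k + f)) (hpart True v))))"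
     using c v1(1) by (simp add: veq_def v_def w1_def[symmetric] T1_def[symmetric] D1vn vn_vn D1_def[symmetric])
    qed
    thus "\<exists>f v. vec v\<and>veq (length ((True, x[^](0::nat))#L 0 0)) (J (k + f)) (vm (a f) (vs (x[^]f#W e f) z))
     (kd ((True, x[^](k + f))#L s (k + f)) v)"
     using vv by (intro exI[of _ f] exI[of _ v]) (simp del: kd.simps)
   qed
  qed
 }
 assume H: "pro_zero (%s k. (True, x[^]k)#L s k) (%e f. x[^]f#W e f) (%s k. J k) a j"
 show "pro_zero L W (%s k. Idl (insert (x[^]k) (J k))) (%f. a f\<otimes>x[^]f) (j - 1)"
  unfolding pro_zero_def
 proof
  fix s
  obtain e where e: "!!k z. vec z ==> homog ((True, x[^](0::nat))#L 0 0) j z ==>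
    vin (Suc ?n) (J k) (kd ((True, x[^]k)#L (s + e) k) z) ==>
    \<exists>f v. vec v\<and>veq (Suc ?n) (J (k + f)) (vm (a f) (vs (x[^]f#W e f) z))
     (kd ((True, x[^](k + f))#L s (k + f)) v)"
   using H unfolding pro_zero_def list.size add_Suc_right add_0_right by blast
  show "\<exists>e. \<forall>k z. vec z --> homog (L 0 0) (j - 1) z --> vin ?n (Idl (insert (x[^]k) (J k))) (kd (L (s + e) k) z) -->
    (\<exists>f v. vec v\<and>veq ?n (Idl (insert (x[^](k + f)) (J (k + f)))) (vm (a f\<otimes>x[^]f) (vs (W e f) z)) (kd (L s (k + f)) v))"
  proof (rule exI[of _ e], intro allI impI)
   fix k w1 assume w1: "vec w1" "homog (L 0 0) (j - 1) w1"
    and cy: "vin ?n (Idl (insert (x[^]k) (J k))) (kd (L (s + e) k) w1)"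
   define D' where "D' = kd (L (s + e) k)"
   have D' [simp]: "vec (D' z)" if "vec z" for z using that by (simp add: D'_def)
   \<comment> \<open>Here \<open>c\<close> represents the image of \<open>w1\<close> under the
     connecting map: its boundary is zero modulo \<open>J k\<close> because \<open>x[^]k\<close> may
     be cancelled.\<close>
   obtain c where c: "vec c" "vin ?n (J k) (va (D' w1) (vn (vm (x[^]k) c)))" "\<forall>bs. D' w1 bs = \<zero> --> c bs = \<zero>"
    using solve_mod[OF J xp, of "D' w1" ?n k k] w1(1) cy unfolding D'_def by auto
   have hc: "homog (L 0 0) j c"
   proof (rule homog_support[OF _ c(3)])
    show "homog (L 0 0) j (D' w1)" using homog_kd[OF ff(1) w1(1), of "s + e" k "j - 1"] w1(2)
     unfolding D'_def ff(3)[of "s + e" k] by simp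
   qed
   have key: "D' c bs\<in>J k" if l: "length bs = ?n" for bs
   proof (rule regular_modD[OF reg])
    show "D' c bs\<in>CR" using c by simp
    have "vin ?n (J k) (D' (va (D' w1) (vn (vm (x[^]k) c))))"
     unfolding D'_def using c w1(1) by (intro vin_D) (simp_all add: D'_def)
    moreover have "D' (va (D' w1) (vn (vm (x[^]k) c))) = va (D' (D' w1)) (vn (vm (x[^]k) (D' c)))"
     using w1(1) c(1) unfolding D'_def by (simp add: Dlin)
    moreover have "D' (D' w1) = vz" unfolding D'_def using kd_kd[OF ff(1) w1(1)] .
    ultimately have "\<ominus>(x[^]k\<otimes>D' c bs)\<in>J k" using l c(1) by (simp add: vin_def vapp)
    hence "\<ominus>(\<ominus>(x[^]k\<otimes>D' c bs))\<in>J k" by (rule ideal_neg[OF J])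
    thus "D' c bs\<otimes>x[^]k\<in>J k" using c(1) by (simp add: m_comm)
   qed
   define z where "z = glue \<zero> c w1"
   have vzz: "vec z" unfolding z_def using w1 c by simp
   have hz: "homog ((True, x[^](0::nat))#L 0 0) j z"
    unfolding homog_Cons z_def using w1(2) hc by simp
   have "vin (Suc ?n) (J k) (kd ((True, x[^]k)#L (s + e) k) z)"
    unfolding vin_part hpart_kd_coh
   proof (intro conjI)
    show "vin ?n (J k) (kd (L (s + e) k) (hpart False z))"
     using key by (simp add: vin_def z_def D'_def)
    have "va (vm (x[^]k) c) (vn (D' w1)) = vn (va (D' w1) (vn (vm (x[^]k) c)))"
     using c(1) w1(1) by (intro ext) (simp add: vapp cr_simps)
    thus "vin ?n (J k) (va (vm (x[^]k) (hpart False z)) (vn (kd (L (s + e) k) (hpart True z))))"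
     using vin_vn[OF J c(2)] by (simp add: z_def D'_def)
   qed
   then obtain f v where v: "vec v" "veq (Suc ?n) (J (k + f)) (vm (a f) (vs (x[^]f#W e f) z)) (kd ((True, x[^](k + f))#L s (k + f)) v)"
    using e[OF vzz hz, of k] by blast
   have "veq ?n (J (k + f)) (hpart True (vm (a f) (vs (x[^]f#W e f) z))) (hpart True (kd ((True, x[^](k + f))#L s (k + f)) v))"
    using v(2) by (simp only: veq_hpart)
   hence v1: "veq ?n (J (k + f)) (vm (a f) (vm (x[^]f) (vs (W e f) w1))) (va (vm (x[^](k + f)) (hpart False v)) (vn (kd (L s (k + f)) (hpart True v))))"
    unfolding hpart_simps hpart_vs2[OF ff(5) xp vzz] hpart_kd_coh by (simp add: z_def)
   have "veq ?n (Idl (insert (x[^](k + f)) (J (k + f)))) (vm (a f\<otimes>x[^]f) (vs (W e f) w1)) (kd (L s (k + f)) (vn (hpart True v)))"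
    unfolding veq_def vin_def
   proof (intro allI impI)
    fix bs :: "bool list" assume l: "length bs = ?n"
    let ?t = "a f\<otimes>(x[^]f\<otimes>vs (W e f) w1 bs)" and ?d = "kd (L s (k + f)) (hpart True v) bs" and ?u = "hpart False v bs"
    have "?t\<ominus>(x[^](k + f)\<otimes>?u\<ominus>?d)\<in>J (k + f)"
     using v1 l v(1) w1(1) by (simp add: veq_def vin_def vapp a_minus_def)
    hence "(?t\<ominus>(x[^](k + f)\<otimes>?u\<ominus>?d))\<oplus>x[^](k + f)\<otimes>?u\<in>Idl (insert (x[^](k + f)) (J (k + f)))"
     using v(1) by (intro idl_insert_intro J) simp_all
    moreover have id: "(t\<ominus>(p\<otimes>u\<ominus>d))\<oplus>p\<otimes>u = t\<oplus>d"
     if [simp]: "t\<in>CR" "d\<in>CR" "p\<in>CR" "u\<in>CR" for t d p u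
     using that by algebra
    ultimately have "?t\<oplus>?d\<in>Idl (insert (x[^](k + f)) (J (k + f)))" using v(1) w1(1) by simp
    thus "va (vm (a f\<otimes>x[^]f) (vs (W e f) w1)) (vn (kd (L s (k + f)) (vn (hpart True v)))) bs\<in>Idl (insert (x[^](k + f)) (J (k + f)))"
     using v(1) w1(1) by (simp add: vapp Dlin vn_vn m_assoc)
   qed
   thus "\<exists>f v. vec v\<and>veq ?n (Idl (insert (x[^](k + f)) (J (k + f)))) (vm (a f\<otimes>x[^]f) (vs (W e f) w1)) (kd (L s (k + f)) v)"
    using v(1) by (intro exI[of _ f] exI[of _ "vn (hpart True v)"]) simp
  qed
 qed
qed

text \<open>In a mixed list the cochain items stand behind the chain items, while
  \<open>pro_zero_coh\<close> removes an item at the head.\<close>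

lemma pro_zero_rot:
 assumes F: "family L W" and x: "x\<in>CR" and J: "!!s k. ideal (J s k) R" and a: "!!f. a f\<in>CR"
 shows "pro_zero (%s k. L s k@[(True, x[^]k)]) (%e f. W e f@[x[^]f]) J a j \<longleftrightarrow>
  pro_zero (%s k. (True, x[^]k)#L s k) (%e f. x[^]f#W e f) J a j"
proof -
 note ff = family_facts[OF F]
 let ?n = "Suc (length (L 0 0))"
 let ?Lt = "%s k. L s k@[(True, x[^]k)]" and ?Lh = "%s k. (True, x[^]k)#L s k"
 let ?Wt = "%e f. W e f@[x[^]f]" and ?Wh = "%e f. x[^]f#W e f"
 have xp [simp]: "x[^](i::nat)\<in>CR" for i using x by simp
 have its [simp]: "its (?Lt s k)" "its (?Lh s k)" for s k using ff(1) by simp_all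
 have Wc [simp]: "set (?Wt e f)\<subseteq>CR" "set (?Wh e f)\<subseteq>CR" for e f using ff(5) by auto
 have len: "length (L s k) = length (L 0 0)" for s k using ff(2) .
 have kr: "kd (?Lh s k) (rot z) bs = rot (kd (?Lt s k) z) bs" if "vec z" "length bs = ?n" for s k z bs
  using kd_rot[OF ff(1) xp that(1), of bs s k k] that(2) len[of s k] by simp
 have vr: "vs (?Wh e f) (rot z) bs = rot (vs (?Wt e f) z) bs" if "vec z" "length bs = ?n" for e f z bs
  using vs_rot[OF ff(5) xp that(1), of bs e f f] that(2) ff(6)[of e f] by simp
 have rm: "rot (vm r z) bs = vm r (rot z) bs" if zr: "vec z" "r\<in>CR" "length bs = ?n" for r z bs
 proof -
  obtain b c where bs: "bs = b#c" using zr(3) by (cases bs) auto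
  show ?thesis unfolding bs app_hpart using zr by (cases b) (simp_all add: vapp ve_app ksgn_mult)
 qed
 have cyc: "vin ?n (J s k) (kd (?Lh s k) (rot z)) \<longleftrightarrow> vin ?n (J s k) (kd (?Lt s k) z)" if "vec z" for s k z
 proof -
  have "vin ?n (J s k) (kd (?Lh s k) (rot z)) \<longleftrightarrow> vin ?n (J s k) (rot (kd (?Lt s k) z))"
   by (rule vin_cong) (use kr that in blast)
  also have "\<dots> \<longleftrightarrow> vin ?n (J s k) (kd (?Lt s k) z)" by (rule vin_rot[OF J vec_kd[OF its(1) that]])
  finally show ?thesis .
 qed
 have nul: "veq ?n (J s k) (vm (a f) (vs (?Wh e f) (rot z))) (kd (?Lh s k) (rot v)) \<longleftrightarrow>
   veq ?n (J s k) (vm (a f) (vs (?Wt e f) z)) (kd (?Lt s k) v)" if z: "vec z" "vec v" for s k e f z v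
 proof -
  have vt: "vec (vs (?Wt e f) z)" "vec (kd (?Lt s k) v)"
   using vec_vs[OF Wc(1) z(1)] vec_kd[OF its(1) z(2)] by blast+
  have "vm (a f) (vs (?Wh e f) (rot z)) bs = rot (vm (a f) (vs (?Wt e f) z)) bs" if l: "length bs = ?n" for bs
   unfolding rm[OF vt(1) a l] using vr[OF z(1) l] by (simp add: vm_def)
  hence "veq ?n (J s k) (vm (a f) (vs (?Wh e f) (rot z))) (kd (?Lh s k) (rot v)) \<longleftrightarrow>
   veq ?n (J s k) (rot (vm (a f) (vs (?Wt e f) z))) (rot (kd (?Lt s k) v))"
   by (rule veq_cong) (use kr z in blast)+
  also have "\<dots> \<longleftrightarrow> veq ?n (J s k) (vm (a f) (vs (?Wt e f) z)) (kd (?Lt s k) v)"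
   by (rule veq_rot[OF J]) (use vt a in simp_all)
  finally show ?thesis .
 qed
 have hom: "homog (?Lh 0 0) j (rot z) \<longleftrightarrow> homog (?Lt 0 0) j z" if "vec z" for z
  using homog_rot[OF that] by simp
 have un: "kd (?Lh s k) (rot (unrot v)) bs = kd (?Lh s k) v bs" if "vec v" "length bs = ?n" for s k v bs
 proof (rule kd_cong[OF its(2)])
  show "rot (unrot v) bs = v bs" if "length bs = length (?Lh s k)" for bs
   using rot_unrot[OF \<open>vec v\<close>, of bs "length (L s k)"] that by simp
 qed (use that len[of s k] in simp_all)
 have un': "vs (?Wh e f) (rot (unrot v)) bs = vs (?Wh e f) v bs" if "vec v" "length bs = ?n" for e f v bs
  using rot_unrot[OF that] by (simp add: vs_def)
 have "(\<forall>z. vec z --> homog (?Lt 0 0) j z --> vin ?n (J (s + e) k) (kd (?Lt (s + e) k) z) -->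
   (\<exists>f v. vec v\<and>veq ?n (J s (k + f)) (vm (a f) (vs (?Wt e f) z)) (kd (?Lt s (k + f)) v))) \<longleftrightarrow>
  (\<forall>z. vec z --> homog (?Lh 0 0) j z --> vin ?n (J (s + e) k) (kd (?Lh (s + e) k) z) -->
   (\<exists>f v. vec v\<and>veq ?n (J s (k + f)) (vm (a f) (vs (?Wh e f) z)) (kd (?Lh s (k + f)) v)))" (is "?A \<longleftrightarrow> ?B") for s e k
 proof
  assume A: ?A
  show ?B
  proof (intro allI impI)
   fix z assume z: "vec z" "homog (?Lh 0 0) j z" "vin ?n (J (s + e) k) (kd (?Lh (s + e) k) z)"
   have vu: "vec (unrot z)" using z by simp
   have "homog (?Lh 0 0) j (rot (unrot z))" using z(2) rot_unrot[OF z(1)] unfolding homog_def by simp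
   hence 1: "homog (?Lt 0 0) j (unrot z)" using hom[OF vu] by simp
   have "vin ?n (J (s + e) k) (kd (?Lh (s + e) k) (rot (unrot z)))"
    using z(3) vin_cong[of ?n "kd (?Lh (s + e) k) (rot (unrot z))" "kd (?Lh (s + e) k) z"] un[OF z(1)] by blast
   hence "vin ?n (J (s + e) k) (kd (?Lt (s + e) k) (unrot z))" using cyc[OF vu] by simp
   then obtain f v where v: "vec v" "veq ?n (J s (k + f)) (vm (a f) (vs (?Wt e f) (unrot z))) (kd (?Lt s (k + f)) v)"
    using A vu 1 by blast
   hence "veq ?n (J s (k + f)) (vm (a f) (vs (?Wh e f) (rot (unrot z)))) (kd (?Lh s (k + f)) (rot v))"
    using nul[OF vu v(1)] by blast
   moreover have "veq ?n (J s (k + f)) (vm (a f) (vs (?Wh e f) (rot (unrot z)))) (kd (?Lh s (k + f)) (rot v)) \<longleftrightarrow>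
    veq ?n (J s (k + f)) (vm (a f) (vs (?Wh e f) z)) (kd (?Lh s (k + f)) (rot v))"
    by (rule veq_cong) (use un'[OF z(1)] in \<open>simp_all add: vm_def\<close>)
   ultimately show "\<exists>f v. vec v\<and>veq ?n (J s (k + f)) (vm (a f) (vs (?Wh e f) z)) (kd (?Lh s (k + f)) v)"
    using rot_vec(1)[OF v(1)] by blast
  qed
 next
  assume B: ?B
  show ?A
  proof (intro allI impI)
   fix z assume z: "vec z" "homog (?Lt 0 0) j z" "vin ?n (J (s + e) k) (kd (?Lt (s + e) k) z)"
   have "homog (?Lh 0 0) j (rot z)" "vin ?n (J (s + e) k) (kd (?Lh (s + e) k) (rot z))"
    using hom[OF z(1)] cyc[OF z(1)] z by blast+
   then obtain f v where v: "vec v" "veq ?n (J s (k + f)) (vm (a f) (vs (?Wh e f) (rot z))) (kd (?Lh s (k + f)) v)"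
    using B rot_vec(1)[OF z(1)] by blast
   moreover have "veq ?n (J s (k + f)) (vm (a f) (vs (?Wh e f) (rot z))) (kd (?Lh s (k + f)) (rot (unrot v))) \<longleftrightarrow>
    veq ?n (J s (k + f)) (vm (a f) (vs (?Wh e f) (rot z))) (kd (?Lh s (k + f)) v)"
    by (rule veq_cong) (use un[OF v(1)] in simp_all)
   ultimately show "\<exists>f v. vec v\<and>veq ?n (J s (k + f)) (vm (a f) (vs (?Wt e f) z)) (kd (?Lt s (k + f)) v)"
    using nul[OF z(1) rot_vec(2)[OF v(1)]] rot_vec(2)[OF v(1)] by blast
  qed
 qed
 thus ?thesis unfolding pro_zero_def by simp
qed

section \<open>Mixed Koszul complexes on the powers of two lists\<close>

definition mixL :: "'a list => 'a list => nat => nat => (bool\<times>'a) list" where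
 "mixL Y X s k = chn (pows Y s)@coh (pows X k)"

definition mixW :: "'a list => 'a list => nat => nat => 'a list" where
 "mixW Y X e f = pows Y e@pows X f"

lemma mix_simps: "mixL (y#Y) X = (%s k. (False, y[^]s)#mixL Y X s k)"
 "mixW (y#Y) X = (%e f. y[^]e#mixW Y X e f)"
 "mixL [] (x#X) = (%s k. (True, x[^]k)#mixL [] X s k)"
 "mixW [] (x#X) = (%e f. x[^]f#mixW [] X e f)"
 "mixL Y (X@[x]) = (%s k. mixL Y X s k@[(True, x[^]k)])"
 "mixW Y (X@[x]) = (%e f. mixW Y X e f@[x[^]f])"
 by (simp_all add: mixL_def mixW_def fun_eq_iff)

lemma family_mix: "inR Y ==> inR X ==> family (mixL Y X) (mixW Y X)"
proof (induction Y)
 case Nil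
 have "inR X" using Nil by simp
 thus ?case
 proof (induction X)
  case Nil show ?case by (simp add: family_def mixL_def mixW_def)
 next
  case (Cons x X) thus ?case unfolding mix_simps by (intro family_coh) simp_all
 qed
next
 case (Cons y Y) thus ?case unfolding mix_simps by (intro family_chn) simp_all
qed

lemma idl_pows_ideal: "inR A ==> ideal (Idl (set (pows A k))) R"
 by (intro genideal_ideal pows_carr)

lemma idl_pows_Cons: "inR A ==> a\<in>CR ==>
 Idl (insert (a[^]k) (Idl (set (pows A k)))) = Idl (set (pows (a#A) k))"
 using idl_insert_idl[of "set (pows A k)" "a[^]k"] by simp

lemma idl_pows_least: "ideal J R ==> (!!a. a\<in>set A ==> a[^]k\<in>J) ==> Idl (set (pows A k))\<subseteq>J"
 by (intro genideal_minimal) (auto simp: pows_def)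

lemma idl_pows_gen: "inR A ==> a\<in>set A ==> a[^]k\<in>Idl (set (pows A k))"
 using genideal_self[OF pows_carr, of A k] by (auto simp: pows_def)

lemma idl_pows_antimono:
 assumes "inR A" "s\<le>t" shows "Idl (set (pows A t))\<subseteq>Idl (set (pows A s))"
proof (rule idl_pows_least[OF idl_pows_ideal[OF assms(1)]])
 fix a assume a: "a\<in>set A"
 have "a\<in>CR" using a assms by blast
 hence "a[^]t = a[^](t - s)\<otimes>a[^]s" using assms(2) by (simp add: nat_pow_mult)
 thus "a[^]t\<in>Idl (set (pows A s))"
  using ideal_mult[OF idl_pows_ideal[OF assms(1)] idl_pows_gen[OF assms(1) a]] \<open>a\<in>CR\<close> by simp
qed

primrec prodl :: "'a list => 'a" where "prodl [] = \<one>" | "prodl (x#xs) = x\<otimes>prodl xs"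

lemma prodl_carr [simp]: "inR xs ==> prodl xs\<in>CR" by (induction xs) auto

lemma pow_mult_pow: "x\<in>CR ==> y\<in>CR ==> (x\<otimes>y)[^](n::nat) = x[^]n\<otimes>y[^]n"
 by (rule nat_pow_distrib)

lemma prodl_mem: "inR A ==> a\<in>set A ==> \<exists>c\<in>CR. prodl A = a\<otimes>c"
proof (induction A)
 case (Cons b A)
 show ?case
 proof (cases "a = b")
  case True thus ?thesis using Cons by auto
 next
  case False
  then obtain c where "c\<in>CR" "prodl A = a\<otimes>c" using Cons by auto
  thus ?thesis using Cons.prems by (intro bexI[of _ "b\<otimes>c"]) (auto simp: cr_simps)
 qed
qed simp

lemma prodl_pow_idl:
 assumes A: "inR A" and r: "r\<in>Idl (set (pows A k))"
 shows "prodl A[^](f::nat)\<otimes>r\<in>Idl (set (pows A (k + f)))"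
proof -
 let ?p = "prodl A[^]f"
 have p: "?p\<in>CR" using A by simp
 note i = idl_pows_ideal[OF A]
 have "Idl (set (pows A k))\<subseteq>colon (Idl (set (pows A (k + f)))) ?p"
 proof (rule idl_pows_least[OF colon_ideal[OF i p]])
  fix a assume a: "a\<in>set A"
  have ac: "a\<in>CR" using a A by blast
  obtain c where c: "c\<in>CR" "prodl A = a\<otimes>c" using prodl_mem[OF A a] by blast
  have "a[^]k\<otimes>?p = c[^]f\<otimes>a[^](k + f)"
   unfolding c(2) using ac c(1) by (simp add: pow_mult_pow nat_pow_mult[symmetric] cr_simps)
  thus "a[^]k\<in>colon (Idl (set (pows A (k + f)))) ?p"
   using ideal_mult[OF i idl_pows_gen[OF A a]] c ac by (simp add: colon_def)
 qed
 thus ?thesis using r p by (auto simp: colon_def m_comm)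
qed

lemma pro_zero_cong:
 "(!!s k. J s k = J' s k) ==> (!!f. a f = a' f) ==> pro_zero L W J a j \<longleftrightarrow> pro_zero L W J' a' j"
 unfolding pro_zero_def by simp

text \<open>Items leave from the end of \<open>X\<close> and join the relations, so \<open>x\<close>
  has to be regular modulo the powers of \<open>A\<close> and of the items \<open>B\<close> behind
  it. The factors gathered on the way multiply up to the product of the whole list.\<close>

lemma pro_zero_strip_coh:
 assumes Y: "inR Y" and A: "inR A" and X: "inR X"
  and reg: "!!B x C k. X = C@x#B ==> regular_mod (Idl (set (pows (B@A) k))) (x[^]k)"
 shows "pro_zero (mixL Y X) (mixW Y X) (%s k. Idl (set (pows A k))) (%f. prodl A[^]f) j \<longleftrightarrow>
  pro_zero (mixL Y []) (mixW Y []) (%s k. Idl (set (pows (X@A) k))) (%f. prodl (X@A)[^]f) (j - int (length X))"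
 using A X reg
proof (induction X arbitrary: A j rule: rev_induct)
 case Nil thus ?case by simp
next
 case (snoc x X)
 have c: "x\<in>CR" "inR X" using snoc.prems by auto
 note F = family_mix[OF Y c(2)]
 have r: "regular_mod (Idl (set (pows A k))) (x[^]k)" for k
  using snoc.prems(3)[of X x "[]" k] by simp
 have "pro_zero (mixL Y (X@[x])) (mixW Y (X@[x])) (%s k. Idl (set (pows A k))) (%f. prodl A[^]f) j \<longleftrightarrow>
  pro_zero (%s k. (True, x[^]k)#mixL Y X s k) (%e f. x[^]f#mixW Y X e f) (%s k. Idl (set (pows A k))) (%f. prodl A[^]f) j"
  unfolding mix_simps by (rule pro_zero_rot[OF F c(1)]) (use snoc.prems in \<open>auto intro: idl_pows_ideal\<close>)
 also have "\<dots> \<longleftrightarrow> pro_zero (mixL Y X) (mixW Y X) (%s k. Idl (insert (x[^]k) (Idl (set (pows A k))))) (%f. prodl A[^]f\<otimes>x[^]f) (j - 1)"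
  by (rule pro_zero_coh[OF F c(1)]) (use snoc.prems r prodl_pow_idl[of A] in \<open>auto intro: idl_pows_ideal\<close>)
 also have "\<dots> \<longleftrightarrow> pro_zero (mixL Y X) (mixW Y X) (%s k. Idl (set (pows (x#A) k))) (%f. prodl (x#A)[^]f) (j - 1)"
 proof (rule pro_zero_cong)
  show "Idl (insert (x[^]k) (Idl (set (pows A k)))) = Idl (set (pows (x#A) k))" for k
   using idl_pows_Cons snoc.prems c by blast
  show "prodl A[^]f\<otimes>x[^]f = prodl (x#A)[^]f" for f :: nat
   using snoc.prems c by (simp add: pow_mult_pow m_comm)
 qed
 also have "\<dots> \<longleftrightarrow> pro_zero (mixL Y []) (mixW Y []) (%s k. Idl (set (pows (X@x#A) k))) (%f. prodl (X@x#A)[^]f) (j - 1 - int (length X))"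
 proof (rule snoc.IH)
  show "regular_mod (Idl (set (pows (B@x#A) k))) (z[^]k)" if "X = C@z#B" for B z C k
   using snoc.prems(3)[of C z "B@[x]" k] that by simp
 qed (use snoc.prems c in auto)
 finally show ?case by (simp add: algebra_simps)
qed

end

section \<open>Chain conditions for colon ideals and for submodules\<close>

context noetherian_cring
begin

text \<open>The ascending chain of the ideals \<open>colon J (y[^]n)\<close> is stationary from some
  \<open>N\<close> on. This supplies the hypothesis of \<open>pro_zero_chn\<close>.\<close>

lemma proregular:
 fixes s :: nat
 assumes J: "ideal J R" and y: "y\<in>CR"
 shows "\<exists>N. \<forall>r\<in>CR. y[^](s + N)\<otimes>r\<in>J --> y[^]N\<otimes>r\<in>J"
proof -
 let ?C = "%n::nat. colon J (y[^]n)"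
 have "\<exists>N. \<forall>n\<ge>N. ?C n = ?C N"
 proof (rule ascending_ideals_stabilize)
  show "ideal (?C n) R" for n using colon_ideal[OF J] y by simp
  show "?C n\<subseteq>?C (Suc n)" for n
  proof
   fix r assume r: "r\<in>?C n"
   hence "r\<otimes>y[^]Suc n = y\<otimes>(r\<otimes>y[^]n)" using y by (auto simp: colon_def cr_simps)
   thus "r\<in>?C (Suc n)" using r y ideal_mult[OF J] by (auto simp: colon_def)
  qed
 qed
 then obtain N where N: "\<forall>n\<ge>N. ?C n = ?C N" by blast
 have "y[^]N\<otimes>r\<in>J" if r: "r\<in>CR" "y[^](s + N)\<otimes>r\<in>J" for r
 proof -
  have "r\<in>?C (s + N)" using r y by (simp add: colon_def m_comm)
  moreover have "?C (s + N) = ?C N" using N by (meson le_add2)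
  ultimately have "r\<in>?C N" by simp
  thus ?thesis using r y by (simp add: colon_def m_comm)
 qed
 thus ?thesis by blast
qed

lemma pro_zero_strip_chn:
 assumes "inR B" "inR A" "inR X"
 shows "pro_zero (mixL B X) (mixW B X) (%s k. Idl (set (pows A s))) (%_. \<one>) j \<longleftrightarrow>
  pro_zero (mixL [] X) (mixW [] X) (%s k. Idl (set (pows (B@A) s))) (%_. \<one>) j"
 using assms
proof (induction B arbitrary: A)
 case Nil thus ?case by simp
next
 case (Cons y B)
 have c: "y\<in>CR" "inR B" "set (y#A)\<subseteq>CR" using Cons.prems by auto
 have "pro_zero (mixL (y#B) X) (mixW (y#B) X) (%s k. Idl (set (pows A s))) (%_. \<one>) j \<longleftrightarrow>
  pro_zero (mixL B X) (mixW B X) (%s k. Idl (insert (y[^]s) (Idl (set (pows A s))))) (%_. \<one>) j"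
  unfolding mix_simps
  by (rule pro_zero_chn[OF family_mix[OF c(2) Cons.prems(3)] c(1)])
   (use Cons.prems idl_pows_antimono[of A] proregular[OF idl_pows_ideal c(1)] in \<open>auto intro: idl_pows_ideal\<close>)
 also have "\<dots> \<longleftrightarrow> pro_zero (mixL B X) (mixW B X) (%s k. Idl (set (pows (y#A) s))) (%_. \<one>) j"
  by (rule pro_zero_cong) (use idl_pows_Cons[OF Cons.prems(2) c(1)] in simp_all)
 also have "\<dots> \<longleftrightarrow> pro_zero (mixL [] X) (mixW [] X) (%s k. Idl (set (pows (B@y#A) s))) (%_. \<one>) j"
  by (rule Cons.IH[OF c(2,3) Cons.prems(3)])
 also have "\<dots> \<longleftrightarrow> pro_zero (mixL [] X) (mixW [] X) (%s k. Idl (set (pows ((y#B)@A) s))) (%_. \<one>) j"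
  by (rule pro_zero_cong) simp_all
 finally show ?case .
qed

text \<open>The free module of cochains of length \<open>n\<close> is Noetherian. Its submodules are
  sets of functions closed under changes at bit lists of other lengths, and a vector is split into
  halves by its first bit.\<close>

lemma vector_acc:
 assumes N: "!!e z. z\<in>N e ==> vec z" "!!e. vz\<in>N e" "!!e z w. z\<in>N e ==> w\<in>N e ==> va z w\<in>N e"
  "!!e z r. z\<in>N e ==> r\<in>CR ==> vm r z\<in>N e"
  "!!e z w. z\<in>N e ==> vec w ==> (\<forall>bs. length bs = n --> z bs = w bs) ==> w\<in>N e"
  "!!e::nat. N e\<subseteq>N (Suc e)"
 shows "\<exists>E. \<forall>e\<ge>E. N e\<subseteq>N E"
 using N
proof (induction n arbitrary: N)
 case 0
 note P = "0.prems"
 let ?I = "%e. (%z. z [])`N e"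
 have "\<exists>E. \<forall>e\<ge>E. ?I e = ?I E"
 proof (rule ascending_ideals_stabilize)
  show "ideal (?I e) R" for e
  proof (rule idealI_cring)
   show "?I e\<subseteq>CR" using P(1) by auto
   show "\<zero>\<in>?I e" using P(2)[of e] by (rule rev_image_eqI) simp
   fix p q assume "p\<in>?I e"
   then obtain z where z: "p = z []" "z\<in>N e" by blast
   { assume "q\<in>?I e"
    then obtain w where w: "q = w []" "w\<in>N e" by blast
    show "p\<oplus>q\<in>?I e" using P(3)[OF z(2) w(2)] by (rule rev_image_eqI) (simp add: va_def z w) }
   assume q: "q\<in>CR"
   show "q\<otimes>p\<in>?I e" using P(4)[OF z(2) q] by (rule rev_image_eqI) (simp add: vm_def z)
  qed
  show "?I e\<subseteq>?I (Suc e)" for e using P(6) by blast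
 qed
 then obtain E where E: "\<forall>e\<ge>E. ?I e = ?I E" by blast
 have "N e\<subseteq>N E" if e: "e\<ge>E" for e
 proof
  fix z assume z: "z\<in>N e"
  hence "z []\<in>?I E" using E e by blast
  then obtain w where "w\<in>N E" "z [] = w []" by blast
  thus "z\<in>N E" using P(5)[of w E z] P(1)[OF z] by simp
 qed
 thus ?case by blast
next
 case (Suc n)
 note P = Suc.prems
 have mono: "N e\<subseteq>N e'" if "e\<le>e'" for e e'
  using that by (induction rule: dec_induct) (use P(6) in blast)+
 have cong: "w\<in>N e" if "z\<in>N e" "vec w" "hpart False z = hpart False w" "hpart True z = hpart True w" for e z w
 proof (rule P(5)[OF that(1,2)], intro allI impI)
  fix bs :: "bool list" assume "length bs = Suc n"
  then obtain b c where "bs = b#c" by (cases bs) auto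
  thus "z bs = w bs" using that(3,4) by (cases b) (simp_all add: app_hpart[of z] app_hpart[of w])
 qed
 have vz2 [simp]: "va vz vz = vz" by (intro ext) (simp add: vapp)
 have vz3 [simp]: "vm r vz = vz" if "r\<in>CR" for r using that by (intro ext) (simp add: vapp)
 \<comment> \<open>The first halves of the members whose second half is zero, and the second halves
   of all members. A member of a later \<open>N e\<close> agrees in its second half with one of
   \<open>N E\<close>, and the difference is governed by \<open>?A\<close>.\<close>
 let ?A = "%e. {u. vec u\<and>glue \<zero> u vz\<in>N e}" and ?B = "%e. {u. vec u\<and>(\<exists>w. vec w\<and>glue \<zero> w u\<in>N e)}"
 have "\<exists>E. \<forall>e\<ge>E. ?A e\<subseteq>?A E"
 proof (rule Suc.IH)
  fix e z assume z: "z\<in>?A e"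
  show "vec z" using z by simp
  show "va z w\<in>?A e" if "w\<in>?A e" for w
   using z that cong[OF P(3)[of "glue \<zero> z vz" e "glue \<zero> w vz"], of "glue \<zero> (va z w) vz"] by simp
  show "vm r z\<in>?A e" if "r\<in>CR" for r
   using z that cong[OF P(4)[of "glue \<zero> z vz" e r], of "glue \<zero> (vm r z) vz"] by simp
  show "w\<in>?A e" if w: "vec w" "\<forall>bs. length bs = n --> z bs = w bs" for w
  proof -
   have "glue \<zero> z vz bs = glue \<zero> w vz bs" if "length bs = Suc n" for bs
    using that w by (cases bs) (simp_all add: glue_def)
   thus ?thesis using z w P(5)[of "glue \<zero> z vz" e "glue \<zero> w vz"] by simp
  qed
 next
  show "vz\<in>?A e" for e using cong[OF P(2)[of e], of "glue \<zero> vz vz"] by simp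
  show "?A e\<subseteq>?A (Suc e)" for e using P(6) by blast
 qed
 then obtain E1 where E1: "\<forall>e\<ge>E1. ?A e\<subseteq>?A E1" by blast
 have "\<exists>E. \<forall>e\<ge>E. ?B e\<subseteq>?B E"
 proof (rule Suc.IH)
  fix e z assume "z\<in>?B e"
  then obtain z' where z: "vec z" "vec z'" "glue \<zero> z' z\<in>N e" by blast
  show "vec z" using z by simp
  show "va z w\<in>?B e" if wB: "w\<in>?B e" for w
  proof -
   obtain w' where w: "vec w" "vec w'" "glue \<zero> w' w\<in>N e" using wB by blast
   have "glue \<zero> (va z' w') (va z w)\<in>N e"
    by (rule cong[OF P(3)[OF z(3) w(3)]]) (use z w in simp_all)
   thus ?thesis using z w by (auto intro!: exI[of _ "va z' w'"])
  qed
  show "vm r z\<in>?B e" if r: "r\<in>CR" for r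
  proof -
   have "glue \<zero> (vm r z') (vm r z)\<in>N e"
    by (rule cong[OF P(4)[OF z(3) r]]) (use z r in simp_all)
   thus ?thesis using z r by (auto intro!: exI[of _ "vm r z'"])
  qed
  show "w\<in>?B e" if w: "vec w" "\<forall>bs. length bs = n --> z bs = w bs" for w
  proof -
   have "glue \<zero> z' z bs = glue \<zero> z' w bs" if "length bs = Suc n" for bs
    using that w by (cases bs) (simp_all add: glue_def)
   thus ?thesis using z w P(5)[of "glue \<zero> z' z" e "glue \<zero> z' w"] by auto
  qed
 next
  show "vz\<in>?B e" for e using cong[OF P(2)[of e], of "glue \<zero> vz vz"] by (auto intro!: exI[of _ vz])
  show "?B e\<subseteq>?B (Suc e)" for e using P(6) by blast
 qed
 then obtain E2 where E2: "\<forall>e\<ge>E2. ?B e\<subseteq>?B E2" by blast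
 define E where "E = max E1 E2"
 have "N e\<subseteq>N E" if e: "e\<ge>E" for e
 proof
  fix z assume z: "z\<in>N e"
  have vz': "vec z" using P(1) z by blast
  have "glue \<zero> (hpart False z) (hpart True z)\<in>N e" by (rule cong[OF z]) (use vz' in simp_all)
  hence "hpart True z\<in>?B e" using vz' by (auto intro!: exI[of _ "hpart False z"])
  moreover have "?B e\<subseteq>?B E2" using E2 e unfolding E_def by simp
  ultimately have "hpart True z\<in>?B E2" by blast
  then obtain w where w: "vec w" "glue \<zero> w (hpart True z)\<in>N E2" by blast
  hence wE: "glue \<zero> w (hpart True z)\<in>N E" using mono[of E2 E] unfolding E_def by auto
  hence we: "glue \<zero> w (hpart True z)\<in>N e" using mono[OF e] by blast
  have ng: "vm (\<ominus>\<one>) (glue \<zero> w (hpart True z))\<in>N e" using P(4)[OF we] by simp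
  define u where "u = va (hpart False z) (vn w)"
  have vu: "vec u" unfolding u_def using vz' w by simp
  have "glue \<zero> u vz\<in>N e"
  proof (rule cong[OF P(3)[OF z ng]])
   show "hpart True (va z (vm (\<ominus>\<one>) (glue \<zero> w (hpart True z)))) = hpart True (glue \<zero> u vz)"
    using vz' by (simp, intro ext) (simp add: vapp l_minus r_neg)
  qed (use vz' w vu in \<open>simp_all add: u_def vn_vm\<close>)
  hence "u\<in>?A e" using vu by simp
  moreover have "?A e\<subseteq>?A E1" using E1 e unfolding E_def by simp
  ultimately have "u\<in>?A E1" by blast
  hence uE: "glue \<zero> u vz\<in>N E" using mono[of E1 E] unfolding E_def by auto
  show "z\<in>N E"
  proof (rule cong[OF P(3)[OF uE wE] vz'])
   have can: "a\<oplus>\<ominus> b\<oplus>b = a" if "a\<in>CR" "b\<in>CR" for a b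
    using that by (simp add: a_assoc l_neg)
   show "hpart False (va (glue \<zero> u vz) (glue \<zero> w (hpart True z))) = hpart False z"
    using vz' w by (simp add: u_def, intro ext) (simp add: vapp can)
   show "hpart True (va (glue \<zero> u vz) (glue \<zero> w (hpart True z))) = hpart True z"
    using vz' by (simp, intro ext) (simp add: vapp)
  qed
 qed
 thus ?case by blast
qed

end

section \<open>Baer's criterion for the union of the quotients by \<open>qx k\<close>\<close>

locale local_parameters = local_noetherian + parameter_system +
 assumes m_gen: "\<mm> = Idl X"
begin

text \<open>The graph of a homomorphism from the ideal of first components to
  \<open>R / qx k\<close>: a submodule of pairs whose values over zero lie in \<open>qx k\<close>.
  As a relation it needs no choice of representatives for the values.\<close>

definition graph_mod :: "nat => ('a\<times>'a) set => bool" where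
 "graph_mod k G \<longleftrightarrow> G\<subseteq>CR\<times>CR\<and>(\<zero>, \<zero>)\<in>G\<and>
  (\<forall>a r b t. (a, r)\<in>G --> (b, t)\<in>G --> (a\<oplus>b, r\<oplus>t)\<in>G)\<and>
  (\<forall>c a r. c\<in>CR --> (a, r)\<in>G --> (c\<otimes>a, c\<otimes>r)\<in>G)\<and>
  (\<forall>r. (\<zero>, r)\<in>G --> r\<in>qx k)"

lemma graph_modD:
 assumes "graph_mod k G"
 shows "(a, r)\<in>G ==> a\<in>CR" "(a, r)\<in>G ==> r\<in>CR" "(\<zero>, \<zero>)\<in>G"
  "(a, r)\<in>G ==> (b, t)\<in>G ==> (a\<oplus>b, r\<oplus>t)\<in>G"
  "c\<in>CR ==> (a, r)\<in>G ==> (c\<otimes>a, c\<otimes>r)\<in>G"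
  "(\<zero>, r)\<in>G ==> r\<in>qx k"
 using assms unfolding graph_mod_def by blast+

lemma graph_mod_unique:
 assumes G: "graph_mod k G" and r: "(a, r)\<in>G" "(a, t)\<in>G" shows "r\<ominus>t\<in>qx k"
proof -
 note D = graph_modD[OF G]
 have c: "a\<in>CR" "r\<in>CR" "t\<in>CR" using D r by blast+
 have "(a\<oplus>(\<ominus>\<one>)\<otimes>a, r\<oplus>(\<ominus>\<one>)\<otimes>t)\<in>G" using D(4)[OF r(1) D(5)[OF _ r(2)]] by simp
 moreover have "a\<oplus>(\<ominus>\<one>)\<otimes>a = \<zero>" "r\<oplus>(\<ominus>\<one>)\<otimes>t = r\<ominus>t" using c by (simp_all add: l_minus r_neg a_minus_def)
 ultimately show ?thesis using D(6) by simp
qed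

lemma graph_mod_dom: assumes G: "graph_mod k G" shows "ideal (fst`G) R"
proof (rule idealI_cring)
 note D = graph_modD[OF G]
 show "fst`G\<subseteq>CR" using D(1) by auto
 show "\<zero>\<in>fst`G" using D(3) by force
 show "a\<oplus>b\<in>fst`G" if "a\<in>fst`G" "b\<in>fst`G" for a b using that D(4) by force
 show "r\<otimes>a\<in>fst`G" if "a\<in>fst`G" "r\<in>CR" for a r using that D(5) by force
qed

text \<open>Extension to \<open>K + dom G\<close> by zero on \<open>K\<close>, for an ideal \<open>K\<close> that meets the domain in the kernel
 and is maximal with this property; such a \<open>K\<close> contains a power of every parameter.\<close>

lemma graph_torsion_complement:
 assumes G: "graph_mod k G"
 obtains K where "ideal K R" "!!a r. a\<in>K ==> (a, r)\<in>G ==> r\<in>qx k" "!!x. x\<in>X ==> \<exists>n::nat. x[^]n\<in>K"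
proof -
 note D = graph_modD[OF G]
 define ker where "ker = {a. \<exists>r. (a, r)\<in>G\<and>r\<in>qx k}"
 have ker: "ideal ker R"
 proof (rule idealI_cring)
  show "ker\<subseteq>CR" unfolding ker_def using D(1) by blast
  show "\<zero>\<in>ker" unfolding ker_def using D(3) ideal_zero[OF qx_ideal] by blast
  show "a\<oplus>b\<in>ker" if "a\<in>ker" "b\<in>ker" for a b
   using that D(4) ideal_add[OF qx_ideal] unfolding ker_def by blast
  show "r\<otimes>a\<in>ker" if "a\<in>ker" "r\<in>CR" for a r
   using that D(5) ideal_mult[OF qx_ideal] unfolding ker_def by blast
 qed
 define F where "F = (%K. ideal K R\<and>ker\<subseteq>K\<and>(\<forall>a r. a\<in>K --> (a, r)\<in>G --> r\<in>qx k))"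
 have "r\<in>qx k" if "a\<in>ker" "(a, r)\<in>G" for a r
 proof -
  obtain t where t: "(a, t)\<in>G" "t\<in>qx k" using \<open>a\<in>ker\<close> unfolding ker_def by blast
  show ?thesis using ideal_sub_cancel[OF qx_ideal t(2) graph_mod_unique[OF G that(2) t(1)]] D(2)[OF that(2)] by blast
 qed
 hence "F ker" unfolding F_def using ker by blast
 then obtain K where FK: "F K" and mx: "!!J. F J ==> K\<subseteq>J ==> J = K"
  by (rule obtain_maximal_ideal) (auto simp: F_def)
 hence K: "ideal K R" "ker\<subseteq>K" "!!a r. a\<in>K ==> (a, r)\<in>G ==> r\<in>qx k" unfolding F_def by blast+
 have "\<exists>n::nat. x[^]n\<in>K" if x: "x\<in>X" for x
 proof -
  have xc: "x\<in>CR" using x X_carr by blast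
  \<comment> \<open>This power lies in \<open>qx k\<close>, so \<open>y\<close> times the domain
    lies in the kernel. With \<open>proregular\<close> the ideal \<open>K + (y[^]n)\<close> then
    still meets the domain in the kernel, and maximality puts \<open>y[^]n\<close> into
    \<open>K\<close>.\<close>
  define y where "y = x[^]k"
  have yc: "y\<in>CR" unfolding y_def using xc by simp
  have yq: "y\<in>qx k" unfolding y_def qx_def using pow_ideal_gen[OF X_carr x, of "%_. k"] .
  obtain n :: nat where n: "!!r. r\<in>CR ==> y[^](1 + n)\<otimes>r\<in>K ==> y[^]n\<otimes>r\<in>K"
   using proregular[OF K(1) yc, of 1] by blast
  define K' where "K' = Idl (insert (y[^]n) K)"
  have K': "ideal K' R" "insert (y[^]n) K\<subseteq>K'" unfolding K'_def
   using idl_insert_is_ideal[OF K(1)] idl_insert_sup[OF K(1)] yc by auto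
  have "F K'" unfolding F_def
  proof (intro conjI allI impI)
   show "ideal K' R" "ker\<subseteq>K'" using K' K by auto
   fix a r assume ar: "a\<in>K'" "(a, r)\<in>G"
   obtain p c where pc: "p\<in>K" "c\<in>CR" "a = p\<oplus>c\<otimes>y[^]n"
    using ar(1) unfolding K'_def using idl_insert_ideal[OF K(1)] yc by auto
   have pR: "p\<in>CR" using pc K ideal_carr by blast
   have "(y\<otimes>a, y\<otimes>r)\<in>G" using D(5)[OF yc ar(2)] .
   moreover have "y\<otimes>r\<in>qx k" using ideal_mult_r[OF qx_ideal yq] D(2)[OF ar(2)] by blast
   ultimately have "y\<otimes>a\<in>K" using K(2) unfolding ker_def by blast
   moreover have "y\<otimes>a = y\<otimes>p\<oplus>y[^](1 + n)\<otimes>c"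
    unfolding pc(3) using pR pc(2) yc by (simp add: nat_pow_mult[symmetric] cr_simps)
   ultimately have "y[^](1 + n)\<otimes>c\<in>K"
    using ideal_add_cancel[OF K(1), of "y\<otimes>p" "y[^](1 + n)\<otimes>c"] ideal_mult[OF K(1) pc(1) yc] pc(2) yc by simp
   hence "y[^]n\<otimes>c\<in>K" using n[OF pc(2)] by blast
   hence "a\<in>K" unfolding pc(3) using ideal_add[OF K(1) pc(1)] pc(2) yc by (simp add: m_comm)
   thus "r\<in>qx k" using K(3) ar(2) by blast
  qed
  hence "y[^]n\<in>K" using mx K' by blast
  thus ?thesis unfolding y_def using xc by (auto simp: nat_pow_pow)
 qed
 thus ?thesis using that K by blast
qed

text \<open>One step of Baer's argument at a socle element \<open>u\<close> modulo the domain. The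
  value at \<open>u\<close> has to agree with the given values at the multiples of \<open>u\<close>
  by parameters; \<open>solve_params\<close> finds it after passing from \<open>k\<close> to
  \<open>Suc k\<close>. The coefficients that bring \<open>u\<close> into the domain lie in \<mm>,
  so the parameters suffice.\<close>

lemma graph_extend_step:
 assumes H: "graph_mod k H" and u: "u\<in>CR" "u\<notin>fst`H" "!!x. x\<in>X ==> x\<otimes>u\<in>fst`H"
 shows "\<exists>H'. graph_mod (Suc k) H'\<and>fst`H\<subset>fst`H'\<and>(\<forall>(a, r)\<in>H. (a, Xp\<otimes>r)\<in>H')"
proof -
 note D = graph_modD[OF H]
 have J: "ideal (fst`H) R" using graph_mod_dom[OF H] .
 have "\<forall>x\<in>X. \<exists>r. (x\<otimes>u, r)\<in>H" using u(3) by force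
 then obtain e where e: "!!x. x\<in>X ==> (x\<otimes>u, e x)\<in>H" by metis
 have "\<exists>w\<in>CR. \<forall>x\<in>X. x\<otimes>w\<ominus>Xp\<otimes>e x\<in>qx (Suc k)"
 proof (rule solve_params)
  show "e x\<in>CR" if "x\<in>X" for x using e[OF that] D(2) by blast
  show "x\<otimes>e y\<ominus>y\<otimes>e x\<in>qx k" if "x\<in>X" "y\<in>X" for x y
  proof -
   have c: "x\<in>CR" "y\<in>CR" using that X_carr by auto
   have "(x\<otimes>(y\<otimes>u), x\<otimes>e y)\<in>H" "(y\<otimes>(x\<otimes>u), y\<otimes>e x)\<in>H" using D(5) e that c by blast+
   moreover have "x\<otimes>(y\<otimes>u) = y\<otimes>(x\<otimes>u)" using c u by (simp add: m_lcomm)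
   ultimately show ?thesis using graph_mod_unique[OF H] by simp
  qed
 qed
 then obtain w where w: "w\<in>CR" "!!x. x\<in>X ==> x\<otimes>w\<ominus>Xp\<otimes>e x\<in>qx (Suc k)" by blast
 define H' where "H' = {(a\<oplus>c\<otimes>u, Xp\<otimes>r\<oplus>c\<otimes>w) | a r c. (a, r)\<in>H\<and>c\<in>CR}"
 note q = qx_ideal[of "Suc k"]
 have mm: "\<exists>r. (c\<otimes>u, r)\<in>H\<and>c\<otimes>w\<ominus>Xp\<otimes>r\<in>qx (Suc k)" if c: "c\<in>\<mm>" for c
 proof -
  let ?S = "{c\<in>CR. \<exists>r. (c\<otimes>u, r)\<in>H\<and>c\<otimes>w\<ominus>Xp\<otimes>r\<in>qx (Suc k)}"
  have "ideal ?S R"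
  proof (rule idealI_cring)
   show "\<zero>\<in>?S" using D(3) u w Xp_carr ideal_zero[OF q] by (auto intro!: exI[of _ \<zero>] simp: a_minus_def)
   fix a b assume "a\<in>?S"
   then obtain r where a: "a\<in>CR" "(a\<otimes>u, r)\<in>H" "a\<otimes>w\<ominus>Xp\<otimes>r\<in>qx (Suc k)" by blast
   have rc: "r\<in>CR" using a D(2) by blast
   { assume "b\<in>?S"
    then obtain t where b: "b\<in>CR" "(b\<otimes>u, t)\<in>H" "b\<otimes>w\<ominus>Xp\<otimes>t\<in>qx (Suc k)" by blast
    have tc: "t\<in>CR" using b D(2) by blast
    have "((a\<oplus>b)\<otimes>u, r\<oplus>t)\<in>H" using D(4)[OF a(2) b(2)] a(1) b(1) u by (simp add: l_distr)
    moreover have "(a\<oplus>b)\<otimes>w\<ominus>Xp\<otimes>(r\<oplus>t) = (a\<otimes>w\<ominus>Xp\<otimes>r)\<oplus>(b\<otimes>w\<ominus>Xp\<otimes>t)"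
     using a(1) b(1) rc tc w(1) Xp_carr by (simp add: cr_simps)
    ultimately show "a\<oplus>b\<in>?S" using ideal_add[OF q a(3) b(3)] a(1) b(1) by auto }
   assume b: "b\<in>CR"
   have "((b\<otimes>a)\<otimes>u, b\<otimes>r)\<in>H" using D(5)[OF b a(2)] a(1) b u by (simp add: m_assoc)
   moreover have "(b\<otimes>a)\<otimes>w\<ominus>Xp\<otimes>(b\<otimes>r) = b\<otimes>(a\<otimes>w\<ominus>Xp\<otimes>r)"
    using a(1) b rc w(1) Xp_carr by (simp add: cr_simps)
   ultimately show "b\<otimes>a\<in>?S" using ideal_mult[OF q a(3) b] a(1) b by auto
  qed auto
  moreover have "X\<subseteq>?S" using e w X_carr by blast
  ultimately have "\<mm>\<subseteq>?S" unfolding m_gen by (rule genideal_minimal)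
  thus ?thesis using c by blast
 qed
 have "graph_mod (Suc k) H'" unfolding graph_mod_def
 proof (intro conjI allI impI)
  show "H'\<subseteq>CR\<times>CR" unfolding H'_def using D(1,2) u w Xp_carr by auto
  have "\<zero> = \<zero>\<oplus>\<zero>\<otimes>u" "\<zero> = Xp\<otimes>\<zero>\<oplus>\<zero>\<otimes>w" using u w Xp_carr by simp_all
  thus "(\<zero>, \<zero>)\<in>H'" unfolding H'_def using D(3) zero_closed by blast
  fix a r b t assume "(a, r)\<in>H'"
  then obtain a1 r1 c1 where 1: "a = a1\<oplus>c1\<otimes>u" "r = Xp\<otimes>r1\<oplus>c1\<otimes>w" "(a1, r1)\<in>H" "c1\<in>CR"
   unfolding H'_def by blast
  note c1 = D(1,2)[OF 1(3)]
  { assume "(b, t)\<in>H'"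
   then obtain a2 r2 c2 where 2: "b = a2\<oplus>c2\<otimes>u" "t = Xp\<otimes>r2\<oplus>c2\<otimes>w" "(a2, r2)\<in>H" "c2\<in>CR"
    unfolding H'_def by blast
   note c2 = D(1,2)[OF 2(3)]
   have "a\<oplus>b = (a1\<oplus>a2)\<oplus>(c1\<oplus>c2)\<otimes>u" "r\<oplus>t = Xp\<otimes>(r1\<oplus>r2)\<oplus>(c1\<oplus>c2)\<otimes>w"
    unfolding 1(1,2) 2(1,2) using c1 c2 1(4) 2(4) u w Xp_carr by (simp_all add: cr_simps)
   thus "(a\<oplus>b, r\<oplus>t)\<in>H'" unfolding H'_def using D(4)[OF 1(3) 2(3)] 1(4) 2(4) by blast }
  { fix c assume c: "c\<in>CR"
   have "c\<otimes>a = c\<otimes>a1\<oplus>(c\<otimes>c1)\<otimes>u" "c\<otimes>r = Xp\<otimes>(c\<otimes>r1)\<oplus>(c\<otimes>c1)\<otimes>w"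
    unfolding 1(1,2) using c1 1(4) c u w Xp_carr by (simp_all add: cr_simps)
   thus "(c\<otimes>a, c\<otimes>r)\<in>H'" unfolding H'_def using D(5)[OF c 1(3)] 1(4) c by blast }
 next
  fix t assume "(\<zero>, t)\<in>H'"
  then obtain a r c where 1: "\<zero> = a\<oplus>c\<otimes>u" "t = Xp\<otimes>r\<oplus>c\<otimes>w" "(a, r)\<in>H" "c\<in>CR"
   unfolding H'_def by blast
  note ac = D(1,2)[OF 1(3)]
  have aJ: "a\<in>fst`H" using 1(3) by force
  have cu: "c\<otimes>u\<in>fst`H"
   using ideal_add_cancel[OF J aJ, of "c\<otimes>u"] ideal_zero[OF J] 1(1,4) u by simp
  have "c\<in>\<mm>"
  proof (rule ccontr)
   assume "c\<notin>\<mm>"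
   hence "u\<in>fst`H" using unit_cancel[OF _ u(1) J cu] 1(4) by blast
   thus False using u by blast
  qed
  then obtain r' where r': "(c\<otimes>u, r')\<in>H" "c\<otimes>w\<ominus>Xp\<otimes>r'\<in>qx (Suc k)" using mm by blast
  have rc': "r'\<in>CR" using r' D(2) by blast
  have "(\<zero>, r\<oplus>r')\<in>H" using D(4)[OF 1(3) r'(1)] 1(1) by simp
  hence "Xp\<otimes>(r\<oplus>r')\<in>qx (Suc k)" using D(6) Xp_qx by blast
  hence "Xp\<otimes>(r\<oplus>r')\<oplus>(c\<otimes>w\<ominus>Xp\<otimes>r')\<in>qx (Suc k)" using ideal_add[OF q _ r'(2)] by blast
  moreover have id: "p\<otimes>(r\<oplus>r')\<oplus>(cw\<ominus>p\<otimes>r') = p\<otimes>r\<oplus>cw"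
   if [simp]: "p\<in>CR" "r\<in>CR" "r'\<in>CR" "cw\<in>CR" for p r r' cw
   using that by algebra
  ultimately show "t\<in>qx (Suc k)" unfolding 1(2) using Xp_carr ac(2) rc' 1(4) w(1) by simp
 qed
 moreover have "(a, Xp\<otimes>r)\<in>H'" if "(a, r)\<in>H" for a r
 proof -
  have "a = a\<oplus>\<zero>\<otimes>u" "Xp\<otimes>r = Xp\<otimes>r\<oplus>\<zero>\<otimes>w" using that D(1,2)[OF that] u w Xp_carr by simp_all
  thus ?thesis unfolding H'_def using that zero_closed by blast
 qed
 moreover have "fst`H\<subseteq>fst`H'" using calculation(2) by force
 moreover have "u\<in>fst`H'"
 proof -
  have "(\<zero>\<oplus>\<one>\<otimes>u, Xp\<otimes>\<zero>\<oplus>\<one>\<otimes>w)\<in>H'" unfolding H'_def using D(3) one_closed by blast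
  thus ?thesis using u by force
 qed
 ultimately show ?thesis using u(2) by blast
qed

text \<open>Extension by zero on \<open>K\<close> puts powers of all parameters into the domain, so
  a proper domain always has a socle element at which \<open>graph_extend_step\<close> applies. A
  maximal domain is therefore all of \<open>R\<close>, and \<open>g\<close> is the value at 1. Each
  extension costs one step in \<open>k\<close>, which is the origin of \<open>l\<close>.\<close>

lemma baer:
 assumes G: "graph_mod k G"
 shows "\<exists>l. \<exists>g\<in>CR. \<forall>(a, r)\<in>G. a\<otimes>g\<ominus>Xp[^](l::nat)\<otimes>r\<in>qx (k + l)"
proof -
 note D = graph_modD[OF G]
 obtain K where K: "ideal K R" "!!a r. a\<in>K ==> (a, r)\<in>G ==> r\<in>qx k" "!!x. x\<in>X ==> \<exists>n::nat. x[^]n\<in>K"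
  using graph_torsion_complement[OF G] by blast
 define F where "F = (%J. \<exists>l H. graph_mod (k + l) H\<and>J = fst`H\<and>K\<subseteq>J\<and>(\<forall>(a, r)\<in>G. (a, Xp[^](l::nat)\<otimes>r)\<in>H))"
 define H0 where "H0 = {(p\<oplus>a, r) | p a r. p\<in>K\<and>(a, r)\<in>G}"
 have "graph_mod k H0" unfolding graph_mod_def
 proof (intro conjI allI impI)
  show "H0\<subseteq>CR\<times>CR" unfolding H0_def using D(1,2) ideal_carr[OF K(1)] by auto
  have "\<zero> = \<zero>\<oplus>\<zero>" by simp
  thus "(\<zero>, \<zero>)\<in>H0" unfolding H0_def using D(3) ideal_zero[OF K(1)] by blast
  fix a r b t assume "(a, r)\<in>H0"
  then obtain p a1 where 1: "a = p\<oplus>a1" "p\<in>K" "(a1, r)\<in>G" unfolding H0_def by blast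
  have c1: "p\<in>CR" "a1\<in>CR" "r\<in>CR" using 1 D(1,2) ideal_carr[OF K(1)] by blast+
  { assume "(b, t)\<in>H0"
   then obtain q a2 where 2: "b = q\<oplus>a2" "q\<in>K" "(a2, t)\<in>G" unfolding H0_def by blast
   have c2: "q\<in>CR" "a2\<in>CR" "t\<in>CR" using 2 D(1,2) ideal_carr[OF K(1)] by blast+
   have "a\<oplus>b = (p\<oplus>q)\<oplus>(a1\<oplus>a2)" unfolding 1(1) 2(1) using c1 c2 by (simp add: cr_simps)
   thus "(a\<oplus>b, r\<oplus>t)\<in>H0" unfolding H0_def using D(4)[OF 1(3) 2(3)] ideal_add[OF K(1) 1(2) 2(2)] by blast }
  { fix c assume c: "c\<in>CR"
   have "c\<otimes>a = c\<otimes>p\<oplus>c\<otimes>a1" unfolding 1(1) using c1 c by (simp add: r_distr)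
   thus "(c\<otimes>a, c\<otimes>r)\<in>H0" unfolding H0_def using D(5)[OF c 1(3)] ideal_mult[OF K(1) 1(2) c] by blast }
 next
  fix t assume "(\<zero>, t)\<in>H0"
  then obtain p a where 1: "\<zero> = p\<oplus>a" "p\<in>K" "(a, t)\<in>G" unfolding H0_def by blast
  have "a\<in>K" using ideal_add_cancel[OF K(1) 1(2), of a] ideal_zero[OF K(1)] 1(1) D(1)[OF 1(3)] by simp
  thus "t\<in>qx k" using K(2) 1(3) by blast
 qed
 moreover have "K\<subseteq>fst`H0"
 proof
  fix p assume p: "p\<in>K"
  have "(p\<oplus>\<zero>, \<zero>)\<in>H0" unfolding H0_def using p D(3) by blast
  thus "p\<in>fst`H0" using p ideal_carr[OF K(1)] by force
 qed
 moreover have "(a, Xp[^](0::nat)\<otimes>r)\<in>H0" if "(a, r)\<in>G" for a r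
 proof -
  have "(\<zero>\<oplus>a, r)\<in>H0" unfolding H0_def using that ideal_zero[OF K(1)] by blast
  thus ?thesis using D(1,2)[OF that] by simp
 qed
 ultimately have F0: "F (fst`H0)" unfolding F_def by (intro exI[of _ "0::nat"] exI[of _ H0]) auto
 have Fi: "ideal J R" if "F J" for J
 proof -
  obtain l H where "graph_mod (k + l) H" "J = fst`H" using \<open>F J\<close> unfolding F_def by (elim exE conjE)
  thus ?thesis using graph_mod_dom by simp
 qed
 obtain J where FJ: "F J" and mx: "!!J'. F J' ==> J\<subseteq>J' ==> J' = J"
  using obtain_maximal_ideal[of F, OF F0 Fi] by metis
 obtain l H where H': "graph_mod (k + l) H" "J = fst`H" "K\<subseteq>J" "\<forall>(a, r)\<in>G. (a, Xp[^](l::nat)\<otimes>r)\<in>H"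
  using FJ unfolding F_def by (elim exE conjE)
 have "(a, Xp[^]l\<otimes>r)\<in>H" if "(a, r)\<in>G" for a r using bspec[OF H'(4) that] by simp
 note H = H'(1-3) this
 have Ji: "ideal J R" using graph_mod_dom H by blast
 have "J = CR"
 proof (rule ccontr)
  assume "J\<noteq>CR"
  then obtain u where u: "u\<in>CR - J" "\<forall>p\<in>X. p\<otimes>u\<in>J"
   using exists_socle[OF Ji _ X_carr] K(3) H(3) by blast
  then obtain H' where H': "graph_mod (Suc (k + l)) H'" "fst`H\<subset>fst`H'" "\<forall>(a, r)\<in>H. (a, Xp\<otimes>r)\<in>H'"
   using graph_extend_step[OF H(1), of u] H(2) by blast
  have "(a, Xp[^]Suc l\<otimes>r)\<in>H'" if "(a, r)\<in>G" for a r
  proof -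
   have "(a, Xp\<otimes>(Xp[^]l\<otimes>r))\<in>H'" using H'(3) H(4)[OF that] by blast
   thus ?thesis using D(2)[OF that] Xp_carr by (simp add: cr_simps)
  qed
  hence "F (fst`H')" unfolding F_def using H' H by (intro exI[of _ "Suc l"] exI[of _ H']) auto
  thus False using mx[of "fst`H'"] H'(2) H(2) by blast
 qed
 hence "\<one>\<in>fst`H" using H(2) by simp
 then obtain g where g: "(\<one>, g)\<in>H" by force
 note DH = graph_modD[OF H(1)]
 have "a\<otimes>g\<ominus>Xp[^]l\<otimes>r\<in>qx (k + l)" if "(a, r)\<in>G" for a r
 proof (rule graph_mod_unique[OF H(1) _ H(4)[OF that]])
  have "(a\<otimes>\<one>, a\<otimes>g)\<in>H" using DH(5)[OF D(1)[OF that] g] .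
  thus "(a, a\<otimes>g)\<in>H" using D(1)[OF that] by simp
 qed
 thus ?thesis using DH(2)[OF g] by blast
qed

section \<open>Baer's criterion for submodules of finite free modules\<close>

definition vgraph_mod :: "nat => nat => ((bool list => 'a)\<times>'a) set => bool" where
 "vgraph_mod n k G \<longleftrightarrow> (\<forall>v r. (v, r)\<in>G --> vec v\<and>r\<in>CR)\<and>(vz, \<zero>)\<in>G\<and>
  (\<forall>a r b t. (a, r)\<in>G --> (b, t)\<in>G --> (va a b, r\<oplus>t)\<in>G)\<and>
  (\<forall>c a r. c\<in>CR --> (a, r)\<in>G --> (vm c a, c\<otimes>r)\<in>G)\<and>
  (\<forall>v r. (v, r)\<in>G --> (\<forall>bs. length bs = n --> v bs = \<zero>) --> r\<in>qx k)"

lemma vgraph_modD: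
 assumes "vgraph_mod n k G"
 shows "(v, r)\<in>G ==> vec v" "(v, r)\<in>G ==> r\<in>CR" "(vz, \<zero>)\<in>G"
  "(v, r)\<in>G ==> (w, t)\<in>G ==> (va v w, r\<oplus>t)\<in>G"
  "c\<in>CR ==> (v, r)\<in>G ==> (vm c v, c\<otimes>r)\<in>G"
  "(v, r)\<in>G ==> (!!bs. length bs = n ==> v bs = \<zero>) ==> r\<in>qx k"
proof -
 note D = assms[unfolded vgraph_mod_def]
 show "(v, r)\<in>G ==> vec v" "(v, r)\<in>G ==> r\<in>CR" using D[THEN conjunct1] by blast+
 show "(vz, \<zero>)\<in>G" using D[THEN conjunct2, THEN conjunct1] .
 show "(v, r)\<in>G ==> (w, t)\<in>G ==> (va v w, r\<oplus>t)\<in>G"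
  using D[THEN conjunct2, THEN conjunct2, THEN conjunct1] by blast
 show "c\<in>CR ==> (v, r)\<in>G ==> (vm c v, c\<otimes>r)\<in>G"
  using D[THEN conjunct2, THEN conjunct2, THEN conjunct2, THEN conjunct1] by blast
 show "(v, r)\<in>G ==> (!!bs. length bs = n ==> v bs = \<zero>) ==> r\<in>qx k"
  using D[THEN conjunct2, THEN conjunct2, THEN conjunct2, THEN conjunct2] by blast
qed

text \<open>The functional is first extended from the vectors with zero second half; the rest of it
  factors through the second half and is extended there. The two extensions happen at successive
  stages, so \<open>l0\<close> and \<open>l1\<close> add up.\<close>

lemma vector_baer:
 assumes "vgraph_mod n k G"
 shows "\<exists>l g. vec g\<and>(\<forall>(v, r)\<in>G. pr n v g\<ominus>Xp[^](l::nat)\<otimes>r\<in>qx (k + l))"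
 using assms
proof (induction n arbitrary: k G)
 case 0
 note D = vgraph_modD[OF "0.prems"]
 define G0 where "G0 = {(v [], r) | v r. (v, r)\<in>G}"
 have gm: "graph_mod k G0" unfolding graph_mod_def
 proof (intro conjI allI impI)
  show "G0\<subseteq>CR\<times>CR"
  proof
   fix p assume "p\<in>G0"
   then obtain v r where "p = (v [], r)" "(v, r)\<in>G" unfolding G0_def by blast
   thus "p\<in>CR\<times>CR" using D(1,2)[of v r] by simp
  qed
  show "(\<zero>, \<zero>)\<in>G0" unfolding G0_def using D(3) by force
  fix a r b t assume "(a, r)\<in>G0"
  then obtain v where v: "a = v []" "(v, r)\<in>G" unfolding G0_def by blast
  { assume "(b, t)\<in>G0"
   then obtain w where w: "b = w []" "(w, t)\<in>G" unfolding G0_def by blast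
   have "a\<oplus>b = va v w []" unfolding v w by (simp add: va_def)
   thus "(a\<oplus>b, r\<oplus>t)\<in>G0" unfolding G0_def using D(4)[OF v(2) w(2)] by blast }
  { fix c assume c: "c\<in>CR"
   have "c\<otimes>a = vm c v []" unfolding v by (simp add: vm_def)
   thus "(c\<otimes>a, c\<otimes>r)\<in>G0" unfolding G0_def using D(5)[OF c v(2)] by blast }
 next
  fix r assume "(\<zero>, r)\<in>G0"
  then obtain v where "\<zero> = v []" "(v, r)\<in>G" unfolding G0_def by blast
  thus "r\<in>qx k" using D(6)[of v r] by simp
 qed
 from baer[OF gm] obtain l g where g': "g\<in>CR" "\<forall>(a, r)\<in>G0. a\<otimes>g\<ominus>Xp[^](l::nat)\<otimes>r\<in>qx (k + l)"
  by (elim exE bexE)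
 have g: "g\<in>CR" "!!a r. (a, r)\<in>G0 ==> a\<otimes>g\<ominus>Xp[^](l::nat)\<otimes>r\<in>qx (k + l)"
  using g'(1) bspec[OF g'(2)] by auto
 have "vec (%_. g)" using g by (simp add: vec_def)
 moreover have "pr 0 v (%_. g)\<ominus>Xp[^]l\<otimes>r\<in>qx (k + l)" if "(v, r)\<in>G" for v r
  using g(2)[of "v []" r] that unfolding G0_def by auto
 ultimately show ?case by blast
next
 case (Suc n)
 note D = vgraph_modD[OF Suc.prems]
 define G0 where "G0 = {(hpart False v, r) | v r. (v, r)\<in>G\<and>(\<forall>bs. length bs = n --> hpart True v bs = \<zero>)}"
 have "vgraph_mod n k G0" unfolding vgraph_mod_def
 proof (intro conjI allI impI)
  show "vec v" "r\<in>CR" if "(v, r)\<in>G0" for v r using that D(1,2) unfolding G0_def by auto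
  have "vz = hpart False vz" "\<forall>bs. length bs = n --> hpart True vz bs = \<zero>" by simp_all
  thus "(vz, \<zero>)\<in>G0" unfolding G0_def using D(3) by blast
  fix a r b t assume "(a, r)\<in>G0"
  then obtain v where v: "a = hpart False v" "(v, r)\<in>G" "\<forall>bs. length bs = n --> hpart True v bs = \<zero>" unfolding G0_def by blast
  { assume "(b, t)\<in>G0"
   then obtain w where w: "b = hpart False w" "(w, t)\<in>G" "\<forall>bs. length bs = n --> hpart True w bs = \<zero>" unfolding G0_def by blast
   have "va a b = hpart False (va v w)" "\<forall>bs. length bs = n --> hpart True (va v w) bs = \<zero>"
    using v w by (simp_all add: va_def hpart_def)
   thus "(va a b, r\<oplus>t)\<in>G0" unfolding G0_def using D(4)[OF v(2) w(2)] by blast }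
  { fix c assume c: "c\<in>CR"
   have "vm c a = hpart False (vm c v)" "\<forall>bs. length bs = n --> hpart True (vm c v) bs = \<zero>"
    using v c by (simp_all add: vm_def hpart_def)
   thus "(vm c a, c\<otimes>r)\<in>G0" unfolding G0_def using D(5)[OF c v(2)] by blast }
 next
  fix u r assume "(u, r)\<in>G0" and z: "\<forall>bs. length bs = n --> u bs = \<zero>"
  then obtain v where v: "u = hpart False v" "(v, r)\<in>G" "\<forall>bs. length bs = n --> hpart True v bs = \<zero>"
   unfolding G0_def by blast
  have "v bs = \<zero>" if l: "length bs = Suc n" for bs
  proof -
   obtain b c where bs: "bs = b#c" "length c = n" using l by (cases bs) auto
   show ?thesis unfolding bs app_hpart using v z bs by (cases b) auto
  qed
  thus "r\<in>qx k" using D(6)[OF v(2)] by blast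
 qed
 then obtain l0 g0 where g0: "vec g0" "!!v r. (v, r)\<in>G0 ==> pr n v g0\<ominus>Xp[^](l0::nat)\<otimes>r\<in>qx (k + l0)"
  using Suc.IH by blast
 \<comment> \<open>What the value of \<open>v\<close> leaves after the first half is accounted for.
   By the choice of \<open>g0\<close> it depends, modulo \<open>qx (k + l0)\<close>, only on the
   second half.\<close>
 define f where "f = (%v r. Xp[^]l0\<otimes>r\<ominus>pr n (hpart False v) g0)"
 have fc: "f v r\<in>CR" if "(v, r)\<in>G" for v r unfolding f_def using D(1,2)[OF that] g0(1) Xp_carr by simp
 define G1 where "G1 = {(hpart True v, f v r) | v r. (v, r)\<in>G}"
 have "vgraph_mod n (k + l0) G1" unfolding vgraph_mod_def
 proof (intro conjI allI impI)
  show "vec v" "r\<in>CR" if "(v, r)\<in>G1" for v r using that D(1) fc unfolding G1_def by auto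
  have "vz = hpart True vz" "\<zero> = f vz \<zero>" using g0(1) Xp_carr by (simp_all add: f_def pr_vz a_minus_def)
  thus "(vz, \<zero>)\<in>G1" unfolding G1_def using D(3) by blast
  fix a r b t assume "(a, r)\<in>G1"
  then obtain v r1 where v: "a = hpart True v" "r = f v r1" "(v, r1)\<in>G" unfolding G1_def by blast
  note vc = D(1,2)[OF v(3)]
  { assume "(b, t)\<in>G1"
   then obtain w t1 where w: "b = hpart True w" "t = f w t1" "(w, t1)\<in>G" unfolding G1_def by blast
   note wc = D(1,2)[OF w(3)]
   have "va a b = hpart True (va v w)" using v w by simp
   moreover have "r\<oplus>t = f (va v w) (r1\<oplus>t1)" unfolding v w f_def
    using vc wc g0(1) Xp_carr by (simp add: pr_add_l cr_simps)
   ultimately show "(va a b, r\<oplus>t)\<in>G1" unfolding G1_def using D(4)[OF v(3) w(3)] by blast }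
  { fix c assume c: "c\<in>CR"
   have "vm c a = hpart True (vm c v)" using v c by simp
   moreover have "c\<otimes>r = f (vm c v) (c\<otimes>r1)" unfolding v f_def
    using vc c g0(1) Xp_carr by (simp add: pr_vm_l cr_simps)
   ultimately show "(vm c a, c\<otimes>r)\<in>G1" unfolding G1_def using D(5)[OF c v(3)] by blast }
 next
  fix u t assume "(u, t)\<in>G1" and z: "\<forall>bs. length bs = n --> u bs = \<zero>"
  then obtain v r where v: "u = hpart True v" "t = f v r" "(v, r)\<in>G" unfolding G1_def by blast
  note vc = D(1,2)[OF v(3)]
  have "(hpart False v, r)\<in>G0" unfolding G0_def using v z by blast
  from ideal_neg[OF qx_ideal g0(2)[OF this]]
  show "t\<in>qx (k + l0)" unfolding v f_def using vc g0(1) Xp_carr by (simp add: cr_simps)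
 qed
 then obtain l1 g1 where g1: "vec g1" "!!v r. (v, r)\<in>G1 ==> pr n v g1\<ominus>Xp[^](l1::nat)\<otimes>r\<in>qx (k + l0 + l1)"
  using Suc.IH by blast
 define g where "g = glue \<zero> (vm (Xp[^]l1) g0) g1"
 have "vec g" unfolding g_def using g0 g1 Xp_carr by simp
 moreover have "pr (Suc n) v g\<ominus>Xp[^](l0 + l1)\<otimes>r\<in>qx (k + (l0 + l1))" if vr: "(v, r)\<in>G" for v r
 proof -
  note vc = D(1,2)[OF vr]
  have "pr n (hpart True v) g1\<ominus>Xp[^]l1\<otimes>f v r\<in>qx (k + l0 + l1)"
   using g1(2)[of "hpart True v" "f v r"] vr unfolding G1_def by blast
  moreover have id: "pt\<ominus>x1\<otimes>(x0\<otimes>r\<ominus>pf) = (x1\<otimes>pf\<oplus>pt)\<ominus>(x0\<otimes>x1)\<otimes>r"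
   if [simp]: "pt\<in>CR" "x1\<in>CR" "x0\<in>CR" "r\<in>CR" "pf\<in>CR" for pt x1 x0 r pf
   using that by algebra
  ultimately show ?thesis using vc g0(1) g1(1) Xp_carr
   by (simp add: g_def f_def pr_vm_r nat_pow_mult[symmetric] add.assoc)
 qed
 ultimately show ?case by blast
qed

end

section \<open>Duality\<close>

context cring
begin

lemma pr_disjoint: "vec z ==> vec w ==> (!!bs. length bs = n ==> z bs = \<zero> \<or> w bs = \<zero>) ==> pr n z w = \<zero>"
proof (induction n arbitrary: z w)
 case 0 thus ?case using "0.prems"(3)[of "[]"] by auto
next
 case (Suc n)
 have "pr n (hpart b z) (hpart b w) = \<zero>" for b
  by (rule Suc.IH) (use Suc.prems in \<open>auto simp: hpart_def\<close>)
 thus ?case by simp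
qed

lemma pr_cong_l:
 assumes "vec z" "vec z'" "vec w" "!!bs. length bs = n ==> z bs = z' bs"
 shows "pr n z w = pr n z' w"
proof -
 have "pr n (va z (vn z')) w = \<zero>"
  by (rule pr_disjoint) (use assms in \<open>simp_all add: vapp r_neg\<close>)
 hence "pr n z w\<ominus>pr n z' w = \<zero>" using assms by (simp add: pr_add_l pr_vn_l a_minus_def)
 thus ?thesis using assms by simp
qed

lemma pr_trunc:
 assumes "vec z" "vec g" "homog (coh Y) i z" "length Y' = length Y" "n = length Y"
 shows "pr n z (trunc (chn Y') (- i) g) = pr n z g"
proof -
 have "pr n z (va (trunc (chn Y') (- i) g) (vn g)) = \<zero>"
 proof (rule pr_disjoint)
  fix bs :: "bool list" assume l: "length bs = n"
  have "kdeg (chn Y') bs = - kdeg (coh Y) bs" using assms(4)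
   by (induction Y' Y arbitrary: bs rule: list_induct2) (simp_all split: list.split)
  thus "z bs = \<zero> \<or> va (trunc (chn Y') (- i) g) (vn g) bs = \<zero>"
   using assms l by (cases "kdeg (coh Y) bs = i") (auto simp: homog_def trunc_def va_def vn_def r_neg)
 qed (use assms in simp_all)
 hence "pr n z (trunc (chn Y') (- i) g)\<ominus>pr n z g = \<zero>" using assms by (simp add: pr_add_r pr_vn_r a_minus_def)
 thus ?thesis using assms by simp
qed

end

context noetherian_cring
begin

text \<open>Cohomology of the Koszul complexes is finitely generated, so the vanishing of every class at some
 level is uniform.\<close>

lemma uniform_null:
 assumes Y: "inR Y" and n: "!!z. cocycle Y s {\<zero>} z ==> homog (coh Y) i z ==> null Y s {\<zero>} z"
 shows "\<exists>e. \<forall>z. cocycle Y s {\<zero>} z --> homog (coh Y) i z -->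
  (\<exists>v. vec v\<and>veq (length Y) {\<zero>} (vs (pows Y e) z) (kd (coh (pows Y (s + e))) v))"
proof -
 let ?n = "length Y"
 note J = zeroideal
 define N where "N = (%e. {z. cocycle Y s {\<zero>} z\<and>homog (coh Y) i z\<and>
   (\<exists>v. vec v\<and>veq ?n {\<zero>} (vs (pows Y e) z) (kd (coh (pows Y (s + e))) v))})"
 have "\<exists>E. \<forall>e\<ge>E. N e\<subseteq>N E"
 proof (rule vector_acc[where n = ?n])
  fix e z assume "z\<in>N e"
  then obtain v where z: "cocycle Y s {\<zero>} z" "homog (coh Y) i z" "vec v" "veq ?n {\<zero>} (vs (pows Y e) z) (kd (coh (pows Y (s + e))) v)"
   unfolding N_def by blast
  show vz: "vec z" using z(1) cocycle_vec by blast
  have cz: "vin ?n {\<zero>} (kd (coh (pows Y s)) z)" using z(1) by (simp add: cocycle_def)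
  show "va z w\<in>N e" if wN: "w\<in>N e" for w
  proof -
   obtain u where w: "cocycle Y s {\<zero>} w" "homog (coh Y) i w" "vec u" "veq ?n {\<zero>} (vs (pows Y e) w) (kd (coh (pows Y (s + e))) u)"
    using wN unfolding N_def by blast
   have vw: "vec w" using w(1) cocycle_vec by blast
   have "cocycle Y s {\<zero>} (va z w)" using z(1) w(1) vz vw Y vin_va[OF J cz, of "kd (coh (pows Y s)) w"]
    by (simp add: cocycle_def kd_va)
   moreover have "veq ?n {\<zero>} (vs (pows Y e) (va z w)) (kd (coh (pows Y (s + e))) (va v u))"
    using veq_va[OF J _ _ _ _ z(4) w(4)] z(3) w(3) vz vw Y by (simp add: vs_va kd_va)
   ultimately show ?thesis unfolding N_def mem_Collect_eq using homog_va[OF z(2) w(2)] vec_closed(1)[OF z(3) w(3)] by blast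
  qed
  show "vm r z\<in>N e" if r: "r\<in>CR" for r
  proof -
   have "cocycle Y s {\<zero>} (vm r z)" using vz Y vin_vm[OF J cz r] r by (simp add: cocycle_def kd_vm)
   moreover have "veq ?n {\<zero>} (vs (pows Y e) (vm r z)) (kd (coh (pows Y (s + e))) (vm r v))"
    using veq_vm[OF J _ _ r z(4)] z(3) vz Y r by (simp add: vs_vm kd_vm)
   ultimately show ?thesis unfolding N_def mem_Collect_eq using homog_vm[OF z(2) r] vec_closed(3)[OF r z(3)] by blast
  qed
  show "w\<in>N e" if w: "vec w" "\<forall>bs. length bs = ?n --> z bs = w bs" for w
  proof -
   have k: "kd (coh (pows Y s)) z bs = kd (coh (pows Y s)) w bs" if "length bs = ?n" for bs
    by (rule kd_cong) (use vz w Y that in simp_all)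
   have "cocycle Y s {\<zero>} w" using cz k w(1) vin_cong[of ?n "kd (coh (pows Y s)) z" "kd (coh (pows Y s)) w"]
    by (simp add: cocycle_def)
   moreover have "homog (coh Y) i w" using z(2) w(2) by (simp add: homog_def)
   moreover have "veq ?n {\<zero>} (vs (pows Y e) w) (kd (coh (pows Y (s + e))) v)"
    using z(4) veq_cong[of ?n "vs (pows Y e) z" "vs (pows Y e) w"] w(2) by (simp add: vs_def)
   ultimately show ?thesis unfolding N_def using z(3) by blast
  qed
 next
  show "N e\<subseteq>N (Suc e)" for e
  proof
   fix z assume "z\<in>N e"
   then obtain v where z: "cocycle Y s {\<zero>} z" "homog (coh Y) i z" "vec v" "veq ?n {\<zero>} (vs (pows Y e) z) (kd (coh (pows Y (s + e))) v)"
    unfolding N_def by blast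
   have vz: "vec z" using z(1) cocycle_vec by blast
   have "veq ?n {\<zero>} (vs (pows Y (1 + e)) z) (kd (coh (pows Y (s + e + 1))) (vs (pows Y 1) v))"
    using null_raise[OF Y J vz z(3,4), of 1] .
   thus "z\<in>N (Suc e)" unfolding N_def mem_Collect_eq using z vec_vs[OF pows_carr[OF Y] z(3), of 1] by auto
  qed
 next
  show "vz\<in>N e" for e
  proof -
   have "cocycle Y s {\<zero>} vz" using Y by (simp add: cocycle_def kd_vz vin_vz[OF J])
   moreover have "veq ?n {\<zero>} (vs (pows Y e) vz) (kd (coh (pows Y (s + e))) vz)"
    using Y by (simp add: vs_vz kd_vz veq_refl[OF J])
   ultimately show ?thesis unfolding N_def using homog_vz vec_closed(4) by blast
  qed
 qed
 then obtain E where E: "\<forall>e\<ge>E. N e\<subseteq>N E" by blast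
 have mono: "N e\<subseteq>N (e + f)" for e f
 proof
  fix z assume "z\<in>N e"
  then obtain v where z: "cocycle Y s {\<zero>} z" "homog (coh Y) i z" "vec v" "veq ?n {\<zero>} (vs (pows Y e) z) (kd (coh (pows Y (s + e))) v)"
   unfolding N_def by blast
  have "veq ?n {\<zero>} (vs (pows Y (f + e)) z) (kd (coh (pows Y (s + e + f))) (vs (pows Y f) v))"
   using null_raise[OF Y J cocycle_vec[OF z(1)] z(3,4)] .
  moreover have "f + e = e + f" "s + e + f = s + (e + f)" by simp_all
  ultimately have "veq ?n {\<zero>} (vs (pows Y (e + f)) z) (kd (coh (pows Y (s + (e + f)))) (vs (pows Y f) v))" by (simp only:)
  thus "z\<in>N (e + f)" unfolding N_def using z(1,2) vec_vs[OF pows_carr[OF Y] z(3), of f] by blast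
 qed
 have "z\<in>N E" if z: "cocycle Y s {\<zero>} z" "homog (coh Y) i z" for z
 proof -
  obtain e where "z\<in>N e" using n[OF z] z unfolding null_def N_def by blast
  hence "z\<in>N (E + e)" using mono[of e E] by (simp add: add.commute subset_iff)
  thus ?thesis using E by (meson le_add1 subsetD)
 qed
 thus ?thesis unfolding N_def by blast
qed

end

section \<open>Koszul duality and local duality\<close>

context local_parameters
begin

lemma homog_chn_neg: "length Y' = length Y ==> homog (chn Y') (- i) w \<longleftrightarrow> homog (coh Y) i w"
 by (rule homog_chn)

text \<open>The modules \<open>R / qx k\<close> exhaust an injective module that detects nonzero elements; pairing with it
 turns vanishing of maps on Koszul cohomology into vanishing of the dual maps on Koszul homology.\<close>

lemma koszul_duality:
 assumes Y: "inR Y"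
 shows "(\<forall>s z. cocycle Y s {\<zero>} z --> homog (coh Y) i z --> null Y s {\<zero>} z) \<longleftrightarrow>
  pro_zero (mixL Y []) (mixW Y []) (%s k. qx k) (%f. Xp[^]f) (- i)" (is "?A \<longleftrightarrow> ?B")
proof -
 let ?n = "length Y"
 note J = zeroideal
 define D where "D = (%s. kd (coh (pows Y s)))"
 define D' where "D' = (%s. kd (chn (pows Y s)))"
 have Dv [simp]: "vec (D s z)" "vec (D' s z)" if "vec z" for s z using that Y by (simp_all add: D_def D'_def)
 have Uv [simp]: "vec (vs (pows Y e) z)" if "vec z" for e z using that Y by simp
 have Xpc [simp]: "Xp[^](f::nat)\<in>CR" for f using Xp_carr by simp
 have adj: "pr ?n (D s z) w = pr ?n z (D' s w)" if "vec z" "vec w" for s z w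
  using pr_adjoint[of "pows Y s" z w] that Y by (simp add: D_def D'_def)
 have adjU: "pr ?n (vs (pows Y e) z) w = pr ?n z (vs (pows Y e) w)" if "vec z" "vec w" for e z w
  using pr_vs[of "pows Y e" ?n z w] that Y by simp
 have Dlin: "D s (va z w) = va (D s z) (D s w)" "D s (vm r z) = vm r (D s z)"
  if "vec z" "vec w" "r\<in>CR" for s z w r using that Y by (simp_all add: D_def kd_va kd_vm)
 have B_iff: "?B \<longleftrightarrow> (\<forall>s. \<exists>e. \<forall>k w. vec w --> homog (coh Y) i w --> vin ?n (qx k) (D' (s + e) w) -->
   (\<exists>f v. vec v\<and>veq ?n (qx (k + f)) (vm (Xp[^]f) (vs (pows Y e) w)) (D' s v)))"
  unfolding pro_zero_def mixL_def mixW_def D'_def pows_simps list.map append_Nil2 length_map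
  using homog_chn_neg[of "pows Y 0" Y i] by simp
 show ?thesis
 proof
  assume A: ?A
  show ?B unfolding B_iff
  proof
   fix s
   obtain e where e: "!!z. cocycle Y s {\<zero>} z ==> homog (coh Y) i z ==>
     \<exists>v. vec v\<and>veq ?n {\<zero>} (vs (pows Y e) z) (D (s + e) v)"
    using uniform_null[OF Y, of s i] A unfolding D_def by blast
   show "\<exists>e. \<forall>k w. vec w --> homog (coh Y) i w --> vin ?n (qx k) (D' (s + e) w) -->
    (\<exists>f v. vec v\<and>veq ?n (qx (k + f)) (vm (Xp[^]f) (vs (pows Y e) w)) (D' s v))"
   proof (rule exI[of _ e], intro allI impI)
    fix k w assume w: "vec w" "homog (coh Y) i w" "vin ?n (qx k) (D' (s + e) w)"
    \<comment> \<open>A functional on boundaries. It is well defined because a cocycle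
      \<open>z\<close> becomes a boundary at level \<open>s + e\<close>, and \<open>w\<close> is a
      cycle there modulo \<open>qx k\<close>. By adjunction, an extension of it to all cochains is a
      chain whose boundary is the image of \<open>w\<close> in degree \<open>- i\<close>.\<close>
    define G where "G = {(D s z, pr ?n (vs (pows Y e) z) w) | z. vec z\<and>homog (coh Y) i z}"
    have "vgraph_mod ?n k G" unfolding vgraph_mod_def
    proof (intro conjI allI impI)
     show "vec v" "r\<in>CR" if "(v, r)\<in>G" for v r using that w unfolding G_def by auto
     have "vz = D s vz" "\<zero> = pr ?n (vs (pows Y e) vz) w" using Y w by (simp_all add: D_def kd_vz vs_vz pr_vz)
     thus "(vz, \<zero>)\<in>G" unfolding G_def using homog_vz vec_closed(4) by blast
     fix a r b t assume "(a, r)\<in>G"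
     then obtain z where z: "a = D s z" "r = pr ?n (vs (pows Y e) z) w" "vec z" "homog (coh Y) i z" unfolding G_def by blast
     { assume "(b, t)\<in>G"
     then obtain z' where z': "b = D s z'" "t = pr ?n (vs (pows Y e) z') w" "vec z'" "homog (coh Y) i z'" unfolding G_def by blast
     have "va a b = D s (va z z')" "r\<oplus>t = pr ?n (vs (pows Y e) (va z z')) w"
     unfolding z z' using z z' w Y by (simp_all add: D_def kd_va vs_va pr_add_l)
     thus "(va a b, r\<oplus>t)\<in>G" unfolding G_def using z z' homog_va vec_closed(1) by blast }
     { fix c assume c: "c\<in>CR"
     have "vm c a = D s (vm c z)" "c\<otimes>r = pr ?n (vs (pows Y e) (vm c z)) w"
     unfolding z using z w Y c by (simp_all add: D_def kd_vm vs_vm pr_vm_l)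
     thus "(vm c a, c\<otimes>r)\<in>G" unfolding G_def using z c homog_vm vec_closed(3) by blast }
    next
     fix v r assume "(v, r)\<in>G" and v0: "\<forall>bs. length bs = ?n --> v bs = \<zero>"
     then obtain z where z: "v = D s z" "r = pr ?n (vs (pows Y e) z) w" "vec z" "homog (coh Y) i z" unfolding G_def by blast
     have "cocycle Y s {\<zero>} z" using z v0 unfolding cocycle_def vin_def D_def by simp
     then obtain u where u: "vec u" "veq ?n {\<zero>} (vs (pows Y e) z) (D (s + e) u)" using e z(4) by blast
     have "vs (pows Y e) z bs = D (s + e) u bs" if "length bs = ?n" for bs
     proof -
     have "vs (pows Y e) z bs\<ominus>D (s + e) u bs = \<zero>"
     using u that z(3) by (simp add: veq_def vin_def vapp a_minus_def)
     thus ?thesis using u(1) z(3) by simp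
     qed
     hence "r = pr ?n (D (s + e) u) w" unfolding z using u(1) z(3) w(1) by (intro pr_cong_l) simp_all
     also have "\<dots> = pr ?n u (D' (s + e) w)" using adj u(1) w(1) by blast
     also have "\<dots>\<in>qx k" using pr_ideal[OF qx_ideal u(1)] w by simp
     finally show "r\<in>qx k" .
    qed
    from vector_baer[OF this] obtain l g where g: "vec g"
     "\<forall>(v, r)\<in>G. pr ?n v g\<ominus>Xp[^](l::nat)\<otimes>r\<in>qx (k + l)" by (elim exE conjE)
    \<comment> \<open>Pairing with \<open>g\<close> is prescribed only on boundaries of cochains of
      degree \<open>i\<close>. Cutting \<open>g\<close> to degree \<open>- i - 1\<close> cuts its
      boundary to degree \<open>- i\<close>, where \<open>w\<close> lives.\<close>
    define v where "v = trunc (chn (pows Y s)) (- i - 1) g"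
    have vv: "vec v" unfolding v_def using g by simp
    have Dv': "D' s v = trunc (chn (pows Y s)) (- i) (D' s g)"
     unfolding v_def D'_def using kd_trunc[of "chn (pows Y s)" g "- i - 1"] Y g(1) by simp
    have "va (vm (Xp[^]l) (vs (pows Y e) w)) (vn (D' s v)) bs\<in>qx (k + l)" if l: "length bs = ?n" for bs
    proof -
     have kb: "kdeg (chn (pows Y s)) bs = - kdeg (coh Y) bs"
     proof -
     have "kdeg (chn (pows Y s)) bs = - kdeg (coh (pows Y s)) bs"
     by (induction Y arbitrary: bs) (simp_all split: list.split)
     thus ?thesis using kdeg_cong[of "coh (pows Y s)" "coh Y"] by (simp add: pows_def comp_def)
     qed
     show ?thesis
     proof (cases "kdeg (coh Y) bs = i")
     case True
     have u: "homog (coh Y) i (unitv bs)" unfolding homog_def unitv_def using True by auto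
     have "(D s (unitv bs), pr ?n (vs (pows Y e) (unitv bs)) w)\<in>G" unfolding G_def using u unitv_vec by blast
     from bspec[OF g(2) this]
     have "pr ?n (D s (unitv bs)) g\<ominus>Xp[^]l\<otimes>pr ?n (vs (pows Y e) (unitv bs)) w\<in>qx (k + l)" by simp
     hence "D' s g bs\<ominus>Xp[^]l\<otimes>vs (pows Y e) w bs\<in>qx (k + l)"
     using adj[OF unitv_vec g(1)] adjU[OF unitv_vec w(1)] pr_unitv l g(1) w(1) by simp
     from ideal_neg[OF qx_ideal this]
     show ?thesis using g(1) w(1) vv True kb by (simp add: Dv' trunc_def vapp cr_simps)
     next
     case False
     hence "w bs = \<zero>" using w(2) l unfolding homog_def by simp
     hence "vs (pows Y e) w bs = \<zero>" using Y by (simp add: vs_def)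
     thus ?thesis using False kb g(1) w(1) ideal_zero[OF qx_ideal]
     by (simp add: Dv' trunc_def va_def vn_def vm_def)
     qed
    qed
    thus "\<exists>f v. vec v\<and>veq ?n (qx (k + f)) (vm (Xp[^]f) (vs (pows Y e) w)) (D' s v)"
     using vv unfolding veq_def vin_def by blast
   qed
  qed
 next
  assume B: ?B
  show ?A
  proof (intro allI impI)
   fix s z assume z: "cocycle Y s {\<zero>} z" "homog (coh Y) i z"
   have vz: "vec z" using z(1) cocycle_vec by blast
   obtain e where e: "!!k w. vec w ==> homog (coh Y) i w ==> vin ?n (qx k) (D' (s + e) w) ==>
     \<exists>f v. vec v\<and>veq ?n (qx (k + f)) (vm (Xp[^]f) (vs (pows Y e) w)) (D' s v)"
    using B unfolding B_iff by blast
   define u where "u = vs (pows Y e) z"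
   have vu [simp]: "vec u" unfolding u_def using vz by simp
   have "\<exists>v. vec v\<and>veq ?n {\<zero>} u (D (s + e) v)"
   proof (rule ccontr)
    assume no: "\<not> ?thesis"
    \<comment> \<open>The annihilator of the class of \<open>u\<close>; it is proper if that class
      is not zero.\<close>
    define I where "I = {c\<in>CR. \<exists>v. vec v\<and>veq ?n {\<zero>} (vm c u) (D (s + e) v)}"
    have "ideal I R"
    proof (rule idealI_cring)
     show "I\<subseteq>CR" unfolding I_def by blast
     have "veq ?n {\<zero>} (vm \<zero> u) (D (s + e) vz)"
     using Y by (intro veq_eq[OF J]) (simp_all add: D_def kd_vz vm_def)
     thus "\<zero>\<in>I" unfolding I_def using vec_closed(4) by blast
     fix a b assume "a\<in>I"
     then obtain v where v: "a\<in>CR" "vec v" "veq ?n {\<zero>} (vm a u) (D (s + e) v)" unfolding I_def by blast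
     { assume "b\<in>I"
     then obtain w where w: "b\<in>CR" "vec w" "veq ?n {\<zero>} (vm b u) (D (s + e) w)" unfolding I_def by blast
     have "veq ?n {\<zero>} (va (vm a u) (vm b u)) (D (s + e) (va v w))"
     using veq_va[OF J _ _ _ _ v(3) w(3)] v w Dlin(1)[OF v(2) w(2) v(1)] by simp
     moreover have "va (vm a u) (vm b u) = vm (a\<oplus>b) u" using v w by (intro ext) (simp add: vapp l_distr)
     ultimately show "a\<oplus>b\<in>I" unfolding I_def mem_Collect_eq using vec_closed(1)[OF v(2) w(2)] a_closed[OF v(1) w(1)] by metis }
     assume b: "b\<in>CR"
     have "veq ?n {\<zero>} (vm b (vm a u)) (D (s + e) (vm b v))"
     using veq_vm[OF J _ _ b v(3)] v b Dlin(2)[OF v(2) v(2) b] by simp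
     moreover have "vm b (vm a u) = vm (b\<otimes>a) u" using v b by (intro ext) (simp add: vapp m_assoc)
     ultimately show "b\<otimes>a\<in>I" unfolding I_def mem_Collect_eq using vec_closed(3)[OF b v(2)] m_closed[OF b v(1)] by metis
    qed
    moreover have "\<one>\<notin>I"
    proof
     assume "\<one>\<in>I"
     moreover have "vm \<one> u = u" by (intro ext) (simp add: vapp)
     ultimately show False using no unfolding I_def by auto
    qed
    ultimately have Im: "I\<subseteq>\<mm>" using proper_ideal_sub_m by auto
    \<comment> \<open>The functional that sends boundaries to zero and \<open>u\<close> to 1 in the
      residue field \<open>R / qx 1\<close>. It is well defined because a multiple of
      \<open>u\<close> that is a boundary has its coefficient in \<open>I\<close>, hence in
      \<mm>.\<close>
    define G where "G = {(va (D (s + e) v) (vm c u), c) | v c. vec v\<and>c\<in>CR}"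
    have "vgraph_mod ?n 1 G" unfolding vgraph_mod_def
    proof (intro conjI allI impI)
     show "vec v" "r\<in>CR" if "(v, r)\<in>G" for v r using that unfolding G_def by auto
     have "vz = va (D (s + e) vz) (vm \<zero> u)" using Y by (intro ext) (simp add: D_def kd_vz vapp)
     thus "(vz, \<zero>)\<in>G" unfolding G_def using vec_closed(4) zero_closed by blast
     fix a r b t assume "(a, r)\<in>G"
     then obtain v where v: "a = va (D (s + e) v) (vm r u)" "vec v" "r\<in>CR" unfolding G_def by blast
     { assume "(b, t)\<in>G"
     then obtain w where w: "b = va (D (s + e) w) (vm t u)" "vec w" "t\<in>CR" unfolding G_def by blast
     have "va a b = va (D (s + e) (va v w)) (vm (r\<oplus>t) u)"
     unfolding v w Dlin(1)[OF v(2) w(2) v(3)] using v w by (intro ext) (simp add: vapp cr_simps)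
     thus "(va a b, r\<oplus>t)\<in>G" unfolding G_def using v w vec_closed(1) a_closed by blast }
     { fix c assume c: "c\<in>CR"
     have "vm c a = va (D (s + e) (vm c v)) (vm (c\<otimes>r) u)"
     unfolding v Dlin(2)[OF v(2) v(2) c] using v c by (intro ext) (simp add: vapp cr_simps)
     thus "(vm c a, c\<otimes>r)\<in>G" unfolding G_def using v c vec_closed(3) m_closed by blast }
    next
     fix a r assume "(a, r)\<in>G" and a0: "\<forall>bs. length bs = ?n --> a bs = \<zero>"
     then obtain v where v: "a = va (D (s + e) v) (vm r u)" "vec v" "r\<in>CR" unfolding G_def by blast
     have "veq ?n {\<zero>} (vm r u) (D (s + e) (vm (\<ominus>\<one>) v))"
     proof (rule veq_eq[OF J])
     fix bs :: "bool list" assume l: "length bs = ?n"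
     have "D (s + e) v bs\<oplus>r\<otimes>u bs = \<zero>" using a0 l v by (simp add: vapp)
     hence "r\<otimes>u bs =\<ominus>D (s + e) v bs" using v by (simp add: sum_zero_eq_neg a_comm)
     thus "vm r u bs = D (s + e) (vm (\<ominus>\<one>) v) bs"
     using v Dlin(2)[OF v(2) v(2), of "\<ominus>\<one>"] by (simp add: vapp l_minus)
     qed (use v in simp)
     hence "r\<in>I" unfolding I_def mem_Collect_eq using v vec_closed(3)[OF _ v(2), of "\<ominus>\<one>"] by blast
     hence "r\<in>\<mm>" using Im by blast
     moreover have "qx 1 = \<mm>"
     proof -
     have "(%x. x[^](1::nat))`X = (%x. x)`X" by (rule image_cong) (use X_carr in \<open>auto simp: nat_pow_def\<close>)
     thus ?thesis unfolding qx_def pow_ideal_def m_gen by simp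
     qed
     ultimately show "r\<in>qx 1" by simp
    qed
    from vector_baer[OF this] obtain l g where g: "vec g"
     "\<forall>(v, r)\<in>G. pr ?n v g\<ominus>Xp[^](l::nat)\<otimes>r\<in>qx (1 + l)" by (elim exE conjE)
    have g1: "pr ?n (D (s + e) v) g\<in>qx (1 + l)" if "vec v" for v
    proof -
     have "(va (D (s + e) v) (vm \<zero> u), \<zero>)\<in>G" unfolding G_def using that zero_closed by blast
     from bspec[OF g(2) this] show ?thesis using that g(1) Xp_carr by (simp add: pr_add_l pr_vm_l a_minus_def)
    qed
    have g2: "pr ?n u g\<ominus>Xp[^]l\<in>qx (1 + l)"
    proof -
     have "(va (D (s + e) vz) (vm \<one> u), \<one>)\<in>G" unfolding G_def using vec_closed(4) one_closed by blast
     from bspec[OF g(2) this] show ?thesis using g(1) Xp_carr Y by (simp add: pr_add_l pr_vm_l D_def kd_vz pr_vz)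
    qed
    define w where "w = trunc (chn (pows Y (s + e))) (- i) g"
    have vw [simp]: "vec w" unfolding w_def using g by simp
    have hw: "homog (coh Y) i w" using trunc_homog[of "chn (pows Y (s + e))" "- i" g] homog_chn_neg[of "pows Y (s + e)" Y i w]
     unfolding w_def by simp
    have "vin ?n (qx (1 + l)) (D' (s + e) w)" unfolding vin_def
    proof (intro allI impI)
     fix bs :: "bool list" assume lb: "length bs = ?n"
     have "D' (s + e) w = trunc (chn (pows Y (s + e))) (- i + 1) (D' (s + e) g)"
     unfolding w_def D'_def using kd_trunc[of "chn (pows Y (s + e))" g "- i"] Y g(1) by simp
     moreover have "D' (s + e) g bs\<in>qx (1 + l)"
     using g1[OF unitv_vec, of bs] adj[OF unitv_vec g(1)] pr_unitv[of "D' (s + e) g" bs] lb g(1) by simp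
     ultimately show "D' (s + e) w bs\<in>qx (1 + l)" using ideal_zero[OF qx_ideal] by (simp add: trunc_def)
    qed
    then obtain f v where v: "vec v" "veq ?n (qx (1 + l + f)) (vm (Xp[^]f) (vs (pows Y e) w)) (D' s v)"
     using e[OF vw hw] by blast
    \<comment> \<open>The cocycle \<open>z\<close> pairs to zero with the boundary
      \<open>D' s v\<close>, so after cancelling \<open>Xp[^]f\<close> the pairing of
      \<open>u\<close> and \<open>w\<close> lies in \<open>qx (1 + l)\<close>. But modulo this ideal
      the pairing is \<open>Xp[^]l\<close>, and cancelling that power puts 1 into
      \<open>qx 1\<close>.\<close>
    have "pr ?n z (va (vm (Xp[^]f) (vs (pows Y e) w)) (vn (D' s v)))\<in>qx (1 + l + f)"
     using v vz by (intro pr_ideal[OF qx_ideal]) (simp_all add: veq_def)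
    moreover have "pr ?n z (va (vm (Xp[^]f) (vs (pows Y e) w)) (vn (D' s v))) = Xp[^]f\<otimes>pr ?n u w"
    proof -
     have "pr ?n z (D' s v) = pr ?n (D s z) v" using adj[OF vz v(1)] by simp
     also have "\<dots> = \<zero>" using z(1) vz v(1) using Dv(1)[OF vz, of s] by (intro pr_disjoint) (simp_all add: D_def cocycle_def vin_def)
     finally have "pr ?n z (D' s v) = \<zero>" .
     thus ?thesis using adjU[OF vz vw, of e] vz v(1) Xp_carr unfolding u_def
     by (simp add: pr_add_r pr_vm_r pr_vn_r)
    qed
    ultimately have "Xp[^]f\<otimes>pr ?n u w\<in>qx (1 + l + f)" by simp
    hence "pr ?n u w\<in>qx (1 + l)" by (rule cancel_param_product_pow[rotated]) simp
    moreover have "pr ?n u w = pr ?n u g" unfolding w_def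
    proof (rule pr_trunc)
     show "homog (coh Y) i u" unfolding u_def using homog_vs[OF pows_carr[OF Y] z(2)] .
    qed (use g in simp_all)
    ultimately have a: "pr ?n u g\<in>qx (1 + l)" by simp
    have "Xp[^]l\<in>qx (1 + l)"
    proof -
     have "\<ominus>(pr ?n u g\<ominus>Xp[^]l)\<oplus>pr ?n u g\<in>qx (1 + l)"
     using ideal_add[OF qx_ideal ideal_neg[OF qx_ideal g2] a] .
     moreover have id: "\<ominus>(p\<ominus>x)\<oplus>p = x" if "p\<in>CR" "x\<in>CR" for p x
     using that by (simp add: minus_add a_minus_def a_comm[of "\<ominus>p" x] a_assoc l_neg)
     ultimately show ?thesis using g(1) by simp
    qed
    hence "Xp[^]l\<otimes>\<one>\<in>qx (1 + l)" using Xp_carr by simp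
    hence "\<one>\<in>qx 1" by (rule cancel_param_product_pow[rotated]) simp
    moreover have "qx 1\<subseteq>\<mm>"
     unfolding qx_def
    proof (rule pow_ideal_least[OF m_ideal])
     fix a assume "a\<in>X"
     thus "a[^](1::nat)\<in>\<mm>" unfolding m_gen using genideal_self[OF X_carr] X_carr by (auto simp: subset_iff)
    qed
    ultimately have "\<one>\<in>\<mm>" by blast
    thus False using prime_one[OF m_prime] by blast
   qed
   thus "null Y s {\<zero>} z" unfolding null_def u_def D_def by blast
  qed
 qed
qed

text \<open>The two strippings start from one mixed complex without relations. There the factor is a
  power of the empty product, which is how the factors \<open>Xp[^]f\<close> on one side and 1 on
  the other become compatible. The shift by the number of parameters turns degree \<open>- i\<close>
  into the degree on the right.\<close>

theorem local_duality:
 assumes Y: "inR Y" and xs: "distinct xs" "set xs = X"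
 shows "(\<forall>s z. cocycle Y s {\<zero>} z --> homog (coh Y) i z --> null Y s {\<zero>} z) \<longleftrightarrow>
  (\<forall>s. \<exists>e. \<forall>k z. cocycle xs k (Idl (set (pows Y (s + e)))) z --> homog (coh xs) (int (length xs) - i) z -->
    null xs k (Idl (set (pows Y s))) z)"
proof -
 have xc: "inR xs" using xs X_carr by simp
 let ?j = "int (length xs) - i"
 have q: "Idl (set (pows (xs@[]) k)) = qx k" for k
  by (simp add: qx_def pow_ideal_def pows_def xs)
 have p: "prodl (xs@[])[^]f = Xp[^](f::nat)" for f
 proof -
  have "prodl zs = finprod R (%x. x) (set zs)" if "distinct zs" "inR zs" for zs
   using that
  proof (induction zs)
   case (Cons a zs)
   hence "finprod R (%x. x) (insert a (set zs)) = a\<otimes>finprod R (%x. x) (set zs)" by (intro finprod_insert) auto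
   thus ?case using Cons by simp
  qed simp
  thus ?thesis using xs X_carr by simp
 qed
 have z: "Idl (set (pows [] k)) = {\<zero>}" for k by (simp add: idl_empty)
 have "(\<forall>s z. cocycle Y s {\<zero>} z --> homog (coh Y) i z --> null Y s {\<zero>} z) \<longleftrightarrow>
   pro_zero (mixL Y []) (mixW Y []) (%s k. qx k) (%f. Xp[^]f) (- i)"
  by (rule koszul_duality[OF Y])
 also have "\<dots> \<longleftrightarrow> pro_zero (mixL Y []) (mixW Y []) (%s k. Idl (set (pows (xs@[]) k))) (%f. prodl (xs@[])[^]f) (?j - int (length xs))"
  unfolding q p by simp
 also have "\<dots> \<longleftrightarrow> pro_zero (mixL Y xs) (mixW Y xs) (%s k. Idl (set (pows [] k))) (%f. prodl [][^]f) ?j"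
 proof (rule pro_zero_strip_coh[symmetric, OF Y _ xc])
  fix B x C k assume e: "xs = C@x#B"
  have "regular_mod (pow_ideal (%_. k) (set B)) (x[^]k)"
   by (rule regular_mod_powers) (use xs e in auto)
  thus "regular_mod (Idl (set (pows (B@[]) k))) (x[^]k)" by (simp add: pow_ideal_def pows_def)
 qed simp
 also have "\<dots> \<longleftrightarrow> pro_zero (mixL Y xs) (mixW Y xs) (%s k. Idl (set (pows [] s))) (%_. \<one>) ?j"
  by (rule pro_zero_cong) simp_all
 also have "\<dots> \<longleftrightarrow> pro_zero (mixL [] xs) (mixW [] xs) (%s k. Idl (set (pows (Y@[]) s))) (%_. \<one>) ?j"
  by (rule pro_zero_strip_chn[OF Y _ xc]) simp
 also have "\<dots> \<longleftrightarrow> (\<forall>s. \<exists>e. \<forall>k z. cocycle xs k (Idl (set (pows Y (s + e)))) z --> homog (coh xs) ?j z -->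
    null xs k (Idl (set (pows Y s))) z)"
 proof -
  have one: "vm \<one> z = z" if "vec z" for z using that by (intro ext) (simp add: vapp)
  have h: "homog (coh (pows xs 0)) ?j = homog (coh xs) ?j" by (rule homog_cong) (simp add: pows_def comp_def)
  have "(\<exists>f v. vec v\<and>veq (length xs) J (vm \<one> (vs (pows xs f) z)) (kd (coh (pows xs (k + f))) v)) \<longleftrightarrow> null xs k J z"
   if "vec z" for J k z unfolding null_def using one[OF vec_vs[OF pows_carr[OF xc] that]] by simp
  thus ?thesis unfolding pro_zero_def mixL_def mixW_def cocycle_def append_Nil2 pows_simps list.map append_Nil length_map h
   by (metis (no_types, lifting))
 qed
 finally show ?thesis .
qed

end

section \<open>Flat base change\<close>

locale endo_cring = noetherian_cring +
 fixes \<phi>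
 assumes phi_hom: "\<phi>\<in>ring_hom R R"
begin

lemma phi_ring_hom_cring: "ring_hom_cring R R \<phi>"
 using phi_hom by unfold_locales

lemmas phi_simps [simp] = ring_hom_closed[OF phi_hom] ring_hom_cring.hom_zero[OF phi_ring_hom_cring]
 ring_hom_one[OF phi_hom] ring_hom_add[OF phi_hom] ring_hom_mult[OF phi_hom]
 ring_hom_cring.hom_a_inv[OF phi_ring_hom_cring] ring_hom_cring.hom_pow[OF phi_ring_hom_cring]

definition pv :: "(bool list => 'a) => bool list => 'a" where "pv v = (%bs. \<phi> (v bs))"

lemma pv_simps [simp]:
 "vec v ==> vec (pv v)" "pv vz = vz" "vec v ==> vec w ==> pv (va v w) = va (pv v) (pv w)"
 "vec v ==> pv (vn v) = vn (pv v)" "vec v ==> r\<in>CR ==> pv (vm r v) = vm (\<phi> r) (pv v)"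
 by (auto simp: vec_def pv_def va_def vn_def vm_def)

lemma hpart_pv: "hpart b (pv z) = pv (hpart b z)" by (auto simp: hpart_def pv_def)

lemma pv_glue: "pv (glue \<zero> z w) = glue \<zero> (pv z) (pv w)"
 by (auto simp: pv_def glue_def fun_eq_iff split: list.splits)

lemma pv_kd: "its L ==> vec z ==> pv (kd L z) = kd (map (map_prod id \<phi>) L) (pv z)"
proof (induction L arbitrary: z)
 case (Cons p L)
 have "its L" "snd p\<in>CR" using Cons.prems by simp_all
 thus ?case using Cons by (simp add: pv_glue hpart_pv)
qed simp

lemma phi_pows: "inR xs ==> map \<phi> (pows xs k) = pows (map \<phi> xs) k"
 by (induction xs) (simp_all add: subset_iff)

lemma coh_phi: "map (map_prod id \<phi>) (coh xs) = coh (map \<phi> xs)" by simp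

lemma map_phi_carr: "inR xs ==> set (map \<phi> xs)\<subseteq>CR" by auto

lemma pv_kd_coh: "inR xs ==> vec z ==> pv (kd (coh (pows xs k)) z) = kd (coh (pows (map \<phi> xs) k)) (pv z)"
 using pv_kd[of "coh (pows xs k)" z] coh_phi[of "pows xs k"] by (simp add: phi_pows)

lemma pv_vs: "inR us ==> vec z ==> pv (vs us z) = vs (map \<phi> us) (pv z)"
proof (induction us arbitrary: z)
 case Nil thus ?case by (auto simp: pv_def vs_def fun_eq_iff)
next
 case (Cons u us)
 have "\<phi> (sel us bs) = sel (map \<phi> us) bs" if "inR us" for us bs using that
  by (induction us arbitrary: bs) (auto split: list.splits)
 from this[OF Cons.prems(1)] show ?case using Cons.prems by (auto simp: pv_def vs_def fun_eq_iff simp del: sel.simps)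
qed

lemma vin_pv: "ideal J R ==> vin n J z ==> vin n (Idl (\<phi>`J)) (pv z)"
 using genideal_self[of "\<phi>`J"] ideal_sub[of J] phi_simps(1) unfolding vin_def pv_def
 by (metis image_eqI image_subset_iff subset_iff)

lemma phi_idl_ideal: "ideal J R ==> ideal (Idl (\<phi>`J)) R"
 by (rule genideal_ideal) (use ideal_carr in auto)

lemma homog_pv: "homog L j z ==> homog L j (pv z)" by (simp add: homog_def pv_def)

lemma cocycle_pv:
 assumes "inR xs" "ideal J R" "cocycle xs k J z"
 shows "cocycle (map \<phi> xs) k (Idl (\<phi>`J)) (pv z)"
 using assms vin_pv[of J "length xs" "kd (coh (pows xs k)) z"] pv_kd_coh[of xs z k] by (simp add: cocycle_def)

lemma null_pv:
 assumes xs: "inR xs" "ideal J R" "vec z" "null xs k J z"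
 shows "null (map \<phi> xs) k (Idl (\<phi>`J)) (pv z)"
proof -
 obtain e v where v: "vec v" "vin (length xs) J (va (vs (pows xs e) z) (vn (kd (coh (pows xs (k + e))) v)))"
  using assms(4) unfolding null_def veq_def by blast
 have "pv (va (vs (pows xs e) z) (vn (kd (coh (pows xs (k + e))) v))) =
   va (vs (pows (map \<phi> xs) e) (pv z)) (vn (kd (coh (pows (map \<phi> xs) (k + e))) (pv v)))"
  using xs v pv_kd_coh[OF xs(1) v(1)] pv_vs[OF pows_carr[OF xs(1)] xs(3)] by (simp add: phi_pows)
 thus ?thesis unfolding null_def veq_def using vin_pv[OF xs(2) v(2)] v(1) by (intro exI[of _ e] exI[of _ "pv v"]) simp
qed

text \<open>The \<open>R\<close>-span of the entrywise images, that is the image of the base change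
  of \<open>V\<close> along \<phi>. As an inductive set it grows by one generator at a time, so
  linear statements follow by induction without finite sums.\<close>

inductive_set phispan :: "(bool list => 'a) set => (bool list => 'a) set" for V where
 phispan_vz: "vz\<in>phispan V"
| phispan_step: "w\<in>phispan V ==> v\<in>V ==> r\<in>CR ==> va w (vm r (pv v))\<in>phispan V"

lemma phispan_vec: "w\<in>phispan V ==> \<forall>v\<in>V. vec v ==> vec w"
 by (induction rule: phispan.induct) simp_all

lemma phispan_lin:
 assumes V: "\<forall>v\<in>V. vec v" and w: "w\<in>phispan V"
 shows "u\<in>phispan V ==> va u w\<in>phispan V" "r\<in>CR ==> vm r w\<in>phispan V" "vn w\<in>phispan V"
proof -
 note pvec = phispan_vec[OF _ V]
 show "va u w\<in>phispan V" if u: "u\<in>phispan V"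
  using w
 proof induction
  case phispan_vz
  have "va u vz = u" using pvec[OF u] by (intro ext) (simp add: vapp)
  thus ?case using u by simp
 next
  case (phispan_step w v r)
  have "va u (va w (vm r (pv v))) = va (va u w) (vm r (pv v))"
   using pvec[OF u] pvec[OF phispan_step(1)] bspec[OF V phispan_step(2)] phispan_step(3)
   by (intro ext) (simp add: vapp a_assoc)
  thus ?case using phispan.phispan_step[OF phispan_step(4,2,3)] by simp
 qed
 show m: "vm r w\<in>phispan V" if r: "r\<in>CR" for r
  using w
 proof induction
  case phispan_vz
  have "vm r vz = vz" using r by (intro ext) (simp add: vapp)
  thus ?case using phispan.phispan_vz by simp
 next
  case (phispan_step w v s)
  have "vm r (va w (vm s (pv v))) = va (vm r w) (vm (r\<otimes>s) (pv v))"
   using r pvec[OF phispan_step(1)] bspec[OF V phispan_step(2)] phispan_step(3)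
   by (intro ext) (simp add: vapp r_distr m_assoc)
  thus ?case using phispan.phispan_step[OF phispan_step(4,2)] r phispan_step(3) by simp
 qed
 show "vn w\<in>phispan V" using m[of "\<ominus>\<one>"] vn_vm[OF pvec[OF w]] by simp
qed

lemma phispan_pv: "v\<in>V ==> vec v ==> r\<in>CR ==> vm r (pv v)\<in>phispan V"
proof -
 assume a: "v\<in>V" "vec v" "r\<in>CR"
 have "va vz (vm r (pv v)) = vm r (pv v)" using a by (intro ext) (simp add: vapp)
 thus ?thesis using phispan_step[OF phispan_vz a(1,3)] by simp
qed

text \<open>Ring elements are wrapped as constant cochains, so that an element of the ideal
  generated by \<phi>(J) can be treated by the same induction over spans.\<close>

lemma phispan_idl:
 assumes J: "ideal J R" and s: "s\<in>Idl (\<phi>`J)"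
 shows "\<exists>u\<in>phispan {%_. j | j. j\<in>J}. u [] = s"
proof -
 let ?V = "{%_. j | j. j\<in>J} :: (bool list => 'a) set"
 have V: "\<forall>v\<in>?V. vec v" using ideal_carr[OF J] by (auto simp: vec_def)
 have "ideal {u [] | u. u\<in>phispan ?V} R"
 proof (rule idealI_cring)
  show "{u [] | u. u\<in>phispan ?V}\<subseteq>CR" using phispan_vec[OF _ V] vecD by blast
  show "\<zero>\<in>{u [] | u. u\<in>phispan ?V}" using phispan_vz[of ?V] by force
  fix a b assume "a\<in>{u [] | u. u\<in>phispan ?V}"
  then obtain u where u: "a = u []" "u\<in>phispan ?V" by blast
  { assume "b\<in>{u [] | u. u\<in>phispan ?V}"
   then obtain w where w: "b = w []" "w\<in>phispan ?V" by blast
   have "va u w\<in>phispan ?V" using phispan_lin(1)[OF V w(2) u(2)] .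
   moreover have "a\<oplus>b = va u w []" using u w by (simp add: va_def)
   ultimately show "a\<oplus>b\<in>{u [] | u. u\<in>phispan ?V}" by blast }
  assume b: "b\<in>CR"
  have "vm b u\<in>phispan ?V" using phispan_lin(2)[OF V u(2) b] .
  moreover have "b\<otimes>a = vm b u []" using u by (simp add: vm_def)
  ultimately show "b\<otimes>a\<in>{u [] | u. u\<in>phispan ?V}" by blast
 qed
 moreover have "\<phi>`J\<subseteq>{u [] | u. u\<in>phispan ?V}"
 proof
  fix a assume "a\<in>\<phi>`J"
  then obtain j where j: "j\<in>J" "a = \<phi> j" by blast
  have "vm \<one> (pv (%_. j))\<in>phispan ?V" using phispan_pv[of "%_. j" ?V \<one>] bspec[OF V, of "%_. j"] j by blast
  moreover have "vm \<one> (pv (%_. j)) [] = a" using j ideal_carr[OF J] by (simp add: vm_def pv_def)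
  ultimately show "a\<in>{u [] | u. u\<in>phispan ?V}" by force
 qed
 ultimately have "Idl (\<phi>`J)\<subseteq>{u [] | u. u\<in>phispan ?V}" by (rule genideal_minimal)
 thus ?thesis using s by blast
qed

lemma phispan_mono:
 assumes "w\<in>phispan V" "!!v. v\<in>V ==> v\<in>W" shows "w\<in>phispan W"
 using assms(1) by induction (use assms(2) phispan.intros in auto)

end

section \<open>Ideals as modules, and flatness in terms of tensor products\<close>

context cring
begin

lemma self_module_module: "module R (self_module R)"
 by (rule moduleI) (auto simp: self_module_def cr_simps intro!: abelian_groupI exI[of _ "\<ominus>_"] is_cring)

lemma ideal_module:
 assumes I: "ideal I R" shows "module R ((self_module R)\<lparr>carrier := I\<rparr>)"
proof -
 note c = ideal_carr[OF I] ideal_add[OF I] ideal_zero[OF I] ideal_neg[OF I]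
 have inv: "\<exists>y\<in>I. y\<oplus>x = \<zero>" if "x\<in>I" for x using c that by (intro bexI[of _ "\<ominus>x"]) (simp_all add: l_neg)
 show ?thesis
  by (rule moduleI) (use c inv in \<open>auto simp: self_module_def cr_simps intro!: abelian_groupI is_cring ideal_mult[OF I]\<close>)
qed

text \<open>The target of the additive maps that are defined on the free abelian group behind a
  tensor product by its universal property.\<close>

definition vgroup :: "(bool list => 'a) monoid" where
 "vgroup = \<lparr>carrier = {v. vec v}, monoid.mult = va, one = vz\<rparr>"

lemma vgroup_comm_group: "comm_group vgroup"
proof (rule comm_groupI)
 fix x assume x: "x\<in>carrier vgroup"
 have "va (vn x) x = vz" using x by (intro ext) (simp add: vgroup_def vapp l_neg)
 thus "\<exists>y\<in>carrier vgroup. y\<otimes>\<^bsub>vgroup\<^esub> x = \<one>\<^bsub>vgroup\<^esub>"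
  using x by (intro bexI[of _ "vn x"]) (simp_all add: vgroup_def)
qed (auto simp: vgroup_def va_def vec_def cr_simps)

end

locale flat_endo = endo_cring +
 assumes flat: "flat_module R (restrict_scalars \<phi> R)"
begin

text \<open>The multiplication map from the tensor product of an ideal \<open>I\<close> with \<open>R\<close> over \<open>\<phi>\<close> to \<open>R\<close> is injective,
 so anything defined on pairs that respects the tensor relations vanishes on its kernel.\<close>

lemma ideal_tensor_kernel:
 assumes I: "ideal I R" and K: "!!u w. u\<in>K ==> w\<in>K ==> va u w\<in>K" "!!w. w\<in>K ==> vn w\<in>K" "vz\<in>K" "!!w. w\<in>K ==> vec w"
  and g: "!!a. a\<in>I ==> vec (g a)"
   "!!a b r. a\<in>I ==> b\<in>I ==> r\<in>CR ==> vm r (pv (va (g (a\<oplus>b)) (vn (va (g a) (g b)))))\<in>K"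
   "!!a b r. a\<in>I ==> b\<in>CR ==> r\<in>CR ==> vm r (pv (va (g (b\<otimes>a)) (vn (vm b (g a)))))\<in>K"
  and h1: "h1\<in>hom (free_Abelian_group (I\<times>CR)) (add_monoid R)" "!!a r. a\<in>I ==> r\<in>CR ==> h1 (frag_of (a, r)) = \<phi> a\<otimes>r"
  and h2: "h2\<in>hom (free_Abelian_group (I\<times>CR)) vgroup" "!!a r. a\<in>I ==> r\<in>CR ==> h2 (frag_of (a, r)) = vm r (pv (g a))"
  and c: "c\<in>carrier (free_Abelian_group (I\<times>CR))" "h1 c = \<zero>"
 shows "h2 c\<in>K"
proof -
 let ?F = "free_Abelian_group (I\<times>CR)"
 let ?F' = "free_Abelian_group (CR\<times>CR)"
 let ?L = "(self_module R)\<lparr>carrier := I\<rparr>" and ?L' = "self_module R" and ?M = "restrict_scalars \<phi> R"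
 interpret h1: group_hom ?F "add_monoid R" h1
  using h1(1) by (intro group_hom.intro) (simp_all add: group_hom_axioms_def a_group)
 interpret V: comm_group vgroup by (rule vgroup_comm_group)
 interpret h2: group_hom ?F vgroup h2
  using h2(1) V.is_group by (intro group_hom.intro) (simp_all add: group_hom_axioms_def)
 have m1: "h1 (a + b) = h1 a\<oplus>h1 b" "h1 (a - b) = h1 a\<ominus>h1 b"
  and m2: "h2 (a + b) = va (h2 a) (h2 b)" "h2 (a - b) = va (h2 a) (vn (h2 b))"
  if ab: "a\<in>carrier ?F" "b\<in>carrier ?F" for a b
 proof -
  show s: "h1 (a + b) = h1 a\<oplus>h1 b" "h2 (a + b) = va (h2 a) (h2 b)"
   using h1.hom_mult[OF ab] h2.hom_mult[OF ab] by (simp_all add: vgroup_def)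
  have ab': "a - b\<in>carrier ?F" using ab keys_diff[of a b] by auto
  have "h1 ((a - b) + b) = h1 (a - b)\<oplus>h1 b" "h2 ((a - b) + b) = va (h2 (a - b)) (h2 b)"
   using h1.hom_mult[OF ab' ab(2)] h2.hom_mult[OF ab' ab(2)] by (simp_all add: vgroup_def)
  moreover have "h1 a\<in>CR" "h1 b\<in>CR" "h1 (a - b)\<in>CR" "vec (h2 a)" "vec (h2 b)" "vec (h2 (a - b))"
   using h1.hom_closed[OF ab(1)] h1.hom_closed[OF ab(2)] h1.hom_closed[OF ab'] h2.hom_closed[OF ab(1)] h2.hom_closed[OF ab(2)]
    h2.hom_closed[OF ab'] by (simp_all add: vgroup_def)
  ultimately show "h1 (a - b) = h1 a\<ominus>h1 b" "h2 (a - b) = va (h2 a) (vn (h2 b))"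
   by (simp_all add: a_minus_def a_assoc r_neg fun_eq_iff vapp)
 qed
 define N0 N where "N0 = tensor_relations R ?L ?M" and "N = tensor_relations R ?L' ?M"
 let ?G = "%S. {frag_of (x\<oplus>x', y) - frag_of (x, y) - frag_of (x', y) | x x' y. x\<in>S\<and>x'\<in>S\<and>y\<in>CR}\<union>
   {frag_of (x, y\<oplus>y') - frag_of (x, y) - frag_of (x, y') | x y y'. x\<in>S\<and>y\<in>CR\<and>y'\<in>CR}\<union>
   {frag_of (r\<otimes>x, y) - frag_of (x, \<phi> r\<otimes>y) | r x y. r\<in>CR\<and>x\<in>S\<and>y\<in>CR}"
 have N0: "N0 = generate ?F (?G I)" and N: "N = generate ?F' (?G (CR))"
  unfolding N0_def N_def tensor_relations_def by (simp_all add: self_module_def restrict_scalars_def)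
 have kd3: "a - b - c'\<in>carrier (free_Abelian_group S)" "a - b\<in>carrier (free_Abelian_group S)"
  if "a\<in>carrier (free_Abelian_group S)" "b\<in>carrier (free_Abelian_group S)" "c'\<in>carrier (free_Abelian_group S)"
  for a b c' :: "('a\<times>'a) \<Rightarrow>\<^sub>0 int" and S
 proof -
  show "a - b\<in>carrier (free_Abelian_group S)" using that(1,2) keys_diff[of a b] unfolding carrier_free_Abelian_group_iff by blast
  thus "a - b - c'\<in>carrier (free_Abelian_group S)" using that(3) keys_diff[of "a - b" c'] unfolding carrier_free_Abelian_group_iff by blast
 qed
 have t3: "h1 (a - b - c') = h1 a\<ominus>h1 b\<ominus>h1 c'" "h2 (a - b - c') = va (va (h2 a) (vn (h2 b))) (vn (h2 c'))"
  if "a\<in>carrier ?F" "b\<in>carrier ?F" "c'\<in>carrier ?F" for a b c'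
  using m1(2)[OF kd3(2)[OF that] that(3)] m2(2)[OF kd3(2)[OF that] that(3)] m1(2)[OF that(1,2)] m2(2)[OF that(1,2)] by simp_all
 have GS: "?G S\<subseteq>carrier (free_Abelian_group (S\<times>CR))" if "ideal S R" for S
  using ideal_add[OF that] ideal_mult[OF that]
  by (intro Un_least subsetI; elim CollectE exE conjE; hypsubst; intro kd3) auto
 have rel: "h1 \<rho> = \<zero>\<and>h2 \<rho>\<in>K" if "\<rho>\<in>N0" for \<rho>
 proof -
  have "subgroup {\<rho>\<in>carrier ?F. h1 \<rho> = \<zero>\<and>h2 \<rho>\<in>K} ?F"
  proof (rule group.subgroupI[OF group_free_Abelian_group])
   show "{\<rho>\<in>carrier ?F. h1 \<rho> = \<zero>\<and>h2 \<rho>\<in>K}\<noteq>{}"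
    using h1.hom_one h2.hom_one K(3) by (auto simp: vgroup_def intro!: exI[of _ 0])
   fix a assume a: "a\<in>{\<rho>\<in>carrier ?F. h1 \<rho> = \<zero>\<and>h2 \<rho>\<in>K}"
   have "h1 (inv\<^bsub>?F\<^esub> a) = \<zero>" using a m1(2)[of 0 a] h1.hom_one by (simp add: a_minus_def)
   moreover have "va vz (vn (h2 a)) = vn (h2 a)" using K(4)[of "h2 a"] a by (intro ext) (simp add: vapp)
   hence "h2 (inv\<^bsub>?F\<^esub> a) = vn (h2 a)" using a m2(2)[of 0 a] h2.hom_one by (simp add: vgroup_def)
   ultimately show "inv\<^bsub>?F\<^esub> a\<in>{\<rho>\<in>carrier ?F. h1 \<rho> = \<zero>\<and>h2 \<rho>\<in>K}"
    using a K(2) group.inv_closed[OF group_free_Abelian_group] by (simp del: carrier_free_Abelian_group_iff)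
   fix b assume b: "b\<in>{\<rho>\<in>carrier ?F. h1 \<rho> = \<zero>\<and>h2 \<rho>\<in>K}"
   show "a\<otimes>\<^bsub>?F\<^esub> b\<in>{\<rho>\<in>carrier ?F. h1 \<rho> = \<zero>\<and>h2 \<rho>\<in>K}"
    using a b m1(1)[of a b] m2(1)[of a b] K(1) keys_add[of a b] by auto
  qed blast
  moreover have "?G I\<subseteq>{\<rho>\<in>carrier ?F. h1 \<rho> = \<zero>\<and>h2 \<rho>\<in>K}"
  proof (rule subsetI)
   fix \<rho> assume r: "\<rho>\<in>?G I"
   hence rc: "\<rho>\<in>carrier ?F" using GS[OF I] by blast
   note Ic = ideal_carr[OF I] ideal_add[OF I] ideal_mult[OF I]
   have f: "frag_of (a, r)\<in>carrier ?F" if "a\<in>I" "r\<in>CR" for a r using that by simp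
   have "h1 \<rho> = \<zero>\<and>h2 \<rho>\<in>K" using r
   proof (elim UnE CollectE exE conjE)
    fix a b y assume e: "\<rho> = frag_of (a\<oplus>b, y) - frag_of (a, y) - frag_of (b, y)" "a\<in>I" "b\<in>I" "y\<in>CR"
    have 0: "h1 \<rho> = h1 (frag_of (a\<oplus>b, y))\<ominus>h1 (frag_of (a, y))\<ominus>h1 (frag_of (b, y))"
     "h2 \<rho> = va (va (h2 (frag_of (a\<oplus>b, y))) (vn (h2 (frag_of (a, y))))) (vn (h2 (frag_of (b, y))))"
     unfolding e(1) by (rule t3; rule f; use e Ic in simp)+
    have "(p\<oplus>q)\<otimes>y\<ominus>p\<otimes>y\<ominus>q\<otimes>y = \<zero>" if "p\<in>CR" "q\<in>CR" for p q
     using that e(4) by algebra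
    hence "h1 \<rho> = \<zero>" unfolding 0 using h1(2) e Ic by simp
    moreover have "h2 \<rho> = vm y (pv (va (g (a\<oplus>b)) (vn (va (g a) (g b)))))" unfolding 0
     using h2(2) e Ic g(1) by (intro ext) (simp add: vapp cr_simps)
    ultimately show ?thesis using g(2) e by simp
   next
    fix a y y' assume e: "\<rho> = frag_of (a, y\<oplus>y') - frag_of (a, y) - frag_of (a, y')" "a\<in>I" "y\<in>CR" "y'\<in>CR"
    have 0: "h1 \<rho> = h1 (frag_of (a, y\<oplus>y'))\<ominus>h1 (frag_of (a, y))\<ominus>h1 (frag_of (a, y'))"
     "h2 \<rho> = va (va (h2 (frag_of (a, y\<oplus>y'))) (vn (h2 (frag_of (a, y))))) (vn (h2 (frag_of (a, y'))))"
     unfolding e(1) by (rule t3; rule f; use e in simp)+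
    have "p\<otimes>(y\<oplus>y')\<ominus>p\<otimes>y\<ominus>p\<otimes>y' = \<zero>" "(y\<oplus>y')\<otimes>p\<oplus>\<ominus> (y\<otimes>p)\<oplus>\<ominus> (y'\<otimes>p) = \<zero>"
     if "p\<in>CR" for p using that e(3,4) by algebra+
    hence "h1 \<rho> = \<zero>" "h2 \<rho> = vz" unfolding 0 using h1(2) h2(2) e Ic g(1) by (simp_all add: fun_eq_iff vapp)
    thus ?thesis using K(3) by simp
   next
    fix b a y assume e: "\<rho> = frag_of (b\<otimes>a, y) - frag_of (a, \<phi> b\<otimes>y)" "b\<in>CR" "a\<in>I" "y\<in>CR"
    have 0: "h1 \<rho> = h1 (frag_of (b\<otimes>a, y))\<ominus>h1 (frag_of (a, \<phi> b\<otimes>y))"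
     "h2 \<rho> = va (h2 (frag_of (b\<otimes>a, y))) (vn (h2 (frag_of (a, \<phi> b\<otimes>y))))"
     unfolding e(1) by (rule m1(2) m2(2); rule f; use e Ic in simp)+
    have "(p\<otimes>q)\<otimes>y\<ominus>q\<otimes>(p\<otimes>y) = \<zero>" if "p\<in>CR" "q\<in>CR" for p q
     using that e(4) by algebra
    hence "h1 \<rho> = \<zero>" unfolding 0 using h1(2) e Ic by simp
    moreover have "h2 \<rho> = vm y (pv (va (g (b\<otimes>a)) (vn (vm b (g a)))))" unfolding 0
     using h2(2) e Ic g(1) by (intro ext) (simp add: vapp cr_simps)
    ultimately show ?thesis using g(3) e by simp
   qed
   thus "\<rho>\<in>{\<rho>\<in>carrier ?F. h1 \<rho> = \<zero>\<and>h2 \<rho>\<in>K}" using rc by simp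
  qed
  ultimately have "N0\<subseteq>{\<rho>\<in>carrier ?F. h1 \<rho> = \<zero>\<and>h2 \<rho>\<in>K}" unfolding N0
   by (rule group.generate_subgroup_incl[OF group_free_Abelian_group, rotated])
  thus ?thesis using that by blast
 qed
 have sN: "subgroup N ?F'" unfolding N
  by (rule group.generate_is_subgroup[OF group_free_Abelian_group]) (rule GS[OF oneideal])
 have sN0: "subgroup N0 ?F" unfolding N0
  by (rule group.generate_is_subgroup[OF group_free_Abelian_group]) (rule GS[OF I])
 have Nd: "a - b\<in>N" "a + b\<in>N" if "a\<in>N" "b\<in>N" for a b
 proof -
  have "a\<otimes>\<^bsub>?F'\<^esub> inv\<^bsub>?F'\<^esub> b\<in>N" using subgroup.m_closed[OF sN that(1) subgroup.m_inv_closed[OF sN that(2)]] .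
  moreover have "Poly_Mapping.keys b\<subseteq>CR\<times>CR" using subgroup.mem_carrier[OF sN that(2)] by simp
  ultimately show "a - b\<in>N" by simp
  show "a + b\<in>N" using subgroup.m_closed[OF sN that] by simp
 qed
 have G: "x\<in>N" if "x\<in>?G (CR)" for x unfolding N using generate.incl[OF that] .
 have z1: "frag_of (\<one>, \<zero>)\<in>N"
 proof -
  have "frag_of (\<one>, \<zero>\<oplus>\<zero>) - frag_of (\<one>, \<zero>) - frag_of (\<one>, \<zero>)\<in>N" by (rule G) blast
  from Nd(1)[OF subgroup.one_closed[OF sN] this] show ?thesis by simp
 qed
 \<comment> \<open>In the tensor product of \<open>R\<close> with \<open>R\<close> every element is
   1 tensor its value under multiplication. So the kernel of \<open>h1\<close> dies there, and by
   injectivity it dies already in the tensor product of \<open>I\<close>.\<close>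
 have toone: "a\<in>carrier ?F'\<and>a - frag_of (\<one>, h1 a)\<in>N" if "Poly_Mapping.keys a\<subseteq>I\<times>CR" for a
  using that
 proof (induction rule: free_Abelian_group_induct[consumes 1, case_names 1 2 3])
  case 1 thus ?case using h1.hom_one subgroup.one_closed[OF sN] Nd(1)[OF _ z1, of 0] by simp
 next
  case (2 x y)
  have c: "h1 x\<in>CR" "h1 y\<in>CR" using h1.hom_closed[of x] h1.hom_closed[of y] 2 by simp_all
  have e: "h1 (x - y) = h1 x\<ominus>h1 y" using m1(2)[of x y] 2 by simp
  have "frag_of (\<one>, (h1 x\<ominus>h1 y)\<oplus>h1 y) - frag_of (\<one>, h1 x\<ominus>h1 y) - frag_of (\<one>, h1 y)\<in>N"
   by (rule G) (use c in blast)
  moreover have "(h1 x\<ominus>h1 y)\<oplus>h1 y = h1 x" using c by (simp add: a_minus_def a_assoc l_neg)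
  ultimately have 3: "frag_of (\<one>, h1 x) - frag_of (\<one>, h1 x\<ominus>h1 y) - frag_of (\<one>, h1 y)\<in>N" by simp
  have "(x - frag_of (\<one>, h1 x)) - (y - frag_of (\<one>, h1 y)) + (frag_of (\<one>, h1 x) - frag_of (\<one>, h1 x\<ominus>h1 y) - frag_of (\<one>, h1 y))\<in>N"
   using Nd(2)[OF Nd(1) 3] 2 by blast
  thus ?case using e 2 kd3(2)[of x "CR\<times>CR" y x] by (simp add: algebra_simps)
 next
  case (3 p)
  obtain a r where p: "p = (a, r)" "a\<in>I" "r\<in>CR" using 3 by auto
  have ac: "a\<in>CR" using p ideal_carr[OF I] by blast
  have "frag_of (a\<otimes>\<one>, r) - frag_of (\<one>, \<phi> a\<otimes>r)\<in>N" by (rule G) (use ac p in blast)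
  thus ?case using p ac h1(2)[OF p(2,3)] by simp
 qed
 have ker: "tensor_map R ?L' ?M id (N0 #>\<^bsub>?F\<^esub> a) = N" if a: "a\<in>carrier ?F" "h1 a = \<zero>" for a
 proof -
  have "N #>\<^bsub>?F'\<^esub> frag_extend (%(l, m). frag_of (id l, m)) b = N" if b: "b\<in>N0 #>\<^bsub>?F\<^esub> a" for b
  proof -
   obtain \<rho> where r: "\<rho>\<in>N0" "b = \<rho> + a" using b by (auto simp: r_coset_def)
   have rc: "\<rho>\<in>carrier ?F" using subgroup.mem_carrier[OF sN0 r(1)] .
   have "h1 b = \<zero>" using m1(1)[OF rc a(1)] rel[OF r(1)] a(2) r(2) by simp
   moreover have "Poly_Mapping.keys b\<subseteq>I\<times>CR" using rc a keys_add[of \<rho> a] r(2) by auto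
   ultimately have "b\<in>N" using toone[of b] Nd(2)[OF _ z1, of "b - frag_of (\<one>, \<zero>)"] by simp
   moreover have "(%(l, m). frag_of (id l, m)) = (frag_of :: 'a\<times>'a => _)" by auto
   hence "frag_extend (%(l, m). frag_of (id l, m)) b = b" using frag_expansion[of b] by simp
   ultimately show ?thesis using subgroup.rcos_const[OF sN group_free_Abelian_group] by simp
  qed
  moreover have "N0 #>\<^bsub>?F\<^esub> a\<noteq>{}" using subgroup.one_closed[OF sN0] by (auto simp: r_coset_def)
  ultimately show ?thesis unfolding tensor_map_def N_def[symmetric] by (simp add: self_module_def restrict_scalars_def)
 qed
 have "id\<in>module_homs R ?L ?L'" unfolding module_homs_def using ideal_carr[OF I] by (auto simp: self_module_def)
 hence inj: "inj_on (tensor_map R ?L' ?M id) (carrier (tensor_product R ?L ?M))"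
  using flat self_module_module ideal_module[OF I] unfolding flat_module_def by (metis inj_on_id)
 have "N0 #>\<^bsub>?F\<^esub> a\<in>carrier (tensor_product R ?L ?M)" if "a\<in>carrier ?F" for a
  using that unfolding tensor_product_def N0_def FactGroup_def RCOSETS_def by (auto simp: self_module_def restrict_scalars_def)
 moreover have "(0 :: ('a\<times>'a) \<Rightarrow>\<^sub>0 int)\<in>carrier ?F" "h1 0 = \<zero>" using h1.hom_one by simp_all
 ultimately have "N0 #>\<^bsub>?F\<^esub> c = N0 #>\<^bsub>?F\<^esub> 0" using inj_onD[OF inj, of "N0 #>\<^bsub>?F\<^esub> c" "N0 #>\<^bsub>?F\<^esub> 0"] ker c by metis
 moreover have "c\<in>N0 #>\<^bsub>?F\<^esub> c" using group.rcos_self[OF group_free_Abelian_group c(1) sN0] .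
 moreover have "N0 #>\<^bsub>?F\<^esub> 0 = N0" by (auto simp: r_coset_def)
 ultimately show ?thesis using rel by blast
qed

section \<open>Kernels of linear forms under flat base change\<close>

definition vsub :: "(bool list => 'a) set => bool" where
 "vsub V \<longleftrightarrow> (\<forall>v\<in>V. vec v)\<and>vz\<in>V\<and>(\<forall>v\<in>V. \<forall>w\<in>V. va v w\<in>V)\<and>(\<forall>v\<in>V. \<forall>r\<in>CR. vm r v\<in>V)"

definition vlin :: "((bool list => 'a) => 'a) => bool" where
 "vlin l \<longleftrightarrow> (\<forall>v. vec v --> l v\<in>CR)\<and>(\<forall>v w. vec v --> vec w --> l (va v w) = l v\<oplus>l w)\<and>
  (\<forall>r v. r\<in>CR --> vec v --> l (vm r v) = r\<otimes>l v)"

lemma vsubD: assumes "vsub V"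
 shows "v\<in>V ==> vec v" "vz\<in>V" "v\<in>V ==> w\<in>V ==> va v w\<in>V" "v\<in>V ==> r\<in>CR ==> vm r v\<in>V" "v\<in>V ==> vn v\<in>V"
 using assms vn_vm[of v] unfolding vsub_def by auto

lemma vlinD: assumes "vlin l"
 shows "vec v ==> l v\<in>CR" "vec v ==> vec w ==> l (va v w) = l v\<oplus>l w" "r\<in>CR ==> vec v ==> l (vm r v) = r\<otimes>l v"
  "l vz = \<zero>" "vec v ==> l (vn v) =\<ominus>l v"
proof -
 note D = assms[unfolded vlin_def, THEN conjunct1] assms[unfolded vlin_def, THEN conjunct2]
 show 1: "vec v ==> l v\<in>CR" and "vec v ==> vec w ==> l (va v w) = l v\<oplus>l w"
  and m: "r\<in>CR ==> vec v ==> l (vm r v) = r\<otimes>l v" for v w r using D by blast+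
 have "vm \<zero> vz = vz" by (intro ext) (simp add: vapp)
 thus "l vz = \<zero>" using m[of \<zero> vz] 1[of vz] by simp
 show "vec v ==> l (vn v) =\<ominus>l v" using m[of "\<ominus>\<one>" v] 1[of v] by (simp add: vn_vm l_minus)
qed

text \<open>Flat base change commutes with the kernel of a linear form modulo an ideal.\<close>

lemma flat_kernel:
 assumes V: "vsub V" and l: "vlin l" and l': "vlin l'" "!!v. v\<in>V ==> l' (pv v) = \<phi> (l v)" and J: "ideal J R"
  and w: "w\<in>phispan V" "l' w\<in>Idl (\<phi>`J)"
 shows "w\<in>phispan {v\<in>V. l v\<in>J}"
proof -
 note VD = vsubD[OF V] and lD = vlinD[OF l] and l'D = vlinD[OF l'(1)]
 define V0 where "V0 = {v\<in>V. l v\<in>J}"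
 define K where "K = phispan V0"
 have Vv: "\<forall>v\<in>V. vec v" using VD(1) by blast
 have V0v: "\<forall>v\<in>V0. vec v" using VD(1) by (simp add: V0_def)
 have Kv: "vec u" if "u\<in>K" for u using phispan_vec[OF _ V0v] that K_def by blast
 note Klin = phispan_lin[where V = V0, OF V0v, folded K_def]
 define I where "I = {a\<in>CR. \<exists>v\<in>V. a\<ominus>l v\<in>J}"
 \<comment> \<open>A set-theoretic section of \<open>l\<close> modulo \<open>J\<close>, defined on
   the ideal \<open>I\<close> of values. Its failure to be linear lies in \<open>V0\<close>, so
   modulo \<open>K\<close> it induces a map on the tensor product of \<open>I\<close>.\<close>
 define g where "g = (%a. SOME v. v\<in>V\<and>a\<ominus>l v\<in>J)"
 have gI: "g a\<in>V" "a\<ominus>l (g a)\<in>J" "a\<in>CR" "l (g a)\<in>CR" "vec (g a)" if a: "a\<in>I" for a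
 proof -
  have "\<exists>v. v\<in>V\<and>a\<ominus>l v\<in>J" using a I_def by blast
  hence "g a\<in>V\<and>a\<ominus>l (g a)\<in>J" unfolding g_def by (rule someI_ex)
  thus "g a\<in>V" "a\<ominus>l (g a)\<in>J" "l (g a)\<in>CR" "vec (g a)" using lD(1) VD(1) by blast+
  show "a\<in>CR" using a I_def by blast
 qed
 have sum3: "(a\<oplus>b)\<ominus>(p\<oplus>q) = (a\<ominus>p)\<oplus>(b\<ominus>q)" "r\<otimes>a\<ominus>r\<otimes>p = r\<otimes>(a\<ominus>p)"
  if "a\<in>CR" "b\<in>CR" "p\<in>CR" "q\<in>CR" "r\<in>CR" for a b p q r
  using that by (simp_all add: cr_simps)
 have I: "ideal I R"
 proof (rule idealI_cring)
  show "I\<subseteq>CR" unfolding I_def by blast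
  have "\<zero>\<ominus>l vz\<in>J" using lD(4) ideal_zero[OF J] by (simp add: a_minus_def)
  thus "\<zero>\<in>I" unfolding I_def using VD(2) by blast
  fix a b assume a: "a\<in>I"
  show "a\<oplus>b\<in>I" if b: "b\<in>I"
  proof -
   have "(a\<oplus>b)\<ominus>l (va (g a) (g b))\<in>J"
    using ideal_add[OF J gI(2)[OF a] gI(2)[OF b]] sum3(1) gI[OF a] gI[OF b] lD(2) by simp
   thus ?thesis unfolding I_def using VD(3)[OF gI(1)[OF a] gI(1)[OF b]] gI(3)[OF a] gI(3)[OF b] by blast
  qed
  show "b\<otimes>a\<in>I" if b: "b\<in>CR"
  proof -
   have "b\<otimes>a\<ominus>l (vm b (g a))\<in>J"
    using ideal_mult[OF J gI(2)[OF a] b] sum3(2)[of a b "l (g a)" b b] gI[OF a] b lD(3) by simp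
   thus ?thesis unfolding I_def using VD(4)[OF gI(1)[OF a] b] gI(3)[OF a] b by blast
  qed
 qed
 have lI: "l v\<in>I" if v: "v\<in>V" for v
 proof -
  have "l v\<ominus>l v\<in>J" using lD(1)[OF VD(1)[OF v]] ideal_zero[OF J] by (simp add: a_minus_def r_neg)
  thus ?thesis unfolding I_def using v lD(1)[OF VD(1)[OF v]] by blast
 qed
 have JI: "j\<in>I" if j: "j\<in>J" for j
 proof -
  have "j\<ominus>l vz\<in>J" using lD(4) j ideal_carr[OF J] by (simp add: a_minus_def)
  thus ?thesis unfolding I_def using VD(2) j ideal_carr[OF J] by blast
 qed
 have Kp: "vm r (pv v)\<in>K" if "v\<in>V" "l v\<in>J" "r\<in>CR" for v r
  unfolding K_def using phispan_pv[of v V0 r] that VD(1) V0_def by blast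
 let ?F = "free_Abelian_group (I\<times>CR)"
 have "(%(a, r). \<phi> a\<otimes>r)`(I\<times>CR)\<subseteq>carrier (add_monoid R)" using ideal_carr[OF I] by auto
 from comm_group.free_Abelian_group_universal[OF a_comm_group this]
 obtain h1 where h1: "h1\<in>hom ?F (add_monoid R)" "!!a r. a\<in>I ==> r\<in>CR ==> h1 (frag_of (a, r)) = \<phi> a\<otimes>r"
  by (metis (no_types, lifting) SigmaI case_prod_conv)
 have "(%(a, r). vm r (pv (g a)))`(I\<times>CR)\<subseteq>carrier vgroup" using gI(5) by (auto simp: vgroup_def)
 from comm_group.free_Abelian_group_universal[OF vgroup_comm_group this]
 obtain h2 where h2: "h2\<in>hom ?F vgroup" "!!a r. a\<in>I ==> r\<in>CR ==> h2 (frag_of (a, r)) = vm r (pv (g a))"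
  by (metis (no_types, lifting) SigmaI case_prod_conv)
 have hv: "h1 c\<in>CR" "vec (h2 c)" if "c\<in>carrier ?F" for c
  using h1(1) h2(1) that unfolding hom_def by (auto simp: vgroup_def Pi_iff)
 have plus: "a + b\<in>carrier ?F" "h1 (a + b) = h1 a\<oplus>h1 b" "h2 (a + b) = va (h2 a) (h2 b)"
  if "a\<in>carrier ?F" "b\<in>carrier ?F" for a b
  using hom_mult[OF h1(1) that] hom_mult[OF h2(1) that] that keys_add[of a b] by (auto simp: vgroup_def)
 have F0: "0\<in>carrier ?F" "h1 0 = \<zero>" "h2 0 = vz"
  using group_hom.hom_one[of ?F "add_monoid R" h1] group_hom.hom_one[of ?F vgroup h2] h1(1) h2(1) a_group
   comm_group.axioms(2)[OF vgroup_comm_group] by (simp_all add: vgroup_def group_hom_def group_hom_axioms_def)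
 have lift: "\<exists>c\<in>carrier ?F. h1 c = l' u\<and>va u (vn (h2 c))\<in>K" if "u\<in>phispan V" for u
  using that
 proof induction
  case phispan_vz
  have "va vz (vn vz) = vz" by (intro ext) (simp add: vapp)
  thus ?case using F0 l'D(4) phispan.phispan_vz[of V0] K_def by (intro bexI[of _ 0]) auto
 next
  case (phispan_step u v r)
  then obtain c where c: "c\<in>carrier ?F" "h1 c = l' u" "va u (vn (h2 c))\<in>K" by blast
  note u = phispan_vec[OF phispan_step(1) Vv] and v = VD(1)[OF phispan_step(2)] and lv = lI[OF phispan_step(2)]
  have f: "frag_of (l v, r)\<in>carrier ?F" using lv phispan_step(3) by simp
  note gl = gI[OF lv]
  have "h1 (c + frag_of (l v, r)) = l' (va u (vm r (pv v)))"
   using plus(2)[OF c(1) f] h1(2)[OF lv] c(2) u v phispan_step(2,3) l' l'D gl(3) by (simp add: m_comm)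
  moreover have "va (va u (vm r (pv v))) (vn (h2 (c + frag_of (l v, r)))) =
    va (va u (vn (h2 c))) (vm r (pv (va v (vn (g (l v))))))"
   using plus(3)[OF c(1) f] h2(2)[OF lv] u v hv[OF c(1)] gl phispan_step(3)
   by (intro ext) (simp add: vapp cr_simps)
  moreover have "l (va v (vn (g (l v))))\<in>J" using gl v lD by (simp add: a_minus_def)
  hence "vm r (pv (va v (vn (g (l v)))))\<in>K" using Kp VD(3)[OF phispan_step(2) VD(5)[OF gl(1)]] phispan_step(3) by blast
  hence "va (va u (vn (h2 c))) (vm r (pv (va v (vn (g (l v))))))\<in>K" using Klin(1)[OF _ c(3)] by blast
  ultimately show ?case using plus(1)[OF c(1) f] by (intro bexI[of _ "c + frag_of (l v, r)"]) auto
 qed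
 have liftJ: "\<exists>c\<in>carrier ?F. h1 c = u []\<and>h2 c\<in>K" if "u\<in>phispan {%_. j | j. j\<in>J}" for u
  using that
 proof induction
  case phispan_vz
  thus ?case using F0 phispan.phispan_vz[of V0] K_def by (intro bexI[of _ 0]) auto
 next
  case (phispan_step u v r)
  then obtain c j where c: "c\<in>carrier ?F" "h1 c = u []" "h2 c\<in>K" and j: "v = (%_. j)" "j\<in>J" by blast
  have f: "frag_of (j, r)\<in>carrier ?F" using JI[OF j(2)] phispan_step(3) by simp
  note gl = gI[OF JI[OF j(2)]]
  have "h1 (c + frag_of (j, r)) = va u (vm r (pv v)) []"
   using plus(2)[OF c(1) f] h1(2)[OF JI[OF j(2)]] c(2) phispan_step(3) gl(3)
   by (simp add: va_def vm_def pv_def j(1) m_comm)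
  moreover have "\<ominus>l (g j)\<in>J" using ideal_add_cancel[OF J j(2), of "\<ominus>l (g j)"] gl by (simp add: a_minus_def)
  hence "l (g j)\<in>J" using ideal_neg[OF J] gl(4) by fastforce
  hence "va (h2 c) (vm r (pv (g j)))\<in>K" using Klin(1)[OF _ c(3)] Kp gl(1) phispan_step(3) by blast
  hence "h2 (c + frag_of (j, r))\<in>K" using plus(3)[OF c(1) f] h2(2)[OF JI[OF j(2)]] phispan_step(3) by simp
  ultimately show ?case using plus(1)[OF c(1) f] by (intro bexI[of _ "c + frag_of (j, r)"]) auto
 qed
 \<comment> \<open>Two tensors with the same value \<open>l' w\<close>: \<open>c\<close> reproduces
   \<open>w\<close> modulo \<open>K\<close>, while \<open>c'\<close>, built from elements of
   \<open>J\<close>, is sent into \<open>K\<close>. Their difference has value zero, so by flatness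
   it is sent into \<open>K\<close>, and \<open>w\<close> follows.\<close>
 obtain c where c: "c\<in>carrier ?F" "h1 c = l' w" "va w (vn (h2 c))\<in>K" using lift[OF w(1)] by blast
 obtain c' where c': "c'\<in>carrier ?F" "h1 c' = l' w" "h2 c'\<in>K"
 proof -
  obtain u where u: "u\<in>phispan {%_. j | j. j\<in>J}" "u [] = l' w" using phispan_idl[OF J w(2)] by blast
  show ?thesis using liftJ[OF u(1)] u(2) that by auto
 qed
 have d: "c - c'\<in>carrier ?F" using c(1) c'(1) keys_diff[of c c'] by auto
 have e: "h1 (c - c')\<oplus>h1 c' = h1 c" "va (h2 (c - c')) (h2 c') = h2 c" using plus(2,3)[OF d c'(1)] by simp_all
 have "h1 (c - c') = \<zero>" using e(1) c(2) c'(2) hv[OF d] hv[OF c(1)] by simp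
 have "h2 (c - c')\<in>K"
 proof (rule ideal_tensor_kernel[where I = I and K = K and g = g and ?h1.0 = h1 and ?h2.0 = h2])
  show "va u w\<in>K" if "u\<in>K" "w\<in>K" for u w using Klin(1) that by blast
  show "vn w\<in>K" if "w\<in>K" for w using Klin(3)[OF that] .
  show "vz\<in>K" unfolding K_def by (rule phispan_vz)
  show "vec (g a)" if "a\<in>I" for a using gI(5)[OF that] .
  show "vec w" if "w\<in>K" for w using Kv[OF that] .
  show "h1 (frag_of (a, r)) = \<phi> a\<otimes>r" "h2 (frag_of (a, r)) = vm r (pv (g a))" if "a\<in>I" "r\<in>CR" for a r
   using h1(2) h2(2) that by simp_all
  fix a b r assume a: "a\<in>I" and r: "r\<in>CR"
  { assume b: "b\<in>I"
   note ab = ideal_add[OF I a b]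
   have "\<ominus>((a\<oplus>b)\<ominus>l (g (a\<oplus>b)))\<oplus>((a\<ominus>l (g a))\<oplus>(b\<ominus>l (g b)))\<in>J"
    using gI(2) ideal_add[OF J] ideal_neg[OF J] a b ab by simp
   moreover have "\<ominus>((a\<oplus>b)\<ominus>x)\<oplus>((a\<ominus>y)\<oplus>(b\<ominus>z)) = x\<ominus>(y\<oplus>z)"
    if [simp]: "a\<in>CR" "b\<in>CR" "x\<in>CR" "y\<in>CR" "z\<in>CR" for a b x y z
    using that by algebra
   ultimately have "l (va (g (a\<oplus>b)) (vn (va (g a) (g b))))\<in>J"
    using gI[OF a] gI[OF b] gI[OF ab] lD by (simp add: a_minus_def)
   thus "vm r (pv (va (g (a\<oplus>b)) (vn (va (g a) (g b)))))\<in>K" using VD gI(1) a b ab r by (intro Kp) simp_all }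
  assume b: "b\<in>CR"
  note ba = ideal_mult[OF I a b]
  have "\<ominus>(b\<otimes>a\<ominus>l (g (b\<otimes>a)))\<oplus>b\<otimes>(a\<ominus>l (g a))\<in>J"
   using gI(2) ideal_add[OF J] ideal_neg[OF J] ideal_mult[OF J] a b ba by simp
  moreover have "\<ominus>(b\<otimes>a\<ominus>x)\<oplus>b\<otimes>(a\<ominus>y) = x\<ominus>b\<otimes>y"
   if [simp]: "a\<in>CR" "b\<in>CR" "x\<in>CR" "y\<in>CR" for a b x y
   using that by algebra
  ultimately have "l (va (g (b\<otimes>a)) (vn (vm b (g a))))\<in>J"
   using gI[OF a] gI[OF ba] b lD by (simp add: a_minus_def)
  thus "vm r (pv (va (g (b\<otimes>a)) (vn (vm b (g a)))))\<in>K" using VD gI(1) a b ba r by (intro Kp) simp_all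
 qed (rule I h1(1) h2(1) d \<open>h1 (c - c') = \<zero>\<close>)+
 hence "va (va w (vn (h2 c))) (va (h2 (c - c')) (h2 c'))\<in>K" using Klin(1) c(3) c'(3) by blast
 moreover have "va (va w (vn (h2 c))) (h2 c) = w"
  using phispan_vec[OF w(1) Vv] hv[OF c(1)] by (intro ext) (simp add: vapp a_assoc l_neg)
 ultimately show ?thesis using e(2) unfolding K_def V0_def by simp
qed

text \<open>One form at a time: the common kernel of the forms already treated is again a submodule,
  to which \<open>flat_kernel\<close> applies.\<close>

lemma flat_kernels:
 assumes "finite C" and V: "vsub V" and l: "!!c. c\<in>C ==> vlin (l c)" and l': "!!c. c\<in>C ==> vlin (l' c)"
  "!!c v. c\<in>C ==> v\<in>V ==> l' c (pv v) = \<phi> (l c v)" and J: "ideal J R"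
  and w: "w\<in>phispan V" "!!c. c\<in>C ==> l' c w\<in>Idl (\<phi>`J)"
 shows "w\<in>phispan {v\<in>V. \<forall>c\<in>C. l c v\<in>J}"
 using assms(1) l l' w
proof (induction C)
 case empty thus ?case using phispan_mono[of w V] by auto
next
 case (insert c C)
 define W where "W = {v\<in>V. \<forall>c\<in>C. l c v\<in>J}"
 have wW: "w\<in>phispan W" unfolding W_def by (rule insert.IH) (use insert.prems in auto)
 have "vsub W" unfolding vsub_def
 proof (intro conjI ballI)
  show "vec v" if "v\<in>W" for v using that vsubD(1)[OF V] by (simp add: W_def)
  show "vz\<in>W" using vsubD[OF V] vlinD(4)[OF insert.prems(1)] ideal_zero[OF J] by (auto simp: W_def)
  fix v assume v: "v\<in>W"
  show "va v u\<in>W" if "u\<in>W" for u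
   using v that vsubD[OF V] vlinD(2)[OF insert.prems(1)] ideal_add[OF J] by (auto simp: W_def)
  show "vm r v\<in>W" if "r\<in>CR" for r
   using v that vsubD[OF V] vlinD(3)[OF insert.prems(1)] ideal_mult[OF J] by (auto simp: W_def)
 qed
 hence "w\<in>phispan {v\<in>W. l c v\<in>J}"
  by (rule flat_kernel[where l' = "l' c"]) (use insert.prems wW J W_def in auto)
 thus ?case by (rule phispan_mono) (auto simp: W_def)
qed

lemma phispan_supported:
 assumes "finite B" "vec w" "!!bs. bs\<notin>B ==> w bs = \<zero>"
 shows "w\<in>phispan {v. vec v\<and>(\<forall>bs. bs\<notin>B --> v bs = \<zero>)}"
 using assms
proof (induction B arbitrary: w)
 case empty
 hence "w = vz" by auto
 thus ?case using phispan_vz by simp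
next
 case (insert b B)
 define w' where "w' = (%bs. if bs = b then \<zero> else w bs)"
 have "w'\<in>phispan {v. vec v\<and>(\<forall>bs. bs\<notin>B --> v bs = \<zero>)}"
  by (rule insert.IH) (use insert.prems in \<open>auto simp: w'_def vec_def\<close>)
 hence "w'\<in>phispan {v. vec v\<and>(\<forall>bs. bs\<notin>insert b B --> v bs = \<zero>)}" by (rule phispan_mono) auto
 hence "va w' (vm (w b) (pv (unitv b)))\<in>phispan {v. vec v\<and>(\<forall>bs. bs\<notin>insert b B --> v bs = \<zero>)}"
  by (rule phispan_step) (use insert.prems in \<open>auto simp: unitv_def vec_def\<close>)
 moreover have "va w' (vm (w b) (pv (unitv b))) = w"
  using insert.prems by (intro ext) (auto simp: va_def vm_def pv_def unitv_def w'_def)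
 ultimately show ?case by simp
qed

text \<open>Only the values of a cochain on bit lists of the right length matter; outside it is cut off.\<close>

lemma flat_cocycle:
 assumes xs: "inR xs" and J: "ideal J R"
  and w: "cocycle (map \<phi> xs) k (Idl (\<phi>`J)) w" "homog (coh xs) j w" "!!bs. length bs\<noteq>length xs ==> w bs = \<zero>"
 shows "w\<in>phispan {z. cocycle xs k J z\<and>homog (coh xs) j z\<and>(\<forall>bs. length bs\<noteq>length xs --> z bs = \<zero>)}"
proof -
 let ?n = "length xs"
 define C where "C = {bs :: bool list. length bs = ?n}"
 define B where "B = {bs\<in>C. kdeg (coh xs) bs = j}"
 have fC: "finite C" using finite_lists_length_eq[of "UNIV :: bool set" ?n] by (simp add: C_def)
 define V where "V = {v. vec v\<and>(\<forall>bs. bs\<notin>B --> v bs = \<zero>)}"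
 have V: "vsub V" by (auto simp: vsub_def V_def va_def vm_def vec_def)
 have Vh: "homog (coh xs) j v\<and>(\<forall>bs. length bs\<noteq>?n --> v bs = \<zero>)" if "v\<in>V" for v
  using that by (auto simp: V_def B_def C_def homog_def)
 have "w\<in>phispan {v\<in>V. \<forall>bs\<in>C. kd (coh (pows xs k)) v bs\<in>J}"
 proof (rule flat_kernels[OF fC V _ _ _ J])
  show "vlin (%v. kd (coh (pows xs k)) v bs)" "vlin (%v. kd (coh (pows (map \<phi> xs) k)) v bs)" for bs
   using xs map_phi_carr[OF xs] by (auto simp: vlin_def kd_va kd_vm vapp)
  show "kd (coh (pows (map \<phi> xs) k)) (pv v) bs = \<phi> (kd (coh (pows xs k)) v bs)" if "v\<in>V" for bs v
   using pv_kd_coh[OF xs, of v k] that by (simp add: V_def pv_def fun_eq_iff)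
  have "w bs = \<zero>" if "bs\<notin>B" for bs using that w(2,3) by (auto simp: B_def C_def homog_def)
  moreover have "finite B" using fC by (simp add: B_def)
  ultimately show "w\<in>phispan V" unfolding V_def using phispan_supported[of B w] cocycle_vec[OF w(1)] by blast
  show "kd (coh (pows (map \<phi> xs) k)) w bs\<in>Idl (\<phi>`J)" if "bs\<in>C" for bs
   using w(1) that by (simp add: cocycle_def vin_def C_def)
 qed
 thus ?thesis
 proof (rule phispan_mono)
  fix v assume v: "v\<in>{v\<in>V. \<forall>bs\<in>C. kd (coh (pows xs k)) v bs\<in>J}"
  hence "vec v" "vin ?n J (kd (coh (pows xs k)) v)" by (simp_all add: V_def vin_def C_def)
  thus "v\<in>{z. cocycle xs k J z\<and>homog (coh xs) j z\<and>(\<forall>bs. length bs\<noteq>?n --> z bs = \<zero>)}"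
   using Vh v by (simp add: cocycle_def)
 qed
qed

text \<open>Regularity says that multiplication by \<open>x\<close> has zero kernel modulo
  \<open>J\<close>, and \<open>flat_kernel\<close> describes the kernel after base change. The ring
  is embedded as the cochains supported at the empty bit list.\<close>

lemma flat_regular_mod:
 assumes J: "ideal J R" "x\<in>CR" "regular_mod J x"
 shows "regular_mod (Idl (\<phi>`J)) (\<phi> x)"
 unfolding regular_mod_def
proof (intro ballI impI)
 fix r assume r: "r\<in>CR" "r\<otimes>\<phi> x\<in>Idl (\<phi>`J)"
 define V where "V = {v. vec v\<and>(\<forall>bs. bs\<notin>{[]} --> v bs = \<zero>)}"
 define w where "w = vm r (unitv [])"
 have V: "vsub V" by (auto simp: vsub_def V_def va_def vm_def vec_def)
 have "w\<in>phispan {v\<in>V. v []\<otimes>x\<in>J}"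
 proof (rule flat_kernel[OF V _ _ _ J(1)])
  show "vlin (%v. v []\<otimes>x)" "vlin (%v. v []\<otimes>\<phi> x)" using J(2) by (auto simp: vlin_def vapp l_distr m_assoc)
  show "pv v []\<otimes>\<phi> x = \<phi> (v []\<otimes>x)" if "v\<in>V" for v using that J(2) by (simp add: V_def pv_def)
  show "w\<in>phispan V" unfolding V_def
   by (rule phispan_supported) (use r in \<open>auto simp: w_def vm_def unitv_def vec_def\<close>)
  show "w []\<otimes>\<phi> x\<in>Idl (\<phi>`J)" using r by (simp add: w_def vm_def unitv_def)
 qed
 hence "w\<in>phispan {v. vec v\<and>v []\<in>J}"
  by (rule phispan_mono) (use J(2,3) in \<open>auto simp: V_def regular_mod_def\<close>)
 hence "w []\<in>Idl (\<phi>`J)"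
 proof induction
  case phispan_vz show ?case using ideal_zero[OF phi_idl_ideal[OF J(1)]] by simp
 next
  case (phispan_step w v s)
  have "\<phi>`J\<subseteq>CR" using ideal_carr[OF J(1)] by auto
  hence "\<phi> (v [])\<in>Idl (\<phi>`J)" using genideal_self[of "\<phi>`J"] phispan_step(2) by blast
  thus ?case using ideal_add[OF phi_idl_ideal[OF J(1)]] ideal_mult[OF phi_idl_ideal[OF J(1)]] phispan_step
   by (simp add: va_def vm_def pv_def)
 qed
 thus "r\<in>Idl (\<phi>`J)" using r(1) by (simp add: w_def vm_def unitv_def)
qed

end

section \<open>Parameters and flat local endomorphisms\<close>

context cring
begin

lemma idl_idl_un: "A\<subseteq>CR ==> B\<subseteq>CR ==> Idl (Idl A\<union>B) = Idl (A\<union>B)"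
proof
 assume c: "A\<subseteq>CR" "B\<subseteq>CR"
 have i: "ideal (Idl (A\<union>B)) R" "Idl A\<subseteq>CR" using c genideal_ideal[of "A\<union>B"] ideal_sub[OF genideal_ideal[of A]] by auto
 show "Idl (Idl A\<union>B)\<subseteq>Idl (A\<union>B)"
  using c i genideal_self[of "A\<union>B"] idl_mono[of A "A\<union>B"] by (intro genideal_minimal) auto
 show "Idl (A\<union>B)\<subseteq>Idl (Idl A\<union>B)" using c i genideal_self[of A] by (intro idl_mono) auto
qed

end

section \<open>Existence of a regular system of parameters\<close>

context local_noetherian
begin

text \<open>The top prime lies in \<mm> and is exchanged for it. For \<open>n = 0\<close> this moves
  the bottom prime too, so only an inclusion is claimed.\<close>

lemma prime_chain_of_primes:
 fixes P :: "nat => 'a set"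
 assumes "!!k. k\<le>n ==> primeideal (P k) R" "!!k. k < n ==> P k\<subset>P (Suc k)"
 shows "\<exists>Q. P 0\<subseteq>Q\<and>prime_chain n Q"
 using assms
proof (induction n arbitrary: P)
 case 0
 have "P 0\<subseteq>\<mm>" using proper_ideal_sub_m[of "P 0"] primeideal.I_notcarr[OF 0(1)[of 0]] primeideal.axioms(1)[OF 0(1)[of 0]] by simp
 thus ?case by simp
next
 case (Suc n)
 obtain Q where "P (Suc 0)\<subseteq>Q" "prime_chain n Q" using Suc.IH[of "%k. P (Suc k)"] Suc.prems by auto
 moreover have "P 0\<subset>P (Suc 0)" using Suc.prems by simp
 ultimately have "prime_chain (Suc n) (P 0)" using Suc.prems(1)[of 0] by (auto intro!: exI[of _ Q])
 thus ?case by blast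
qed

text \<open>By regularity \<mm> has \<open>d\<close> generators, and there is a chain of primes of
  length \<open>d\<close>. Adjoining generators one at a time, \<open>prime_chain_through\<close>
  keeps the chain above the ideal and \<open>full_chain_start\<close> makes its first prime equal to
  the ideal. Each \<open>Idl A\<close> is thus prime with a chain of length
  \<open>card (X - A)\<close> above it, which yields independence as well.\<close>

lemma regular_parameters:
 assumes reg: "regular_local_ring R \<mm>" and d: "krull_dim R = enat d"
 shows "\<exists>X. card X = d\<and>local_parameters R \<mm> X"
proof -
 let ?Q = "%n. \<exists>A\<subseteq>CR. finite A\<and>card A = n\<and>\<mm> = genideal R A"
 have "d = (LEAST n. ?Q n)" using reg d by (simp add: regular_local_ring_def)
 moreover have "\<exists>n. ?Q n" using finetely_gen[OF m_ideal] by blast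
 ultimately obtain X where X: "X\<subseteq>CR" "finite X" "card X = d" "\<mm> = Idl X" using LeastI_ex[of ?Q] by blast
 let ?C = "%n (P :: nat => 'a set). (\<forall>k\<le>n. primeideal (P k) R)\<and>(\<forall>k<n. P k\<subset>P (Suc k))"
 let ?S = "{enat n | n. \<exists>P. ?C n P}"
 have S: "Sup ?S = enat d" using d by (simp add: krull_dim_def)
 have 0: "enat 0\<in>?S" unfolding mem_Collect_eq using m_prime by (intro exI[of _ 0] conjI exI[of _ "%_. \<mm>"]) simp_all
 \<comment> \<open>A finite supremum of extended naturals is attained; the trivial chain covers
   \<open>d = 0\<close>.\<close>
 have "enat d\<in>?S"
 proof (rule ccontr)
  assume n: "enat d\<notin>?S"
  then obtain d' where d': "d = Suc d'" using 0 by (cases d) auto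
  have "x\<le>enat d'" if x: "x\<in>?S" for x
  proof -
   have "x\<le>enat d" using Sup_upper[OF x] S by simp
   moreover have "x\<noteq>enat d" using x n by blast
   ultimately show ?thesis using d' x by auto
  qed
  hence "Sup ?S\<le>enat d'" by (rule Sup_least)
  thus False using S d' by simp
 qed
 then obtain P where "?C d P" unfolding mem_Collect_eq by (metis enat.inject)
 hence "\<exists>Q. P 0\<subseteq>Q\<and>prime_chain d Q" by (intro prime_chain_of_primes) blast+
 then obtain Q where Q: "prime_chain d Q" by blast
 have Xm: "X\<subseteq>\<mm>" using genideal_self[OF X(1)] X(4) by simp
 have main: "prime_chain (card (X - A)) (Idl A)" if "finite A" "A\<subseteq>X" for A
  using that
 proof (induction A)
  case empty
  have "Idl ({\<zero>}\<union>X) = Idl X" using idl_idl_un[of "{}" X] X(1) idl_empty by simp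
  moreover have "{\<zero>}\<subseteq>Q" using ideal_zero primeideal.axioms(1)[OF prime_chain_prime[OF Q]] by simp
  ultimately have "Q = {\<zero>}" using full_chain_start[of X "{\<zero>}" Q] X Xm zeroideal Q by simp
  thus ?case using Q X(3) idl_empty by simp
 next
  case (insert a A)
  have c: "A\<subseteq>CR" "a\<in>CR" "insert a A\<subseteq>CR" using insert X(1) by auto
  have "X - A - {a} = X - insert a A" "a\<in>X - A" using insert by blast+
  hence "card (X - A) = Suc (card (X - insert a A))" using card.remove[OF finite_Diff[OF X(2)], of a A] by metis
  moreover have "prime_chain (card (X - A)) (Idl A)" using insert.IH insert.prems by blast
  ultimately have pc: "prime_chain (Suc (card (X - insert a A))) (Idl A)" by (simp only:)
  have "a\<in>\<mm>" using insert.prems Xm by blast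
  then obtain Q where Q: "Idl A\<subset>Q" "a\<in>Q" "prime_chain (card (X - insert a A)) Q"
   using prime_chain_through[OF pc] by blast
  have "Idl (insert a A)\<subseteq>Q" using Q genideal_self[OF c(1)] primeideal.axioms(1)[OF prime_chain_prime[OF Q(3)]]
   by (intro genideal_minimal) auto
  moreover have "insert a A\<union>(X - insert a A) = X" using insert by blast
  hence "Idl (Idl (insert a A)\<union>(X - insert a A)) = \<mm>" using idl_idl_un[OF c(3), of "X - insert a A"] X by auto
  ultimately have "Q = Idl (insert a A)"
   using full_chain_start[of "X - insert a A" "Idl (insert a A)" Q] X Xm Q(3) genideal_ideal[OF c(3)] by auto
  thus ?case using Q by simp
 qed
 have "local_parameters R \<mm> X"
 proof (intro local_parameters.intro parameter_system.intro local_noetherian_axioms noetherian_cring_axioms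
   parameter_system_axioms.intro local_parameters_axioms.intro X)
  show "primeideal (Idl A) R" if "A\<subseteq>X" for A using prime_chain_prime[OF main[OF _ that]] finite_subset[OF that X(2)] .
  show "x\<notin>Idl A" if "A\<subseteq>X" "x\<in>X - A" for A x
  proof
   assume "x\<in>Idl A"
   have c: "A\<subseteq>CR" "insert x A\<subseteq>CR" "insert x A\<subseteq>X" using that X(1) by auto
   have "X - A - {x} = X - insert x A" using that by blast
   hence s: "card (X - A) = Suc (card (X - insert x A))" using card.remove[OF finite_Diff[OF X(2)], of x A] that by metis
   have "Idl (insert x A)\<subseteq>Idl A"
    using \<open>x\<in>Idl A\<close> genideal_self[OF c(1)] genideal_ideal[OF c(1)] by (intro genideal_minimal) auto
   moreover have "Idl A\<subseteq>Idl (insert x A)" using idl_mono[of A "insert x A"] c by blast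
   \<comment> \<open>The same ideal then starts chains of two lengths. The longer one has a second
     prime strictly above it, which \<open>full_chain_start\<close> identifies with the ideal
     itself.\<close>
   ultimately have e: "Idl A = Idl (insert x A)" by blast
   have f: "prime_chain (Suc (card (X - insert x A))) (Idl A)" "prime_chain (card (X - insert x A)) (Idl A)"
    using main[of A] main[of "insert x A"] finite_subset[OF c(3) X(2)] c(3) that(1) s e by auto
   then obtain Q where Q: "Idl A\<subset>Q" "prime_chain (card (X - insert x A)) Q" by auto
   have "insert x A\<union>(X - insert x A) = X" using that by blast
   hence "Idl (Idl (insert x A)\<union>(X - insert x A)) = \<mm>" using idl_idl_un[OF c(2), of "X - insert x A"] X by auto
   hence "Q = Idl (insert x A)"
    using full_chain_start[of "X - insert x A" "Idl (insert x A)" Q] X Xm Q genideal_ideal[OF c(2)] e by auto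
   thus False using Q e by simp
  qed
 qed
 thus ?thesis using X(3) by blast
qed

end

text \<open>If a prime \<open>P\<noteq>\<mm>\<close> contained the images of the parameters, then these images, still a regular
 sequence by flatness, would give a chain of primes below \<open>P\<close> making the dimension too big.\<close>

locale flat_local_parameters = local_parameters + flat_endo +
 assumes phi_m: "\<phi>`\<mm>\<subseteq>\<mm>"
begin

lemma phi_parameters_primary:
 assumes P: "primeideal P R" "\<phi>`X\<subseteq>P"
 shows "P = \<mm>"
proof (rule ccontr)
 assume "P\<noteq>\<mm>"
 have "P\<subseteq>\<mm>" using proper_ideal_sub_m[OF primeideal.axioms(1)[OF P(1)] ] primeideal.I_notcarr[OF P(1)] by blast
 \<comment> \<open>Images are dropped one at a time, starting from \<open>A = X\<close>, where
   \<open>P\<close> itself serves because it is strictly below \<mm>. Each drop finds a strictly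
   smaller prime, so at \<open>A = {}\<close> the chain has one step more than there are
   parameters.\<close>
 have "\<exists>Q. prime_chain (Suc (card (X - A))) Q\<and>Idl (\<phi>`A)\<subseteq>Q\<and>Q\<subseteq>P" if "A\<subseteq>X" for A
  using finite_subset[OF Diff_subset X_fin, of A] that
 proof (induction "X - A" arbitrary: A rule: finite_induct)
  case empty
  hence "A = X" by blast
  have "Idl (\<phi>`X)\<subseteq>P" using P primeideal.axioms(1)[OF P(1)] by (intro genideal_minimal) auto
  thus ?case using \<open>A = X\<close> \<open>P\<subseteq>\<mm>\<close> \<open>P\<noteq>\<mm>\<close> P(1) by (intro exI[of _ P]) auto
 next
  case (insert x F)
  have xX: "x\<in>X - A" "F = X - insert x A" "insert x A\<subseteq>X" using insert.hyps(2,4) insert.prems by blast+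
  have c: "A\<subseteq>CR" "x\<in>CR" "\<phi>`A\<subseteq>CR" "\<phi>`insert x A\<subseteq>CR" using xX insert.prems X_carr by auto
  obtain Q where Q: "prime_chain (Suc (card (X - insert x A))) Q" "Idl (\<phi>`insert x A)\<subseteq>Q" "Q\<subseteq>P"
   using insert.hyps(3)[OF xX(2,3)] by blast
  have Qp: "primeideal Q R" using prime_chain_prime[OF Q(1)] .
  have "regular_mod (Idl A) x"
   unfolding regular_mod_def
  proof (intro ballI impI)
   fix r assume r: "r\<in>CR" "r\<otimes>x\<in>Idl A"
   show "r\<in>Idl A" using primeideal.I_prime[OF X_prime[OF insert.prems] r(1) c(2) r(2)] X_indep[OF insert.prems xX(1)] by blast
  qed
  hence "regular_mod (Idl (\<phi>`(Idl A))) (\<phi> x)" using flat_regular_mod[OF genideal_ideal[OF c(1)] c(2)] by blast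
  moreover have "Idl (\<phi>`(Idl A)) = Idl (\<phi>`A)"
  proof
   have i: "ideal {r\<in>CR. \<phi> r\<in>Idl (\<phi>`A)} R"
    using genideal_ideal[OF c(3)] by (intro idealI_cring) (auto intro: ideal_zero ideal_add ideal_mult)
   have "Idl A\<subseteq>{r\<in>CR. \<phi> r\<in>Idl (\<phi>`A)}"
    using c(1) genideal_self[OF c(3)] by (intro genideal_minimal[OF i]) auto
   thus "Idl (\<phi>`(Idl A))\<subseteq>Idl (\<phi>`A)" by (intro genideal_minimal genideal_ideal c(3)) auto
   show "Idl (\<phi>`A)\<subseteq>Idl (\<phi>`(Idl A))"
    using genideal_self[OF c(1)] ideal_sub[OF genideal_ideal[OF c(1)]] by (intro idl_mono) auto
  qed
  ultimately have r: "regular_mod (Idl (\<phi>`A)) (\<phi> x[^]n)" for n :: nat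
   using regular_mod_pow[of "Idl (\<phi>`A)" "\<phi> x" n] phi_simps(1)[OF c(2)] by simp
  have px: "\<phi> x\<in>Q" using Q(2) genideal_self[OF c(4)] by auto
  \<comment> \<open>Since \<open>\<phi> x\<close> is regular modulo the images of \<open>A\<close>,
    these products avoid the ideal of those images. A prime over it that misses them lies in
    \<open>Q\<close> and does not contain \<open>\<phi> x\<close>.\<close>
  let ?S = "{s\<otimes>(\<phi> x[^](n::nat)) | s n. s\<in>CR - Q}"
  have "\<exists>Q'. primeideal Q' R\<and>Idl (\<phi>`A)\<subseteq>Q'\<and>Q'\<inter>?S = {}"
  proof (rule exists_prime_avoiding[OF genideal_ideal[OF c(3)]])
   show "?S\<subseteq>CR" using c(2) by auto
   have "\<one> = \<one>\<otimes>\<phi> x[^](0::nat)" by simp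
   thus "\<one>\<in>?S" using prime_one[OF Qp] by blast
   fix s t assume "s\<in>?S" "t\<in>?S"
   then obtain a n b m where s: "s = a\<otimes>\<phi> x[^](n::nat)" "a\<in>CR - Q" "t = b\<otimes>\<phi> x[^](m::nat)" "b\<in>CR - Q" by blast
   have "s\<otimes>t = (a\<otimes>b)\<otimes>\<phi> x[^](n + m)" using s c(2) by (simp add: nat_pow_mult[symmetric] cr_simps)
   thus "s\<otimes>t\<in>?S" using prime_compl_mult[OF Qp s(2,4)] by blast
  next
   have False if "s\<in>CR - Q" "s\<otimes>\<phi> x[^]n\<in>Idl (\<phi>`A)" for s and n :: nat
   proof -
    have "s\<in>Idl (\<phi>`A)" using regular_modD[OF r] that by blast
    thus False using that(1) Q(2) idl_mono[of "\<phi>`A" "\<phi>`insert x A"] c(4) by blast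
   qed
   thus "Idl (\<phi>`A)\<inter>?S = {}" by blast
  qed
  then obtain Q' where Q': "primeideal Q' R" "Idl (\<phi>`A)\<subseteq>Q'" "Q'\<inter>?S = {}" by blast
  have sub: "Q'\<subseteq>Q"
  proof
   fix s assume s: "s\<in>Q'"
   have sc: "s\<in>CR" using s ideal_carr primeideal.axioms(1)[OF Q'(1)] by blast
   hence "s = s\<otimes>\<phi> x[^](0::nat)" by simp
   thus "s\<in>Q" using s sc Q'(3) by blast
  qed
  have "\<phi> x = \<one>\<otimes>\<phi> x[^](1::nat)" using c(2) by simp
  hence "\<phi> x\<in>?S" using prime_one[OF Qp] by blast
  hence "Q'\<subset>Q" using px sub Q'(3) by blast
  moreover have "card (X - A) = Suc (card (X - insert x A))" using insert.hyps xX(2) by (metis card_insert_disjoint)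
  ultimately have "prime_chain (Suc (card (X - A))) Q'" using Q(1) Q'(1) by auto
  thus ?case using Q' sub Q(3) by blast
 qed
 from this[of "{}"] obtain Q where Q: "prime_chain (Suc (card X)) Q" by auto
 then obtain Q1 where Q1: "Q\<subset>Q1" "prime_chain (card X) Q1" by auto
 have "Idl ({\<zero>}\<union>X) = \<mm>" using idl_idl_un[of "{}" X] X_carr idl_empty m_gen by simp
 moreover have "X\<subseteq>\<mm>" using genideal_self[OF X_carr] m_gen by simp
 moreover have "{\<zero>}\<subseteq>Q1" using ideal_zero primeideal.axioms(1)[OF prime_chain_prime[OF Q1(2)]] by simp
 ultimately have "Q1 = {\<zero>}" using full_chain_start[of X "{\<zero>}" Q1] X_fin zeroideal Q1 by simp
 moreover have "\<zero>\<in>Q" using ideal_zero primeideal.axioms(1)[OF prime_chain_prime[OF Q]] by simp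
 ultimately show False using Q1(1) by blast
qed

end

section \<open>Vanishing and nilpotence\<close>

context noetherian_cring
begin

text \<open>\<open>kills xs j J J'\<close>: the map from the cohomology of \<open>R/J\<close> to that of \<open>R/J'\<close> in degree \<open>j\<close> is zero.\<close>

definition kills :: "'a list => int => 'a set => 'a set => bool" where
 "kills xs j J J' \<longleftrightarrow> (\<forall>k z. cocycle xs k J z --> homog (coh xs) j z --> null xs k J' z)"

lemma cocycle_mono: "J\<subseteq>K ==> cocycle xs k J z ==> cocycle xs k K z"
 unfolding cocycle_def using vin_mono by blast

lemma kills_mono: "kills xs j J J' ==> I\<subseteq>J ==> J'\<subseteq>K ==> kills xs j I K"
 unfolding kills_def using cocycle_mono null_mono by blast

lemma cocycle_cong:
 assumes "inR xs" "vec z" "vec w" "!!bs. length bs = length xs ==> z bs = w bs"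
 shows "cocycle xs k J z \<longleftrightarrow> cocycle xs k J w"
proof -
 have "kd (coh (pows xs k)) z bs = kd (coh (pows xs k)) w bs" if "length bs = length xs" for bs
  by (rule kd_cong) (use assms that in simp_all)
 from vin_cong[of "length xs" "kd (coh (pows xs k)) z" "kd (coh (pows xs k)) w", OF this]
 show ?thesis using assms(2,3) by (simp add: cocycle_def)
qed

lemma null_cong:
 assumes "!!bs. length bs = length xs ==> z bs = w bs"
 shows "null xs k J z \<longleftrightarrow> null xs k J w"
 unfolding null_def using veq_cong[of "length xs" "vs (pows xs _) z" "vs (pows xs _) w"] assms by (simp add: vs_def)

lemma cocycle_right:
 assumes "inR A" "inR B" "ideal J R" "cocycle (A@B) k J u"
 shows "cocycle B k J (%bs. u (replicate (length A) False@bs))"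
 using assms
proof (induction A arbitrary: u)
 case (Cons a A)
 have "cocycle (A@B) k J (hpart False u)"
  using cocycle_Cons[of "A@B" a J u k] Cons.prems cocycle_vec[OF Cons.prems(4)] by simp
 from Cons.IH[OF _ Cons.prems(2,3) this] show ?case using Cons.prems(1) by (simp add: hpart_def)
qed simp

lemma kdeg_false: "kdeg (coh xs) (replicate (length xs) False) = 0"
 by (induction xs) simp_all

lemma homog_right: "homog (coh (A@B)) j u ==> homog (coh B) j (%bs. u (replicate (length A) False@bs))"
 unfolding homog_def using kdeg_append[of "replicate (length A) False" "coh A" "coh B"] kdeg_false[of A] by simp

lemma mem_radicalI: "ideal I R ==> a\<in>I ==> a\<in>radical R I"
 unfolding radical_def using ideal_carr nat_pow_eone by (metis (mono_tags, lifting) mem_Collect_eq)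

lemma same_radical:
 assumes "generates_up_to_radical R xs I" "generates_up_to_radical R ys I" "b\<in>set ys"
 shows "\<exists>n::nat. b[^]n\<in>Idl (set xs)"
proof -
 have "b\<in>radical R (Idl (set ys))" using assms(2,3) genideal_self[of "set ys"]
  unfolding generates_up_to_radical_def by (intro mem_radicalI genideal_ideal) auto
 thus ?thesis using assms(1,2) unfolding generates_up_to_radical_def radical_def by auto
qed

text \<open>A cocycle on \<open>ys\<close> is extended over \<open>J\<close> to the concatenated
  list. Its part on \<open>xs\<close> dies over \<open>J'\<close> by assumption, and over
  \<open>J'\<close> the two parts are null together by \<open>null_right\<close> and
  \<open>null_left\<close>.\<close>

lemma kills_change:
 assumes xs: "inR xs" and ys: "inR ys"
  and r: "!!b. b\<in>set xs ==> \<exists>n::nat. b[^]n\<in>Idl (set ys)" "!!b. b\<in>set ys ==> \<exists>n::nat. b[^]n\<in>Idl (set xs)"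
  and J: "ideal J R" "ideal J' R" "J\<subseteq>J'" and k: "kills xs j J J'"
 shows "kills ys j J J'"
 unfolding kills_def
proof (intro allI impI)
 fix k z assume z: "cocycle ys k J z" "homog (coh ys) j z"
 obtain N u where u: "cocycle (ys@xs) (k + N) J u" "homog (coh (ys@xs)) j u"
   "!!bs. length bs = length ys ==> u (bs@replicate (length xs) False) = vs (pows ys N) z bs"
  using extend_cocycle[OF ys xs J(1) r(1) z] by blast
 have u': "cocycle (ys@xs) (k + N) J' u" using cocycle_mono[OF J(3) u(1)] .
 have "null xs (k + N) J' (%bs. u (replicate (length ys) False@bs))"
  using k cocycle_right[OF ys xs J(1) u(1)] homog_right[OF u(2)] unfolding kills_def by blast
 hence "null (ys@xs) (k + N) J' u" using null_right[OF ys xs J(2) r(2) u'] by blast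
 hence "null ys (k + N) J' (%bs. u (bs@replicate (length xs) False))" using null_left[OF ys xs J(2) r(1) u'] by blast
 hence "null ys (k + N) J' (vs (pows ys N) z)" using null_cong[of ys _ "vs (pows ys N) z", OF u(3)] by blast
 thus "null ys k J' z" using null_level[OF ys J(2) cocycle_vec[OF z(1)]] by blast
qed

abbreviation "ipow I\<equiv>([^]\<^bsub>ideals_set R\<^esub>) I"

lemma ideal_pow_le:
 assumes I: "ideal I R" shows "ideal (ipow I (n::nat)) R" "ipow I (Suc n) = ipow I n \<cdot> I"
proof -
 show "ideal (ipow I n) R"
  by (induction n) (use I oneideal ideal_prod_is_ideal in \<open>simp_all add: ideals_set_def nat_pow_def\<close>)
 show "ipow I (Suc n) = ipow I n \<cdot> I" by (simp add: ideals_set_def nat_pow_def)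
qed

lemma pow_mem_ideal_pow: "ideal I R ==> a\<in>I ==> a[^]n\<in>ipow I (n::nat)"
proof (induction n)
 case 0 thus ?case by (simp add: ideals_set_def)
next
 case (Suc n) thus ?case using ideal_pow_le(2)[of I n] ideal_prod.prod[of "a[^]n" "ipow I n" a I R] by simp
qed

text \<open>Noetherian induction on \<open>J\<close>: enlarge \<open>J\<close> by a socle element and lose one factor of \<open>I\<close>.\<close>

lemma ideal_pow_sub:
 assumes I: "ideal I R" and J: "ideal J R" "!!a. a\<in>I ==> \<exists>n::nat. a[^]n\<in>J"
 shows "\<exists>N::nat. ipow I N\<subseteq>J"
proof (rule ccontr)
 define Q where "Q = (%J. ideal J R\<and>(\<forall>a\<in>I. \<exists>n::nat. a[^]n\<in>J)\<and>\<not> (\<exists>N::nat. ipow I N\<subseteq>J))"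
 assume "\<not> ?thesis"
 hence Q0: "Q J" unfolding Q_def using J by blast
 have Qi: "ideal J R" if "Q J" for J using that unfolding Q_def by blast
 obtain K where QK: "Q K" and KM: "!!L. Q L ==> K\<subseteq>L ==> L = K"
  using obtain_maximal_ideal[of Q, OF Q0 Qi] by metis
 note K = QK[unfolded Q_def]
 have "K\<noteq>CR" using K ideal_sub[OF ideal_pow_le(1)[OF I]] by blast
 then obtain u where u: "u\<in>CR - K" "\<forall>p\<in>I. p\<otimes>u\<in>K"
  using exists_socle[of K I] conjunct1[OF K] conjunct2[OF K] ideal_sub[OF I] by blast
 let ?L = "Idl (insert u K)"
 have L: "ideal ?L R" "insert u K\<subseteq>?L" using idl_insert_is_ideal idl_insert_sup K(1) u(1) by blast+
 hence "\<not> Q ?L" using KM[of ?L] u(1) by blast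
 hence "\<exists>N::nat. ipow I N\<subseteq>?L" unfolding Q_def using L K by blast
 then obtain N :: nat where N: "ipow I N\<subseteq>?L" by blast
 have "r\<in>K" if "r\<in>ipow I N \<cdot> I" for r
  using that
 proof (induction rule: ideal_prod.induct)
  case (prod i j)
  have "i\<in>?L" using N prod(1) by blast
  then obtain a c where a: "i = a\<oplus>c\<otimes>u" "a\<in>K" "c\<in>CR"
   using idl_insert_ideal[OF conjunct1[OF K], of u] u(1) by blast
  have jc: "j\<in>CR" "a\<in>CR" using prod(2) ideal_carr[OF I] a(2) K(1) ideal_carr by blast+
  have "i\<otimes>j = j\<otimes>a\<oplus>c\<otimes>(j\<otimes>u)" unfolding a(1) using jc a(3) u(1) by (simp add: cr_simps)
  thus ?case using ideal_add ideal_mult a(2,3) jc u(2) prod(2) K(1) by simp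
 next
  case (sum s t) thus ?case using ideal_add K(1) by blast
 qed
 hence "ipow I (Suc N)\<subseteq>K" using ideal_pow_le(2)[OF I] by blast
 thus False using K(1) by blast
qed

lemma idl_pows_mono: "inR ys ==> s\<le>t ==> Idl (set (pows ys t))\<subseteq>Idl (set (pows ys s))"
proof (rule genideal_minimal)
 assume h: "inR ys" "s\<le>t"
 show i: "ideal (Idl (set (pows ys s))) R" using genideal_ideal[OF pows_carr[OF h(1)]] .
 show "set (pows ys t)\<subseteq>Idl (set (pows ys s))"
 proof
  fix a assume "a\<in>set (pows ys t)"
  then obtain y where y: "y\<in>set ys" "a = y[^]t" by (auto simp: pows_def)
  have yc: "y\<in>CR" using y(1) h(1) by blast
  have "y[^]s\<in>Idl (set (pows ys s))" using genideal_self[OF pows_carr[OF h(1)], of s] y(1) by (auto simp: pows_def)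
  hence "y[^](t - s)\<otimes>y[^]s\<in>Idl (set (pows ys s))" using ideal_mult[OF i] yc by blast
  thus "a\<in>Idl (set (pows ys s))" using y(2) yc h(2) by (simp add: nat_pow_mult)
 qed
qed

text \<open>Elements of \<open>I\<close> are nilpotent modulo the powers of \<open>ys\<close>, so
  \<open>ideal_pow_sub\<close> gives the first inclusion. For the second, if exponents up to
  \<open>M\<close> bring all generators into \<open>I\<close>, then their powers with exponent
  \<open>M * N\<close> lie in the \<open>N\<close>-th power of \<open>I\<close>.\<close>

lemma pows_cofinal:
 assumes I: "ideal I R" and g: "generates_up_to_radical R ys I"
 shows "\<exists>N::nat. ipow I N\<subseteq>Idl (set (pows ys s))" "\<exists>s. Idl (set (pows ys s))\<subseteq>ipow I (N::nat)"
proof -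
 have ys: "inR ys" and r: "radical R (Idl (set ys)) = radical R I" using g by (auto simp: generates_up_to_radical_def)
 note P = genideal_ideal[OF pows_carr[OF ys]]
 have y1: "\<exists>n::nat. a[^]n\<in>Idl (set (pows ys s))" if a: "a\<in>I" for a
 proof (rule radical_gens)
  show "a\<in>CR" using ideal_carr[OF I a] .
  have "a\<in>radical R I" using mem_radicalI[OF I a] .
  thus "\<exists>n::nat. a[^]n\<in>Idl (set ys)" using r by (auto simp: radical_def)
  show "\<exists>n::nat. b[^]n\<in>Idl (set (pows ys s))" if "b\<in>set ys" for b
   using genideal_self[OF pows_carr[OF ys], of s] that by (auto simp: pows_def)
 qed (rule pows_carr[OF ys] ys)+
 show "\<exists>N::nat. ipow I N\<subseteq>Idl (set (pows ys s))" by (rule ideal_pow_sub[OF I P y1])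
 have "\<exists>M::nat. \<forall>y\<in>set ys. \<exists>m\<le>M. y[^]m\<in>I"
 proof -
  have "\<exists>m::nat. y[^]m\<in>I" if "y\<in>set ys" for y
  proof -
   have "y\<in>radical R (Idl (set ys))" using mem_radicalI[OF genideal_ideal[OF ys]] that genideal_self[OF ys] by blast
   thus ?thesis using r by (auto simp: radical_def)
  qed
  then obtain f :: "'a => nat" where f: "!!y. y\<in>set ys ==> y[^]f y\<in>I" by metis
  have "f y\<le>Max (f`set ys)" if "y\<in>set ys" for y using that by (intro Max_ge) auto
  thus ?thesis using f by blast
 qed
 then obtain M :: nat where M: "!!y. y\<in>set ys ==> \<exists>m\<le>M. y[^]m\<in>I" by blast
 note IN = ideal_pow_le(1)[OF I, of N]
 have "Idl (set (pows ys (M * N)))\<subseteq>ipow I N"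
 proof (rule genideal_minimal[OF IN], rule subsetI)
  fix a assume "a\<in>set (pows ys (M * N))"
  then obtain y where y: "y\<in>set ys" "a = y[^](M * N)" by (auto simp: pows_def)
  obtain m where m: "m\<le>M" "y[^]m\<in>I" using M[OF y(1)] by blast
  have yc: "y\<in>CR" using y(1) ys by blast
  have "(y[^]m)[^]N\<in>ipow I N" using pow_mem_ideal_pow[OF I m(2)] .
  hence "y[^](M * N - m * N)\<otimes>(y[^]m)[^]N\<in>ipow I N" using ideal_mult[OF IN] yc by blast
  moreover have "y[^](M * N - m * N)\<otimes>(y[^]m)[^]N = a"
   using y(2) yc m(1) by (simp add: nat_pow_pow nat_pow_mult)
  ultimately show "a\<in>ipow I N" by simp
 qed
 thus "\<exists>s. Idl (set (pows ys s))\<subseteq>ipow I N" by blast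
qed

end

section \<open>Iterated images of an ideal\<close>

context endo_cring
begin

lemma funpow_hom: "\<phi> ^^ t\<in>ring_hom R R"
proof (induction t)
 case (Suc t) thus ?case using ring_hom_trans[OF Suc phi_hom] by (simp add: o_def)
qed (simp add: ring_hom_def id_def[symmetric])

lemma funpow_endo: "endo_cring R (\<phi> ^^ t)"
 using funpow_hom noetherian_cring_axioms by (simp add: endo_cring_def endo_cring_axioms_def)

text \<open>In the role of the Frobenius powers of \<open>J\<close>, with \<phi> in place of the
  Frobenius endomorphism.\<close>

abbreviation It :: "'a set => nat => 'a set" where "It J t\<equiv>Idl ((\<phi> ^^ t)`J)"

lemma It_ideal: "ideal J R ==> ideal (It J t) R"
 using endo_cring.phi_idl_ideal[OF funpow_endo] .

lemma It_step:
 assumes J: "J\<subseteq>CR" shows "Idl (\<phi>`It J t) = It J (Suc t)" "(\<phi> ^^ t)`It J s\<subseteq>It J (t + s)"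
proof -
 have c: "(\<phi> ^^ t)`J\<subseteq>CR" for t using J ring_hom_closed[OF funpow_hom] by blast
 have gen: "(\<phi> ^^ t)`It J s\<subseteq>It J (t + s)" for t s
 proof -
  interpret e: endo_cring R "\<phi> ^^ t" by (rule funpow_endo)
  have i: "ideal {r\<in>CR. (\<phi> ^^ t) r\<in>It J (t + s)} R"
   using genideal_ideal[OF c[of "t + s"]] by (intro idealI_cring) (auto intro: ideal_zero ideal_add ideal_mult)
  have "It J s\<subseteq>{r\<in>CR. (\<phi> ^^ t) r\<in>It J (t + s)}"
  proof (rule genideal_minimal[OF i], rule subsetI)
   fix a assume "a\<in>(\<phi> ^^ s)`J"
   then obtain b where b: "b\<in>J" "a = (\<phi> ^^ s) b" by blast
   hence "(\<phi> ^^ t) a = (\<phi> ^^ (t + s)) b" by (simp add: funpow_add)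
   thus "a\<in>{r\<in>CR. (\<phi> ^^ t) r\<in>It J (t + s)}"
    using b genideal_self[OF c[of "t + s"]] c[of s] by auto
  qed
  thus ?thesis by blast
 qed
 show "(\<phi> ^^ t)`It J s\<subseteq>It J (t + s)" by (rule gen)
 have cI: "It J t\<subseteq>CR" using ideal_sub[OF genideal_ideal[OF c]] .
 have "\<phi>`It J t\<subseteq>It J (Suc t)" using gen[of 1 t] by simp
 hence "Idl (\<phi>`It J t)\<subseteq>It J (Suc t)" by (rule genideal_minimal[OF genideal_ideal[OF c]])
 moreover have "(\<phi> ^^ Suc t)`J = \<phi>`((\<phi> ^^ t)`J)" by (simp add: image_comp)
 hence "It J (Suc t) = Idl (\<phi>`((\<phi> ^^ t)`J))" by simp
 moreover have "\<dots>\<subseteq>Idl (\<phi>`It J t)" by (rule idl_mono[OF image_mono[OF genideal_self[OF c]]]) (use cI in auto)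
 ultimately show "Idl (\<phi>`It J t) = It J (Suc t)" by blast
qed

end

section \<open>Base change of cocycles and of vanishing maps along iterates\<close>

context flat_endo
begin

lemma null_phispan:
 assumes xs: "inR xs" "ideal J R" and V: "\<forall>v\<in>V. vec v" and n: "!!v. v\<in>V ==> null xs k J (pv v)"
  and w: "w\<in>phispan V"
 shows "null xs k J w"
 using w
proof induction
 case phispan_vz show ?case using null_vin[OF xs vec_closed(4) vin_vz[OF xs(2)]] .
next
 case (phispan_step w v r)
 thus ?case using null_va[OF xs phispan_vec[OF phispan_step(1) V]] null_vm[OF xs] n V by simp
qed

definition cut :: "nat => (bool list => 'a) => bool list => 'a" where
 "cut n z = (%bs. if length bs = n then z bs else \<zero>)"

lemma cut_simps [simp]: "vec z ==> vec (cut n z)" "length bs = n ==> cut n z bs = z bs" "length bs\<noteq>n ==> cut n z bs = \<zero>"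
 by (auto simp: cut_def vec_def)

lemma cocycle_cut: "inR xs ==> cocycle xs k J z ==> cocycle xs k J (cut (length xs) z)"
 using cocycle_cong[of xs z "cut (length xs) z" k J] cocycle_vec by simp

lemma homog_cut: "homog L j z ==> homog L j (cut n z)"
 by (simp add: homog_def cut_def)

lemma null_cut: "null xs k J (cut (length xs) z) \<longleftrightarrow> null xs k J z"
 by (rule null_cong) simp

lemma homog_map: "homog (coh (map f xs)) j = homog (coh xs) j"
 by (rule homog_cong) (simp add: comp_def)

text \<open>By \<open>flat_cocycle\<close> the cocycles over the image ideal are spanned by images
  of cocycles modulo \<open>J\<close>; each of these images is null, with the image of the old
  witness as witness.\<close>

lemma kills_phi:
 assumes xs: "inR xs" and J: "ideal J R" "ideal J' R" and k: "kills xs j J J'"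
 shows "kills (map \<phi> xs) j (Idl (\<phi>`J)) (Idl (\<phi>`J'))"
 unfolding kills_def homog_map
proof (intro allI impI)
 fix k z assume z: "cocycle (map \<phi> xs) k (Idl (\<phi>`J)) z" "homog (coh xs) j z"
 have "null (map \<phi> xs) k (Idl (\<phi>`J')) (cut (length xs) z)"
 proof (rule null_phispan[OF map_phi_carr[OF xs] phi_idl_ideal[OF J(2)]])
  show "cut (length xs) z\<in>phispan {z. cocycle xs k J z\<and>homog (coh xs) j z\<and>(\<forall>bs. length bs\<noteq>length xs --> z bs = \<zero>)}"
   using cocycle_cut[OF map_phi_carr[OF xs] z(1)] homog_cut[OF z(2)] by (intro flat_cocycle[OF xs J(1)]) simp_all
 qed (use k cocycle_vec null_pv[OF xs J(2)] kills_def in blast)+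
 thus "null (map \<phi> xs) k (Idl (\<phi>`J')) z" using null_cut[of "map \<phi> xs"] by simp
qed

lemma map_funpow_carr: "inR xs ==> set (map (\<phi> ^^ t) xs)\<subseteq>CR"
 by (rule endo_cring.map_phi_carr[OF funpow_endo])

lemma kills_funpow:
 assumes xs: "inR xs" and J: "ideal J R" "ideal J' R" and k: "kills xs j J J'"
 shows "kills (map (\<phi> ^^ t) xs) j (It J t) (It J' t)"
proof (induction t)
 case 0 thus ?case using k J by (simp add: idl_ideal)
next
 case (Suc t)
 have "map \<phi> (map (\<phi> ^^ t) xs) = map (\<phi> ^^ Suc t) xs" by simp
 with kills_phi[OF map_funpow_carr[OF xs] It_ideal[OF J(1)] It_ideal[OF J(2)] Suc]
 show ?case by (simp only: It_step(1)[OF ideal_sub[OF J(1)]] It_step(1)[OF ideal_sub[OF J(2)]])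
qed

text \<open>Flatness is given for \<phi> only, so the span statement is iterated in place of
  flatness: a \<phi>-span inside spans along \<open>\<phi> ^^ t\<close> is a span along
  \<open>\<phi> ^^ Suc t\<close>.\<close>

lemma flat_cocycle_funpow:
 assumes xs: "inR xs" and J: "ideal J R"
  and w: "cocycle (map (\<phi> ^^ t) xs) k (It J t) w" "homog (coh xs) j w" "!!bs. length bs\<noteq>length xs ==> w bs = \<zero>"
 shows "w\<in>endo_cring.phispan R (\<phi> ^^ t) {z. cocycle xs k J z\<and>homog (coh xs) j z\<and>(\<forall>bs. length bs\<noteq>length xs --> z bs = \<zero>)}"
  (is "_\<in>endo_cring.phispan R _ ?V")
 using w
proof (induction t arbitrary: w)
 case 0
 interpret e: endo_cring R "\<phi> ^^ 0" by (rule funpow_endo)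
 have "(\<phi> ^^ 0)`J = J" by simp
 hence "w\<in>?V" using "0.prems" idl_ideal[OF J] by (simp del: image_cong_simp)
 moreover have "vec w" using cocycle_vec[OF "0.prems"(1)] .
 moreover from this have "vm \<one> (e.pv w) = w" unfolding e.pv_def by (intro ext) (simp add: vm_def)
 ultimately show ?case using e.phispan_pv[of w ?V \<one>] one_closed by metis
next
 case (Suc t)
 interpret e: endo_cring R "\<phi> ^^ t" by (rule funpow_endo)
 interpret f: endo_cring R "\<phi> ^^ Suc t" by (rule funpow_endo)
 have V: "\<forall>v\<in>?V. vec v" using cocycle_vec by blast
 have pp: "pv (e.pv v) = f.pv v" for v unfolding pv_def e.pv_def f.pv_def by simp
 have l: "map \<phi> (map (\<phi> ^^ t) xs) = map (\<phi> ^^ Suc t) xs" by simp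
 let ?W = "{z. cocycle (map (\<phi> ^^ t) xs) k (It J t) z\<and>homog (coh xs) j z\<and>(\<forall>bs. length bs\<noteq>length xs --> z bs = \<zero>)}"
 have "w\<in>phispan ?W"
  using flat_cocycle[OF map_funpow_carr[OF xs] It_ideal[OF J], of t k t w j] Suc.prems
  unfolding l It_step(1)[OF ideal_sub[OF J]] homog_map length_map by blast
 hence "w\<in>phispan (e.phispan ?V)" by (rule phispan_mono) (use Suc.IH in blast)
 thus ?case
 proof induction
  case phispan_vz show ?case by (rule f.phispan_vz)
 next
  case (phispan_step w v r)
  from \<open>v\<in>e.phispan ?V\<close> have "pv v\<in>f.phispan ?V"
  proof induction
   case phispan_vz show ?case unfolding pv_simps(2) by (rule f.phispan_vz)
  next
   case (phispan_step u v s)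
   have "pv (va u (vm s (e.pv v))) = va (pv u) (vm (\<phi> s) (f.pv v))"
    using e.phispan_vec[OF phispan_step(1) V] bspec[OF V phispan_step(2)] phispan_step(3) pp by simp
   thus ?case using f.phispan_step[OF phispan_step(4,2) phi_simps(1)[OF phispan_step(3)]] by (simp only:)
  qed
  from f.phispan_lin(1)[OF V f.phispan_lin(2)[OF V this phispan_step(3)] phispan_step(4)] show ?case .
 qed
qed

end

section \<open>From pro-vanishing to nilpotence\<close>

context flat_local_parameters
begin

lemma m_generators:
 assumes g: "generates_up_to_radical R xs \<mm>"
 shows "set xs\<subseteq>\<mm>" "b\<in>\<mm> ==> \<exists>n::nat. b[^]n\<in>Idl (set xs)"
proof -
 have c: "inR xs" and r: "radical R (Idl (set xs)) = radical R \<mm>" using g by (auto simp: generates_up_to_radical_def)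
 show "set xs\<subseteq>\<mm>"
 proof
  fix x assume x: "x\<in>set xs"
  hence "x\<in>radical R \<mm>" using mem_radicalI[OF genideal_ideal[OF c]] genideal_self[OF c] r by blast
  thus "x\<in>\<mm>" using prime_pow[OF m_prime] unfolding radical_def by blast
 qed
 show "b\<in>\<mm> ==> \<exists>n::nat. b[^]n\<in>Idl (set xs)"
  using mem_radicalI[OF m_ideal, of b] unfolding r[symmetric] by (simp add: radical_def)
qed

lemma funpow_m: "x\<in>\<mm> ==> (\<phi> ^^ t) x\<in>\<mm>"
 using phi_m by (induction t) auto

text \<open>By \<open>phi_parameters_primary\<close> every prime over the images of \<open>X\<close>
  is \<mm>, so these images generate \<mm> up to radical. Applying \<phi> to the statement for
  \<open>t\<close> puts powers of them into the ideal of the next iterate.\<close>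

lemma funpow_generators:
 assumes g: "generates_up_to_radical R xs \<mm>" and b: "b\<in>\<mm>"
 shows "\<exists>n::nat. b[^]n\<in>Idl (set (map (\<phi> ^^ t) xs))"
 using b
proof (induction t arbitrary: b)
 case 0 thus ?case using m_generators(2)[OF g] by simp
next
 case (Suc t)
 have xc: "inR xs" using g by (simp add: generates_up_to_radical_def)
 note cs = map_funpow_carr[OF xc]
 have pX: "\<phi>`X\<subseteq>CR" using X_carr by auto
 have Xm: "X\<subseteq>\<mm>" using genideal_self[OF X_carr] m_gen by simp
 show ?case
 proof (rule radical_gens[OF cs pX])
  fix c assume "c\<in>\<phi>`X"
  then obtain x where x: "x\<in>X" "c = \<phi> x" by blast
  obtain n :: nat where n: "x[^]n\<in>Idl (set (map (\<phi> ^^ t) xs))" using Suc.IH[of x] x Xm by blast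
  have "Idl (set (map (\<phi> ^^ t) xs))\<subseteq>{r\<in>CR. \<phi> r\<in>Idl (set (map (\<phi> ^^ Suc t) xs))}"
  proof (rule genideal_minimal)
   show "ideal {r\<in>CR. \<phi> r\<in>Idl (set (map (\<phi> ^^ Suc t) xs))} R"
    using genideal_ideal[OF cs[of "Suc t"]] by (intro idealI_cring) (auto intro: ideal_zero ideal_add ideal_mult)
   show "set (map (\<phi> ^^ t) xs)\<subseteq>{r\<in>CR. \<phi> r\<in>Idl (set (map (\<phi> ^^ Suc t) xs))}"
    using cs[of t] genideal_self[OF cs[of "Suc t"]] by auto
  qed
  hence "\<phi> (x[^]n)\<in>Idl (set (map (\<phi> ^^ Suc t) xs))" using n by blast
  moreover have "\<phi> (x[^]n) = c[^]n" using x X_carr by auto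
  ultimately show "\<exists>n::nat. c[^]n\<in>Idl (set (map (\<phi> ^^ Suc t) xs))" by (intro exI[of _ n]) (simp only:)
 next
  show bc: "b\<in>CR" using Suc.prems m_carr by blast
  have "b\<in>P" if P: "primeideal P R" "Idl (\<phi>`X)\<subseteq>P" for P
   using phi_parameters_primary[OF P(1)] P(2) genideal_self[OF pX] Suc.prems by blast
  thus "\<exists>n::nat. b[^]n\<in>Idl (\<phi>`X)" using mem_radical_iff[OF genideal_ideal[OF pX] bc] by blast
 qed
qed

text \<open>Forwards, \<open>\<phi> ^^ t\<close> carries cocycles modulo \<open>I\<close> to
  cocycles modulo \<open>It I t\<close>, and for large \<open>t\<close> the classes of those die
  over \<open>I\<close>. Backwards, by flatness such images span the cocycles modulo
  \<open>It I k\<close>, so nilpotence kills the map from level \<open>k\<close> to level 0; base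
  change along \<open>\<phi> ^^ t\<close> kills the one from level \<open>t + k\<close> to level
  \<open>t\<close>.\<close>

lemma pro_zero_iff_nilpotent:
 assumes xs: "generates_up_to_radical R xs \<mm>" and I: "ideal I R" and dec: "decseq (It I)"
 shows "(\<forall>t. \<exists>t'. kills xs j (It I t') (It I t)) \<longleftrightarrow>
  (\<exists>k\<ge>1. \<forall>l z. cocycle xs l I z --> homog (coh xs) j z --> null (map (\<phi> ^^ k) xs) l I (%bs. (\<phi> ^^ k) (z bs)))"
  (is "?A \<longleftrightarrow> ?B")
proof -
 have xc: "inR xs" using xs by (simp add: generates_up_to_radical_def)
 have I0: "It I 0 = I" using idl_ideal[OF I] by simp
 have le: "It I t\<subseteq>It I s" if "s\<le>t" for s t using decseqD[OF dec that] .
 note c = map_funpow_carr[OF xc] and Ii = It_ideal[OF I]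
 have rad: "b\<in>set xs ==> \<exists>n::nat. b[^]n\<in>Idl (set (map (\<phi> ^^ t) xs))"
  "b\<in>set (map (\<phi> ^^ t) xs) ==> \<exists>n::nat. b[^]n\<in>Idl (set xs)" for b t
  using funpow_generators[OF xs, of b t] m_generators(1)[OF xs] m_generators(2)[OF xs, of b] funpow_m by (auto simp del: image_cong_simp)
 show ?thesis
 proof
  assume ?A
  then obtain t where "kills xs j (It I t) (It I 0)" by blast
  \<comment> \<open>The level is raised by one so that the exponent obtained is at least 1 even when
    \<open>t = 0\<close>.\<close>
  hence k0: "kills xs j (It I (Suc t)) I" using kills_mono[OF _ le[of t "Suc t"]] I0 by simp
  have sub: "It I (Suc t)\<subseteq>I" using le[OF le0, of "Suc t"] unfolding I0 .
  have k: "kills (map (\<phi> ^^ Suc t) xs) j (It I (Suc t)) I"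
   by (rule kills_change[OF xc c rad(1)[of _ "Suc t"] rad(2)[of _ "Suc t"] Ii I sub k0])
  interpret e: endo_cring R "\<phi> ^^ Suc t" by (rule funpow_endo)
  have "null (map (\<phi> ^^ Suc t) xs) l I (e.pv z)" if "cocycle xs l I z" "homog (coh xs) j z" for l z
   using k e.cocycle_pv[OF xc I that(1)] e.homog_pv[OF that(2)] unfolding kills_def homog_map by blast
  thus ?B unfolding e.pv_def by (intro exI[of _ "Suc t"] conjI allI impI) simp_all
 next
  assume ?B
  then obtain k where k: "!!l z. cocycle xs l I z ==> homog (coh xs) j z ==> null (map (\<phi> ^^ k) xs) l I (%bs. (\<phi> ^^ k) (z bs))" by blast
  interpret e: endo_cring R "\<phi> ^^ k" by (rule funpow_endo)
  have kk: "kills (map (\<phi> ^^ k) xs) j (It I k) I"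
   unfolding kills_def homog_map
  proof (intro allI impI)
   fix l z assume z: "cocycle (map (\<phi> ^^ k) xs) l (It I k) z" "homog (coh xs) j z"
   let ?V = "{z. cocycle xs l I z\<and>homog (coh xs) j z\<and>(\<forall>bs. length bs\<noteq>length xs --> z bs = \<zero>)}"
   have "cut (length xs) z\<in>e.phispan ?V"
    using cocycle_cut[OF c z(1)] homog_cut[OF z(2)] by (intro flat_cocycle_funpow[OF xc I]) simp_all
   hence "null (map (\<phi> ^^ k) xs) l I (cut (length xs) z)"
   proof induction
    case phispan_vz show ?case using null_vin[OF c I vec_closed(4) vin_vz[OF I]] .
   next
    case (phispan_step w v r)
    have V: "\<forall>v\<in>?V. vec v" using cocycle_vec by blast
    have "vec (e.pv v)" using V phispan_step(2) by simp
    moreover have "null (map (\<phi> ^^ k) xs) l I (e.pv v)" using k phispan_step(2) unfolding e.pv_def by blast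
    ultimately show ?case using null_va[OF c I e.phispan_vec[OF phispan_step(1) V]] null_vm[OF c I] phispan_step by simp
   qed
   thus "null (map (\<phi> ^^ k) xs) l I z" using null_cut[of "map (\<phi> ^^ k) xs"] by simp
  qed
  have "kills xs j (It I (t + k)) (It I t)" for t
  proof (rule kills_change[OF c xc])
   have "It I (t + k)\<subseteq>Idl ((\<phi> ^^ t)`It I k)"
   proof (rule idl_mono)
    have "(\<phi> ^^ (t + k))`I = (\<phi> ^^ t)`((\<phi> ^^ k)`I)" by (simp add: funpow_add image_comp)
    moreover have "(\<phi> ^^ k)`I\<subseteq>It I k" using ideal_carr[OF I] by (intro genideal_self) (auto simp: e.phi_simps(1))
    ultimately show "(\<phi> ^^ (t + k))`I\<subseteq>(\<phi> ^^ t)`It I k" by auto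
    show "(\<phi> ^^ t)`It I k\<subseteq>CR"
     using ideal_sub[OF Ii] ring_hom_closed[OF funpow_hom] by blast
   qed
   moreover have "map (\<phi> ^^ t) (map (\<phi> ^^ k) xs) = map (\<phi> ^^ (t + k)) xs" by (simp add: funpow_add)
   ultimately show "kills (map (\<phi> ^^ (t + k)) xs) j (It I (t + k)) (It I t)"
    using kills_mono[OF kills_funpow[OF c Ii I kk, of t] _ subset_refl] by (simp only:)
  qed (use rad Ii le in simp_all)
  thus ?A by blast
 qed
qed

theorem vanishing_iff_nilpotent:
 assumes xs: "generates_up_to_radical R xs \<mm>" and I: "ideal I R" and dec: "decseq (It I)"
  and cof: "cofinal_chains (It I) (ipow I)" and ys: "generates_up_to_radical R ys I"
 shows "(\<forall>s z. cocycle ys s {\<zero>} z --> homog (coh ys) i z --> null ys s {\<zero>} z) \<longleftrightarrow>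
  (\<exists>k\<ge>1. \<forall>l z. cocycle xs l I z --> homog (coh xs) (int (card X) - i) z -->
    null (map (\<phi> ^^ k) xs) l I (%bs. (\<phi> ^^ k) (z bs)))"
proof -
 let ?j = "int (card X) - i"
 let ?P = "%s. Idl (set (pows ys s))"
 have yc: "inR ys" and xc: "inR xs" using xs ys by (simp_all add: generates_up_to_radical_def)
 note P = genideal_ideal[OF pows_carr[OF yc]] and Pm = idl_pows_mono[OF yc]
 obtain ps where ps: "set ps = X" "distinct ps" using finite_distinct_list[OF X_fin] by blast
 have pc: "inR ps" using ps X_carr by simp
 have pg: "generates_up_to_radical R ps \<mm>" using ps X_carr m_gen by (simp add: generates_up_to_radical_def)
 have len: "length ps = card X" using ps distinct_card by metis
 \<comment> \<open>Duality is proved on a list of the parameters; this passes to the given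
   generators of \<mm> up to radical.\<close>
 have ch: "kills ps ?j (?P t) (?P s) \<longleftrightarrow> kills xs ?j (?P t) (?P s)" if "s\<le>t" for s t
  using kills_change[OF pc xc _ _ P P Pm[OF that]] kills_change[OF xc pc _ _ P P Pm[OF that]]
   same_radical[OF xs pg] same_radical[OF pg xs] by blast
 have "(\<forall>s z. cocycle ys s {\<zero>} z --> homog (coh ys) i z --> null ys s {\<zero>} z) \<longleftrightarrow> (\<forall>s. \<exists>e. kills ps ?j (?P (s + e)) (?P s))"
  using local_duality[OF yc ps(2,1), of i] unfolding kills_def len .
 also have "\<dots> \<longleftrightarrow> (\<forall>s. \<exists>e. kills xs ?j (?P (s + e)) (?P s))" using ch by simp
 also have "\<dots> \<longleftrightarrow> (\<forall>t. \<exists>t'. kills xs ?j (It I t') (It I t))"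
 proof
  have 1: "\<exists>s. ?P s\<subseteq>It I t" for t
  proof -
   obtain N :: nat where "ipow I N\<subseteq>It I t" using cof unfolding cofinal_chains_def by metis
   thus ?thesis using pows_cofinal(2)[OF I ys, of N] by blast
  qed
  have 2: "\<exists>t. It I t\<subseteq>?P s" for s
  proof -
   obtain N :: nat where "ipow I N\<subseteq>?P s" using pows_cofinal(1)[OF I ys] by blast
   moreover obtain t where "It I t\<subseteq>ipow I N" using cof unfolding cofinal_chains_def by metis
   ultimately show ?thesis by blast
  qed
  { assume A: "\<forall>s. \<exists>e. kills xs ?j (?P (s + e)) (?P s)"
   show "\<forall>t. \<exists>t'. kills xs ?j (It I t') (It I t)"
   proof
    fix t
    obtain s where s: "?P s\<subseteq>It I t" using 1 by blast
    obtain e where e: "kills xs ?j (?P (s + e)) (?P s)" using A by blast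
    obtain t' where "It I t'\<subseteq>?P (s + e)" using 2 by blast
    from kills_mono[OF e this s] show "\<exists>t'. kills xs ?j (It I t') (It I t)" by (rule exI)
   qed }
  { assume A: "\<forall>t. \<exists>t'. kills xs ?j (It I t') (It I t)"
   show "\<forall>s. \<exists>e. kills xs ?j (?P (s + e)) (?P s)"
   proof
    fix s
    obtain t where t: "It I t\<subseteq>?P s" using 2 by blast
    obtain t' where t': "kills xs ?j (It I t') (It I t)" using A by blast
    obtain e where e: "?P e\<subseteq>It I t'" using 1 by metis
    have "?P (s + e)\<subseteq>It I t'" using subset_trans[OF Pm[OF le_add2] e] .
    from kills_mono[OF t' this t] show "\<exists>e. kills xs ?j (?P (s + e)) (?P s)" by (rule exI)
   qed }
 qed
 also note pro_zero_iff_nilpotent[OF xs I dec]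
 finally show ?thesis .
qed

end

section \<open>Cech complexes of cyclic modules\<close>

text \<open>A cyclic module \<open>M\<close>, presented as \<open>R/J\<close> by \<open>p\<close>; this covers both \<open>R\<close> and \<open>R/\<aa>\<close>.\<close>

locale cyclic_module = noetherian_cring +
 fixes M :: "('a, 'c) module" and p :: "'a => 'c" and J
 assumes J: "ideal J R" and p_img: "carrier M = p`CR"
  and p_eq: "a\<in>CR ==> b\<in>CR ==> p a = p b \<longleftrightarrow> a\<ominus>b\<in>J"
  and p_add: "a\<in>CR ==> b\<in>CR ==> p a\<oplus>\<^bsub>M\<^esub> p b = p (a\<oplus>b)"
  and p_smult: "a\<in>CR ==> b\<in>CR ==> a \<odot>\<^bsub>M\<^esub> p b = p (a\<otimes>b)"
  and p_zero: "\<zero>\<^bsub>M\<^esub> = p \<zero>"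
begin

abbreviation "L f\<equiv>loc_module R M f"

definition "fr f r k = loc_frac R M f (p r) k"

text \<open>Equality of \<open>r\<close> over \<open>f[^]k\<close> and \<open>s\<close> over
  \<open>f[^]l\<close> as fractions of \<open>R / J\<close>, expressed in \<open>R\<close>.\<close>

definition rel :: "'a => 'a => nat => 'a => nat => bool" where
 "rel f r k s l \<longleftrightarrow> (\<exists>e::nat. f[^]e\<otimes>(f[^]l\<otimes>r\<ominus>f[^]k\<otimes>s)\<in>J)"

lemma relI: "a = \<zero> ==> f[^](e::nat)\<otimes>(f[^]l\<otimes>r\<ominus>f[^]k\<otimes>s) = a ==> rel f r k s l"
 unfolding rel_def using ideal_zero[OF J] by metis

lemma fr_mem:
 assumes [simp]: "f\<in>CR" "r\<in>CR" "s\<in>CR"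
 shows "(p s, l)\<in>fr f r k \<longleftrightarrow> rel f r k s l"
proof -
 have "a\<otimes>b\<ominus>a\<otimes>c = a\<otimes>(b\<ominus>c)" if "a\<in>CR" "b\<in>CR" "c\<in>CR" for a b c
  using that by (simp add: cr_simps)
 thus ?thesis unfolding fr_def loc_frac_def rel_def by (simp add: p_smult p_eq p_img)
qed

lemma fr_memE:
 assumes "x\<in>fr f r k" "f\<in>CR" "r\<in>CR"
 obtains s l where "s\<in>CR" "x = (p s, l)" "rel f r k s l"
proof -
 obtain s l where "s\<in>CR" "x = (p s, l)" using assms(1) unfolding fr_def loc_frac_def p_img by blast
 thus thesis using assms fr_mem that by blast
qed

lemma rel_refl: "f\<in>CR ==> r\<in>CR ==> rel f r k r k"
 by (rule relI[where e = 0]) (simp_all add: a_minus_def r_neg)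

lemma rel_sym: assumes [simp]: "f\<in>CR" "r\<in>CR" "s\<in>CR" and h: "rel f r k s l" shows "rel f s l r k"
proof -
 obtain e :: nat where e: "f[^]e\<otimes>(f[^]l\<otimes>r\<ominus>f[^]k\<otimes>s)\<in>J" using h rel_def by blast
 have "\<ominus>(f[^]e\<otimes>(f[^]l\<otimes>r\<ominus>f[^]k\<otimes>s)) = f[^]e\<otimes>(f[^]k\<otimes>s\<ominus>f[^]l\<otimes>r)" by (simp add: cr_simps)
 thus ?thesis using ideal_neg[OF J e] rel_def by metis
qed

lemma rel_trans:
 assumes c: "f\<in>CR" "r\<in>CR" "s\<in>CR" "t\<in>CR" and h: "rel f r k s l" "rel f s l t m"
 shows "rel f r k t m"
proof -
 obtain e e' :: nat where e: "f[^]e\<otimes>(f[^]l\<otimes>r\<ominus>f[^]k\<otimes>s)\<in>J" "f[^]e'\<otimes>(f[^]m\<otimes>s\<ominus>f[^]l\<otimes>t)\<in>J"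
  using h rel_def by blast
 \<comment> \<open>The middle numerator is eliminated by combining the two relations crosswise. The
   middle denominator stays as a factor, hence the exponent \<open>e + e' + l\<close> below.\<close>
 have id: "(a\<otimes>b\<otimes>x)\<otimes>(z\<otimes>r\<ominus>y\<otimes>t) = (b\<otimes>z)\<otimes>(a\<otimes>(x\<otimes>r\<ominus>y\<otimes>s))\<oplus>(a\<otimes>y)\<otimes>(b\<otimes>(z\<otimes>s\<ominus>x\<otimes>t))"
  if "a\<in>CR" "b\<in>CR" "x\<in>CR" "y\<in>CR" "z\<in>CR" "r\<in>CR" "s\<in>CR" "t\<in>CR"
  for a b x y z r s t using that by algebra
 have "f[^](e + e' + l)\<otimes>(f[^]m\<otimes>r\<ominus>f[^]k\<otimes>t)\<in>J"
  using ideal_add[OF J ideal_mult[OF J e(1), of "f[^]e'\<otimes>f[^]m"] ideal_mult[OF J e(2), of "f[^]e\<otimes>f[^]k"]] c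
  by (simp add: id[of _ _ _ _ _ _ s] nat_pow_mult[symmetric])
 thus ?thesis using rel_def by blast
qed

lemma fr_eq:
 assumes c: "f\<in>CR" "r\<in>CR" "s\<in>CR"
 shows "fr f r k = fr f s l \<longleftrightarrow> rel f r k s l"
proof
 assume "fr f r k = fr f s l"
 thus "rel f r k s l" using fr_mem[OF c] fr_mem[OF c(1,3,3)] rel_refl[OF c(1,3)] by blast
next
 assume h: "rel f r k s l"
 have "fr f r k\<subseteq>fr f s l" if c: "r\<in>CR" "s\<in>CR" "rel f r k s l" for r k s l
 proof
  fix x assume "x\<in>fr f r k"
  then obtain t m where t: "t\<in>CR" "x = (p t, m)" "rel f r k t m" using fr_memE c assms(1) by metis
  thus "x\<in>fr f s l" using rel_trans[OF _ c(2,1) t(1) rel_sym[OF _ c] t(3)] fr_mem c assms(1) by simp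
 qed
 from this[OF c(2,3) h] this[OF c(3,2) rel_sym[OF c h]] show "fr f r k = fr f s l" by blast
qed

text \<open>The operations on fractions are unions over all representatives. Once the body does not
  depend on the representative, the union is its value at any one of them, since a fraction is
  nonempty.\<close>

lemma fr_union:
 assumes c: "f\<in>CR" "r\<in>CR" and G: "!!s l. s\<in>CR ==> rel f r k s l ==> G (p s) l = G (p r) k"
 shows "(\<Union>(m, l)\<in>fr f r k. G m l) = G (p r) k"
proof
 show "(\<Union>(m, l)\<in>fr f r k. G m l)\<subseteq>G (p r) k"
 proof
  fix y assume "y\<in>(\<Union>(m, l)\<in>fr f r k. G m l)"
  then obtain x where x: "x\<in>fr f r k" "y\<in>G (fst x) (snd x)" by auto
  thus "y\<in>G (p r) k" using fr_memE[OF x(1) c] G by (metis fst_conv snd_conv)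
 qed
 have "(p r, k)\<in>fr f r k" using fr_mem[OF c c(2)] rel_refl[OF c] by simp
 thus "G (p r) k\<subseteq>(\<Union>(m, l)\<in>fr f r k. G m l)" by blast
qed

lemma fr_raise: assumes "f\<in>CR" "r\<in>CR" shows "fr f r k = fr f (f[^]e\<otimes>r) (k + e)"
 using assms by (subst fr_eq) (auto intro!: relI[where e = 0] simp: nat_pow_mult[symmetric] m_assoc a_minus_def r_neg)

lemma fr_add:
 assumes c: "f\<in>CR" "r\<in>CR" "s\<in>CR"
 shows "fr f r k\<oplus>\<^bsub>L f\<^esub> fr f s l = fr f (f[^]l\<otimes>r\<oplus>f[^]k\<otimes>s) (k + l)"
proof -
 have id: "a\<otimes>(k'\<otimes>l\<otimes>(l\<otimes>r\<oplus>k\<otimes>s)\<ominus>k\<otimes>l\<otimes>(l\<otimes>t\<oplus>k'\<otimes>s)) = l\<otimes>l\<otimes>(a\<otimes>(k'\<otimes>r\<ominus>k\<otimes>t))"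
  if "a\<in>CR" "k\<in>CR" "k'\<in>CR" "l\<in>CR" "r\<in>CR" "s\<in>CR" "t\<in>CR"
  for a k k' l r s t using that by algebra
 have 1: "fr f (f[^]l\<otimes>t\<oplus>f[^]k'\<otimes>s) (k' + l) = fr f (f[^]l\<otimes>r\<oplus>f[^]k\<otimes>s) (k + l)"
  if t: "t\<in>CR" "rel f r k t k'" "r\<in>CR" "s\<in>CR" for r t k k' s l
 proof -
  obtain e :: nat where e: "f[^]e\<otimes>(f[^]k'\<otimes>r\<ominus>f[^]k\<otimes>t)\<in>J" using t(2) rel_def by blast
  have "f[^]e\<otimes>(f[^](k' + l)\<otimes>(f[^]l\<otimes>r\<oplus>f[^]k\<otimes>s)\<ominus>f[^](k + l)\<otimes>(f[^]l\<otimes>t\<oplus>f[^]k'\<otimes>s))\<in>J"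
   using ideal_mult[OF J e, of "f[^]l\<otimes>f[^]l"] c t(1,3,4) by (simp add: id nat_pow_mult[symmetric])
  thus ?thesis using c t by (subst eq_commute, subst fr_eq) (auto simp: rel_def)
 qed
 have 2: "(\<Union>(n, l')\<in>fr f s l. loc_frac R M f (((f[^]l') \<odot>\<^bsub>M\<^esub> p t)\<oplus>\<^bsub>M\<^esub> ((f[^]k') \<odot>\<^bsub>M\<^esub> n)) (k' + l')) =
   fr f (f[^]l\<otimes>t\<oplus>f[^]k'\<otimes>s) (k' + l)" if t: "t\<in>CR" for t k'
 proof (subst fr_union[OF c(1,3)])
  fix s' l' assume s': "s'\<in>CR" "rel f s l s' l'"
  show "loc_frac R M f (((f[^]l') \<odot>\<^bsub>M\<^esub> p t)\<oplus>\<^bsub>M\<^esub> ((f[^]k') \<odot>\<^bsub>M\<^esub> p s')) (k' + l') =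
    loc_frac R M f (((f[^]l) \<odot>\<^bsub>M\<^esub> p t)\<oplus>\<^bsub>M\<^esub> ((f[^]k') \<odot>\<^bsub>M\<^esub> p s)) (k' + l)"
   using 1[OF s' c(3) t, of k'] s'(1) c t by (simp add: p_smult p_add fr_def[symmetric] add.commute a_comm)
 qed (use c t in \<open>simp add: p_smult p_add fr_def\<close>)
 have "fr f r k\<oplus>\<^bsub>L f\<^esub> fr f s l = (\<Union>(m, k')\<in>fr f r k. \<Union>(n, l')\<in>fr f s l.
   loc_frac R M f (((f[^]l') \<odot>\<^bsub>M\<^esub> m)\<oplus>\<^bsub>M\<^esub> ((f[^]k') \<odot>\<^bsub>M\<^esub> n)) (k' + l'))" by (simp add: loc_module_def)
 also have "\<dots> = (\<Union>(n, l')\<in>fr f s l. loc_frac R M f (((f[^]l') \<odot>\<^bsub>M\<^esub> p r)\<oplus>\<^bsub>M\<^esub> ((f[^]k) \<odot>\<^bsub>M\<^esub> n)) (k + l'))"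
  by (rule fr_union[OF c(1,2)]) (use 1 2 c in simp)
 finally show ?thesis using 2[OF c(2)] by simp
qed

lemma fr_add_same:
 assumes "f\<in>CR" "r\<in>CR" "s\<in>CR"
 shows "fr f r k\<oplus>\<^bsub>L f\<^esub> fr f s k = fr f (r\<oplus>s) k"
 using assms fr_raise[of f "r\<oplus>s" k k] by (simp add: fr_add r_distr)

lemma fr_carrier: "carrier (L f) = {fr f r k | r k. r\<in>CR}"
 unfolding loc_module_def fr_def p_img by auto

lemma fr_closed [simp]: "r\<in>CR ==> fr f r k\<in>carrier (L f)" using fr_carrier by blast

lemma fr_zero: assumes "f\<in>CR" shows "\<zero>\<^bsub>L f\<^esub> = fr f \<zero> k"
 using fr_raise[of f "\<zero>" 0 k] assms by (simp add: loc_module_def p_zero fr_def)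

lemma fr_common:
 assumes "f\<in>CR" "X\<in>carrier (L f)" "Y\<in>carrier (L f)" "Z\<in>carrier (L f)"
 shows "\<exists>r s t k. r\<in>CR\<and>s\<in>CR\<and>t\<in>CR\<and>X = fr f r k\<and>Y = fr f s k\<and>Z = fr f t k"
proof -
 obtain r k s l t m where h: "r\<in>CR" "s\<in>CR" "t\<in>CR" "X = fr f r k" "Y = fr f s l" "Z = fr f t m"
  using assms unfolding fr_carrier by blast
 have "X = fr f (f[^](l + m)\<otimes>r) (k + l + m)" "Y = fr f (f[^](k + m)\<otimes>s) (k + l + m)" "Z = fr f (f[^](k + l)\<otimes>t) (k + l + m)"
  using h fr_raise[OF assms(1) h(1), of k "l + m"] fr_raise[OF assms(1) h(2), of l "k + m"] fr_raise[OF assms(1) h(3), of m "k + l"]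
  by (simp_all add: ac_simps)
 moreover have "f[^](l + m)\<otimes>r\<in>CR" "f[^](k + m)\<otimes>s\<in>CR" "f[^](k + l)\<otimes>t\<in>CR"
  using assms(1) h by simp_all
 ultimately show ?thesis by blast
qed

lemma L_group: assumes f: "f\<in>CR" shows "abelian_group (L f)"
proof (rule abelian_groupI)
 fix X Y Z assume X: "X\<in>carrier (L f)" and Y: "Y\<in>carrier (L f)" and Z: "Z\<in>carrier (L f)"
 obtain r s t k where h: "r\<in>CR" "s\<in>CR" "t\<in>CR" "X = fr f r k" "Y = fr f s k" "Z = fr f t k"
  using fr_common[OF f X Y Z] by blast
 show "X\<oplus>\<^bsub>L f\<^esub> Y\<oplus>\<^bsub>L f\<^esub> Z = X\<oplus>\<^bsub>L f\<^esub> (Y\<oplus>\<^bsub>L f\<^esub> Z)" using h f by (simp add: fr_add_same a_assoc)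
next
 fix X Y assume X: "X\<in>carrier (L f)" and Y: "Y\<in>carrier (L f)"
 obtain r s t k where h: "r\<in>CR" "s\<in>CR" "X = fr f r k" "Y = fr f s k"
  using fr_common[OF f X Y Y] by blast
 show "X\<oplus>\<^bsub>L f\<^esub> Y\<in>carrier (L f)" using h f by (simp add: fr_add_same)
 show "X\<oplus>\<^bsub>L f\<^esub> Y = Y\<oplus>\<^bsub>L f\<^esub> X" using h f by (simp add: fr_add_same a_comm)
next
 fix X assume "X\<in>carrier (L f)"
 then obtain r k where h: "r\<in>CR" "X = fr f r k" unfolding fr_carrier by blast
 show "\<zero>\<^bsub>L f\<^esub>\<oplus>\<^bsub>L f\<^esub> X = X" using h f by (simp add: fr_zero[OF f, of k] fr_add_same)
 show "\<exists>Y\<in>carrier (L f). Y\<oplus>\<^bsub>L f\<^esub> X = \<zero>\<^bsub>L f\<^esub>"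
  using h f by (intro bexI[of _ "fr f (\<ominus>r) k"]) (simp_all add: fr_zero[OF f, of k] fr_add_same l_neg)
qed (simp add: fr_zero[OF f, of 0])

lemma fr_neg: assumes "f\<in>CR" "r\<in>CR" shows "\<ominus>\<^bsub>L f\<^esub> fr f r k = fr f (\<ominus>r) k"
 using assms by (intro abelian_group.minus_equality[OF L_group]) (simp_all add: fr_zero[of f k] fr_add_same l_neg)

lemma fr_finsum:
 assumes f: "f\<in>CR" and S: "finite S" "!!i. i\<in>S ==> a i\<in>CR"
 shows "(\<Oplus>\<^bsub>L f\<^esub>i\<in>S. fr f (a i) k) = fr f (\<Oplus>i\<in>S. a i) k"
 using S
proof (induction S)
 case empty
 interpret L: abelian_group "L f" by (rule L_group[OF f])
 show ?case using fr_zero[OF f] by simp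
next
 case (insert i S)
 interpret L: abelian_group "L f" by (rule L_group[OF f])
 have a: "a\<in>S \<rightarrow> CR" "a i\<in>CR" using insert.prems by auto
 have "(\<Oplus>\<^bsub>L f\<^esub>i\<in>insert i S. fr f (a i) k) = fr f (a i) k\<oplus>\<^bsub>L f\<^esub> (\<Oplus>\<^bsub>L f\<^esub>i\<in>S. fr f (a i) k)"
  by (rule L.finsum_insert) (use insert in auto)
 thus ?case using insert a f by (simp add: fr_add_same)
qed

lemma fr_further:
 assumes c: "f\<in>CR" "g\<in>CR" "r\<in>CR"
 shows "loc_further R M g (g\<otimes>f) (fr f r k) = fr (g\<otimes>f) (g[^]k\<otimes>r) k"
proof -
 have id: "(b\<otimes>a)\<otimes>((y\<otimes>x)\<otimes>(w\<otimes>r)\<ominus>(w\<otimes>z)\<otimes>(y\<otimes>s)) = (b\<otimes>y\<otimes>w)\<otimes>(a\<otimes>(x\<otimes>r\<ominus>z\<otimes>s))"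
  if "a\<in>CR" "b\<in>CR" "x\<in>CR" "y\<in>CR" "z\<in>CR" "w\<in>CR" "r\<in>CR" "s\<in>CR"
  for a b x y z w r s using that by algebra
 have "loc_further R M g (g\<otimes>f) (fr f r k) = loc_frac R M (g\<otimes>f) (g[^]k \<odot>\<^bsub>M\<^esub> p r) k"
  unfolding loc_further_def
 proof (rule fr_union[OF c(1,3)])
  fix s l assume s: "s\<in>CR" "rel f r k s l"
  then obtain e :: nat where e: "f[^]e\<otimes>(f[^]l\<otimes>r\<ominus>f[^]k\<otimes>s)\<in>J" using rel_def by blast
  have "(g\<otimes>f)[^]e\<otimes>((g\<otimes>f)[^]l\<otimes>(g[^]k\<otimes>r)\<ominus>(g\<otimes>f)[^]k\<otimes>(g[^]l\<otimes>s))\<in>J"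
   using ideal_mult[OF J e, of "g[^]e\<otimes>g[^]l\<otimes>g[^]k"] c s(1) by (simp add: id nat_pow_distrib)
  hence "fr (g\<otimes>f) (g[^]k\<otimes>r) k = fr (g\<otimes>f) (g[^]l\<otimes>s) l" using c s(1) by (subst fr_eq) (auto simp: rel_def)
  thus "loc_frac R M (g\<otimes>f) (g[^]l \<odot>\<^bsub>M\<^esub> p s) l = loc_frac R M (g\<otimes>f) (g[^]k \<odot>\<^bsub>M\<^esub> p r) k"
   using c s(1) by (simp add: p_smult fr_def)
 qed
 thus ?thesis using c by (simp add: p_smult fr_def)
qed

lemma fr_zero_iff:
 assumes "f\<in>CR" "r\<in>CR"
 shows "fr f r k = \<zero>\<^bsub>L f\<^esub> \<longleftrightarrow> (\<exists>e::nat. f[^]e\<otimes>r\<in>J)"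
 using assms fr_eq[OF assms zero_closed, of k 0] by (simp add: fr_zero[of f 0] rel_def a_minus_def)

end

text \<open>The dictionary from the index sets of the Cech complex to the bit lists of the Koszul
  complex. The head of the list is position 0, so dropping it becomes the preimage of the set under
  \<open>Suc\<close>.\<close>

definition bits :: "nat => nat set => bool list" where
 "bits n S = map (%i. i\<in>S) [0..<n]"

lemma bits_simps [simp]: "bits 0 S = []" "bits (Suc n) S = (0\<in>S)#bits n (Suc -` S)" "length (bits n S) = n"
 unfolding bits_def by (simp_all add: upt_conv_Cons map_Suc_upt[symmetric] del: upt_Suc)

lemma bits_set: "length bs = n ==> bits n {i. i < n\<and>bs ! i} = bs"
 by (simp add: bits_def list_eq_iff_nth_eq)

lemma vimage_Suc:
 fixes S :: "nat set"
 shows "S = (if 0\<in>S then {0} else {})\<union>Suc`(Suc -` S)"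
proof (rule Set.set_eqI)
 fix x show "x\<in>S \<longleftrightarrow> x\<in>(if 0\<in>S then {0} else {})\<union>Suc`(Suc -` S)" by (cases x) auto
qed

lemma vimage_Suc_sub: "S\<subseteq>{..<Suc n} ==> Suc -` S\<subseteq>{..<n}" by auto

lemma card_vimage_Suc:
 assumes "finite S" shows "card S = (if 0\<in>S then 1 else 0) + card (Suc -` S)"
proof -
 have f: "finite (Suc -` S)" using assms by (intro finite_vimageI) auto
 have "card S = card ((if 0\<in>S then {0} else {})\<union>Suc`(Suc -` S))" using vimage_Suc[of S] by simp
 also have "\<dots> = card (if 0\<in>S then {0::nat} else {}) + card (Suc`(Suc -` S))" using f by (intro card_Un_disjoint) (auto simp del: image_vimage_eq)
 finally show ?thesis by (simp add: card_image del: image_vimage_eq)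
qed

lemma kdeg_bits: "S\<subseteq>{..<length xs} ==> kdeg (coh xs) (bits (length xs) S) = int (card S)"
proof (induction xs arbitrary: S)
 case (Cons x xs)
 from card_vimage_Suc[of S] Cons.IH[OF vimage_Suc_sub] Cons.prems show ?case using finite_subset[OF Cons.prems] by auto
qed simp

lemma (in comm_monoid) finprod_vimage_Suc:
 assumes "finite S" "!!i. i\<in>S ==> f i\<in>carrier G"
 shows "finprod G f S = (if 0\<in>S then f 0 else \<one>)\<otimes>finprod G (%i. f (Suc i)) (Suc -` S)"
proof -
 have fin: "finite (Suc -` S)" using assms(1) by (intro finite_vimageI) auto
 have "finprod G f S = finprod G f ((if 0\<in>S then {0} else {})\<union>Suc`(Suc -` S))" using vimage_Suc[of S] by simp
 also have "\<dots> = finprod G f (if 0\<in>S then {0} else {})\<otimes>finprod G f (Suc`(Suc -` S))"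
  using assms fin by (intro finprod_Un_disjoint) (auto simp del: image_vimage_eq)
 also have "finprod G f (Suc`(Suc -` S)) = finprod G (%i. f (Suc i)) (Suc -` S)"
  using assms by (intro finprod_reindex) (auto simp del: image_vimage_eq)
 finally show ?thesis using assms(2)[of 0] by simp
qed

context cring
begin

lemmas finsum_vimage_Suc = add.finprod_vimage_Suc[folded finsum_def, simplified]

lemma nth_carr: "inR xs ==> S\<subseteq>{..<length xs} ==> i\<in>S ==> xs ! i\<in>CR"
 using nth_mem by (meson lessThan_iff subsetD)

lemma subprod_carr [simp]: "inR xs ==> S\<subseteq>{..<length xs} ==> subprod R xs S\<in>CR"
 unfolding subprod_def using nth_carr by (intro finprod_closed) blast

lemma subprod_Cons:
 assumes "set (x#xs)\<subseteq>CR" "S\<subseteq>{..<length (x#xs)}"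
 shows "subprod R (x#xs) S = (if 0\<in>S then x else \<one>)\<otimes>subprod R xs (Suc -` S)"
proof -
 have "(x#xs) ! i\<in>CR" if "i\<in>S" for i using nth_carr[OF assms that] .
 thus ?thesis unfolding subprod_def using finprod_vimage_Suc[of S "%i. (x#xs) ! i"] finite_subset[OF assms(2)] by simp
qed

lemma sel_bits:
 "inR xs ==> S\<subseteq>{..<length xs} ==> sel (pows xs e) (bits (length xs) S) = subprod R xs S[^]e"
proof (induction xs arbitrary: S)
 case Nil thus ?case by (simp add: subprod_def)
next
 case (Cons x xs)
 have "Suc -` S\<subseteq>{..<length xs}" using Cons.prems by auto
 thus ?case using Cons by (simp add: subprod_Cons nat_pow_distrib)
qed

text \<open>The recursion of \<open>kd\<close> negates the tail exactly when the head bit is set.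
  Unrolled, this gives the sign of the Cech differential, which counts the elements of
  \<open>S\<close> below \<open>i\<close>.\<close>

lemma kd_bits:
 assumes "inR xs" "vec z" "S\<subseteq>{..<length xs}"
 shows "kd (coh (pows xs k)) z (bits (length xs) S) =
  (\<Oplus>i\<in>S. (if even (card {l\<in>S. l < i}) then (xs ! i)[^]k\<otimes>z (bits (length xs) (S - {i}))
   else\<ominus>((xs ! i)[^]k\<otimes>z (bits (length xs) (S - {i})))))"
 using assms
proof (induction xs arbitrary: z S)
 case Nil thus ?case by simp
next
 case (Cons x xs)
 let ?n = "length xs" and ?S = "Suc -` S"
 have S': "?S\<subseteq>{..<?n}" and fS: "finite S" using Cons.prems(3) finite_subset[OF Cons.prems(3)] by auto
 have c: "x\<in>CR" "inR xs" using Cons.prems by auto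
 have nc: "xs ! i\<in>CR" if "i\<in>?S" for i using nth_carr[OF c(2) S' that] .
 define g where "g = (%i. let t = ((x#xs) ! i)[^]k\<otimes>z (bits (Suc ?n) (S - {i})) in if even (card {l\<in>S. l < i}) then t else\<ominus>t)"
 define h where "h = (%i. let t = (xs ! i)[^]k\<otimes>hpart (0\<in>S) z (bits ?n (?S - {i})) in if even (card {l\<in>?S. l < i}) then t else\<ominus>t)"
 have hc: "h i\<in>CR" if "i\<in>?S" for i using nc[OF that] Cons.prems(2) by (simp add: h_def Let_def hpart_def)
 have gc: "g i\<in>CR" if "i\<in>S" for i
  using nth_carr[OF Cons.prems(1,3) that] Cons.prems(2) by (simp add: g_def Let_def)
 have gh: "g (Suc i) = (if 0\<in>S then\<ominus>h i else h i)" if i: "i\<in>?S" for i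
 proof -
  have "card {l\<in>S. l < Suc i} = (if 0\<in>S then 1 else 0) + card {l\<in>?S. l < i}"
  proof -
   have "Suc -` {l\<in>S. l < Suc i} = {l\<in>?S. l < i}" by auto
   thus ?thesis using card_vimage_Suc[of "{l\<in>S. l < Suc i}"] fS by simp
  qed
  moreover have "Suc -` (S - {Suc i}) = ?S - {i}" by auto
  ultimately show ?thesis using nc[OF i] Cons.prems(2) by (simp add: g_def h_def Let_def app_hpart)
 qed
 have IH: "kd (coh (pows xs k)) (hpart (0\<in>S) z) (bits ?n ?S) = (\<Oplus>i\<in>?S. h i)"
  using Cons.IH[OF c(2) _ S', of "hpart (0\<in>S) z"] Cons.prems(2) by (simp add: h_def Let_def)
 have "(\<Oplus>i\<in>S. g i) = (if 0\<in>S then g 0 else \<zero>)\<oplus>(\<Oplus>i\<in>?S. g (Suc i))"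
  using finsum_vimage_Suc[of S g] gc fS by auto
 also have "(\<Oplus>i\<in>?S. g (Suc i)) = (\<Oplus>i\<in>?S. if 0\<in>S then\<ominus>h i else h i)"
  by (rule finsum_cong') (use gh hc in auto)
 also have "\<dots> = (if 0\<in>S then\<ominus>(\<Oplus>i\<in>?S. h i) else (\<Oplus>i\<in>?S. h i))"
 proof -
  have "finite T ==> T\<subseteq>?S ==> (\<Oplus>i\<in>T.\<ominus>h i) =\<ominus>(\<Oplus>i\<in>T. h i)" for T
  proof (induction T rule: finite_induct)
   case (insert i T)
   have "(%i.\<ominus>h i)\<in>T \<rightarrow> CR" "h\<in>T \<rightarrow> CR" "h i\<in>CR" using insert.prems hc by auto
   thus ?case using insert by (simp add: minus_add)
  qed simp
  from this[OF finite_subset[OF S' finite_lessThan] subset_refl] show ?thesis by simp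
 qed
 finally have s: "(\<Oplus>i\<in>S. g i) = (if 0\<in>S then g 0 else \<zero>)\<oplus>(if 0\<in>S then\<ominus>(\<Oplus>i\<in>?S. h i) else (\<Oplus>i\<in>?S. h i))" .
 have "(\<Oplus>i\<in>?S. h i)\<in>CR" using hc by (intro finsum_closed) auto
 moreover have "Suc -` (S - {0}) = ?S" by auto
 ultimately have "(\<Oplus>i\<in>S. g i) = kd (coh (pows (x#xs) k)) z (bits (Suc ?n) S)"
  unfolding s using IH c Cons.prems(2) by (cases "0\<in>S") (simp_all add: g_def Let_def app_hpart vapp a_minus_def)
 moreover have "length (x#xs) = Suc ?n" by simp
 ultimately show ?case unfolding g_def Let_def by (simp only:)
qed

end

section \<open>Cech cochains as numerators with a common exponent\<close>

context cyclic_module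
begin

abbreviation "CC xs j\<equiv>cech_module R xs M j"
abbreviation "CB xs j\<equiv>cech_coboundaries R xs M j"

definition cc :: "'a list => int => nat => (bool list => 'a) => nat set => ('c\<times>nat) set" where
 "cc xs j k z = (\<lambda>S\<in>cech_index (length xs) j. fr (subprod R xs S) (z (bits (length xs) S)) k)"

lemma idx: "S\<in>cech_index n j ==> S\<subseteq>{..<n}" by (simp add: cech_index_def)

lemma cc_ext: "(!!S. S\<in>cech_index (length xs) j ==> fr (subprod R xs S) (z (bits (length xs) S)) k = fr (subprod R xs S) (w (bits (length xs) S)) l)
  ==> cc xs j k z = cc xs j l w"
 unfolding cc_def by (rule restrict_ext)

lemma cc_cong: "(!!bs. length bs = length xs ==> z bs = w bs) ==> cc xs j k z = cc xs j k w"
 by (rule cc_ext) simp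

lemma CC_group: assumes xs: "inR xs" shows "abelian_group (CC xs j)"
proof (rule abelian_groupI)
 note G = L_group[OF subprod_carr[OF xs idx]] and d = cech_module_def
 note a = abelian_groupE[OF G]
 show "\<zero>\<^bsub>CC xs j\<^esub>\<in>carrier (CC xs j)" using a(2) by (simp add: d)
 fix X Y Z assume h: "X\<in>carrier (CC xs j)" 
 show "\<zero>\<^bsub>CC xs j\<^esub>\<oplus>\<^bsub>CC xs j\<^esub> X = X" using h a(5) by (auto simp: d PiE_iff extensional_def fun_eq_iff)
 show "\<exists>Y\<in>carrier (CC xs j). Y\<oplus>\<^bsub>CC xs j\<^esub> X = \<zero>\<^bsub>CC xs j\<^esub>"
 proof
  let ?Y = "\<lambda>S\<in>cech_index (length xs) j.\<ominus>\<^bsub>L (subprod R xs S)\<^esub> X S"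
  show "?Y\<in>carrier (CC xs j)" using h abelian_group.a_inv_closed[OF G] by (auto simp: d PiE_iff)
  show "?Y\<oplus>\<^bsub>CC xs j\<^esub> X = \<zero>\<^bsub>CC xs j\<^esub>" using h abelian_group.l_neg[OF G] by (auto simp: d PiE_iff fun_eq_iff)
 qed
 assume y: "Y\<in>carrier (CC xs j)"
 show "X\<oplus>\<^bsub>CC xs j\<^esub> Y\<in>carrier (CC xs j)" using h y a(1) by (auto simp: d PiE_iff)
 show "X\<oplus>\<^bsub>CC xs j\<^esub> Y = Y\<oplus>\<^bsub>CC xs j\<^esub> X" using h y a(4) by (auto simp: d PiE_iff fun_eq_iff)
 assume "Z\<in>carrier (CC xs j)"
 thus "X\<oplus>\<^bsub>CC xs j\<^esub> Y\<oplus>\<^bsub>CC xs j\<^esub> Z = X\<oplus>\<^bsub>CC xs j\<^esub> (Y\<oplus>\<^bsub>CC xs j\<^esub> Z)"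
  using h y a(3) by (auto simp: d PiE_iff fun_eq_iff)
qed

lemma index_of_bits:
 assumes "length bs = length xs" "kdeg (coh xs) bs = j" shows "{i. i < length xs\<and>bs ! i}\<in>cech_index (length xs) j"
proof -
 have "{i. i < length xs\<and>bs ! i}\<subseteq>{..<length xs}" by auto
 thus ?thesis using kdeg_bits[of "{i. i < length xs\<and>bs ! i}" xs] bits_set[OF assms(1)] assms(2) by (simp add: cech_index_def)
qed

context
 fixes xs :: "'a list"
 assumes xs: "inR xs"
begin

lemma cc_closed: "vec z ==> cc xs j k z\<in>carrier (CC xs j)"
 unfolding cc_def cech_module_def by auto

lemma cc_va: "vec z ==> vec w ==> cc xs j k (va z w) = cc xs j k z\<oplus>\<^bsub>CC xs j\<^esub> cc xs j k w"
 unfolding cc_def cech_module_def using subprod_carr[OF xs idx] by (auto simp: fun_eq_iff fr_add_same va_def)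

lemma cc_zero: "\<zero>\<^bsub>CC xs j\<^esub> = cc xs j k vz"
 unfolding cc_def cech_module_def using fr_zero[OF subprod_carr[OF xs idx]] by (auto simp: fun_eq_iff)

lemma cc_raise: assumes "vec z" shows "cc xs j k z = cc xs j (k + e) (vs (pows xs e) z)"
 by (rule cc_ext) (use assms fr_raise subprod_carr[OF xs idx] sel_bits[OF xs idx] in \<open>simp add: vs_def\<close>)

text \<open>There are finitely many components, so the largest exponent \<open>K\<close> serves for
  all of them. Outside degree \<open>j\<close> the numerators are set to zero to make
  \<open>z\<close> homogeneous.\<close>

lemma cc_surj:
 assumes h: "\<eta>\<in>carrier (CC xs j)"
 shows "\<exists>k z. vec z\<and>homog (coh xs) j z\<and>\<eta> = cc xs j k z"
proof -
 let ?I = "cech_index (length xs) j"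
 have fin: "finite ?I" by (rule finite_subset[of _ "Set.Pow {..<length xs}"]) (auto simp: cech_index_def)
 have "\<exists>r k. r\<in>CR\<and>\<eta> S = fr (subprod R xs S) r k" if "S\<in>?I" for S
 proof -
  have "\<eta> S\<in>carrier (L (subprod R xs S))" using h that unfolding cech_module_def by auto
  thus ?thesis unfolding fr_carrier by blast
 qed
 then obtain r k where rk: "!!S. S\<in>?I ==> r S\<in>CR\<and>\<eta> S = fr (subprod R xs S) (r S) (k S)" by metis
 define K where "K = Max (insert 0 (k`?I))"
 have K: "k S\<le>K" if "S\<in>?I" for S unfolding K_def using fin that by (intro Max_ge) auto
 define s where "s = (%S. subprod R xs S[^](K - k S)\<otimes>r S)"
 have s: "s S\<in>CR\<and>\<eta> S = fr (subprod R xs S) (s S) K" if "S\<in>?I" for S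
  using rk[OF that] fr_raise[of "subprod R xs S" "r S" "k S" "K - k S"] K[OF that] subprod_carr[OF xs idx[OF that]] by (simp add: s_def)
 define z where "z = (%bs. if length bs = length xs\<and>kdeg (coh xs) bs = j then s {i. i < length xs\<and>bs ! i} else \<zero>)"
 have I: "{i. i < length xs\<and>bs ! i}\<in>?I" if "length bs = length xs" "kdeg (coh xs) bs = j" for bs
  using index_of_bits that by blast
 have "vec z" using s I by (auto simp: vec_def z_def)
 moreover have "homog (coh xs) j z" by (auto simp: homog_def z_def)
 moreover have "\<eta> = cc xs j K z"
 proof (rule PiE_ext[of _ ?I "%S. carrier (L (subprod R xs S))"])
  fix S assume S: "S\<in>?I"
  have "{i. i < length xs\<and>bits (length xs) S ! i} = S" using idx[OF S] by (auto simp: bits_def)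
  moreover have "kdeg (coh xs) (bits (length xs) S) = j" using kdeg_bits[OF idx[OF S]] S by (simp add: cech_index_def)
  ultimately have "z (bits (length xs) S) = s S" by (simp add: z_def)
  thus "\<eta> S = cc xs j K z S" using s[OF S] S by (simp add: cc_def)
 qed (use h cc_closed[OF \<open>vec z\<close>] in \<open>simp_all add: cech_module_def\<close>)
 ultimately show ?thesis by blast
qed

lemma cc_zero_iff:
 assumes z: "vec z" "homog (coh xs) j z"
 shows "cc xs j k z = \<zero>\<^bsub>CC xs j\<^esub> \<longleftrightarrow> (\<exists>e. vin (length xs) J (vs (pows xs e) z))"
proof
 let ?I = "cech_index (length xs) j" and ?n = "length xs"
 { assume h: "cc xs j k z = \<zero>\<^bsub>CC xs j\<^esub>"
  have "\<exists>e::nat. subprod R xs S[^]e\<otimes>z (bits ?n S)\<in>J" if S: "S\<in>?I" for S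
   using fun_cong[OF h, of S] S fr_zero_iff[of "subprod R xs S"] subprod_carr[OF xs idx[OF S]] z(1) by (simp add: cc_def cech_module_def)
  then obtain e :: "nat set => nat" where e: "!!S. S\<in>?I ==> subprod R xs S[^]e S\<otimes>z (bits ?n S)\<in>J" by metis
  have fin: "finite ?I" by (rule finite_subset[of _ "Set.Pow {..<?n}"]) (auto simp: cech_index_def)
  define E where "E = Max (insert 0 (e`?I))"
  have "vs (pows xs E) z bs\<in>J" if l: "length bs = ?n" for bs
  proof (cases "kdeg (coh xs) bs = j")
   case True
   define S where "S = {i. i < ?n\<and>bs ! i}"
   have b: "bits ?n S = bs" and SI: "S\<in>?I"
    using index_of_bits[OF l True] bits_set[OF l] by (simp_all add: S_def)
   have "e S\<le>E" unfolding E_def using fin SI by (intro Max_ge) auto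
   hence "subprod R xs S[^]E = subprod R xs S[^](E - e S)\<otimes>subprod R xs S[^]e S"
    using subprod_carr[OF xs idx[OF SI]] by (simp add: nat_pow_mult)
   moreover have "subprod R xs S[^](E - e S)\<otimes>(subprod R xs S[^]e S\<otimes>z bs)\<in>J"
    using ideal_mult[OF J e[OF SI]] subprod_carr[OF xs idx[OF SI]] b by simp
   ultimately show ?thesis
    using sel_bits[OF xs idx[OF SI], of E] b subprod_carr[OF xs idx[OF SI]] z(1) by (simp add: vs_def m_assoc)
  next
   case False
   hence "z bs = \<zero>" using z(2) l by (simp add: homog_def)
   thus ?thesis using ideal_zero[OF J] sel_carr[OF pows_carr[OF xs], of E bs] by (simp add: vs_def)
  qed
  thus "\<exists>e. vin ?n J (vs (pows xs e) z)" unfolding vin_def by blast }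
 { assume "\<exists>e. vin ?n J (vs (pows xs e) z)"
  then obtain e where e: "!!bs. length bs = ?n ==> vs (pows xs e) z bs\<in>J" unfolding vin_def by blast
  show "cc xs j k z = \<zero>\<^bsub>CC xs j\<^esub>" unfolding cc_def cech_module_def
  proof (simp, rule restrict_ext)
   fix S assume S: "S\<in>?I"
   have "subprod R xs S[^]e\<otimes>z (bits ?n S)\<in>J" using e[of "bits ?n S"] sel_bits[OF xs idx[OF S], of e] by (simp add: vs_def)
   thus "fr (subprod R xs S) (z (bits ?n S)) k = \<zero>\<^bsub>L (subprod R xs S)\<^esub>"
    using fr_zero_iff subprod_carr[OF xs idx[OF S]] z(1) by auto
  qed }
qed

lemma cc_diff: assumes z: "vec z" shows "cech_diff R xs M j (cc xs j k z) = cc xs (j + 1) k (kd (coh (pows xs k)) z)"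
 unfolding cech_diff_def cc_def[of xs "j + 1"]
proof (rule restrict_ext)
 let ?n = "length xs"
 fix S assume S: "S\<in>cech_index ?n (j + 1)"
 let ?f = "subprod R xs S"
 have f: "?f\<in>CR" and fS: "finite S" using subprod_carr[OF xs idx[OF S]] finite_subset[OF idx[OF S]] by auto
 define t where "t = (%i. (xs ! i)[^]k\<otimes>z (bits ?n (S - {i})))"
 define a where "a = (%i. if even (card {l\<in>S. l < i}) then t i else\<ominus>t i)"
 have xc: "xs ! i\<in>CR" if "i\<in>S" for i using nth_carr[OF xs idx[OF S] that] .
 have tc: "t i\<in>CR" if "i\<in>S" for i using xc[OF that] z by (simp add: t_def)
 have trm: "(let t = loc_further R M (xs ! i) ?f (cc xs j k z (S - {i})) in if even (card {l\<in>S. l < i}) then t else\<ominus>\<^bsub>L ?f\<^esub> t) = fr ?f (a i) k"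
  if i: "i\<in>S" for i
 proof -
  have "S - {i}\<subseteq>{..<?n}" "card S = Suc (card (S - {i}))" using idx[OF S] card.remove[OF fS i] by blast+
  hence I: "S - {i}\<in>cech_index ?n j" using S unfolding cech_index_def by simp
  have "?f = xs ! i\<otimes>subprod R xs (S - {i})"
  proof -
   have "insert i (S - {i}) = S" using i by blast
   moreover have "finprod R (%k. xs ! k) (insert i (S - {i})) = xs ! i\<otimes>finprod R (%k. xs ! k) (S - {i})"
    using fS xc i by (intro finprod_insert) auto
   ultimately show ?thesis by (simp add: subprod_def)
  qed
  hence "loc_further R M (xs ! i) ?f (cc xs j k z (S - {i})) = fr ?f (t i) k"
   using fr_further[OF subprod_carr[OF xs idx[OF I]] xc[OF i]] z I by (simp add: cc_def t_def)
  thus ?thesis using fr_neg[OF f tc[OF i]] by (simp add: a_def Let_def)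
 qed
 interpret L: abelian_group "L ?f" by (rule L_group[OF f])
 have "(\<Oplus>\<^bsub>L ?f\<^esub>i\<in>S. (let t = loc_further R M (xs ! i) ?f (cc xs j k z (S - {i})) in if even (card {l\<in>S. l < i}) then t else\<ominus>\<^bsub>L ?f\<^esub> t)) =
   (\<Oplus>\<^bsub>L ?f\<^esub>i\<in>S. fr ?f (a i) k)"
  by (rule L.finsum_cong') (use trm tc a_def in auto)
 also have "\<dots> = fr ?f (\<Oplus>i\<in>S. a i) k" by (rule fr_finsum[OF f fS]) (use tc a_def in auto)
 also have "(\<Oplus>i\<in>S. a i) = kd (coh (pows xs k)) z (bits ?n S)"
  unfolding kd_bits[OF xs z idx[OF S]] a_def t_def by simp
 finally show "(\<Oplus>\<^bsub>L ?f\<^esub>i\<in>S. (let t = loc_further R M (xs ! i) ?f (cc xs j k z (S - {i})) in if even (card {l\<in>S. l < i}) then t else\<ominus>\<^bsub>L ?f\<^esub> t)) =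
   fr ?f (kd (coh (pows xs k)) z (bits ?n S)) k" .
qed

end

lemma its_pows: "inR xs ==> its (coh (pows xs e))" by (auto simp: its_def dest: subsetD[OF pows_carr])

lemma homog_pows: "homog (coh (pows xs e)) = homog (coh xs)"
 by (rule ext, rule homog_cong) (simp add: pows_def comp_def)

lemma mem_coset: "x\<in>N +>\<^bsub>CC xs j\<^esub> c \<longleftrightarrow> (\<exists>h\<in>N. x = h\<oplus>\<^bsub>CC xs j\<^esub> c)"
 by (simp add: a_r_coset_def r_coset_def)

definition "cls xs j k z = CB xs j +>\<^bsub>CC xs j\<^esub> cc xs j k z"

context
 fixes xs :: "'a list"
 assumes xs: "inR xs"
begin

lemma cc_diff_eq: assumes "vec z" "vec w" shows "cc xs j k (va z (vn w))\<oplus>\<^bsub>CC xs j\<^esub> cc xs j k w = cc xs j k z"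
proof -
 have "va (va z (vn w)) w = z" using assms by (intro ext) (simp add: vapp a_assoc l_neg)
 thus ?thesis using cc_va[OF xs, of "va z (vn w)" w] assms by simp
qed

lemma cc_eq_iff:
 assumes "vec z" "vec w" "homog (coh xs) j z" "homog (coh xs) j w"
 shows "cc xs j k z = cc xs j k w \<longleftrightarrow> (\<exists>e. vin (length xs) J (vs (pows xs e) (va z (vn w))))"
proof -
 interpret C: abelian_group "CC xs j" by (rule CC_group[OF xs])
 have "cc xs j k z = cc xs j k w \<longleftrightarrow> cc xs j k (va z (vn w)) = \<zero>\<^bsub>CC xs j\<^esub>"
  using cc_diff_eq[OF assms(1,2), of j k] cc_closed[OF xs] assms(1,2)
  by (metis C.add.r_cancel_one C.add.m_comm vec_closed(1,2))
 thus ?thesis using cc_zero_iff[OF xs, of "va z (vn w)" j k] assms homog_simps by simp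
qed

text \<open>Bringing the fractions of an equation with a coboundary to one exponent and clearing
  denominators gives exactly the equation in \<open>null\<close>.\<close>

lemma cc_null:
 assumes z: "vec z" "homog (coh xs) j z"
 shows "cc xs j k z\<in>CB xs j \<longleftrightarrow> null xs k J z"
proof
 let ?n = "length xs"
 have hv: "homog (coh xs) j (vs (pows xs e) w)" if "homog (coh xs) j w" for e w using homog_vs[OF pows_carr[OF xs] that] .
 note ic = its_pows[OF xs]
 { assume "cc xs j k z\<in>CB xs j"
  then obtain \<eta> where "\<eta>\<in>carrier (CC xs (j - 1))" "cc xs j k z = cech_diff R xs M (j - 1) \<eta>"
   unfolding cech_coboundaries_def by blast
  then obtain l v where v: "vec v" "homog (coh xs) (j - 1) v" "cc xs j k z = cc xs j l (kd (coh (pows xs l)) v)"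
   using cc_surj[OF xs] cc_diff[OF xs] by (metis diff_add_cancel)
  define d where "d = kd (coh (pows xs l)) v"
  have d: "vec d" "homog (coh xs) j d" using v ic homog_kd[of "coh (pows xs l)" v "j - 1"] by (simp_all add: d_def homog_pows)
  have "cc xs j (k + l) (vs (pows xs l) z) = cc xs j (k + l) (vs (pows xs k) d)"
   using v(3) cc_raise[OF xs z(1), of j k l] cc_raise[OF xs d(1), of j l k] by (simp add: d_def add.commute)
  then obtain e where e: "vin ?n J (vs (pows xs e) (va (vs (pows xs l) z) (vn (vs (pows xs k) d))))"
   using cc_eq_iff[of "vs (pows xs l) z" "vs (pows xs k) d" j "k + l"] hv z d xs by auto
  have "veq ?n J (vs (pows xs (e + l)) z) (vs (pows xs (e + k)) d)"
   using e z d xs unfolding veq_def by (simp add: vs_va vs_vn vs_pows_add)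
  moreover have "veq ?n J (vs (pows xs (e + k)) d) (kd (coh (pows xs (l + (e + k)))) (vs (pows xs (e + k)) v))"
   using veq_sym[OF J _ _ kd_pows[OF xs J v(1)]] d(1) v(1) xs ic by (simp add: d_def)
  ultimately have "veq ?n J (vs (pows xs (e + l)) z) (kd (coh (pows xs (l + (e + k)))) (vs (pows xs (e + k)) v))"
   by (rule veq_trans[OF J, rotated 3]) (use z d v xs ic in simp_all)
  moreover have "l + (e + k) = k + (e + l)" by simp
  ultimately show "null xs k J z" unfolding null_def using v(1) xs by (metis pows_carr vec_vs) }
 { assume "null xs k J z"
  then obtain e v where v: "vec v" "veq ?n J (vs (pows xs e) z) (kd (coh (pows xs (k + e))) v)" unfolding null_def by blast
  \<comment> \<open>The witness in \<open>null\<close> has no prescribed degree, while a coboundary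
    needs one of degree \<open>j - 1\<close>; the other components do not affect degree
    \<open>j\<close>.\<close>
  define v' where "v' = trunc (coh xs) (j - 1) v"
  have tr: "trunc (coh (pows xs (k + e))) = trunc (coh xs)"
   unfolding trunc_def fun_eq_iff using kdeg_cong[of "coh (pows xs (k + e))" "coh xs"] by (simp add: pows_def comp_def)
  have kv: "kd (coh (pows xs (k + e))) v' = trunc (coh xs) j (kd (coh (pows xs (k + e))) v)"
   using kd_trunc[OF ic v(1), of "k + e" "j - 1"] by (simp add: v'_def tr)
  have "vin ?n J (va (vs (pows xs e) z) (vn (kd (coh (pows xs (k + e))) v')))"
   unfolding vin_def
  proof (intro allI impI)
   fix bs :: "bool list" assume l: "length bs = ?n"
   show "va (vs (pows xs e) z) (vn (kd (coh (pows xs (k + e))) v')) bs\<in>J"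
   proof (cases "kdeg (coh xs) bs = j")
    case True thus ?thesis using v(2) l unfolding kv veq_def vin_def by (simp add: va_def vn_def trunc_def)
   next
    case False
    hence "vs (pows xs e) z bs = \<zero>" using hv[OF z(2), of e] l by (simp add: homog_def)
    thus ?thesis unfolding kv va_def vn_def using False ideal_zero[OF J] by (simp add: trunc_def)
   qed
  qed
  moreover have w: "vec (kd (coh (pows xs (k + e))) v')" "homog (coh xs) j (kd (coh (pows xs (k + e))) v')" "vec v'"
   using v(1) ic trunc_homog[of "coh xs" j] unfolding kv by (simp_all add: v'_def)
  ultimately have "cc xs j (k + e) (vs (pows xs e) z) = cc xs j (k + e) (kd (coh (pows xs (k + e))) v')"
   using cc_eq_iff[OF _ w(1) hv[OF z(2)] w(2)] vs_pows_0[OF xs] z(1) xs by (metis pows_carr vec_closed(1,2) vec_vs)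
  hence "cc xs j k z = cech_diff R xs M (j - 1) (cc xs (j - 1) (k + e) v')"
   using cc_raise[OF xs z(1), of j k e] cc_diff[OF xs w(3), of "j - 1"] by simp
  thus "cc xs j k z\<in>CB xs j" unfolding cech_coboundaries_def using cc_closed[OF xs w(3)] by blast }
qed

text \<open>The differential of the numerators need vanish only after multiplication by some power.
  Raising the denominators by that power gives numerators that satisfy the strict condition.\<close>

lemma cc_cocycle:
 assumes h: "\<eta>\<in>cech_cocycles R xs M j"
 shows "\<exists>k z. cocycle xs k J z\<and>homog (coh xs) j z\<and>\<eta> = cc xs j k z"
proof -
 note ic = its_pows[OF xs]
 obtain k z where z: "vec z" "homog (coh xs) j z" "\<eta> = cc xs j k z" using h cc_surj[OF xs] unfolding cech_cocycles_def by blast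
 have hk: "homog (coh xs) (j + 1) (kd (coh (pows xs k)) z)" using homog_kd[OF ic z(1), of k j] z(2) unfolding homog_pows .
 have "cc xs (j + 1) k (kd (coh (pows xs k)) z) = \<zero>\<^bsub>CC xs (j + 1)\<^esub>"
  using h z cc_diff[OF xs z(1)] unfolding cech_cocycles_def by simp
 then obtain e where e: "vin (length xs) J (vs (pows xs e) (kd (coh (pows xs k)) z))"
  using cc_zero_iff[OF xs _ hk, of k] ic z(1) by auto
 have "cocycle xs (k + e) J (vs (pows xs e) z)"
  unfolding cocycle_def using veq_vin[OF J _ _ kd_pows[OF xs J z(1), of k e]] e z(1) ic xs by simp
 thus ?thesis using z cc_raise[OF xs z(1), of j k e] homog_vs[OF pows_carr[OF xs] z(2)] by blast
qed

lemma cocycle_cc: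
 assumes "cocycle xs k J z" "homog (coh xs) j z" shows "cc xs j k z\<in>cech_cocycles R xs M j"
proof -
 note ic = its_pows[OF xs]
 have z: "vec z" and v: "vin (length xs) J (kd (coh (pows xs k)) z)" using assms by (simp_all add: cocycle_def)
 have "cc xs (j + 1) k (kd (coh (pows xs k)) z) = \<zero>\<^bsub>CC xs (j + 1)\<^esub>"
  using v ic z subprod_carr[OF xs idx]
  by (auto simp: cc_def cech_module_def fun_eq_iff fr_zero_iff vin_def intro!: exI[of _ "0::nat"])
 thus ?thesis unfolding cech_cocycles_def using cc_closed[OF xs z] cc_diff[OF xs z] by simp
qed

lemma CB_null:
 assumes "\<eta>\<in>CB xs j" shows "\<exists>k z. cocycle xs k J z\<and>homog (coh xs) j z\<and>null xs k J z\<and>\<eta> = cc xs j k z"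
proof -
 note ic = its_pows[OF xs]
 obtain \<theta> where "\<theta>\<in>carrier (CC xs (j - 1))" "\<eta> = cech_diff R xs M (j - 1) \<theta>"
  using assms unfolding cech_coboundaries_def by blast
 then obtain l v where v: "vec v" "homog (coh xs) (j - 1) v" "\<eta> = cc xs j l (kd (coh (pows xs l)) v)"
  using cc_surj[OF xs] cc_diff[OF xs] by (metis diff_add_cancel)
 have "homog (coh xs) j (kd (coh (pows xs l)) v)"
  using homog_kd[OF ic v(1), of l "j - 1"] v(2) unfolding homog_pows by simp
 moreover have "cocycle xs l J (kd (coh (pows xs l)) v)" using v(1) ic kd_kd[OF ic v(1)] vin_vz[OF J] by (simp add: cocycle_def)
 ultimately show ?thesis using v(3) cc_null cocycle_vec assms by metis
qed

lemma CB_subgroup: "subgroup (CB xs j) (add_monoid (CC xs j))"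
proof (rule group.subgroupI)
 interpret C: abelian_group "CC xs j" by (rule CC_group[OF xs])
 show "group (add_monoid (CC xs j))" by (rule C.a_group)
 show "CB xs j\<subseteq>carrier (add_monoid (CC xs j))"
 proof
  fix x assume "x\<in>CB xs j"
  then obtain k z where "cocycle xs k J z" "x = cc xs j k z" using CB_null by blast
  thus "x\<in>carrier (add_monoid (CC xs j))" using cc_closed[OF xs] cocycle_vec by simp
 qed
 have "null xs 0 J vz" using null_vin[OF xs J _ vin_vz[OF J]] by simp
 thus "CB xs j\<noteq>{}" using cc_null[of vz j 0] homog_vz by auto
 fix a assume a: "a\<in>CB xs j"
 obtain k z where z': "cocycle xs k J z" "homog (coh xs) j z" "null xs k J z" "a = cc xs j k z" using CB_null[OF a] by blast
 note z = cocycle_vec[OF z'(1)] z'(2-4)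
 have 0: "va vz (vn z) = vm (\<ominus>\<one>) z" using z(1) vn_vm[OF z(1)] by (intro ext) (simp add: vapp)
 have "cc xs j k (vm (\<ominus>\<one>) z)\<oplus>\<^bsub>CC xs j\<^esub> a = \<zero>\<^bsub>CC xs j\<^esub>" using cc_diff_eq[of vz z j k] z cc_zero[OF xs] unfolding 0 by simp
 hence "\<ominus>\<^bsub>CC xs j\<^esub> a = cc xs j k (vm (\<ominus>\<one>) z)" using cc_closed[OF xs] z by (intro C.minus_equality) simp_all
 moreover have "cc xs j k (vm (\<ominus>\<one>) z)\<in>CB xs j"
  using cc_null[of "vm (\<ominus>\<one>) z"] null_vm[OF xs J z(1) _ z(3)] homog_vm[OF z(2)] z(1) by simp
 ultimately show "inv\<^bsub>add_monoid (CC xs j)\<^esub> a\<in>CB xs j" by (simp add: a_inv_def)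
 fix b assume b: "b\<in>CB xs j"
 obtain l w where w': "cocycle xs l J w" "homog (coh xs) j w" "null xs l J w" "b = cc xs j l w" using CB_null[OF b] by blast
 note w = cocycle_vec[OF w'(1)] w'(2-4)
 have "a\<oplus>\<^bsub>CC xs j\<^esub> b = cc xs j (k + l) (va (vs (pows xs l) z) (vs (pows xs k) w))"
  using cc_va[OF xs, of "vs (pows xs l) z" "vs (pows xs k) w"] cc_raise[OF xs z(1), of j k l] cc_raise[OF xs w(1), of j l k] z w xs
  by (simp add: add.commute)
 moreover have "null xs (k + l) J (va (vs (pows xs l) z) (vs (pows xs k) w))"
  using null_va[OF xs J, of "vs (pows xs l) z" "vs (pows xs k) w" "k + l"] null_level[OF xs J z(1), of k l] null_level[OF xs J w(1), of l k] z w xs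
  by (simp add: add.commute)
 ultimately show "a\<otimes>\<^bsub>add_monoid (CC xs j)\<^esub> b\<in>CB xs j"
  using cc_null[of "va (vs (pows xs l) z) (vs (pows xs k) w)" j "k + l"] z w xs homog_vs[OF pows_carr[OF xs]] homog_va by simp
qed

lemma CB_coset: assumes "h\<in>CB xs j" "c\<in>carrier (CC xs j)" shows "CB xs j +>\<^bsub>CC xs j\<^esub> (h\<oplus>\<^bsub>CC xs j\<^esub> c) = CB xs j +>\<^bsub>CC xs j\<^esub> c"
proof -
 note S = CB_subgroup[of j] and G = abelian_group.a_group[OF CC_group[OF xs], of j]
 have "h\<in>carrier (add_monoid (CC xs j))" using subgroup.mem_carrier[OF S assms(1)] .
 thus ?thesis using group.coset_mult_assoc[OF G subgroup.subset[OF S], of h c] group.coset_join2[OF G _ S assms(1)] assms(2)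
  by (simp add: a_r_coset_def)
qed

lemma cls_eq_iff:
 assumes "vec z" "vec w" "homog (coh xs) j z" "homog (coh xs) j w"
 shows "cls xs j k z = cls xs j l w \<longleftrightarrow> null xs (k + l) J (va (vs (pows xs l) z) (vn (vs (pows xs k) w)))"
proof -
 interpret C: abelian_group "CC xs j" by (rule CC_group[OF xs])
 let ?d = "va (vs (pows xs l) z) (vn (vs (pows xs k) w))"
 have v: "vec (vs (pows xs l) z)" "vec (vs (pows xs k) w)" "vec ?d" using assms xs by simp_all
 have e: "cc xs j (k + l) ?d\<oplus>\<^bsub>CC xs j\<^esub> cc xs j l w = cc xs j k z"
  using cc_diff_eq[OF v(1,2), of j "k + l"] cc_raise[OF xs assms(1), of j k l] cc_raise[OF xs assms(2), of j l k] by (simp add: add.commute)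
 have "homog (coh xs) j ?d" using assms homog_vs[OF pows_carr[OF xs]] homog_simps by simp
 hence "null xs (k + l) J ?d \<longleftrightarrow> cc xs j (k + l) ?d\<in>CB xs j" using cc_null[OF v(3)] by simp
 also have "\<dots> \<longleftrightarrow> cls xs j k z = cls xs j l w"
 proof
  assume "cc xs j (k + l) ?d\<in>CB xs j"
  from CB_coset[OF this cc_closed[OF xs assms(2)], of l] e show "cls xs j k z = cls xs j l w" by (simp add: cls_def)
 next
  assume h: "cls xs j k z = cls xs j l w"
  have "cc xs j k z\<in>cls xs j k z" unfolding cls_def a_r_coset_def
   by (rule group.rcos_self[OF C.a_group _ CB_subgroup]) (use cc_closed[OF xs assms(1)] in simp)
  hence "cc xs j k z\<in>cls xs j l w" using h by simp
  then obtain b where b: "b\<in>CB xs j" "cc xs j k z = b\<oplus>\<^bsub>CC xs j\<^esub> cc xs j l w"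
   unfolding cls_def mem_coset by blast
  have "b = cc xs j (k + l) ?d"
   using b e cc_closed[OF xs] v assms subgroup.mem_carrier[OF CB_subgroup b(1)] by (metis C.add.r_cancel partial_object.select_convs(1))
  thus "cc xs j (k + l) ?d\<in>CB xs j" using b by simp
 qed
 finally show ?thesis by simp
qed

lemma cls_zero_iff:
 assumes "vec z" "homog (coh xs) j z" shows "cls xs j k z = CB xs j \<longleftrightarrow> null xs k J z"
proof -
 note S = CB_subgroup[of j]
 have 0: "\<zero>\<^bsub>CC xs j\<^esub>\<in>CB xs j" using subgroup.one_closed[OF S] by simp
 have "CB xs j = cls xs j 0 vz" unfolding cls_def a_r_coset_def cc_zero[OF xs, of j 0, symmetric]
  by (rule group.coset_join2[OF abelian_group.a_group[OF CC_group[OF xs]] subgroup.mem_carrier[OF S 0] S 0, symmetric])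
 moreover have "va (vs (pows xs 0) z) (vn (vs (pows xs k) vz)) = z"
  using assms(1) xs vs_pows_0[OF xs assms(1)] vs_vz[OF pows_carr[OF xs], of k] by (intro ext) (simp add: vapp)
 ultimately show ?thesis using cls_eq_iff[OF assms(1) vec_closed(4) assms(2) homog_vz, of k 0] by simp
qed

lemma LC_carrier:
 "carrier (local_cohomology R xs M j) = {cls xs j k z | k z. cocycle xs k J z\<and>homog (coh xs) j z}"
 "\<zero>\<^bsub>local_cohomology R xs M j\<^esub> = CB xs j"
proof -
 have "carrier (local_cohomology R xs M j) = {CB xs j +>\<^bsub>CC xs j\<^esub> \<eta> | \<eta>. \<eta>\<in>cech_cocycles R xs M j}"
  unfolding local_cohomology_def quot_module_def
  by (auto simp: ring.extend_def ring.fields_def module.fields_def FactRing_def A_RCOSETS_def RCOSETS_def a_r_coset_def r_coset_def)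
 also have "\<dots> = {cls xs j k z | k z. cocycle xs k J z\<and>homog (coh xs) j z}"
 proof (rule Set.set_eqI)
  fix X
  show "X\<in>{CB xs j +>\<^bsub>CC xs j\<^esub> \<eta> | \<eta>. \<eta>\<in>cech_cocycles R xs M j} \<longleftrightarrow> X\<in>{cls xs j k z | k z. cocycle xs k J z\<and>homog (coh xs) j z}"
   unfolding cls_def mem_Collect_eq using cc_cocycle cocycle_cc by metis
 qed
 finally show "carrier (local_cohomology R xs M j) = {cls xs j k z | k z. cocycle xs k J z\<and>homog (coh xs) j z}" .
 show "\<zero>\<^bsub>local_cohomology R xs M j\<^esub> = CB xs j"
  unfolding local_cohomology_def quot_module_def by (simp add: ring.extend_def FactRing_def)
qed

lemma LC_zero_iff:
 "carrier (local_cohomology R xs M j) = {\<zero>\<^bsub>local_cohomology R xs M j\<^esub>} \<longleftrightarrow>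
  (\<forall>k z. cocycle xs k J z --> homog (coh xs) j z --> null xs k J z)"
proof -
 have "cocycle xs 0 J vz" using kd_vz[OF its_pows[OF xs, of 0]] vin_vz[OF J] unfolding cocycle_def by simp
 hence "cls xs j 0 vz\<in>carrier (local_cohomology R xs M j)" unfolding LC_carrier using homog_vz by blast
 hence "carrier (local_cohomology R xs M j) = {CB xs j} \<longleftrightarrow> carrier (local_cohomology R xs M j)\<subseteq>{CB xs j}" by (metis empty_iff order_refl subset_singletonD)
 also have "\<dots> \<longleftrightarrow> (\<forall>k z. cocycle xs k J z --> homog (coh xs) j z --> cls xs j k z = CB xs j)" unfolding LC_carrier(1) by blast
 also have "\<dots> \<longleftrightarrow> (\<forall>k z. cocycle xs k J z --> homog (coh xs) j z --> null xs k J z)" using cls_zero_iff cocycle_vec by metis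
 finally show ?thesis unfolding LC_carrier(2) .
qed

end

text \<open>The pattern shared by the two projections and by the map that \<phi> induces: on
  cochains \<open>f\<close> acts through \<open>F\<close> on numerators and keeps the exponent.
  Since \<open>F\<close> preserves nullity, all representatives of a class give the same coset, and
  the union in \<open>coset_map\<close> collapses.\<close>

lemma coset_map_cls:
 assumes xs: "inR xs" and ys: "inR ys"
  and f: "!!k z. vec z ==> homog (coh xs) j z ==> f (cc xs j k z) = cc ys j k (F z)"
  and F: "!!z. vec z ==> vec (F z)" "!!z w. vec z ==> vec w ==> F (va z w) = va (F z) (F w)"
   "!!z. homog (coh xs) j z ==> homog (coh ys) j (F z)"
   "!!z e bs. vec z ==> length bs = length ys ==> F (vs (pows xs e) z) bs = vs (pows ys e) (F z) bs"
   "!!k z. cocycle xs k J z ==> null xs k J z ==> null ys k J (F z)"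
  and z: "vec z" "homog (coh xs) j z"
 shows "coset_map (CC ys j) (CB ys j) f (cls xs j k z) = cls ys j k (F z)"
proof -
 have "CB ys j +>\<^bsub>CC ys j\<^esub> f x = cls ys j k (F z)" if x: "x\<in>cls xs j k z" for x
 proof -
  obtain h where h: "h\<in>CB xs j" "x = h\<oplus>\<^bsub>CC xs j\<^esub> cc xs j k z" using x unfolding cls_def mem_coset by blast
  then obtain l w where w: "cocycle xs l J w" "homog (coh xs) j w" "null xs l J w" "h = cc xs j l w" using CB_null[OF xs] by blast
  have vw: "vec w" using cocycle_vec[OF w(1)] .
  note c = pows_carr[OF xs] pows_carr[OF ys]
  have "x = cc xs j (k + l) (va (vs (pows xs k) w) (vs (pows xs l) z))"
   using cc_va[OF xs, of "vs (pows xs k) w" "vs (pows xs l) z"] cc_raise[OF xs z(1), of j k l] cc_raise[OF xs vw, of j l k] z vw h(2) w(4) c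
   by (simp add: add.commute)
  hence "f x = cc ys j (k + l) (F (va (vs (pows xs k) w) (vs (pows xs l) z)))"
   using f z vw w(2) c homog_vs[OF c(1)] homog_va by simp
  also have "\<dots> = cc ys j (k + l) (va (vs (pows ys k) (F w)) (vs (pows ys l) (F z)))"
   by (rule cc_cong) (use F(2,4) z vw c in \<open>simp add: va_def\<close>)
  also have "\<dots> = cc ys j l (F w)\<oplus>\<^bsub>CC ys j\<^esub> cc ys j k (F z)"
   using cc_va[OF ys, of "vs (pows ys k) (F w)" "vs (pows ys l) (F z)"] cc_raise[OF ys, of "F z" j k l] cc_raise[OF ys, of "F w" j l k] F(1) z vw c
   by (simp add: add.commute)
  finally show ?thesis unfolding cls_def
   using CB_coset[OF ys, of "cc ys j l (F w)" j "cc ys j k (F z)"] cc_null[OF ys F(1)[OF vw] F(3)[OF w(2)]] F(5)[OF w(1,3)] cc_closed[OF ys F(1)[OF z(1)]] by simp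
 qed
 moreover have "cls xs j k z\<noteq>{}"
  using subgroup.one_closed[OF CB_subgroup[OF xs, of j]] unfolding cls_def a_r_coset_def r_coset_def by blast
 ultimately show ?thesis unfolding coset_map_def by blast
qed

end

section \<open>Projections from the complex on a concatenated list\<close>

lemma bits_left: "S\<subseteq>{..<a} ==> bits (a + b) S = bits a S@replicate b False"
 by (rule nth_equalityI) (auto simp: bits_def nth_append)

lemma bits_right: "S\<subseteq>{..<b} ==> bits (a + b) ((%k. a + k)`S) = replicate a False@bits b S"
proof -
 have "i\<in>(%k. a + k)`S \<longleftrightarrow> a\<le>i\<and>i - a\<in>S" for i by (auto simp: image_iff) (metis le_add_diff_inverse)
 thus ?thesis by (intro nth_equalityI) (auto simp: bits_def nth_append)
qed

lemma (in cring) add_neg_cancel: "x\<in>CR ==> y\<in>CR ==> x\<oplus>(y\<oplus>\<ominus> x) = y"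
 by (metis a_assoc a_comm a_inv_closed r_neg r_zero)

context cyclic_module
begin

lemma sel_false: "sel us (replicate n False) = \<one>" if "inR us"
 using that
proof (induction us arbitrary: n)
 case (Cons u us) thus ?case by (cases n) auto
qed simp

lemma homog_left: "homog (coh (A@B)) j u ==> homog (coh A) j (%bs. u (bs@replicate (length B) False))"
 unfolding homog_def using kdeg_append[of _ "coh A" "coh B" "replicate (length B) False"] kdeg_false[of B] by simp

lemma cls_cong: "(!!bs. length bs = length xs ==> z bs = w bs) ==> cls xs j k z = cls xs j k w"
 unfolding cls_def using cc_cong by metis

lemma null_diff:
 assumes xs: "inR xs" and v: "vec a" "vec b" and d: "null xs (l + k) J (va (vs (pows xs k) a) (vn (vs (pows xs l) b)))"
 shows "null xs l J a \<longleftrightarrow> null xs k J b"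
proof -
 let ?a = "vs (pows xs k) a" and ?b = "vs (pows xs l) b"
 have c: "vec ?a" "vec ?b" using v xs by simp_all
 have "null xs (l + k) J ?a \<longleftrightarrow> null xs (l + k) J ?b"
 proof
  assume "null xs (l + k) J ?b"
  moreover have "va (va ?a (vn ?b)) ?b = ?a" using c by (intro ext) (simp add: vapp a_assoc l_neg)
  ultimately show "null xs (l + k) J ?a" using null_va[OF xs J _ c(2) d] c by simp
 next
  assume "null xs (l + k) J ?a"
  moreover have "va (vm (\<ominus>\<one>) (va ?a (vn ?b))) ?a = ?b" using c by (intro ext) (simp add: vapp cr_simps add_neg_cancel)
  ultimately show "null xs (l + k) J ?b" using null_va[OF xs J _ c(1) null_vm[OF xs J _ _ d, of "\<ominus>\<one>"]] c by simp
 qed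
 thus ?thesis using null_level[OF xs J v(1), of l k] null_level[OF xs J v(2), of k l] by (simp add: add.commute)
qed

context
 fixes A B :: "'a list"
 assumes A: "inR A" and B: "inR B"
begin

lemma AB: "set (A@B)\<subseteq>CR" using A B by simp

lemma cc_left: "cech_proj_left A j (cc (A@B) j k z) = cc A j k (%bs. z (bs@replicate (length B) False))"
 unfolding cech_proj_left_def cc_def[of A]
proof (rule restrict_ext)
 fix S assume S: "S\<in>cech_index (length A) j"
 have "S\<in>cech_index (length (A@B)) j" using S by (auto simp: cech_index_def)
 moreover have "subprod R (A@B) S = subprod R A S"
  unfolding subprod_def using nth_carr[OF A idx[OF S]] idx[OF S] by (intro finprod_cong') (auto simp: nth_append)
 ultimately show "cc (A@B) j k z S = fr (subprod R A S) (z (bits (length A) S@replicate (length B) False)) k"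
  using bits_left[OF idx[OF S], of "length B"] by (simp add: cc_def)
qed

lemma cc_right: "cech_proj_right A B j (cc (A@B) j k z) = cc B j k (%bs. z (replicate (length A) False@bs))"
 unfolding cech_proj_right_def cc_def[of B]
proof (rule restrict_ext)
 fix S assume S: "S\<in>cech_index (length B) j"
 let ?S = "(%k. length A + k)`S"
 have "?S\<in>cech_index (length (A@B)) j" using S by (auto simp: cech_index_def card_image)
 moreover have "subprod R (A@B) ?S = finprod R (%k. (A@B) ! (length A + k)) S"
  unfolding subprod_def using nth_carr[OF B idx[OF S]] by (intro finprod_reindex) auto
 hence "subprod R (A@B) ?S = subprod R B S" by (simp add: subprod_def)
 ultimately show "cc (A@B) j k z ?S = fr (subprod R B S) (z (replicate (length A) False@bits (length B) S)) k"
  using bits_right[OF idx[OF S], of "length A"] by (simp add: cc_def)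
qed

text \<open>The inverse in \<open>change_generators\<close> is only a choice of preimage. What can
  be used of it is a cocycle \<open>u\<close> on the concatenated list: its part on \<open>A\<close>
  represents the given class and its part on \<open>B\<close> the result.\<close>

lemma change_cls:
 assumes r: "!!b. b\<in>set B ==> \<exists>n::nat. b[^]n\<in>Idl (set A)" "!!a. a\<in>set A ==> \<exists>n::nat. a[^]n\<in>Idl (set B)"
  and z: "cocycle A k J z" "homog (coh A) j z"
 shows "\<exists>l u. cocycle (A@B) l J u\<and>homog (coh (A@B)) j u\<and>
  cls A j l (%bs. u (bs@replicate (length B) False)) = cls A j k z\<and>
  change_generators R A B M j (cls A j k z) = cls B j l (%bs. u (replicate (length A) False@bs))"
proof -
 let ?P = "coset_map (CC A j) (CB A j) (cech_proj_left A j)"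
 let ?L = "local_cohomology R (A@B) M j"
 have P: "?P (cls (A@B) j l u) = cls A j l (%bs. u (bs@replicate (length B) False))" if "vec u" "homog (coh (A@B)) j u" for l u
 proof (rule coset_map_cls[OF AB A cc_left _ _ _ _ _ that])
  show "vs (pows (A@B) e) z (bs@replicate (length B) False) = vs (pows A e) (%bs. z (bs@replicate (length B) False)) bs"
   if "vec z" "length bs = length A" for z e bs
   using sel_append[of bs "pows A e" "pows B e" "replicate (length B) False"] sel_false[OF pows_carr[OF B]] that(2) A B by (simp add: vs_def)
  show "null A k J (%bs. z (bs@replicate (length B) False))" if "cocycle (A@B) k J z" "null (A@B) k J z" for k z
   using null_left[OF A B J r(1) that(1)] that(2) by blast
  show "homog (coh A) j (%bs. z (bs@replicate (length B) False))" if "homog (coh (A@B)) j z" for z using homog_left[OF that] .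
 qed (auto simp: va_def vec_def)
 have Q: "coset_map (CC B j) (CB B j) (cech_proj_right A B j) (cls (A@B) j l u) = cls B j l (%bs. u (replicate (length A) False@bs))"
  if "vec u" "homog (coh (A@B)) j u" for l u
 proof (rule coset_map_cls[OF AB B cc_right _ _ _ _ _ that])
  show "vs (pows (A@B) e) z (replicate (length A) False@bs) = vs (pows B e) (%bs. z (replicate (length A) False@bs)) bs"
   if "vec z" "length bs = length B" for z e bs
   using sel_append[of "replicate (length A) False" "pows A e" "pows B e" bs] sel_false[OF pows_carr[OF A]] that(2) A B by (simp add: vs_def)
  show "null B k J (%bs. z (replicate (length A) False@bs))" if "cocycle (A@B) k J z" "null (A@B) k J z" for k z
   using null_right[OF A B J r(2) that(1)] that(2) by blast
  show "homog (coh B) j (%bs. z (replicate (length A) False@bs))" if "homog (coh (A@B)) j z" for z using homog_right[OF that] .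
 qed (auto simp: va_def vec_def)
 obtain N u where u: "cocycle (A@B) (k + N) J u" "homog (coh (A@B)) j u"
   "!!bs. length bs = length A ==> u (bs@replicate (length B) False) = vs (pows A N) z bs"
  using extend_cocycle[OF A B J r(1) z] by blast
 have "cls A j (k + N) (%bs. u (bs@replicate (length B) False)) = cls A j (k + N) (vs (pows A N) z)"
  by (rule cls_cong) (rule u(3))
 hence "?P (cls (A@B) j (k + N) u) = cls A j k z"
  using P[OF cocycle_vec[OF u(1)] u(2), of "k + N"] cc_raise[OF A cocycle_vec[OF z(1)], of j k N] by (simp add: cls_def)
 moreover have "cls (A@B) j (k + N) u\<in>carrier ?L" unfolding LC_carrier(1)[OF AB] using u(1,2) by blast
 ultimately have im: "cls A j k z\<in>?P`carrier ?L" by (metis image_eqI)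
 let ?U = "inv_into (carrier ?L) ?P (cls A j k z)"
 obtain l w where w: "?U = cls (A@B) j l w" "cocycle (A@B) l J w" "homog (coh (A@B)) j w"
  using inv_into_into[OF im] unfolding LC_carrier(1)[OF AB] by blast
 have "cls A j l (%bs. w (bs@replicate (length B) False)) = cls A j k z"
  using P[OF cocycle_vec[OF w(2)] w(3), of l] f_inv_into_f[OF im] w(1) by simp
 moreover have "change_generators R A B M j (cls A j k z) = cls B j l (%bs. w (replicate (length A) False@bs))"
  unfolding change_generators_def comp_def w(1) by (rule Q[OF cocycle_vec[OF w(2)] w(3)])
 ultimately show ?thesis using w(2,3) by blast
qed

end

end

section \<open>The induced action on classes\<close>

locale cyclic_endo = endo_cring + cyclic_module +
 fixes \<psi> :: "'c => 'c"
 assumes psi: "a\<in>CR ==> \<psi> (p a) = p (\<phi> a)" and phi_J: "\<phi>`J\<subseteq>J"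
begin

lemma funpow_J: "It J t\<subseteq>J"
proof (rule genideal_minimal[OF J])
 show "(\<phi> ^^ t)`J\<subseteq>J" using phi_J by (induction t) auto
qed

lemma subprod_map: "inR xs ==> S\<subseteq>{..<length xs} ==> subprod R (map \<phi> xs) S = \<phi> (subprod R xs S)"
proof (induction xs arbitrary: S)
 case Nil thus ?case by (simp add: subprod_def)
next
 case (Cons x xs)
 have s: "Suc -` S\<subseteq>{..<length xs}" using Cons.prems by auto
 have "subprod R (map \<phi> (x#xs)) S = (if 0\<in>S then \<phi> x else \<one>)\<otimes>subprod R (map \<phi> xs) (Suc -` S)"
  using subprod_Cons[of "\<phi> x" "map \<phi> xs" S] Cons.prems map_phi_carr[of "x#xs"] by simp
 thus ?case using Cons.IH[OF _ s] Cons.prems s by (simp add: subprod_Cons)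
qed

lemma cc_map:
 assumes xs: "inR xs" and z: "vec z"
 shows "cech_map R xs M \<phi> \<psi> j (cc xs j k z) = cc (map \<phi> xs) j k (pv z)"
 unfolding cech_map_def cc_def[of "map \<phi> xs"] length_map
proof (rule restrict_ext)
 fix S assume S: "S\<in>cech_index (length xs) j"
 let ?f = "subprod R xs S" and ?r = "z (bits (length xs) S)"
 have f: "?f\<in>CR" using subprod_carr[OF xs idx[OF S]] .
 have "(\<Union>(m, l)\<in>fr ?f ?r k. loc_frac R M (\<phi> ?f) (\<psi> m) l) = loc_frac R M (\<phi> ?f) (\<psi> (p ?r)) k"
 proof (rule fr_union[OF f])
  fix s l assume s: "s\<in>CR" "rel ?f ?r k s l"
  obtain e :: nat where e: "?f[^]e\<otimes>(?f[^]l\<otimes>?r\<ominus>?f[^]k\<otimes>s)\<in>J" using s(2) rel_def by blast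
  have "\<phi> (?f[^]e\<otimes>(?f[^]l\<otimes>?r\<ominus>?f[^]k\<otimes>s))\<in>J" using e phi_J by blast
  hence "rel (\<phi> ?f) (\<phi> ?r) k (\<phi> s) l" unfolding rel_def using f s(1) z by (intro exI[of _ e]) (simp add: a_minus_def)
  hence "fr (\<phi> ?f) (\<phi> ?r) k = fr (\<phi> ?f) (\<phi> s) l" using fr_eq[of "\<phi> ?f" "\<phi> ?r" "\<phi> s"] f s(1) z by simp
  thus "loc_frac R M (\<phi> ?f) (\<psi> (p s)) l = loc_frac R M (\<phi> ?f) (\<psi> (p ?r)) k" using psi s(1) z by (simp add: fr_def)
 qed (use z in simp)
 thus "(\<Union>(m, l)\<in>cc xs j k z S. loc_frac R M (subprod R (map \<phi> xs) S) (\<psi> m) l) =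
   fr (subprod R (map \<phi> xs) S) (pv z (bits (length xs) S)) k"
  using S psi z subprod_map[OF xs idx[OF S]] by (simp add: cc_def fr_def pv_def)
qed

text \<open>Each application of the action ends with a change of generators, so its iterates are not
  given by a formula on numerators. Vanishing can still be followed: the change is recorded by a
  cocycle \<open>u\<close> on the concatenated list, and applying \<open>\<phi> ^^ m\<close> to
  \<open>u\<close> compares nullity of its two parts on the image lists.\<close>

lemma action_zero_iff:
 fixes j :: int
 assumes xs: "inR xs"
  and r: "!!s t b. b\<in>set (map (\<phi> ^^ s) xs) ==> \<exists>n::nat. b[^]n\<in>Idl (set (map (\<phi> ^^ t) xs))"
 defines "act\<equiv>change_generators R (map \<phi> xs) xs M j \<circ> coset_map (CC (map \<phi> xs) j) (CB (map \<phi> xs) j) (cech_map R xs M \<phi> \<psi> j)"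
 assumes z: "cocycle xs k J z" "homog (coh xs) j z"
 shows "(act ^^ m) (cls xs j k z) = CB xs j \<longleftrightarrow> null (map (\<phi> ^^ m) xs) k J (%bs. (\<phi> ^^ m) (z bs))"
 using z
proof (induction m arbitrary: k z)
 case 0 thus ?case using cls_zero_iff[OF xs cocycle_vec[OF "0.prems"(1)]] by simp
next
 case (Suc m)
 let ?ys = "map \<phi> xs"
 have ys: "set ?ys\<subseteq>CR" using map_phi_carr[OF xs] .
 have h: "homog (coh ?ys) j = homog (coh xs) j" by (rule homog_cong) (simp add: comp_def)
 have zv: "vec z" using cocycle_vec[OF Suc.prems(1)] .
 have r1: "\<exists>n::nat. b[^]n\<in>Idl (set ?ys)" if "b\<in>set xs" for b using r[of b 0 1] that by simp
 have r2: "\<exists>n::nat. b[^]n\<in>Idl (set xs)" if "b\<in>set ?ys" for b using r[of b 1 0] that by simp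
 have nJ: "null ?ys k J (pv z)" if "cocycle xs k J z" "null xs k J z" for k z
  using null_pv[OF xs J cocycle_vec[OF that(1)] that(2)] null_mono[OF funpow_J[of 1]] by simp
 have "coset_map (CC ?ys j) (CB ?ys j) (cech_map R xs M \<phi> \<psi> j) (cls xs j k z) = cls ?ys j k (pv z)"
  by (rule coset_map_cls[OF xs ys cc_map[OF xs] _ _ _ _ nJ zv Suc.prems(2)])
   (use h homog_pv pv_vs[OF pows_carr[OF xs]] phi_pows[OF xs] in simp_all)
 moreover have pz: "cocycle ?ys k J (pv z)" "homog (coh ?ys) j (pv z)"
  using cocycle_mono[OF funpow_J[of 1]] cocycle_pv[OF xs J Suc.prems(1)] homog_pv[OF Suc.prems(2)] h by simp_all
 moreover obtain l u where u: "cocycle (?ys@xs) l J u" "homog (coh (?ys@xs)) j u"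
   "cls ?ys j l (%bs. u (bs@replicate (length xs) False)) = cls ?ys j k (pv z)"
   "change_generators R ?ys xs M j (cls ?ys j k (pv z)) = cls xs j l (%bs. u (replicate (length ?ys) False@bs))"
  using change_cls[OF ys xs r1 r2 pz] by blast
 ultimately have a: "(act ^^ Suc m) (cls xs j k z) = (act ^^ m) (cls xs j l (%bs. u (replicate (length ?ys) False@bs)))"
  by (simp add: funpow_swap1 act_def)
 interpret e: endo_cring R "\<phi> ^^ m" by (rule funpow_endo)
 let ?xm = "map (\<phi> ^^ m) xs" and ?ym = "map (\<phi> ^^ m) ?ys"
 have ym: "?ym = map (\<phi> ^^ Suc m) xs" by (simp add: funpow_swap1)
 note c = e.map_phi_carr[OF xs] e.map_phi_carr[OF ys]
 have vu: "vec u" using cocycle_vec[OF u(1)] .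
 have w: "cocycle (?ym@?xm) l J (e.pv u)"
  using cocycle_mono[OF funpow_J] e.cocycle_pv[OF _ J u(1)] xs ys by simp
 have "(act ^^ m) (cls xs j l (%bs. u (replicate (length ?ys) False@bs))) = CB xs j \<longleftrightarrow>
   null ?xm l J (%bs. e.pv u (replicate (length ?ym) False@bs))"
  unfolding e.pv_def length_map using Suc.IH[OF cocycle_right[OF ys xs J u(1)] homog_right[OF u(2)]] by simp
 also have "\<dots> \<longleftrightarrow> null (?ym@?xm) l J (e.pv u)"
  by (rule null_right[OF c(2,1) J _ w, symmetric]) (use r ym in metis)
 also have "\<dots> \<longleftrightarrow> null ?ym l J (%bs. e.pv u (bs@replicate (length ?xm) False))"
  by (rule null_left[OF c(2,1) J _ w]) (use r ym in metis)
 also have "\<dots> \<longleftrightarrow> null ?ym k J (e.pv (pv z))"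
 proof (rule null_diff[OF c(2)])
  let ?l = "%bs. u (bs@replicate (length xs) False)"
  have n: "null ?ys (l + k) J (va (vs (pows ?ys k) ?l) (vn (vs (pows ?ys l) (pv z))))"
   using cls_eq_iff[OF ys vec_app[OF vu] cocycle_vec[OF pz(1)] homog_left[OF u(2)] pz(2)] u(3) by blast
  have v1: "vec ?l" by (rule vec_app[OF vu])
  have v2: "vec (pv z)" using zv by simp
  note v = v1 v2
  have vE: "vec (va (vs (pows ?ys k) ?l) (vn (vs (pows ?ys l) (pv z))))" by (intro vec_closed vec_vs pows_carr ys v)
  have "null ?ym (l + k) J (e.pv (va (vs (pows ?ys k) ?l) (vn (vs (pows ?ys l) (pv z)))))"
   by (rule null_mono[OF funpow_J e.null_pv[OF ys J vE n]])
  moreover have "e.pv (va (vs (pows ?ys k) ?l) (vn (vs (pows ?ys l) (pv z)))) = va (vs (pows ?ym k) (e.pv ?l)) (vn (vs (pows ?ym l) (e.pv (pv z))))"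
   using e.pv_vs[OF pows_carr[OF ys] v(1), of k] e.pv_vs[OF pows_carr[OF ys] v(2), of l] vec_vs[OF pows_carr[OF ys]] v
   by (simp only: e.pv_simps vec_closed e.phi_pows[OF ys])
  moreover have "e.pv ?l = (%bs. e.pv u (bs@replicate (length ?xm) False))" by (simp add: e.pv_def)
  ultimately show "null ?ym (l + k) J (va (vs (pows ?ym k) (%bs. e.pv u (bs@replicate (length ?xm) False))) (vn (vs (pows ?ym l) (e.pv (pv z)))))"
   by (simp only:)
  show "vec (%bs. e.pv u (bs@replicate (length ?xm) False))" "vec (e.pv (pv z))" using vec_app[OF e.pv_simps(1)[OF vu]] zv by simp_all
 qed
 also have "e.pv (pv z) = (%bs. (\<phi> ^^ Suc m) (z bs))" unfolding e.pv_def pv_def by (simp add: funpow_swap1)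
 finally show ?case unfolding a ym .
qed

end

context cring
begin

lemma self_cyclic: "noetherian_ring R ==> cyclic_module R (self_module R) id {\<zero>}"
 by (intro cyclic_module.intro cyclic_module_axioms.intro noetherian_cring.intro is_cring zeroideal)
  (auto simp: self_module_def)

lemma quot_cyclic:
 assumes "noetherian_ring R" and I: "ideal I R"
 shows "cyclic_module R (quot_module (self_module R) I) (%r. I +> r) I"
proof -
 interpret I: ideal I R by fact
 have s: "a_r_coset (self_module R) I x = I +> x" for x by (simp add: self_module_def a_r_coset_def r_coset_def)
 have add: "(I +> a) <+> (I +> b) = I +> (a\<oplus>b)" if "a\<in>CR" "b\<in>CR" for a b using I.a_rcos_sum that by simp
 have sm: "(\<Union>x\<in>I +> b. I +> (a\<otimes>x)) = I +> (a\<otimes>b)" if c: "a\<in>CR" "b\<in>CR" for a b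
 proof -
  have "I +> (a\<otimes>x) = I +> (a\<otimes>b)" if x: "x\<in>I +> b" for x
  proof -
   obtain i where i: "i\<in>I" "x = i\<oplus>b" using x by (auto simp: a_r_coset_def r_coset_def)
   hence "a\<otimes>x\<ominus>a\<otimes>b = a\<otimes>i" using c I.Icarr by (simp add: cr_simps add_neg_cancel)
   hence "a\<otimes>x\<ominus>a\<otimes>b\<in>I" using i(1) c(1) I.I_l_closed by simp
   thus ?thesis using quotient_eq_iff_same_a_r_cos[OF I] c i I.Icarr by simp
  qed
  moreover have "b\<in>I +> b" using I.a_rcos_self c by simp
  ultimately show ?thesis by blast
 qed
 show ?thesis
 proof (intro cyclic_module.intro cyclic_module_axioms.intro noetherian_cring.intro is_cring I assms(1))
  show "(I +> a = I +> b) = (a\<ominus>b\<in>I)" if "a\<in>CR" "b\<in>CR" for a b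
   using quotient_eq_iff_same_a_r_cos[OF I that] by simp
  show "carrier (quot_module (self_module R) I) = (%r. I +> r)`CR"
   by (auto simp: quot_module_def ring.extend_def FactRing_def A_RCOSETS_def RCOSETS_def self_module_def a_r_coset_def r_coset_def)
  show "(I +> a)\<oplus>\<^bsub>quot_module (self_module R) I\<^esub> (I +> b) = I +> (a\<oplus>b)" if "a\<in>CR" "b\<in>CR" for a b
   using add[OF that] by (simp add: quot_module_def ring.extend_def FactRing_def self_module_def set_add_def set_mult_def)
  show "a \<odot>\<^bsub>quot_module (self_module R) I\<^esub> (I +> b) = I +> (a\<otimes>b)" if "a\<in>CR" "b\<in>CR" for a b
   using sm[OF that] unfolding quot_module_def ring.extend_def module.fields_def by (simp add: s) (simp add: self_module_def)
  show "\<zero>\<^bsub>quot_module (self_module R) I\<^esub> = I +> \<zero>"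
   using a_coset_add_zero[OF ideal_sub[OF I]] by (simp add: quot_module_def ring.extend_def FactRing_def)
 qed
qed

end

theorem theorem4p1:
  fixes R :: "('a, 'r) ring_scheme"
    and \<mm> \<aa> :: "'a set"
    and \<phi> :: "'a \<Rightarrow> 'a"
    and d i :: nat
    and xs ys :: "'a list"
  assumes "regular_local_ring R \<mm>"
    and "krull_dim R = enat d"
    and "ideal \<aa> R"
    and "flat_local_endomorphism R \<mm> \<phi>"
    and "decseq (\<lambda>t. genideal R ((\<phi> ^^ t) ` \<aa>))"
    and "cofinal_chains (\<lambda>t. genideal R ((\<phi> ^^ t) ` \<aa>)) (\<lambda>t. \<aa> [^]\<^bsub>ideals_set R\<^esub> t)"
    and "generates_up_to_radical R ys \<aa>"
    and "generates_up_to_radical R xs \<mm>"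
  shows "carrier (local_cohomology R ys (self_module R) (int i)) =
           {\<zero>\<^bsub>local_cohomology R ys (self_module R) (int i)\<^esub>} \<longleftrightarrow>
         (\<exists>k\<ge>1. \<forall>\<eta> \<in> carrier (local_cohomology R xs (quot_module (self_module R) \<aa>) (int d - int i)).
            (induced_action R \<aa> \<phi> xs (int d - int i) ^^ k) \<eta> =
              \<zero>\<^bsub>local_cohomology R xs (quot_module (self_module R) \<aa>) (int d - int i)\<^esub>)"
proof -
 let ?M = "quot_module (self_module R) \<aa>" and ?j = "int d - int i"
 have R: "local_ring R \<mm>" "noetherian_ring R" "cring R" using assms(1) by (auto simp: regular_local_ring_def local_ring_def)
 have nc: "noetherian_cring R" using R by (simp add: noetherian_cring_def)
 interpret local_noetherian R \<mm> using nc R(1) by (simp add: local_noetherian_def local_noetherian_axioms_def)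
 obtain X where X: "card X = d" "local_parameters R \<mm> X" using regular_parameters[OF assms(1,2)] by blast
 have phi: "\<phi>\<in>ring_hom R R" "\<phi>`\<mm>\<subseteq>\<mm>" "flat_module R (restrict_scalars \<phi> R)"
  using assms(4) by (auto simp: flat_local_endomorphism_def)
 have ec: "endo_cring R \<phi>" using nc phi(1) by (simp add: endo_cring_def endo_cring_axioms_def)
 interpret flat_local_parameters R \<mm> X \<phi>
  using X(2) ec phi by (simp add: flat_local_parameters_def flat_local_parameters_axioms_def flat_endo_def flat_endo_axioms_def)
 interpret S: cyclic_module R "self_module R" id "{\<zero>\<^bsub>R\<^esub>}" by (rule self_cyclic[OF R(2)])
 \<comment> \<open>Levels 0 and 1 of the decreasing chain show that \<phi> maps \<aa> into itself,
   which makes the endomorphism of \<open>R / \<aa>\<close> well defined.\<close>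
 have sub: "genideal R (\<phi>`\<aa>)\<subseteq>\<aa>" using decseqD[OF assms(5), of 0 1] idl_ideal[OF assms(3)] by simp
 have "\<phi>`\<aa>\<subseteq>carrier R" using ideal_carr[OF assms(3)] by auto
 hence pa: "\<phi>`\<aa>\<subseteq>\<aa>" using sub genideal_self[of "\<phi>`\<aa>"] by blast
 have psi: "quot_endo R \<aa> \<phi> (\<aa> +>\<^bsub>R\<^esub> a) = \<aa> +>\<^bsub>R\<^esub> \<phi> a" if a: "a\<in>carrier R" for a
 proof -
  have "\<aa> +>\<^bsub>R\<^esub> \<phi> x = \<aa> +>\<^bsub>R\<^esub> \<phi> a" if x: "x\<in>\<aa> +>\<^bsub>R\<^esub> a" for x
  proof -
   obtain b where b: "b\<in>\<aa>" "x = b\<oplus>\<^bsub>R\<^esub> a" using x by (auto simp: a_r_coset_def r_coset_def)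
   have bc: "b\<in>carrier R" using ideal_carr[OF assms(3) b(1)] .
   have "\<phi> x\<ominus>\<^bsub>R\<^esub> \<phi> a = \<phi> b" using b a bc by (simp add: a_minus_def a_assoc r_neg)
   thus ?thesis using quotient_eq_iff_same_a_r_cos[OF assms(3), of "\<phi> x" "\<phi> a"] pa b a bc by auto
  qed
  moreover have "a\<in>\<aa> +>\<^bsub>R\<^esub> a" using additive_subgroup.zero_closed[OF ideal.axioms(1)[OF assms(3)]] a
   by (force simp: a_r_coset_def r_coset_def)
  ultimately show ?thesis unfolding quot_endo_def coset_map_def by blast
 qed
 interpret Q: cyclic_endo R \<phi> ?M "%r. \<aa> +>\<^bsub>R\<^esub> r" \<aa> "quot_endo R \<aa> \<phi>"
  using ec quot_cyclic[OF R(2) assms(3)] psi pa by (simp add: cyclic_endo_def cyclic_endo_axioms_def)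
 have xc: "set xs\<subseteq>carrier R" and yc: "set ys\<subseteq>carrier R" using assms(7,8) by (simp_all add: generates_up_to_radical_def)
 \<comment> \<open>All iterated images of \<open>xs\<close> generate \<mm> up to radical, so the
   complexes on any two of them can be compared.\<close>
 have gens: "\<exists>n::nat. b [^]\<^bsub>R\<^esub> n\<in>genideal R (set (map (\<phi> ^^ t) xs))" if "b\<in>set (map (\<phi> ^^ s) xs)" for s t b
  using funpow_generators[OF assms(8)] funpow_m m_generators(1)[OF assms(8)] that by auto
 have act: "(induced_action R \<aa> \<phi> xs ?j ^^ k) (Q.cls xs ?j l z) = Q.CB xs ?j \<longleftrightarrow>
   null (map (\<phi> ^^ k) xs) l \<aa> (%bs. (\<phi> ^^ k) (z bs))" if "cocycle xs l \<aa> z" "homog (coh xs) ?j z" for k l z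
  unfolding induced_action_def Let_def by (rule Q.action_zero_iff[OF xc _ that]) (rule gens)
 have "carrier (local_cohomology R ys (self_module R) (int i)) = {\<zero>\<^bsub>local_cohomology R ys (self_module R) (int i)\<^esub>} \<longleftrightarrow>
   (\<exists>k\<ge>1. \<forall>l z. cocycle xs l \<aa> z --> homog (coh xs) ?j z --> null (map (\<phi> ^^ k) xs) l \<aa> (%bs. (\<phi> ^^ k) (z bs)))"
  using S.LC_zero_iff[OF yc, of "int i"] vanishing_iff_nilpotent[OF assms(8,3,5,6,7), of "int i"] X(1) by simp
 also have "\<dots> \<longleftrightarrow> (\<exists>k\<ge>1. \<forall>l z. cocycle xs l \<aa> z --> homog (coh xs) ?j z -->
   (induced_action R \<aa> \<phi> xs ?j ^^ k) (Q.cls xs ?j l z) = Q.CB xs ?j)"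
  using act by metis
 also have "\<dots> \<longleftrightarrow> (\<exists>k\<ge>1. \<forall>\<eta>\<in>carrier (local_cohomology R xs ?M ?j).
   (induced_action R \<aa> \<phi> xs ?j ^^ k) \<eta> = \<zero>\<^bsub>local_cohomology R xs ?M ?j\<^esub>)"
  unfolding Q.LC_carrier(2)[OF xc] Q.LC_carrier(1)[OF xc] by blast
 finally show ?thesis .
qed

end
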